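(* Let $1\le p<\infty$, let $u\in M_c(M^p(\mathbb{R}^d))$, and let $$\phi(z)=\int_{\mathbb{R}^d}u(y)e^{-\pi y^2/2-\pi yz}\,dy,\qquad z\in\mathbb{C}^d .$$ Then the operator $S:\mathcal{F}^1(\mathbb{C}^d)\to\mathcal{F}^\infty(\mathbb{C}^d)$ defined by $$SF(z)=\int_{\mathbb{C}^d}F(w)e^{\pi\overline{w}z}\phi(\overline{w}-z)e^{-\pi|w|^2}\,dw,\qquad F\in\mathcal{F}^1(\mathbb{C}^d),\qquad ( * )$$ extends uniquely to a bounded, translation invariant operator on $\mathcal{F}^p(\mathbb{C}^d)$. Conversely, if $S$ is a bounded and translation invariant operator on $\mathcal{F}^p(\mathbb{C}^d)$, then $S$ is of the form $( * )$ (on $\mathcal{F}^1(\mathbb{C}^d)$) with $\phi(z)=\int_{\mathbb{R}^d}u(y)e^{-\pi y^2/2-\pi yz}\,dy$ for some $u\in M_c(M^p(\mathbb{R}^d))$.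
   Context: For $x,y\in\mathbb{C}^d$ write $xy=\sum_j x_jy_j$ and $x^2=xx$; $|w|^2=w\overline{w}$; $dw$ on $\mathbb{C}^d$ is Lebesgue measure on $\mathbb{R}^{2d}$. Modulation spaces: let $\varphi_0(t)=2^{d/4}e^{-\pi t^2}$ on $\mathbb{R}^d$, $\pi(x,\omega)f(t)=e^{2\pi i\omega t}f(t-x)$, and for $f\in\mathscr{S}'(\mathbb{R}^d)$ let $V_{\varphi_0}f(x,\omega)=\langle f,\pi(x,\omega)\varphi_0\rangle$ (bracket antilinear in the second slot). For $1\le p\le\infty$, $M^p(\mathbb{R}^d)=\{f\in\mathscr{S}'(\mathbb{R}^d):V_{\varphi_0}f\in L^p(\mathbb{R}^{2d})\}$ with norm $\|V_{\varphi_0}f\|_{L^p}$. $M_c(M^p(\mathbb{R}^d))$ is the space of tempered distributions $u$ (necessarily in $M^\infty(\mathbb{R}^d)$) corresponding to bounded translation-invariant operators on $M^p(\mathbb{R}^d)$, i.e. such that $f\mapsto u*f$, $f\in M^1(\mathbb{R}^d)$, extends to a bounded operator on $M^p(\mathbb{R}^d)$. Integrals $\int u(y)g(y)\,dy$ with $u$ a distribution denote the bilinear pairing of $u$ with the Schwartz function $g$. Sobolev-Fock spaces: for $1\le p\le\infty$, $\mathcal{F}^p(\mathbb{C}^d)$ is the space of entire functions $F$ on $\mathbb{C}^d$ such that $z\mapsto F(z)e^{-\pi|z|^2/2}$ is in $L^p(\mathbb{C}^d)$, normed by the $L^p$ norm of this function. Shifts: for $y\in\mathbb{R}^d$, $\beta_yF(w)=e^{-\pi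 y^2/2+\pi yw}F(w-y)$. An operator $S$ on $\mathcal{F}^p(\mathbb{C}^d)$ is called translation invariant if $S\beta_y=\beta_yS$ for all $y\in\mathbb{R}^d$. *)

theory Defs
  imports "HOL-Analysis.Analysis" "HOL-Probability.Essential_Supremum"
begin

section \<open>$L^p$ and bounded operators\<close>

definition Lp_space :: "ennreal \<Rightarrow> 'a measure \<Rightarrow> ('a \<Rightarrow> complex) set" where
  "Lp_space p M = {f \<in> borel_measurable M.
     if p = \<infinity> then esssup M (\<lambda>x. ennreal (norm (f x))) < \<infinity>
     else (\<integral>\<^sup>+x. ennreal (norm (f x) powr enn2real p) \<partial>M) < \<infinity>}"

definition Lp_norm :: "ennreal \<Rightarrow> 'a measure \<Rightarrow> ('a \<Rightarrow> complex) \<Rightarrow> real" where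
  "Lp_norm p M f =
     (if p = \<infinity> then enn2real (esssup M (\<lambda>x. ennreal (norm (f x))))
      else (\<integral>x. norm (f x) powr enn2real p \<partial>M) powr (1 / enn2real p))"

text \<open>Bounded complex-linear operators on a normed space whose elements are complex-valued
  functions, with carrier \<open>X\<close>, norm \<open>N\<close> and pointwise operations. The space may be a space of
  distributions, since these are functions of the test function. The behaviour of \<open>T\<close>
  outside \<open>X\<close> is irrelevant.\<close>

definition bounded_operator_on ::
    "('a \<Rightarrow> complex) set \<Rightarrow> (('a \<Rightarrow> complex) \<Rightarrow> real) \<Rightarrow> (('a \<Rightarrow> complex) \<Rightarrow> 'a \<Rightarrow> complex) \<Rightarrow> bool" where
  "bounded_operator_on X N T \<longleftrightarrow>
     (\<forall>f\<in>X. T f \<in> X) \<and>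
     (\<forall>f\<in>X. \<forall>g\<in>X. T (\<lambda>x. f x + g x) = (\<lambda>x. T f x + T g x)) \<and>
     (\<forall>c. \<forall>f\<in>X. T (\<lambda>x. c * f x) = (\<lambda>x. c * T f x)) \<and>
     (\<exists>C. \<forall>f\<in>X. N (T f) \<le> C * N f)"

section \<open>Schwartz functions and tempered distributions\<close>

definition partial :: "'n::finite \<Rightarrow> (real^'n \<Rightarrow> complex) \<Rightarrow> real^'n \<Rightarrow> complex" where
  "partial j f x = frechet_derivative f (at x) (axis j 1)"

definition partials :: "'n::finite list \<Rightarrow> (real^'n \<Rightarrow> complex) \<Rightarrow> real^'n \<Rightarrow> complex" where
  "partials js f = foldr partial js f"

definition smooth :: "(real^'n::finite \<Rightarrow> complex) \<Rightarrow> bool" where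
  "smooth f \<longleftrightarrow> (\<forall>js x. partials js f differentiable (at x))"

definition schwartz :: "(real^'n::finite \<Rightarrow> complex) set" where
  "schwartz = {f. smooth f \<and>
     (\<forall>m js. bdd_above (range (\<lambda>x. (1 + norm x) ^ m * norm (partials js f x))))}"

definition schwartz_seminorm :: "nat \<Rightarrow> 'n::finite list \<Rightarrow> (real^'n \<Rightarrow> complex) \<Rightarrow> real" where
  "schwartz_seminorm m js f = (SUP x. (1 + norm x) ^ m * norm (partials js f x))"

text \<open>A distribution is represented by its bilinear pairing \<open>g \<mapsto> u g\<close> with test functions,
  set to \<open>0\<close> off the Schwartz space, so that equality of distributions is equality of
  functions.\<close>

type_synonym 'n functional = "(real^'n \<Rightarrow> complex) \<Rightarrow> complex"

definition tempered_distributions :: "'n::finite functional set" where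
  "tempered_distributions = {u.
     (\<forall>g. g \<notin> schwartz \<longrightarrow> u g = 0) \<and>
     (\<forall>g\<in>schwartz. \<forall>h\<in>schwartz. u (\<lambda>x. g x + h x) = u g + u h) \<and>
     (\<forall>c. \<forall>g\<in>schwartz. u (\<lambda>x. c * g x) = c * u g) \<and>
     (\<exists>C N. \<forall>g\<in>schwartz. norm (u g) \<le> C * (\<Sum>js | length js \<le> N. schwartz_seminorm N js g))}"

definition distribution_of :: "(real^'n::finite \<Rightarrow> complex) \<Rightarrow> 'n functional" where
  "distribution_of f g = (if g \<in> schwartz then \<integral>x. f x * g x \<partial>lborel else 0)"

section \<open>Modulation spaces\<close>

definition gauss_window :: "real^'n::finite \<Rightarrow> complex" where
  "gauss_window t = of_real (2 powr (real CARD('n) / 4) * exp (- pi * (t \<bullet> t)))"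

definition tf_shift ::
    "real^'n::finite \<Rightarrow> real^'n \<Rightarrow> (real^'n \<Rightarrow> complex) \<Rightarrow> real^'n \<Rightarrow> complex" where
  "tf_shift x \<omega> f t = exp (2 * of_real pi * \<i> * of_real (\<omega> \<bullet> t)) * f (t - x)"

text \<open>The bracket is antilinear in its second slot, hence the conjugate.\<close>

definition stft :: "'n::finite functional \<Rightarrow> (real^'n) \<times> (real^'n) \<Rightarrow> complex" where
  "stft f = (\<lambda>(x, \<omega>). f (\<lambda>t. cnj (tf_shift x \<omega> gauss_window t)))"

definition modulation_space :: "ennreal \<Rightarrow> 'n::finite functional set" where
  "modulation_space p = {f \<in> tempered_distributions. stft f \<in> Lp_space p lborel}"

definition modulation_norm :: "ennreal \<Rightarrow> 'n::finite functional \<Rightarrow> real" where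
  "modulation_norm p f = Lp_norm p lborel (stft f)"

text \<open>The sesquilinear duality between \<open>u \<in> M\<^sup>\<infinity>\<close> and \<open>h \<in> M\<^sup>1\<close>. Since the window has
  \<open>L\<^sup>2\<close>-norm 1, it equals \<open>u (\<lambda>t. cnj (h t))\<close> when \<open>h\<close> is a Schwartz function.\<close>

definition modulation_pairing :: "'n::finite functional \<Rightarrow> 'n functional \<Rightarrow> complex" where
  "modulation_pairing u h = (\<integral>z. stft u z * cnj (stft h z) \<partial>lborel)"

text \<open>For a function \<open>f\<close> this is \<open>t \<mapsto> cnj (f (x - t))\<close>.\<close>

definition reflect_conj_shift :: "real^'n::finite \<Rightarrow> 'n functional \<Rightarrow> 'n functional" where
  "reflect_conj_shift x f g = cnj (f (\<lambda>t. cnj (g (x - t))))"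

text \<open>The convolution \<open>(u * f)(x) = \<integral> u(t) f(x - t) dt\<close> of \<open>u \<in> M\<^sup>\<infinity>\<close> and \<open>f \<in> M\<^sup>1\<close>, a bounded
  continuous function, regarded as a distribution.\<close>

definition convolution :: "'n::finite functional \<Rightarrow> 'n functional \<Rightarrow> 'n functional" where
  "convolution u f = distribution_of (\<lambda>x. modulation_pairing u (reflect_conj_shift x f))"

text \<open>Convolutors of \<open>M\<^sup>p\<close>. Membership of \<open>u\<close> in \<open>M\<^sup>\<infinity>\<close> is what makes \<open>u * f\<close> meaningful for all
  \<open>f \<in> M\<^sup>1\<close>.\<close>

definition convolutors :: "ennreal \<Rightarrow> 'n::finite functional set" where
  "convolutors p = {u \<in> modulation_space \<infinity>.
     \<exists>T. bounded_operator_on (modulation_space p) (modulation_norm p) T \<and>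
         (\<forall>f\<in>modulation_space 1. T f = convolution u f)}"

section \<open>Sobolev-Fock spaces\<close>

definition dotc :: "complex^'n::finite \<Rightarrow> complex^'n \<Rightarrow> complex" where
  "dotc x y = (\<Sum>j\<in>UNIV. x $ j * y $ j)"

definition cnj_vec :: "complex^'n::finite \<Rightarrow> complex^'n" where
  "cnj_vec w = (\<chi> j. cnj (w $ j))"

definition of_real_vec :: "real^'n::finite \<Rightarrow> complex^'n" where
  "of_real_vec y = (\<chi> j. of_real (y $ j))"

definition entire :: "(complex^'n::finite \<Rightarrow> complex) \<Rightarrow> bool" where
  "entire F \<longleftrightarrow>
     (\<forall>z. \<exists>D. (F has_derivative D) (at z) \<and> (\<forall>c v. D (c *s v) = c * D v))"

definition fock_weighted :: "(complex^'n::finite \<Rightarrow> complex) \<Rightarrow> complex^'n \<Rightarrow> complex" where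
  "fock_weighted F z = F z * of_real (exp (- pi * (norm z)\<^sup>2 / 2))"

definition fock_space :: "ennreal \<Rightarrow> (complex^'n::finite \<Rightarrow> complex) set" where
  "fock_space p = {F. entire F \<and> fock_weighted F \<in> Lp_space p lborel}"

definition fock_norm :: "ennreal \<Rightarrow> (complex^'n::finite \<Rightarrow> complex) \<Rightarrow> real" where
  "fock_norm p F = Lp_norm p lborel (fock_weighted F)"

definition fock_shift ::
    "real^'n::finite \<Rightarrow> (complex^'n \<Rightarrow> complex) \<Rightarrow> complex^'n \<Rightarrow> complex" where
  "fock_shift y F w =
     exp (- of_real pi * of_real (y \<bullet> y) / 2 + of_real pi * dotc (of_real_vec y) w)
       * F (w - of_real_vec y)"

definition translation_invariant_on ::
    "ennreal \<Rightarrow> ((complex^'n::finite \<Rightarrow> complex) \<Rightarrow> complex^'n \<Rightarrow> complex) \<Rightarrow> bool" where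
  "translation_invariant_on p S \<longleftrightarrow>
     (\<forall>y. \<forall>F\<in>fock_space p. S (fock_shift y F) = fock_shift y (S F))"

definition fock_symbol :: "'n::finite functional \<Rightarrow> complex^'n \<Rightarrow> complex" where
  "fock_symbol u z =
     u (\<lambda>y. exp (- of_real pi * of_real (y \<bullet> y) / 2 - of_real pi * dotc (of_real_vec y) z))"

definition fock_integrand ::
    "(complex^'n::finite \<Rightarrow> complex) \<Rightarrow> (complex^'n \<Rightarrow> complex) \<Rightarrow> complex^'n \<Rightarrow> complex^'n \<Rightarrow> complex" where
  "fock_integrand \<phi> F z w =
     F w * exp (of_real pi * dotc (cnj_vec w) z) * \<phi> (cnj_vec w - z)
       * of_real (exp (- pi * (norm w)\<^sup>2))"

definition fock_integral_operator ::
    "(complex^'n::finite \<Rightarrow> complex) \<Rightarrow> (complex^'n \<Rightarrow> complex) \<Rightarrow> complex^'n \<Rightarrow> complex" where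
  "fock_integral_operator \<phi> F z = (\<integral>w. fock_integrand \<phi> F z w \<partial>lborel)"

definition bounded_invariant_extension ::
    "ennreal \<Rightarrow> ((complex^'n::finite \<Rightarrow> complex) \<Rightarrow> complex^'n \<Rightarrow> complex)
      \<Rightarrow> ((complex^'n \<Rightarrow> complex) \<Rightarrow> complex^'n \<Rightarrow> complex) \<Rightarrow> bool" where
  "bounded_invariant_extension p S T \<longleftrightarrow>
     bounded_operator_on (fock_space p) (fock_norm p) T \<and>
     translation_invariant_on p T \<and>
     (\<forall>F\<in>fock_space 1. T F = S F)"

end

theory Submission
  imports Defs "HOL-Complex_Analysis.Complex_Analysis" "HOL-Probability.Probability"
begin

text \<open>
  Everything is transported to the Sobolev-Fock side by the Bargmann transform. Testing a tempered
  distribution \<open>u\<close> against the Gaussians \<open>kf z\<close> gives an entire function \<open>bargmann u\<close>, and the short-time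
  Fourier transform of \<open>u\<close> with Gaussian window is, up to a phase and the reflection
  \<open>(x, \<omega>) \<mapsto> x - \<i> \<omega>\<close>, this function times the weight \<open>exp (- pi |z|\<^sup>2 / 2)\<close> (\<open>stft_bargmann\<close>). So
  \<open>bargmann\<close> maps \<open>M\<^sup>p\<close> isometrically to \<open>F\<^sup>p\<close>. Its inverse is \<open>synth\<close>: pairing with a Schwartz function
  \<open>g\<close> means integrating against the Bargmann transform of \<open>g\<close>, and this integral converges for all
  functions in \<open>F\<^sup>\<infinity>\<close> because the Bargmann transform of \<open>g\<close> decays rapidly relative to the weight.

  In this picture convolution with \<open>u \<in> M\<^sup>\<infinity>\<close> is an integral operator. Writing \<open>F\<close> as a superposition of
  reproducing kernels and carrying out Gaussian integrals shows that the Bargmann transform of \<open>u * f\<close>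
  is the operator with symbol \<open>fock_symbol u\<close> applied to \<open>F = bargmann f\<close> (\<open>fbarg_hconv_symbol\<close>).
  The symbol is entire and bounded by a multiple of \<open>exp (pi |Re \<zeta>|\<^sup>2 / 2)\<close>, which is exactly the growth
  for which the integral converges on \<open>F\<^sup>1\<close> and defines a function in \<open>F\<^sup>\<infinity>\<close> (\<open>fock_operator\<close>).

  If \<open>u\<close> is a convolutor of \<open>M\<^sup>p\<close>, then conjugating the bounded operator on \<open>M\<^sup>p\<close> by the Bargmann
  transform gives the bounded extension. Translation invariance is a change of variables on \<open>F\<^sup>1\<close>.
  It passes to \<open>F\<^sup>p\<close>, and the extension is unique, because \<open>F\<^sup>1\<close> is dense in \<open>F\<^sup>p\<close>: the dilates
  \<open>F (r z)\<close> with \<open>r < 1\<close> lie in \<open>F\<^sup>1\<close> and converge to \<open>F\<close> (\<open>fock_dilation_tendsto\<close>).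

  Conversely, let \<open>S\<close> be bounded and translation invariant, and apply it to the reproducing kernels
  \<open>ekern \<zeta>\<close>. A real shift maps a kernel to a multiple of the kernel with translated parameter, so invariance together with
  analytic continuation from real points gives \<open>S (ekern \<zeta>) z = ekern \<zeta> z * \<phi> (\<zeta> - z)\<close> with a single
  entire function \<open>\<phi>\<close> (\<open>S_ekern\<close>). A bounded functional on \<open>F\<^sup>1\<close> is determined by its values on the
  kernels through an integral (\<open>representation\<close>), so \<open>S\<close> is the operator with symbol \<open>\<phi>\<close>. Boundedness
  of \<open>S\<close> gives \<open>\<phi>\<close> the growth of a symbol. The formula which recovers \<open>bargmann u\<close> from the symbol of
  \<open>u\<close> (\<open>symbol_inversion\<close>) then produces from \<open>\<phi>\<close> a function \<open>U\<close> in \<open>F\<^sup>\<infinity>\<close>, and \<open>u = synth U\<close> has symbol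
  \<open>\<phi>\<close>, since the recovery formula is injective (\<open>cross_eq_0\<close>). Conjugating \<open>S\<close> back to \<open>M\<^sup>p\<close> shows that
  \<open>u\<close> is a convolutor.
\<close>

unbundle no fps_syntax

section \<open>Complex vectors and their bilinear product\<close>

definition re_vec :: "complex^'n \<Rightarrow> real^'n" where "re_vec z = (\<chi> j. Re (z $ j))"
definition im_vec :: "complex^'n \<Rightarrow> real^'n" where "im_vec z = (\<chi> j. Im (z $ j))"
definition cvec :: "real^'n \<Rightarrow> real^'n \<Rightarrow> complex^'n" where "cvec x y = (\<chi> j. Complex (x $ j) (y $ j))"

lemma re_vec_simps [simp]:
  "re_vec (x + y) = re_vec x + re_vec y" "re_vec (x - y) = re_vec x - re_vec y"
  "re_vec (- x) = - re_vec x" "re_vec 0 = 0" "re_vec (cnj_vec x) = re_vec x"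
  "re_vec (of_real_vec a) = a" "re_vec (cvec a b) = a" "re_vec (r *\<^sub>R x) = r *\<^sub>R re_vec x"
  "re_vec (\<i> *s x) = - im_vec x" "re_vec (of_real r *s x) = r *\<^sub>R re_vec x"
  "re_vec (numeral k *s x) = numeral k *\<^sub>R re_vec x"
  by (auto simp: re_vec_def im_vec_def cvec_def cnj_vec_def of_real_vec_def vec_eq_iff)

lemma im_vec_simps [simp]:
  "im_vec (x + y) = im_vec x + im_vec y" "im_vec (x - y) = im_vec x - im_vec y"
  "im_vec (- x) = - im_vec x" "im_vec 0 = 0" "im_vec (cnj_vec x) = - im_vec x"
  "im_vec (of_real_vec a) = 0" "im_vec (cvec a b) = b" "im_vec (r *\<^sub>R x) = r *\<^sub>R im_vec x"
  "im_vec (\<i> *s x) = re_vec x" "im_vec (of_real r *s x) = r *\<^sub>R im_vec x"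
  "im_vec (numeral k *s x) = numeral k *\<^sub>R im_vec x"
  by (auto simp: re_vec_def im_vec_def cvec_def cnj_vec_def of_real_vec_def vec_eq_iff)

lemma cvec_re_im [simp]: "cvec (re_vec z) (im_vec z) = z"
  by (auto simp: re_vec_def im_vec_def cvec_def vec_eq_iff)

lemma cvec_eq: "cvec x y = of_real_vec x + \<i> *s of_real_vec y"
  by (auto simp: cvec_def of_real_vec_def vec_eq_iff complex_eq_iff)

lemma cnj_vec_simps [simp]:
  "cnj_vec (x + y) = cnj_vec x + cnj_vec y" "cnj_vec (x - y) = cnj_vec x - cnj_vec y"
  "cnj_vec (- x) = - cnj_vec x" "cnj_vec 0 = 0" "cnj_vec (cnj_vec x) = x"
  "cnj_vec (of_real_vec a) = of_real_vec a" "cnj_vec (c *s x) = cnj c *s cnj_vec x"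
  "cnj_vec (r *\<^sub>R x) = r *\<^sub>R cnj_vec x"
  by (auto simp: cnj_vec_def of_real_vec_def vec_eq_iff)

lemma of_real_vec_simps [simp]:
  "of_real_vec (x + y) = of_real_vec x + of_real_vec y" "of_real_vec (x - y) = of_real_vec x - of_real_vec y"
  "of_real_vec (- x) = - of_real_vec x" "of_real_vec 0 = 0"
  "of_real_vec (r *\<^sub>R x) = of_real r *s of_real_vec x"
  by (auto simp: of_real_vec_def vec_eq_iff)

lemma dotc_commute: "dotc x y = dotc y x"
  by (simp add: dotc_def mult.commute)

lemma dotc_simps [simp]:
  "dotc (x + y) z = dotc x z + dotc y z" "dotc z (x + y) = dotc z x + dotc z y"
  "dotc (x - y) z = dotc x z - dotc y z" "dotc z (x - y) = dotc z x - dotc z y"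
  "dotc (- x) z = - dotc x z" "dotc z (- x) = - dotc z x" "dotc 0 z = 0" "dotc z 0 = 0"
  "dotc (c *s x) z = c * dotc x z" "dotc z (c *s x) = c * dotc z x"
  "dotc (r *\<^sub>R x) z = of_real r * dotc x z" "dotc z (r *\<^sub>R x) = of_real r * dotc z x"
  by (auto simp: dotc_def sum.distrib sum_subtractf sum_negf sum_distrib_left algebra_simps scaleR_conv_of_real[where 'a=complex])

lemma cnj_dotc: "cnj (dotc x y) = dotc (cnj_vec x) (cnj_vec y)"
  by (simp add: dotc_def cnj_vec_def)

lemma dotc_of_real [simp]: "dotc (of_real_vec x) (of_real_vec y) = of_real (x \<bullet> y)"
  by (simp add: dotc_def of_real_vec_def inner_vec_def)

lemma Re_dotc: "Re (dotc w z) = re_vec w \<bullet> re_vec z - im_vec w \<bullet> im_vec z"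
  by (simp add: dotc_def re_vec_def im_vec_def inner_vec_def sum_subtractf)

lemma Im_dotc: "Im (dotc w z) = re_vec w \<bullet> im_vec z + im_vec w \<bullet> re_vec z"
  by (simp add: dotc_def re_vec_def im_vec_def inner_vec_def sum.distrib)

lemma norm_sq_re_im: "(norm z)\<^sup>2 = re_vec z \<bullet> re_vec z + im_vec z \<bullet> im_vec (z::complex^'n::finite)"
  by (simp add: norm_vec_def L2_set_def re_vec_def im_vec_def inner_vec_def sum.distrib [symmetric]
      sum_nonneg cmod_power2 power2_eq_square[symmetric])

lemma dotc_cnj_self: "dotc (cnj_vec w) w = of_real ((norm w)\<^sup>2)"
  by (simp add: complex_eq_iff Re_dotc Im_dotc norm_sq_re_im inner_commute)

lemma norm_dotc_le: "norm (dotc w z) \<le> norm w * norm z"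
proof -
  have "norm (dotc w z) \<le> (\<Sum>j\<in>UNIV. norm (w $ j) * norm (z $ j))"
    unfolding dotc_def by (rule order_trans[OF norm_sum]) (simp add: norm_mult)
  also have "\<dots> \<le> norm w * norm z"
    unfolding norm_vec_def using L2_set_mult_ineq[of "\<lambda>j. norm (w $ j)" "\<lambda>j. norm (z $ j)" UNIV]
    by simp
  finally show ?thesis .
qed

lemma norm_cnj_vec [simp]: "norm (cnj_vec w) = norm w"
  by (simp add: norm_vec_def cnj_vec_def)

lemma norm_of_real_vec [simp]: "norm (of_real_vec x) = norm x"
  by (simp add: norm_vec_def of_real_vec_def)

lemma norm_smult [simp]: "norm (c *s w) = norm c * norm (w::complex^'n::finite)"
  by (simp add: norm_vec_def L2_set_def norm_mult power_mult_distrib sum_distrib_left[symmetric] real_sqrt_mult)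

lemma norm_re_vec_le: "norm (re_vec z) \<le> norm z" and norm_im_vec_le: "norm (im_vec z) \<le> norm z"
proof -
  have "(norm (re_vec z))\<^sup>2 \<le> (norm z)\<^sup>2" "(norm (im_vec z))\<^sup>2 \<le> (norm z)\<^sup>2"
    unfolding norm_sq_re_im by (simp_all add: power2_norm_eq_inner)
  then show "norm (re_vec z) \<le> norm z" "norm (im_vec z) \<le> norm z"
    by (simp_all add: power2_le_iff_abs_le)
qed

lemma bounded_linear_vec_maps:
  "bounded_linear (re_vec :: complex^'n::finite \<Rightarrow> _)" "bounded_linear (im_vec :: complex^'n::finite \<Rightarrow> _)"
  "bounded_linear (cnj_vec :: complex^'n::finite \<Rightarrow> _)" "bounded_linear (of_real_vec :: real^'n::finite \<Rightarrow> _)"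
  "bounded_linear (\<lambda>(x, y). cvec x (y :: real^'n::finite))"
  "bounded_linear (\<lambda>z. c *s (z :: complex^'n::finite))"
  by (auto simp: linear_conv_bounded_linear[symmetric] vec_eq_iff of_real_vec_def cvec_def complex_eq_iff
      algebra_simps cnj_vec_def re_vec_def im_vec_def intro!: linearI)

lemmas continuous_vec_maps [continuous_intros] =
  bounded_linear.continuous_on[OF bounded_linear_vec_maps(1)]
  bounded_linear.continuous_on[OF bounded_linear_vec_maps(2)]
  bounded_linear.continuous_on[OF bounded_linear_vec_maps(3)]
  bounded_linear.continuous_on[OF bounded_linear_vec_maps(4)]
  bounded_linear.continuous_on[OF bounded_linear_vec_maps(6)]

lemma continuous_on_cvec [continuous_intros]:
  assumes "continuous_on S f" "continuous_on S g"
  shows "continuous_on S (\<lambda>x. cvec (f x) (g x))"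
  using bounded_linear.continuous_on[OF bounded_linear_vec_maps(5) continuous_on_Pair[OF assms]] by simp

lemma continuous_on_dotc [continuous_intros]:
  assumes "continuous_on S f" "continuous_on S g"
  shows "continuous_on S (\<lambda>x. dotc (f x) (g x))"
  unfolding dotc_def by (intro continuous_intros assms)

lemma continuous_on_smult [continuous_intros]:
  fixes g :: "_ \<Rightarrow> complex^'n::finite"
  assumes "continuous_on S f" "continuous_on S g"
  shows "continuous_on S (\<lambda>x. f x *s g x)"
  unfolding vector_scalar_mult_def by (intro continuous_on_vec_lambda continuous_intros assms)

lemma measurable_vec_maps [measurable]:
  "re_vec \<in> borel_measurable borel" "im_vec \<in> borel_measurable borel"
  "cnj_vec \<in> borel_measurable borel" "of_real_vec \<in> borel_measurable borel"
  by (intro borel_measurable_continuous_onI continuous_intros)+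

lemma measurable_cvec [measurable (raw)]:
  assumes [measurable]: "f \<in> borel_measurable M" "g \<in> borel_measurable M"
  shows "(\<lambda>x. cvec (f x) (g x)) \<in> borel_measurable M"
proof -
  have "(\<lambda>p. cvec (fst p) (snd p)) \<in> borel_measurable (borel \<Otimes>\<^sub>M borel)"
    unfolding borel_prod by (intro borel_measurable_continuous_onI continuous_intros)
  from measurable_compose[OF _ this, of "\<lambda>x. (f x, g x)" M] show ?thesis by simp
qed

lemma measurable_dotc [measurable (raw)]:
  fixes f g :: "_ \<Rightarrow> complex^'n::finite"
  assumes [measurable]: "f \<in> borel_measurable M" "g \<in> borel_measurable M"
  shows "(\<lambda>x. dotc (f x) (g x)) \<in> borel_measurable M"
proof -
  have "(\<lambda>p. dotc (fst p) (snd p :: complex^'n)) \<in> borel_measurable (borel \<Otimes>\<^sub>M borel)"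
    unfolding borel_prod by (intro borel_measurable_continuous_onI continuous_intros)
  from measurable_compose[OF _ this, of "\<lambda>x. (f x, g x)" M] show ?thesis by simp
qed

lemma measurable_smult [measurable (raw)]:
  fixes g :: "_ \<Rightarrow> complex^'n::finite"
  assumes [measurable]: "f \<in> borel_measurable M" "g \<in> borel_measurable M"
  shows "(\<lambda>x. f x *s g x) \<in> borel_measurable M"
proof -
  have "(\<lambda>p. fst p *s (snd p :: complex^'n)) \<in> borel_measurable (borel \<Otimes>\<^sub>M borel)"
    unfolding borel_prod by (intro borel_measurable_continuous_onI continuous_intros)
  from measurable_compose[OF _ this, of "\<lambda>x. (f x, g x)" M] show ?thesis by simp
qed

section \<open>Lebesgue measure on complex space\<close>

lemma prod_Basis_vec:
  "prod f (Basis :: (('a::euclidean_space)^'n::finite) set) = (\<Prod>i\<in>UNIV. \<Prod>b\<in>Basis. f (axis i b))"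
proof -
  have B: "(Basis :: ('a^'n) set) = (\<lambda>(i, b). axis i b) ` (UNIV \<times> Basis)"
    by (auto simp: Basis_vec_def)
  have "inj_on (\<lambda>(i, b). axis i b) (UNIV \<times> (Basis::'a set))"
    by (auto simp: inj_on_def axis_eq_axis)
  then show ?thesis
    unfolding B by (subst prod.reindex) (auto simp: prod.cartesian_product case_prod_unfold comp_def)
qed

text \<open>The product basis of \<open>complex^'n\<close> consists of the coordinate vectors and their multiples by \<open>\<i>\<close>,
  so a box in \<open>complex^'n\<close> is a product of two boxes in \<open>real^'n\<close>.\<close>

lemma lborel_cvec: "(lborel :: (complex^'n::finite) measure) = distr (lborel \<Otimes>\<^sub>M lborel) borel (\<lambda>p. cvec (fst p) (snd p))"
proof (rule lborel_eqI)
  fix l u :: "complex^'n" assume le: "\<And>b. b \<in> Basis \<Longrightarrow> l \<bullet> b \<le> u \<bullet> b"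
  have mem: "z \<in> box l u \<longleftrightarrow> re_vec z \<in> box (re_vec l) (re_vec u) \<and> im_vec z \<in> box (im_vec l) (im_vec u)" for z
    by (auto simp: mem_box Basis_vec_def inner_axis Basis_complex_def re_vec_def im_vec_def)
  have eq: "(\<lambda>p. cvec (fst p) (snd p)) -` box l u = box (re_vec l) (re_vec u) \<times> box (im_vec l) (im_vec u)"
    by (auto simp: mem)
  have le': "re_vec l \<bullet> b \<le> re_vec u \<bullet> b" "im_vec l \<bullet> b \<le> im_vec u \<bullet> b" if bB: "b \<in> Basis" for b
  proof -
    obtain i where b: "b = axis i (1::real)" using bB unfolding Basis_vec_def Basis_real_def by blast
    show "re_vec l \<bullet> b \<le> re_vec u \<bullet> b" "im_vec l \<bullet> b \<le> im_vec u \<bullet> b"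
      using le[of "axis i 1"] le[of "axis i \<i>"] 
      by (auto simp: b inner_axis re_vec_def im_vec_def axis_in_Basis_iff Basis_complex_def)
  qed
  have "emeasure (distr (lborel \<Otimes>\<^sub>M lborel) borel (\<lambda>p. cvec (fst p) (snd p))) (box l u)
     = emeasure lborel (box (re_vec l) (re_vec u)) * emeasure lborel (box (im_vec l) (im_vec u))"
    by (subst emeasure_distr) (auto simp: eq space_pair_measure lborel.emeasure_pair_measure_Times)
  also have "\<dots> = ennreal ((\<Prod>b\<in>Basis. (re_vec u - re_vec l) \<bullet> b) * (\<Prod>b\<in>Basis. (im_vec u - im_vec l) \<bullet> b))"
    using le' by (simp add: emeasure_lborel_box_eq inner_diff_left prod_nonneg ennreal_mult)
  also have "(\<Prod>b\<in>Basis. (re_vec u - re_vec l) \<bullet> b) * (\<Prod>b\<in>Basis. (im_vec u - im_vec l) \<bullet> b) = (\<Prod>b\<in>Basis. (u - l) \<bullet> b)"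
    unfolding prod_Basis_vec
    by (simp add: Basis_complex_def inner_axis re_vec_def im_vec_def prod.distrib)
  finally show "emeasure (distr (lborel \<Otimes>\<^sub>M lborel) borel (\<lambda>p. cvec (fst p) (snd p))) (box l u) = ennreal (\<Prod>b\<in>Basis. (u - l) \<bullet> b)" .
qed simp

lemma nn_integral_cvec:
  fixes f :: "complex^'n::finite \<Rightarrow> ennreal"
  assumes [measurable]: "f \<in> borel_measurable borel"
  shows "(\<integral>\<^sup>+z. f z \<partial>lborel) = (\<integral>\<^sup>+y. \<integral>\<^sup>+x. f (cvec x y) \<partial>lborel \<partial>lborel)"
  by (subst lborel_cvec) (simp add: nn_integral_distr lborel_pair.nn_integral_snd[symmetric] )

lemma nn_integral_cvec':
  fixes f :: "complex^'n::finite \<Rightarrow> ennreal"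
  assumes [measurable]: "f \<in> borel_measurable borel"
  shows "(\<integral>\<^sup>+z. f z \<partial>lborel) = (\<integral>\<^sup>+x. \<integral>\<^sup>+y. f (cvec x y) \<partial>lborel \<partial>lborel)"
  by (subst lborel_cvec) (simp add: nn_integral_distr lborel.nn_integral_fst[symmetric] )

lemma nn_integral_lborel_translate:
  fixes f :: "'a::euclidean_space \<Rightarrow> ennreal"
  assumes [measurable]: "f \<in> borel_measurable borel"
  shows "(\<integral>\<^sup>+x. f (x + a) \<partial>lborel) = (\<integral>\<^sup>+x. f x \<partial>lborel)"
proof -
  have "(\<integral>\<^sup>+x. f x \<partial>lborel) = (\<integral>\<^sup>+x. f x \<partial>distr lborel borel ((+) a))"
    by (simp add: lborel_distr_plus)
  also have "\<dots> = (\<integral>\<^sup>+x. f (x + a) \<partial>lborel)"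
    by (simp add: nn_integral_distr add.commute)
  finally show ?thesis ..
qed

lemma integral_lborel_translate:
  fixes f :: "'a::euclidean_space \<Rightarrow> 'b::{banach, second_countable_topology}"
  assumes [measurable]: "f \<in> borel_measurable borel"
  shows "(\<integral>x. f (x + a) \<partial>lborel) = (\<integral>x. f x \<partial>lborel)"
    and "integrable lborel (\<lambda>x. f (x + a)) \<longleftrightarrow> integrable lborel f"
proof -
  have "(\<integral>x. f x \<partial>lborel) = (\<integral>x. f x \<partial>distr lborel borel ((+) a))"
    by (simp add: lborel_distr_plus)
  also have "\<dots> = (\<integral>x. f (x + a) \<partial>lborel)"
    by (simp add: integral_distr add.commute)
  finally show "(\<integral>x. f (x + a) \<partial>lborel) = (\<integral>x. f x \<partial>lborel)" ..
  have "integrable lborel f \<longleftrightarrow> integrable (distr lborel borel ((+) a)) f"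
    by (simp add: lborel_distr_plus)
  also have "\<dots> \<longleftrightarrow> integrable lborel (\<lambda>x. f (x + a))"
    by (subst integrable_distr_eq) (auto simp: add.commute)
  finally show "integrable lborel (\<lambda>x. f (x + a)) \<longleftrightarrow> integrable lborel f" ..
qed

text \<open>A rotation other than by \<open>- 1\<close> is a composition of three shears, applied here in all coordinate
  planes at once, and a shear preserves iterated integrals by translation invariance in one variable.\<close>

lemma nn_integral_rotate_aux:
  fixes f :: "complex^'n::finite \<Rightarrow> ennreal"
  assumes [measurable]: "f \<in> borel_measurable borel" and c: "norm c = 1" "c \<noteq> -1"
  shows "(\<integral>\<^sup>+z. f (c *s z) \<partial>lborel) = (\<integral>\<^sup>+z. f z \<partial>lborel)"
proof -
  define b where "b = Im c"
  \<comment> \<open>the shears are by the tangent of half the angle, by the sine, and again by the tangent\<close>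
  define a where "a = - Im c / (1 + Re c)"
  have sq: "(Re c)\<^sup>2 + (Im c)\<^sup>2 = 1" using c(1) cmod_power2[of c] by simp
  have nz: "1 + Re c \<noteq> 0"
  proof
    assume "1 + Re c = 0"
    then have "Re c = -1" by simp
    with sq have "c = -1" by (simp add: complex_eq_iff)
    with c show False by simp
  qed
  have im2: "Im c * Im c = (1 + Re c) * (1 - Re c)" using sq by (simp add: power2_eq_square algebra_simps)
  have ab: "1 + a * b = Re c" using nz im2 by (simp add: a_def b_def field_simps)
  have "a * (1 + (1 + a * b)) = - Im c" unfolding ab using nz by (simp add: a_def)
  then have aab: "a + (a + a * (a * b)) = - Im c" by (simp add: algebra_simps)
  have key: "c *s cvec x y = cvec ((x + a *\<^sub>R y) + a *\<^sub>R (y + b *\<^sub>R (x + a *\<^sub>R y))) (y + b *\<^sub>R (x + a *\<^sub>R y))" for x y :: "real^'n"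
  proof (simp add: vec_eq_iff cvec_def complex_eq_iff, intro allI conjI)
    fix i
    have "x $ i + a * y $ i + a * (y $ i + b * (x $ i + a * y $ i)) = (1 + a * b) * x $ i + (a + (a + a * (a * b))) * y $ i"
      by (simp add: algebra_simps)
    then show "Re c * x $ i - Im c * y $ i = x $ i + a * y $ i + a * (y $ i + b * (x $ i + a * y $ i))"
      unfolding ab aab by simp
    have "y $ i + b * (x $ i + a * y $ i) = (1 + a * b) * y $ i + b * x $ i" by (simp add: algebra_simps)
    then show "Re c * y $ i + Im c * x $ i = y $ i + b * (x $ i + a * y $ i)"
      unfolding ab by (simp add: b_def)
  qed
  have "(\<integral>\<^sup>+z. f (c *s z) \<partial>lborel) = (\<integral>\<^sup>+y. \<integral>\<^sup>+x. f (cvec ((x + a *\<^sub>R y) + a *\<^sub>R (y + b *\<^sub>R (x + a *\<^sub>R y))) (y + b *\<^sub>R (x + a *\<^sub>R y))) \<partial>lborel \<partial>lborel)"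
    by (subst nn_integral_cvec) (auto simp: key)
  also have "\<dots> = (\<integral>\<^sup>+y. \<integral>\<^sup>+x. f (cvec (x + a *\<^sub>R (y + b *\<^sub>R x)) (y + b *\<^sub>R x)) \<partial>lborel \<partial>lborel)"
    by (intro nn_integral_cong nn_integral_lborel_translate[where f="\<lambda>x. f (cvec (x + a *\<^sub>R (_ + b *\<^sub>R x)) (_ + b *\<^sub>R x))"]) measurable
  also have "\<dots> = (\<integral>\<^sup>+x. \<integral>\<^sup>+y. f (cvec (x + a *\<^sub>R (y + b *\<^sub>R x)) (y + b *\<^sub>R x)) \<partial>lborel \<partial>lborel)"
    by (rule lborel_pair.Fubini') measurable
  also have "\<dots> = (\<integral>\<^sup>+x. \<integral>\<^sup>+y. f (cvec (x + a *\<^sub>R y) y) \<partial>lborel \<partial>lborel)"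
    by (intro nn_integral_cong nn_integral_lborel_translate[where f="\<lambda>y. f (cvec (_ + a *\<^sub>R y) y)"]) measurable
  also have "\<dots> = (\<integral>\<^sup>+y. \<integral>\<^sup>+x. f (cvec (x + a *\<^sub>R y) y) \<partial>lborel \<partial>lborel)"
    by (rule lborel_pair.Fubini') measurable
  also have "\<dots> = (\<integral>\<^sup>+y. \<integral>\<^sup>+x. f (cvec x y) \<partial>lborel \<partial>lborel)"
    by (intro nn_integral_cong nn_integral_lborel_translate[where f="\<lambda>x. f (cvec x _)"]) measurable
  also have "\<dots> = (\<integral>\<^sup>+z. f z \<partial>lborel)"
    by (rule nn_integral_cvec[symmetric]) simp
  finally show ?thesis .
qed

lemma nn_integral_uminus:
  fixes f :: "'a::euclidean_space \<Rightarrow> ennreal"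
  assumes [measurable]: "f \<in> borel_measurable borel"
  shows "(\<integral>\<^sup>+x. f (- x) \<partial>lborel) = (\<integral>\<^sup>+x. f x \<partial>lborel)"
proof -
  have "(lborel :: 'a measure) = distr lborel borel uminus"
    using lborel_affine[of "-1" "0::'a"] by (simp add: density_1)
  then have "(\<integral>\<^sup>+x. f x \<partial>lborel) = (\<integral>\<^sup>+x. f x \<partial>distr lborel borel uminus)" by simp
  also have "\<dots> = (\<integral>\<^sup>+x. f (- x) \<partial>lborel)" by (simp add: nn_integral_distr)
  finally show ?thesis ..
qed

lemma distr_rotate:
  assumes c: "norm c = 1"
  shows "distr lborel borel (\<lambda>z. c *s z) = (lborel :: (complex^'n::finite) measure)"
proof (rule measure_eqI)
  fix A :: "(complex^'n) set" assume "A \<in> sets (distr lborel borel (\<lambda>z. c *s z))"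
  then have [measurable]: "A \<in> sets borel" by simp
  have "emeasure (distr lborel borel (\<lambda>z. c *s z)) A = (\<integral>\<^sup>+z. indicator A z \<partial>distr lborel borel (\<lambda>z. c *s z))"
    by simp
  also have "\<dots> = (\<integral>\<^sup>+z. indicator A (c *s z) \<partial>lborel)"
    by (subst nn_integral_distr) auto
  also have "\<dots> = (\<integral>\<^sup>+z. indicator A z \<partial>lborel)"
  proof (cases "c = -1")
    case True
    then have "c *s z = - z" for z :: "complex^'n" by (simp add: vec_eq_iff)
    then show ?thesis using nn_integral_uminus[of "indicator A"] by simp
  next
    case False
    then show ?thesis using nn_integral_rotate_aux[of "indicator A" c] c by simp
  qed
  finally show "emeasure (distr lborel borel (\<lambda>z. c *s z)) A = emeasure lborel A" by simp
qed simp

lemma integral_rotate: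
  fixes f :: "complex^'n::finite \<Rightarrow> complex"
  assumes [measurable]: "f \<in> borel_measurable borel" and c: "norm c = 1"
  shows "(\<integral>z. f (c *s z) \<partial>lborel) = (\<integral>z. f z \<partial>lborel)"
  using integral_distr[of "\<lambda>z. c *s z" lborel borel f] distr_rotate[OF c, where 'n='n] by simp

lemma nn_gauss_1:
  assumes "a > 0"
  shows "(\<integral>\<^sup>+t. ennreal (exp (- pi * a * t\<^sup>2)) \<partial>lborel) = ennreal (1 / sqrt a)"
proof -
  define s where "s = 1 / sqrt (2 * pi * a)"
  have s: "s > 0" "s\<^sup>2 = 1 / (2 * pi * a)" using assms by (simp_all add: s_def power_divide)
  have eq: "normal_density 0 s t = sqrt a * exp (- pi * a * t\<^sup>2)" for t
    using assms s(1) by (simp add: normal_density_def s(2) real_sqrt_divide)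
  have "(\<integral>\<^sup>+t. ennreal (normal_density 0 s t) \<partial>lborel) = 1"
    using s(1) by (subst nn_integral_eq_integral) auto
  then have "ennreal (sqrt a) * (\<integral>\<^sup>+t. ennreal (exp (- pi * a * t\<^sup>2)) \<partial>lborel) = 1"
    unfolding eq using assms by (simp add: ennreal_mult nn_integral_cmult)
  then have "ennreal (1 / sqrt a) * (ennreal (sqrt a) * (\<integral>\<^sup>+t. ennreal (exp (- pi * a * t\<^sup>2)) \<partial>lborel)) = ennreal (1 / sqrt a)"
    by simp
  then show ?thesis
    unfolding mult.assoc[symmetric] using assms by (subst (asm) ennreal_mult[symmetric]) auto
qed

lemma nn_gauss:
  assumes "a > 0"
  shows "(\<integral>\<^sup>+x. ennreal (exp (- pi * a * (norm (x::'a::euclidean_space))\<^sup>2)) \<partial>lborel) = ennreal ((1 / sqrt a) ^ DIM('a))"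
proof -
  have "(norm x)\<^sup>2 = (\<Sum>b\<in>Basis. (x \<bullet> b)\<^sup>2)" for x :: 'a
    using euclidean_inner[of x x] by (simp only: power2_norm_eq_inner power2_eq_square[symmetric])
  then have "exp (- pi * a * (norm x)\<^sup>2) = (\<Prod>b\<in>Basis. exp (- pi * a * (x \<bullet> b)\<^sup>2))" for x :: 'a
    by (subst exp_sum[symmetric]) (simp_all add: sum_distrib_left)
  then have "(\<integral>\<^sup>+x. ennreal (exp (- pi * a * (norm (x::'a))\<^sup>2)) \<partial>lborel) = (\<integral>\<^sup>+x. (\<Prod>b\<in>Basis. ennreal (exp (- pi * a * ((x::'a) \<bullet> b)\<^sup>2))) \<partial>lborel)"
    by (simp add: prod_ennreal)
  also have "\<dots> = (\<Prod>b\<in>(Basis::'a set). (\<integral>\<^sup>+t. ennreal (exp (- pi * a * t\<^sup>2)) \<partial>lborel))"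
    by (rule nn_integral_lborel_prod) auto
  also have "\<dots> = ennreal ((1 / sqrt a) ^ DIM('a))"
    unfolding nn_gauss_1[OF assms] using assms by (simp add: ennreal_power)
  finally show ?thesis .
qed

lemma integrable_gauss:
  assumes "a > 0" shows "integrable lborel (\<lambda>x::'a::euclidean_space. exp (- pi * a * (norm x)\<^sup>2))"
  by (rule integrableI_bounded) (use nn_gauss[OF assms, where 'a='a] in auto)

lemma integral_gauss:
  assumes "a > 0" shows "(\<integral>x. exp (- pi * a * (norm (x::'a::euclidean_space))\<^sup>2) \<partial>lborel) = (1 / sqrt a) ^ DIM('a)"
  using nn_gauss[OF assms, where 'a='a] assms
  by (subst integral_eq_nn_integral) auto

lemma nn_integral_inverse_1_plus_square_finite:
  "(\<integral>\<^sup>+x. ennreal (1 / (1 + x\<^sup>2)) \<partial>lborel) < \<infinity>"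
proof -
  have "integrable lborel (\<lambda>x::real. inverse (1 + x^2))"
    using integrable_inverse_1_plus_square by (simp add: set_integrable_def einterval_def)
  then have "(\<integral>\<^sup>+x. ennreal (norm (inverse (1 + (x::real)\<^sup>2))) \<partial>lborel) < \<infinity>" 
    unfolding integrable_iff_bounded by (rule conjunct2)
  moreover have "norm (inverse (1 + x\<^sup>2)) = 1 / (1 + x\<^sup>2)" for x :: real
    by (simp add: inverse_eq_divide add_nonneg_nonneg)
  ultimately show ?thesis by simp
qed

lemma integrable_decay:
  assumes "K \<ge> 2 * DIM('a)"
  shows "integrable lborel (\<lambda>x::'a::euclidean_space. 1 / (1 + norm x) ^ K)"
proof (rule integrableI_bounded)
  have le: "1 / (1 + norm x) ^ K \<le> (\<Prod>b\<in>Basis. 1 / (1 + (x \<bullet> b)\<^sup>2))" for x :: 'a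
  proof -
    have "(\<Prod>b\<in>Basis. 1 + (x \<bullet> b)\<^sup>2) \<le> (\<Prod>b\<in>(Basis::'a set). (1 + norm x)\<^sup>2)"
    proof (rule prod_mono, intro conjI)
      fix b :: 'a assume "b \<in> Basis"
      then have "\<bar>x \<bullet> b\<bar> \<le> norm x" by (rule Basis_le_norm)
      then have "(x \<bullet> b)\<^sup>2 \<le> (norm x)\<^sup>2" by (simp add: power2_le_iff_abs_le)
      then show "1 + (x \<bullet> b)\<^sup>2 \<le> (1 + norm x)\<^sup>2" using norm_ge_zero[of x] unfolding power2_sum power_one by linarith
    qed simp
    also have "\<dots> = (1 + norm x) ^ (2 * DIM('a))" by (simp add: power_mult)
    also have "\<dots> \<le> (1 + norm x) ^ K" using assms by (intro power_increasing) auto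
    finally have "(\<Prod>b\<in>Basis. 1 + (x \<bullet> b)\<^sup>2) \<le> (1 + norm x) ^ K" .
    moreover have "(\<Prod>b\<in>Basis. 1 + (x \<bullet> b)\<^sup>2) > 0" by (intro prod_pos) (auto simp: add_pos_nonneg)
    ultimately show ?thesis unfolding prod_dividef by (intro divide_mono) auto
  qed
  have "(\<integral>\<^sup>+x. ennreal (norm (1 / (1 + norm (x::'a)) ^ K)) \<partial>lborel) \<le> (\<integral>\<^sup>+x. (\<Prod>b\<in>Basis. ennreal (1 / (1 + ((x::'a) \<bullet> b)\<^sup>2))) \<partial>lborel)"
    using le by (intro nn_integral_mono) (auto simp: prod_ennreal intro!: ennreal_leI)
  also have "\<dots> = (\<Prod>b\<in>(Basis::'a set). (\<integral>\<^sup>+t. ennreal (1 / (1 + t\<^sup>2)) \<partial>lborel))"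
    by (rule nn_integral_lborel_prod) auto
  also have "\<dots> < \<infinity>"
    using nn_integral_inverse_1_plus_square_finite by (simp add: power_less_top_ennreal)
  finally show "(\<integral>\<^sup>+x. ennreal (norm (1 / (1 + norm (x::'a)) ^ K)) \<partial>lborel) < \<infinity>" .
qed simp

lemma Fubini_lborel:
  fixes f :: "'a::euclidean_space \<Rightarrow> 'b::euclidean_space \<Rightarrow> 'c::{banach, second_countable_topology}"
  assumes m [measurable]: "(\<lambda>p. f (fst p) (snd p)) \<in> borel_measurable (borel \<Otimes>\<^sub>M borel)"
    and fin: "(\<integral>\<^sup>+x. \<integral>\<^sup>+y. ennreal (norm (f x y)) \<partial>lborel \<partial>lborel) < \<infinity>"
  shows "(\<integral>x. \<integral>y. f x y \<partial>lborel \<partial>lborel) = (\<integral>y. \<integral>x. f x y \<partial>lborel \<partial>lborel)"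
    and "integrable lborel (\<lambda>x. \<integral>y. f x y \<partial>lborel)" "integrable lborel (\<lambda>y. \<integral>x. f x y \<partial>lborel)"
proof -
  have m' [measurable]: "(\<lambda>p. f (fst p) (snd p)) \<in> borel_measurable (lborel \<Otimes>\<^sub>M lborel)"
    using m by (simp cong: measurable_cong_sets)
  have int: "integrable (lborel \<Otimes>\<^sub>M lborel) (\<lambda>(x, y). f x y)"
  proof (rule integrableI_bounded)
    show "(\<lambda>(x, y). f x y) \<in> borel_measurable (lborel \<Otimes>\<^sub>M lborel)" using m' by (simp add: case_prod_unfold)
    have "(\<integral>\<^sup>+p. ennreal (norm (f (fst p) (snd p))) \<partial>(lborel \<Otimes>\<^sub>M lborel)) = (\<integral>\<^sup>+x. \<integral>\<^sup>+y. ennreal (norm (f x y)) \<partial>lborel \<partial>lborel)"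
      by (subst lborel.nn_integral_fst[symmetric]) auto
    then show "(\<integral>\<^sup>+p. ennreal (norm (case p of (x, y) \<Rightarrow> f x y)) \<partial>(lborel \<Otimes>\<^sub>M lborel)) < \<infinity>"
      using fin by (simp add: case_prod_unfold)
  qed
  show "(\<integral>x. \<integral>y. f x y \<partial>lborel \<partial>lborel) = (\<integral>y. \<integral>x. f x y \<partial>lborel \<partial>lborel)"
    using lborel_pair.Fubini_integral[OF int] by simp
  show "integrable lborel (\<lambda>x. \<integral>y. f x y \<partial>lborel)" using lborel_pair.integrable_fst[OF int] by simp
  show "integrable lborel (\<lambda>y. \<integral>x. f x y \<partial>lborel)" using lborel_pair.integrable_snd[OF int] by simp
qed

lemma norm_integral_le:
  fixes f :: "'a \<Rightarrow> 'b::{banach, second_countable_topology}"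
  assumes "integrable M g" "\<And>x. norm (f x) \<le> g x"
  shows "norm (\<integral>x. f x \<partial>M) \<le> (\<integral>x. g x \<partial>M)"
proof (cases "integrable M f")
  case True
  have "norm (\<integral>x. f x \<partial>M) \<le> (\<integral>x. norm (f x) \<partial>M)" by (rule integral_norm_bound)
  also have "\<dots> \<le> (\<integral>x. g x \<partial>M)" using True assms by (intro integral_mono) auto
  finally show ?thesis .
next
  case False
  have "0 \<le> g x" for x using assms(2)[of x] norm_ge_zero[of "f x"] by linarith
  then show ?thesis using False by (simp add: not_integrable_integral_eq)
qed

section \<open>Entire functions\<close>

lemma has_derivative_quadratic:
  fixes f :: "'a::euclidean_space \<Rightarrow> 'b::real_normed_vector"
  assumes D: "linear D" and r: "r > 0"
    and le: "\<And>v. norm v < r \<Longrightarrow> norm (f (z + v) - f z - D v) \<le> C * (norm v)\<^sup>2"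
  shows "(f has_derivative D) (at z)"
proof -
  have "norm (f (z + v) - f z - D v) / norm v \<le> C * norm v" if "norm v < r" for v
  proof (cases "v = 0")
    case False
    then show ?thesis using le[OF that] by (simp add: divide_le_eq power2_eq_square mult.assoc)
  qed simp
  then have "\<forall>\<^sub>F v in at 0. norm (norm (f (z + v) - f z - D v) / norm v) \<le> C * norm v"
    unfolding eventually_at using r by (intro exI[of _ r]) (auto simp: dist_norm)
  moreover have "((\<lambda>v::'a. C * norm v) \<longlongrightarrow> 0) (at 0)"
    by (auto intro!: tendsto_eq_intros)
  ultimately have "((\<lambda>v. norm (f (z + v) - f z - D v) / norm v) \<longlongrightarrow> 0) (at 0)"
    by (rule Lim_null_comparison)
  then show ?thesis using D by (simp only: has_derivative_at linear_conv_bounded_linear simp_thms)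
qed

text \<open>All differentiability proofs below end in a remainder that is quadratic in the increment,
  uniformly in some parameter, because Cauchy estimates give such remainders.\<close>

lemma entireI_quadratic:
  fixes F :: "complex^'n::finite \<Rightarrow> complex"
  assumes "\<And>z. \<exists>D C r. r > 0 \<and> (\<forall>v w. D (v + w) = D v + D w) \<and> (\<forall>c v. D (c *s v) = c * D v) \<and>
      (\<forall>v. norm v < r \<longrightarrow> norm (F (z + v) - F z - D v) \<le> C * (norm v)\<^sup>2)"
  shows "entire F"
  unfolding entire_def
proof
  fix z
  obtain D C r where *: "r > 0" "\<And>v w. D (v + w) = D v + D w" "\<And>c v. D (c *s v) = c * D v"
     "\<And>v. norm v < r \<Longrightarrow> norm (F (z + v) - F z - D v) \<le> C * (norm v)\<^sup>2"
    using assms[of z] by blast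
  have "D (r *\<^sub>R v) = r *\<^sub>R D v" for r v
  proof -
    have "r *\<^sub>R v = of_real r *s v" by (simp add: vec_eq_iff scaleR_conv_of_real[where 'a=complex])
    then show ?thesis by (simp only: *(3) scaleR_conv_of_real[where 'a=complex])
  qed
  then have "linear D" using *(2) by (intro linearI) auto
  from has_derivative_quadratic[OF this *(1,4)] *(3) show "\<exists>D. (F has_derivative D) (at z) \<and> (\<forall>c v. D (c *s v) = c * D v)"
    by blast
qed

lemma entireD:
  assumes "entire F"
  shows "(F has_derivative frechet_derivative F (at z)) (at z)"
    "frechet_derivative F (at z) (c *s v) = c * frechet_derivative F (at z) v"
proof -
  obtain D where D: "(F has_derivative D) (at z)" "\<And>c v. D (c *s v) = c * D v"
    using assms unfolding entire_def by blast
  have "frechet_derivative F (at z) = D" using frechet_derivative_at[OF D(1)] by simp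
  then show "(F has_derivative frechet_derivative F (at z)) (at z)"
    "frechet_derivative F (at z) (c *s v) = c * frechet_derivative F (at z) v" using D by auto
qed

lemma entire_continuous: "entire F \<Longrightarrow> continuous_on S F"
  by (rule continuous_at_imp_continuous_on) (auto intro: has_derivative_continuous entireD(1))

lemma entire_measurable: "entire F \<Longrightarrow> F \<in> borel_measurable borel"
  by (intro borel_measurable_continuous_onI entire_continuous)

lemma entire_line_derivative:
  assumes "entire F"
  shows "((\<lambda>t. F (z + t *s v)) has_field_derivative frechet_derivative F (at (z + t *s v)) v) (at t)"
proof -
  have "linear (\<lambda>t. t *s v)" by (intro linearI) (auto simp: vec_eq_iff algebra_simps)
  then have "((\<lambda>t. t *s v) has_derivative (\<lambda>t. t *s v)) (at t)"
    by (simp add: bounded_linear_imp_has_derivative linear_conv_bounded_linear)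
  then have "((\<lambda>t. z + t *s v) has_derivative (\<lambda>t. t *s v)) (at t)"
    by (rule has_derivative_add_const[where c=z, unfolded add.commute[of _ z]])
  from has_derivative_compose[OF this entireD(1)[OF assms]]
  have "((\<lambda>t. F (z + t *s v)) has_derivative (\<lambda>x. x * frechet_derivative F (at (z + t *s v)) v)) (at t)"
    by (simp add: entireD(2)[OF assms])
  moreover have "(\<lambda>x. x * d) = (*) d" for d :: complex by (simp add: fun_eq_iff)
  ultimately show ?thesis by (simp only: has_field_derivative_def)
qed

lemma entire_line_holomorphic: "entire F \<Longrightarrow> (\<lambda>t. F (z + t *s v)) holomorphic_on S"
  unfolding holomorphic_on_def field_differentiable_def
  by (blast intro: has_field_derivative_at_within entire_line_derivative)

lemma entire_const: "entire (\<lambda>z. c)"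
  unfolding entire_def by (intro allI exI[of _ "\<lambda>v. 0"]) auto

lemma entire_nth: "entire (\<lambda>z. z $ j)"
  unfolding entire_def
  by (intro allI exI[of _ "\<lambda>v. v $ j"]) (auto intro: bounded_linear_imp_has_derivative bounded_linear_vec_nth)

lemma entire_add: assumes "entire F" "entire G" shows "entire (\<lambda>z. F z + G z)"
  unfolding entire_def
proof
  fix z
  show "\<exists>D. ((\<lambda>z. F z + G z) has_derivative D) (at z) \<and> (\<forall>c v. D (c *s v) = c * D v)"
    by (rule exI, rule conjI, rule has_derivative_add[OF entireD(1)[OF assms(1)] entireD(1)[OF assms(2)]])
      (auto simp: entireD(2)[OF assms(1)] entireD(2)[OF assms(2)] algebra_simps)
qed

lemma entire_minus: assumes "entire F" shows "entire (\<lambda>z. - F z)"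
  unfolding entire_def
proof
  fix z
  show "\<exists>D. ((\<lambda>z. - F z) has_derivative D) (at z) \<and> (\<forall>c v. D (c *s v) = c * D v)"
    by (rule exI, rule conjI, rule has_derivative_minus[OF entireD(1)[OF assms(1)]])
      (auto simp: entireD(2)[OF assms(1)])
qed

lemma entire_diff: "entire F \<Longrightarrow> entire G \<Longrightarrow> entire (\<lambda>z. F z - G z)"
  using entire_add[OF _ entire_minus, of F G] by simp

lemma entire_mult: assumes "entire F" "entire G" shows "entire (\<lambda>z. F z * G z)"
  unfolding entire_def
proof
  fix z
  show "\<exists>D. ((\<lambda>z. F z * G z) has_derivative D) (at z) \<and> (\<forall>c v. D (c *s v) = c * D v)"
    by (rule exI, rule conjI, rule has_derivative_mult[OF entireD(1)[OF assms(1)] entireD(1)[OF assms(2)]])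
      (auto simp: entireD(2)[OF assms(1)] entireD(2)[OF assms(2)] algebra_simps)
qed

lemma entire_exp: assumes "entire F" shows "entire (\<lambda>z. exp (F z))"
  unfolding entire_def
proof
  fix z
  have "((\<lambda>z. exp (F z)) has_derivative (\<lambda>v. exp (F z) * frechet_derivative F (at z) v)) (at z)"
    using has_derivative_compose[OF entireD(1)[OF assms] DERIV_exp[THEN has_field_derivative_imp_has_derivative]]
    by (simp add: mult.commute)
  then show "\<exists>D. ((\<lambda>z. exp (F z)) has_derivative D) (at z) \<and> (\<forall>c v. D (c *s v) = c * D v)"
    by (intro exI conjI) (auto simp: entireD(2)[OF assms] algebra_simps)
qed

lemma entire_sum: "(\<And>i. i \<in> I \<Longrightarrow> entire (F i)) \<Longrightarrow> entire (\<lambda>z. \<Sum>i\<in>I. F i z)"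
  by (induction I rule: infinite_finite_induct) (auto intro: entire_const entire_add)

lemma entire_affine: 
  fixes F :: "complex^'n::finite \<Rightarrow> complex"
  assumes "entire F" shows "entire (\<lambda>z. F (c *s z + b))"
  unfolding entire_def
proof
  fix z
  have "((\<lambda>z. c *s z + b) has_derivative (\<lambda>v. c *s v)) (at z)"
    by (intro has_derivative_add_const bounded_linear_imp_has_derivative bounded_linear_vec_maps)
  from has_derivative_compose[OF this entireD(1)[OF assms]]
  show "\<exists>D. ((\<lambda>z. F (c *s z + b)) has_derivative D) (at z) \<and> (\<forall>c v. D (c *s v) = c * D v)"
    by (intro exI conjI) (auto simp: entireD(2)[OF assms] mult_ac)
qed

lemma entire_translate: "entire F \<Longrightarrow> entire (\<lambda>z. F (z + b))"
  using entire_affine[of F 1 b] by simp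

lemma entire_smult: "entire F \<Longrightarrow> entire (\<lambda>z. F (c *s z))"
  using entire_affine[of F c 0] by simp

lemma entire_dotc: "entire (\<lambda>z. dotc a z)" "entire (\<lambda>z. dotc z a)" "entire (\<lambda>z. dotc z z)"
  unfolding dotc_def by (intro entire_sum entire_mult entire_const entire_nth)+

lemmas entire_intros = entire_const entire_nth entire_add entire_minus entire_diff entire_mult entire_exp entire_sum entire_dotc

text \<open>Restrict to the complex line through \<open>Re z\<close> in the direction \<open>Im z\<close>: it contains \<open>z\<close>, and its real
  points are real vectors. The identity theorem in one variable applies on that line.\<close>

lemma entire_eq_on_real:
  fixes F G :: "complex^'n::finite \<Rightarrow> complex"
  assumes F: "entire F" and G: "entire G" and eq: "\<And>x. F (of_real_vec x) = G (of_real_vec x)"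
  shows "F z = G z"
proof -
  define h where "h = (\<lambda>t. F (of_real_vec (re_vec z) + t *s of_real_vec (im_vec z)) - G (of_real_vec (re_vec z) + t *s of_real_vec (im_vec z)))"
  have hol: "h holomorphic_on UNIV"
    unfolding h_def by (intro holomorphic_intros entire_line_holomorphic F G)
  have z0: "h t = 0" if "t \<in> \<real>" for t
  proof -
    obtain r where "t = of_real r" using \<open>t \<in> \<real>\<close> by (auto elim: Reals_cases)
    then show ?thesis using eq[of "re_vec z + r *\<^sub>R im_vec z"] by (simp add: h_def)
  qed
  have "0 islimpt (\<real>::complex set)"
  proof (rule islimpt_approachable[THEN iffD2], intro allI impI)
    fix e :: real assume "e > 0"
    then show "\<exists>x'\<in>\<real>. x' \<noteq> (0::complex) \<and> dist x' 0 < e"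
      by (intro bexI[of _ "of_real (e/2)"]) (auto simp: dist_norm)
  qed
  then have "h \<i> = 0"
    by (intro analytic_continuation[where f=h and S=UNIV and U=\<real> and \<xi>=0 and w=\<i>]) (auto intro: z0 hol)
  then show ?thesis by (simp add: h_def cvec_eq[symmetric])
qed

text \<open>Cauchy's inequality on the disc of radius \<open>r / 2\<close> bounds the second derivative; Taylor's formula
  does the rest. Only a bound of \<open>g\<close> enters, so the estimate can be integrated over a parameter.\<close>

lemma Cauchy_quadratic_1:
  assumes hol: "g holomorphic_on UNIV" and r: "r > 0" and M: "\<And>t. norm t \<le> r \<Longrightarrow> norm (g t) \<le> M" and t: "norm t \<le> r / 2"
  shows "norm (g t - g 0 - t * deriv g 0) \<le> 8 * M / r\<^sup>2 * (norm t)\<^sup>2"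
proof -
  define f where "f i = (deriv ^^ i) g" for i
  have hd: "(f i has_field_derivative f (Suc i) x) (at x within S)" for i x S
  proof -
    have "(f i) holomorphic_on UNIV" unfolding f_def by (intro holomorphic_higher_deriv hol) auto
    from holomorphic_derivI[OF this open_UNIV, of x] show ?thesis 
      by (simp add: f_def has_field_derivative_at_within)
  qed
  have B: "norm (f (Suc 1) x) \<le> 8 * M / r\<^sup>2" if "x \<in> cball 0 (r/2)" for x
  proof -
    have "norm ((deriv ^^ 2) g x) \<le> fact 2 * M / (r/2)^2"
    proof (rule Cauchy_inequality)
      fix y assume y: "norm (x - y) = r / 2"
      have "norm y \<le> norm x + norm (x - y)" using norm_triangle_ineq4[of x "x - y"] by simp
      then have "norm y \<le> r" using that y by simp
      then show "norm (g y) \<le> M" by (rule M)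
    qed (use hol r in \<open>auto intro: holomorphic_on_subset holomorphic_on_imp_continuous_on\<close>)
    then show ?thesis by (simp add: f_def numeral_2_eq_2[symmetric] power_divide)
  qed
  have "norm (f 0 t - (\<Sum>i\<le>1. f i 0 * (t - 0)^i / fact i)) \<le> 8 * M / r\<^sup>2 * norm (t - 0)^(Suc 1) / fact 1"
    by (rule complex_Taylor[of "cball 0 (r/2)"]) (use hd B r t in auto)
  then show ?thesis by (simp add: f_def algebra_simps power2_eq_square)
qed

lemma entire_quadratic_bound:
  fixes F :: "complex^'n::finite \<Rightarrow> complex"
  assumes F: "entire F" and r: "r > 0" and M: "\<And>w. norm w \<le> r \<Longrightarrow> norm (F (z + w)) \<le> M" and v: "norm v \<le> r / 2"
  shows "norm (F (z + v) - F z - frechet_derivative F (at z) v) \<le> 8 * M / r\<^sup>2 * (norm v)\<^sup>2"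
proof (cases "v = 0")
  case True
  then show ?thesis using linear_0[OF has_derivative_linear[OF entireD(1)[OF F]]] by simp
next
  case False
  define u where "u = of_real (1 / norm v) *s v"
  have u: "norm u = 1" "of_real (norm v) *s u = v" using False by (simp_all add: u_def norm_divide vec_eq_iff)
  define g where "g = (\<lambda>t. F (z + t *s u))"
  have "norm (g (of_real (norm v)) - g 0 - of_real (norm v) * deriv g 0) \<le> 8 * M / r\<^sup>2 * (norm (of_real (norm v) :: complex))\<^sup>2"
  proof (rule Cauchy_quadratic_1)
    show "g holomorphic_on UNIV" unfolding g_def by (rule entire_line_holomorphic[OF F])
  qed (use r v u in \<open>auto simp: g_def intro!: M\<close>)
  moreover have "deriv g 0 = frechet_derivative F (at z) u"
    using DERIV_imp_deriv[OF entire_line_derivative[OF F, of z u 0]] by (simp add: g_def)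
  moreover have "of_real (norm v) * frechet_derivative F (at z) u = frechet_derivative F (at z) v"
    by (subst entireD(2)[OF F, symmetric]) (simp add: u)
  ultimately show ?thesis by (simp add: g_def u)
qed

lemma entire_derivative_bound:
  fixes F :: "complex^'n::finite \<Rightarrow> complex"
  assumes F: "entire F" and M: "\<And>w. norm w \<le> 1 \<Longrightarrow> norm (F (z + w)) \<le> M"
  shows "norm (frechet_derivative F (at z) v) \<le> M * norm v"
proof (cases "v = 0")
  case True
  then show ?thesis using linear_0[OF has_derivative_linear[OF entireD(1)[OF F]]] by simp
next
  case False
  define u where "u = of_real (1 / norm v) *s v"
  have u: "norm u = 1" "of_real (norm v) *s u = v" using False by (simp_all add: u_def norm_divide vec_eq_iff)
  define g where "g = (\<lambda>t. F (z + t *s u))"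
  have hol: "g holomorphic_on S" for S unfolding g_def by (rule entire_line_holomorphic[OF F])
  have "norm ((deriv ^^ 1) g 0) \<le> fact 1 * M / 1 ^ 1"
    by (rule Cauchy_inequality) (use u in \<open>auto intro!: entire_line_holomorphic[OF F] holomorphic_on_imp_continuous_on M simp: g_def\<close>)
  then have "norm (deriv g 0) \<le> M" by simp
  moreover have "deriv g 0 = frechet_derivative F (at z) u"
    using DERIV_imp_deriv[OF entire_line_derivative[OF F, of z u 0]] by (simp add: g_def)
  moreover have "frechet_derivative F (at z) v = of_real (norm v) * frechet_derivative F (at z) u"
    by (subst entireD(2)[OF F, symmetric]) (simp add: u)
  ultimately show ?thesis by (simp add: norm_mult mult.commute[of M] mult_left_mono)
qed

text \<open>Domination on balls of the integrand alone suffices: Cauchy estimates turn it into domination of the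
  derivative and of the Taylor remainder.\<close>

lemma entire_integral:
  fixes f :: "complex^'n::finite \<Rightarrow> 'a \<Rightarrow> complex"
  assumes ent: "\<And>w. entire (\<lambda>z. f z w)"
    and [measurable]: "\<And>z. f z \<in> borel_measurable M"
    and dom: "\<And>R. \<exists>h. integrable M h \<and> (\<forall>z w. norm z \<le> R \<longrightarrow> norm (f z w) \<le> h w)"
  shows "entire (\<lambda>z. \<integral>w. f z w \<partial>M)"
proof (rule entireI_quadratic)
  fix z :: "complex^'n"
  obtain h where h: "integrable M h" "\<And>y w. norm y \<le> norm z + 1 \<Longrightarrow> norm (f y w) \<le> h w"
    using dom[of "norm z + 1"] by blast
  have int: "integrable M (f y)" if "norm y \<le> norm z + 1" for y
    by (rule Bochner_Integration.integrable_bound[OF h(1)]) (auto intro!: order_trans[OF h(2)[OF that] abs_ge_self])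
  have hz: "norm (f (z + w) x) \<le> h x" if "norm w \<le> 1" for w x
    using that norm_triangle_ineq[of z w] by (intro h(2)) simp
  define D where "D w v = frechet_derivative (\<lambda>z. f z w) (at z) v" for w v
  have quad: "norm (f (z + v) w - f z w - D w v) \<le> 8 * h w * (norm v)\<^sup>2" if "norm v \<le> 1/2" for v w
    using entire_quadratic_bound[OF ent, of 1 z w "h w" v] hz that by (simp add: D_def)
  have Db: "norm (D w v) \<le> h w * norm v" for w v
    unfolding D_def by (rule entire_derivative_bound[OF ent hz])
  have Dm [measurable]: "(\<lambda>w. D w v) \<in> borel_measurable M" for v
  proof (rule borel_measurable_LIMSEQ_metric)
    fix w assume "w \<in> space M"
    have "((\<lambda>t. f (z + t *s v) w) has_field_derivative D w v) (at 0)"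
      using entire_line_derivative[OF ent[of w], of z v 0] by (simp add: D_def)
    then have "((\<lambda>t. (f (z + t *s v) w - f z w) / t) \<longlongrightarrow> D w v) (at 0)"
      by (simp add: DERIV_def)
    moreover have "filterlim (\<lambda>n. of_real (inverse (real (Suc n))) :: complex) (at 0) sequentially"
      unfolding filterlim_at using LIMSEQ_inverse_real_of_nat tendsto_of_real[OF LIMSEQ_inverse_real_of_nat, where 'a=complex]
      by (auto simp del: of_nat_Suc)
    ultimately show "(\<lambda>n. (f (z + of_real (inverse (real (Suc n))) *s v) w - f z w) / of_real (inverse (real (Suc n)))) \<longlonglongrightarrow> D w v"
      by (rule filterlim_compose)
  qed measurable
  have Di: "integrable M (\<lambda>w. D w v)" for v
    by (rule Bochner_Integration.integrable_bound[OF integrable_mult_left[OF h(1), of "norm v"]])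
       (use Db in \<open>auto intro!: AE_I2 order_trans[OF Db]\<close>)
  show "\<exists>D C r. r > 0 \<and> (\<forall>v w. D (v + w) = D v + D w) \<and> (\<forall>c v. D (c *s v) = c * D v) \<and>
      (\<forall>v. norm v < r \<longrightarrow> norm ((\<integral>w. f (z + v) w \<partial>M) - (\<integral>w. f z w \<partial>M) - D v) \<le> C * (norm v)\<^sup>2)"
  proof (rule exI[of _ "\<lambda>v. \<integral>w. D w v \<partial>M"], rule exI[of _ "8 * (\<integral>w. h w \<partial>M)"], rule exI[of _ "1/2"],
      intro conjI allI impI)
    fix v w
    show "(\<integral>x. D x (v + w) \<partial>M) = (\<integral>x. D x v \<partial>M) + (\<integral>x. D x w \<partial>M)"
      using linear_add[OF has_derivative_linear[OF entireD(1)[OF ent]]] 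
      by (simp add: Bochner_Integration.integral_add[OF Di Di, symmetric]) (simp add: D_def)
  next
    fix c v show "(\<integral>x. D x (c *s v) \<partial>M) = c * (\<integral>x. D x v \<partial>M)"
      by (subst integral_mult_right_zero[symmetric]) (simp add: D_def entireD(2)[OF ent])
  next
    fix v :: "complex^'n" assume v: "norm v < 1 / 2"
    have "norm (z + v) \<le> norm z + 1" using v norm_triangle_ineq[of z v] by simp
    note i = int[OF this] int[of z] Di[of v]
    have "(\<integral>w. f (z + v) w \<partial>M) - (\<integral>w. f z w \<partial>M) - (\<integral>w. D w v \<partial>M) = (\<integral>w. f (z + v) w - f z w - D w v \<partial>M)"
      using i by simp
    also have "norm \<dots> \<le> (\<integral>w. 8 * h w * (norm v)\<^sup>2 \<partial>M)"
      by (rule norm_integral_le) (use i h(1) quad v in auto)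
    finally show "norm ((\<integral>w. f (z + v) w \<partial>M) - (\<integral>w. f z w \<partial>M) - (\<integral>w. D w v \<partial>M)) \<le> 8 * (\<integral>w. h w \<partial>M) * (norm v)\<^sup>2"
      by simp
  qed simp
qed

section \<open>The reproducing formula\<close>

text \<open>The density of the Gaussian measure of the Fock space, complex-valued so that it can be multiplied
  with entire functions without coercions.\<close>

definition gw :: "complex^'n::finite \<Rightarrow> complex" where "gw w = of_real (exp (- pi * (norm w)\<^sup>2))"

lemma gw_eq: "gw w = exp (- of_real pi * dotc (cnj_vec w) w)"
  by (simp add: gw_def dotc_cnj_self exp_of_real[symmetric])

lemma norm_gw: "norm (gw w) = exp (- pi * (norm w)\<^sup>2)"
  by (simp add: gw_def)

lemma continuous_gw [continuous_intros]: "continuous_on S gw"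
  unfolding gw_def by (intro continuous_intros)

lemma measurable_gw [measurable]: "gw \<in> borel_measurable borel"
  by (intro borel_measurable_continuous_onI continuous_gw)

lemma gw_integral: "integrable lborel (gw :: complex^'n::finite \<Rightarrow> complex)" "(\<integral>w. gw (w :: complex^'n) \<partial>lborel) = 1"
proof -
  show "integrable lborel (gw :: complex^'n::finite \<Rightarrow> complex)"
    unfolding gw_def[abs_def] using integrable_gauss[of 1, where 'a="complex^'n"] by (intro integrable_of_real) simp
  show "(\<integral>w. gw (w :: complex^'n) \<partial>lborel) = 1"
    unfolding gw_def using integral_gauss[of 1, where 'a="complex^'n"] by simp
qed

lemma circle_mean:
  assumes "g holomorphic_on UNIV"
  shows "(\<integral>t. indicator {0..1} t *\<^sub>R g (exp (2 * of_real pi * \<i> * of_real t)) \<partial>lborel) = g 0"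
proof -
  have c: "continuous_on {0..1} (\<lambda>t. g (exp (2 * of_real pi * \<i> * of_real t)))"
    by (intro continuous_on_compose2[OF holomorphic_on_imp_continuous_on[OF assms]] continuous_intros) auto
  have "((\<lambda>u. g u / (u - 0)) has_contour_integral (2 * of_real pi * \<i> * g 0)) (circlepath 0 1)"
    by (rule Cauchy_integral_circlepath_simple) (use assms in \<open>auto intro: holomorphic_on_subset\<close>)
  then have "((\<lambda>t. 2 * of_real pi * \<i> * g (exp (2 * of_real pi * \<i> * of_real t))) has_integral 2 * of_real pi * \<i> * g 0) {0..1}"
    unfolding has_contour_integral vector_derivative_circlepath by (simp add: circlepath mult_ac)
  from has_integral_mult_right[OF this, of "1 / (2 * of_real pi * \<i>)"]
  have "((\<lambda>t. g (exp (2 * of_real pi * \<i> * of_real t))) has_integral g 0) {0..1}"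
    by simp
  then have "integral {0..1} (\<lambda>t. g (exp (2 * of_real pi * \<i> * of_real t))) = g 0" by (rule integral_unique)
  with set_borel_integral_eq_integral(2)[OF borel_integrable_atLeastAtMost'[OF c]] 
  show ?thesis by (simp add: set_lebesgue_integral_def)
qed

text \<open>The measure is invariant under \<open>w \<mapsto> e w\<close> with \<open>|e| = 1\<close>. Averaging over the circle replaces \<open>F w\<close> by the mean
  of \<open>F\<close> over a circle in the complex line through \<open>0\<close> and \<open>w\<close>, which is \<open>F 0\<close>.\<close>

lemma mean_value_gauss:
  fixes F :: "complex^'n::finite \<Rightarrow> complex"
  assumes F: "entire F" and int: "integrable lborel (\<lambda>w. F w * gw w)"
  shows "(\<integral>w. F w * gw w \<partial>lborel) = F 0"
proof -
  note [measurable] = entire_measurable[OF F]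
  define e where "e t = exp (2 * of_real pi * \<i> * of_real t)" for t :: real
  have e1: "norm (e t) = 1" for t unfolding e_def by (simp add: norm_exp_eq_Re)
  have em [measurable]: "e \<in> borel_measurable borel" unfolding e_def[abs_def] by measurable
  have rot: "(\<integral>w. F (e t *s w) * gw w \<partial>lborel) = (\<integral>w. F w * gw w \<partial>lborel)" for t
    using integral_rotate[of "\<lambda>w. F w * gw w" "e t"] e1 by (simp add: gw_def)
  have rotn: "(\<integral>\<^sup>+w. ennreal (norm (F (e t *s w) * gw w)) \<partial>lborel) = (\<integral>\<^sup>+w. ennreal (norm (F w * gw w)) \<partial>lborel)" for t
    by (subst (2) distr_rotate[OF e1[of t], where 'n='n, symmetric]) (simp add: nn_integral_distr gw_def e1)
  have "(\<integral>w. F w * gw w \<partial>lborel) = (\<integral>t. indicator {0..1::real} t *\<^sub>R (\<integral>w. F w * gw w \<partial>lborel) \<partial>lborel)"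
    by (simp add: integral_scaleR_left)
  also have "\<dots> = (\<integral>t. (\<integral>w. indicator {0..1::real} t *\<^sub>R (F (e t *s w) * gw w) \<partial>lborel) \<partial>lborel)"
    by (simp add: rot)
  also have "\<dots> = (\<integral>w. (\<integral>t. indicator {0..1::real} t *\<^sub>R (F (e t *s w) * gw w) \<partial>lborel) \<partial>lborel)"
  proof (rule Fubini_lborel)
    have "(\<integral>\<^sup>+t. \<integral>\<^sup>+w. ennreal (norm (indicator {0..1::real} t *\<^sub>R (F (e t *s w) * gw w))) \<partial>lborel \<partial>lborel)
        = (\<integral>\<^sup>+t. indicator {0..1::real} t * (\<integral>\<^sup>+w. ennreal (norm (F w * gw w)) \<partial>lborel) \<partial>lborel)"
    proof (intro nn_integral_cong)
      fix t :: real
      show "(\<integral>\<^sup>+w. ennreal (norm (indicator {0..1::real} t *\<^sub>R (F (e t *s w) * gw w))) \<partial>lborel)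
        = indicator {0..1::real} t * (\<integral>\<^sup>+w. ennreal (norm (F w * gw w)) \<partial>lborel)"
        by (cases "t \<in> {0..1}") (use rotn[of t] in auto)
    qed
    also have "\<dots> = (\<integral>\<^sup>+w. ennreal (norm (F w * gw w)) \<partial>lborel)"
      by (subst nn_integral_multc) auto
    also have "\<dots> < \<infinity>" using int by (simp add: integrable_iff_bounded)
    finally show "(\<integral>\<^sup>+t. \<integral>\<^sup>+w. ennreal (norm (indicator {0..1::real} t *\<^sub>R (F (e t *s w) * gw w))) \<partial>lborel \<partial>lborel) < \<infinity>" .
  qed measurable
  also have "\<dots> = (\<integral>w. F 0 * gw (w::complex^'n) \<partial>lborel)"
  proof (rule Bochner_Integration.integral_cong[OF refl])
    fix w :: "complex^'n"
    have "(\<integral>t. indicator {0..1::real} t *\<^sub>R F (e t *s w) \<partial>lborel) = F 0"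
      using circle_mean[OF entire_line_holomorphic[OF F, of 0 w]] by (simp add: e_def)
    moreover have "(\<integral>t. indicator {0..1::real} t *\<^sub>R (F (e t *s w) * gw w) \<partial>lborel) = (\<integral>t. indicator {0..1::real} t *\<^sub>R F (e t *s w) \<partial>lborel) * gw w"
      by (subst integral_mult_left_zero[symmetric]) simp
    ultimately show "(\<integral>t. indicator {0..1::real} t *\<^sub>R (F (e t *s w) * gw w) \<partial>lborel) = F 0 * gw w" by simp
  qed
  also have "\<dots> = F 0" by (simp add: gw_integral)
  finally show ?thesis .
qed

text \<open>Translation by \<open>z\<close> turns the integral into the Gaussian mean of
  \<open>w \<mapsto> F (w + z) exp (- pi w cnj z)\<close>, whose value at \<open>0\<close> is \<open>F z\<close>.\<close>

lemma reproducing: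
  fixes F :: "complex^'n::finite \<Rightarrow> complex"
  assumes F: "entire F" and int: "integrable lborel (\<lambda>w. F w * exp (of_real pi * dotc (cnj_vec w) z) * gw w)"
  shows "(\<integral>w. F w * exp (of_real pi * dotc (cnj_vec w) z) * gw w \<partial>lborel) = F z"
proof -
  note [measurable] = entire_measurable[OF F]
  define Q where "Q = (\<lambda>w. F w * exp (of_real pi * dotc (cnj_vec w) z) * gw w)"
  have [measurable]: "Q \<in> borel_measurable borel" unfolding Q_def by measurable
  define H where "H = (\<lambda>w. F (w + z) * exp (- of_real pi * dotc w (cnj_vec z)))"
  have HQ: "H w * gw w = Q (w + z)" for w
  proof -
    have E: "- of_real pi * dotc w (cnj_vec z) + - of_real pi * dotc (cnj_vec w) w =
      of_real pi * dotc (cnj_vec (w + z)) z + - of_real pi * dotc (cnj_vec (w + z)) (w + z)"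
      by (simp add: algebra_simps dotc_commute[of w "cnj_vec z"])
    show ?thesis unfolding H_def Q_def gw_eq mult.assoc mult_exp_exp E by (rule refl)
  qed
  have entH: "entire H" unfolding H_def by (intro entire_intros entire_translate F)
  have "(\<integral>w. Q w \<partial>lborel) = (\<integral>w. H w * gw w \<partial>lborel)"
    unfolding HQ by (simp add: integral_lborel_translate(1))
  also have "\<dots> = H 0"
  proof (rule mean_value_gauss[OF entH])
    have "integrable lborel Q" using int by (simp add: Q_def)
    then show "integrable lborel (\<lambda>w. H w * gw w)" unfolding HQ using integral_lborel_translate(2)[of Q z] by simp
  qed
  finally show ?thesis by (simp add: Q_def H_def)
qed

section \<open>Gaussians\<close>

text \<open>The family of all Gaussian test functions needed: \<open>a = 1\<close> gives the kernel of the Bargmann transform,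
  \<open>a = 1 / 2\<close> the test functions in the definition of the symbol.\<close>

definition gker :: "complex \<Rightarrow> complex^'n::finite \<Rightarrow> real^'n \<Rightarrow> complex" where
  "gker a z y = exp (- of_real pi * a * of_real (y \<bullet> y) + of_real pi * dotc (of_real_vec y) z)"

lemma norm_gker: "norm (gker a z y) = exp (- pi * Re a * (norm y)\<^sup>2 + pi * (y \<bullet> re_vec z))"
  by (simp add: gker_def Re_dotc power2_norm_eq_inner)

lemma continuous_gker [continuous_intros]:
  "continuous_on S f \<Longrightarrow> continuous_on S g \<Longrightarrow> continuous_on S h \<Longrightarrow> continuous_on S (\<lambda>x. gker (f x) (g x) (h x))"
  unfolding gker_def by (intro continuous_intros)

lemma measurable_gker [measurable (raw)]:
  assumes [measurable]: "f \<in> borel_measurable M" "g \<in> borel_measurable M" "h \<in> borel_measurable M"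
  shows "(\<lambda>x. gker (f x) (g x) (h x)) \<in> borel_measurable M"
  unfolding gker_def by measurable

lemma quad_lin_le: 
  fixes a b t :: real assumes "a > 0" shows "- pi * a * t\<^sup>2 + b * t \<le> - pi * (a / 2) * t\<^sup>2 + b\<^sup>2 / (2 * pi * a)"
proof -
  have "0 \<le> (pi * a * t - b)\<^sup>2 / (2 * pi * a)" using assms by simp
  also have "\<dots> = pi * (a / 2) * t\<^sup>2 - b * t + b\<^sup>2 / (2 * pi * a)"
    using assms by (simp add: power2_eq_square field_simps)
  finally show ?thesis by (simp add: algebra_simps)
qed

lemma integrable_gauss_lin:
  assumes "a > 0"
  shows "integrable lborel (\<lambda>x::'a::euclidean_space. exp (- pi * a * (norm x)\<^sup>2 + b * norm x))"
proof (rule Bochner_Integration.integrable_bound)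
  show "integrable lborel (\<lambda>x::'a. exp (b\<^sup>2 / (2 * pi * a)) * exp (- pi * (a / 2) * (norm x)\<^sup>2))"
    using assms by (intro integrable_mult_right integrable_gauss) simp
  show "AE x::'a in lborel. norm (exp (- pi * a * (norm x)\<^sup>2 + b * norm x)) \<le> norm (exp (b\<^sup>2 / (2 * pi * a)) * exp (- pi * (a / 2) * (norm x)\<^sup>2))"
    using quad_lin_le[OF assms] by (intro AE_I2) (simp add: mult_exp_exp add.commute)
qed measurable

lemma gker_bound:
  assumes "a \<le> Re c" "norm (re_vec z) \<le> R"
  shows "norm (gker c z y) \<le> exp (- pi * a * (norm y)\<^sup>2 + pi * R * norm y)"
proof -
  have "y \<bullet> re_vec z \<le> norm y * norm (re_vec z)" by (rule norm_cauchy_schwarz)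
  also have "\<dots> \<le> norm y * R" using assms by (intro mult_left_mono) auto
  finally have 1: "pi * (y \<bullet> re_vec z) \<le> pi * R * norm y" by (simp add: algebra_simps)
  have "a * (norm y)\<^sup>2 \<le> Re c * (norm y)\<^sup>2" using assms by (intro mult_right_mono) auto
  then have 2: "- pi * Re c * (norm y)\<^sup>2 \<le> - pi * a * (norm y)\<^sup>2" by (simp add: mult.assoc)
  show ?thesis unfolding norm_gker exp_le_cancel_iff using 1 2 by linarith
qed

lemma entire_gker: "entire (\<lambda>z. gker a z y)"
  unfolding gker_def by (intro entire_intros)

lemma gker_integrable:
  assumes "a > 0" shows "integrable lborel (gker (of_real a) z)"
  by (rule Bochner_Integration.integrable_bound[OF integrable_gauss_lin[OF assms, of "pi * norm (re_vec z)"]])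
     (measurable, rule AE_I2, unfold real_norm_def abs_exp_cancel, rule gker_bound, auto)

text \<open>For real \<open>z\<close> complete the square; both sides are entire in \<open>z\<close>.\<close>

lemma gker_integral:
  fixes z :: "complex^'n::finite"
  assumes "a > 0"
  shows "(\<integral>y. gker (of_real a) z y \<partial>lborel) = of_real ((1 / sqrt a) ^ CARD('n)) * exp (of_real pi * dotc z z / (4 * of_real a))"
proof (rule entire_eq_on_real)
  show "entire (\<lambda>z::complex^'n. \<integral>y. gker (of_real a) z y \<partial>lborel)"
  proof (rule entire_integral)
    fix R :: real
    show "\<exists>h. integrable lborel h \<and> (\<forall>z w. norm (z::complex^'n) \<le> R \<longrightarrow> norm (gker (of_real a) z w) \<le> h w)"
      by (rule exI[of _ "\<lambda>y. exp (- pi * a * (norm y)\<^sup>2 + pi * R * norm y)"], intro conjI allI impI)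
        (rule integrable_gauss_lin[OF assms], rule gker_bound, simp, erule order_trans[OF norm_re_vec_le])
  qed (auto intro: entire_gker)
  show "entire (\<lambda>z::complex^'n. of_real ((1 / sqrt a) ^ CARD('n)) * exp (of_real pi * dotc z z / (4 * of_real a)))"
    unfolding divide_inverse by (intro entire_intros)
  fix x :: "real^'n"
  have real_eq: "- pi * a * (y \<bullet> y) + pi * (y \<bullet> x) = pi * (x \<bullet> x) / (4 * a) + - pi * a * (norm (y - x /\<^sub>R (2 * a)))\<^sup>2" for y
  proof -
    define c where "c = inverse (2 * a)"
    have ac: "a * c = 1 / 2" "1 / (4 * a) = c / 2" using assms by (simp_all add: c_def field_simps)
    have "(norm (y - c *\<^sub>R x))\<^sup>2 = y \<bullet> y - 2 * c * (y \<bullet> x) + c * c * (x \<bullet> x)"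
      unfolding power2_norm_eq_inner by (simp add: inner_diff_left inner_diff_right inner_commute[of x y] algebra_simps)
    then have "- pi * a * (norm (y - c *\<^sub>R x))\<^sup>2 = - pi * a * (y \<bullet> y) + 2 * pi * (a * c) * (y \<bullet> x) - pi * (a * c) * c * (x \<bullet> x)"
      by (simp only:) (simp add: algebra_simps)
    moreover have "pi * (x \<bullet> x) / (4 * a) = pi * (x \<bullet> x) * (c / 2)" unfolding ac(2)[symmetric] by simp
    ultimately show ?thesis unfolding ac c_def[symmetric] by simp
  qed
  have "gker (of_real a) (of_real_vec x) y = of_real (exp (- pi * a * (y \<bullet> y) + pi * (y \<bullet> x)))" for y
    by (simp add: gker_def exp_of_real[symmetric])
  then have "gker (of_real a) (of_real_vec x) y = of_real (exp (pi * (x \<bullet> x) / (4 * a))) * of_real (exp (- pi * a * (norm (y - x /\<^sub>R (2 * a)))\<^sup>2))" for y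
    unfolding real_eq exp_add of_real_mult .
  then have "(\<integral>y. gker (of_real a) (of_real_vec x) y \<partial>lborel) = of_real (exp (pi * (x \<bullet> x) / (4 * a))) * of_real (\<integral>y. exp (- pi * a * (norm (y + (- x /\<^sub>R (2 * a))))\<^sup>2) \<partial>lborel)"
    by simp
  also have "(\<integral>y. exp (- pi * a * (norm (y + (- x /\<^sub>R (2 * a))))\<^sup>2) \<partial>lborel) = (1 / sqrt a) ^ CARD('n)"
    using integral_lborel_translate(1)[of "\<lambda>y. exp (- pi * a * (norm (y::real^'n))\<^sup>2)" "- x /\<^sub>R (2 * a)"] integral_gauss[OF assms, where 'a="real^'n"] by simp
  finally show "(\<integral>y. gker (of_real a) (of_real_vec x) y \<partial>lborel) = of_real ((1 / sqrt a) ^ CARD('n)) * exp (of_real pi * dotc (of_real_vec x) (of_real_vec x) / (4 * of_real a))"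
    by (simp add: exp_of_real[symmetric])
qed

section \<open>Sobolev-Fock spaces: point evaluations and dilations\<close>

lemma norm_fock_weighted: "norm (fock_weighted F z) = norm (F z) * exp (- (pi / 2) * (norm z)\<^sup>2)"
  by (simp add: fock_weighted_def norm_mult)

lemma norm_eq_fock_weighted: "norm (F z) = norm (fock_weighted F z) * exp ((pi / 2) * (norm z)\<^sup>2)"
  by (simp add: norm_fock_weighted mult.assoc mult_exp_exp)

lemma fock_weighted_measurable: "entire F \<Longrightarrow> fock_weighted F \<in> borel_measurable borel"
  using entire_measurable[of F] unfolding fock_weighted_def[abs_def] by measurable

lemma fock_weighted_add: "fock_weighted (\<lambda>z. F z + G z) z = fock_weighted F z + fock_weighted G z"
  and fock_weighted_diff: "fock_weighted (\<lambda>z. F z - G z) z = fock_weighted F z - fock_weighted G z"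
  and fock_weighted_mult: "fock_weighted (\<lambda>z. c * F z) z = c * fock_weighted F z"
  by (simp_all add: fock_weighted_def algebra_simps)

lemma mem_fock_space_fin:
  assumes "p < \<infinity>"
  shows "F \<in> fock_space p \<longleftrightarrow> entire F \<and> integrable lborel (\<lambda>z. norm (fock_weighted F z) powr enn2real p)"
proof (cases "entire F")
  case True
  note [measurable] = fock_weighted_measurable[OF True]
  have "p \<noteq> \<infinity>" using assms by auto
  then show ?thesis using True
    by (simp add: fock_space_def Lp_space_def integrable_iff_bounded)
qed (simp add: fock_space_def)

lemma fock_norm_fin:
  "p < \<infinity> \<Longrightarrow> fock_norm p F = (\<integral>z. norm (fock_weighted F z) powr enn2real p \<partial>lborel) powr (1 / enn2real p)"
  by (simp add: fock_norm_def Lp_norm_def)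

lemma fock_norm_nonneg: "0 \<le> fock_norm p F"
  by (simp add: fock_norm_def Lp_norm_def)

lemma fock_space_entire: "F \<in> fock_space p \<Longrightarrow> entire F"
  by (simp add: fock_space_def)

text \<open>A continuous function that is essentially bounded is bounded, since nonempty open sets have positive
  measure.\<close>

lemma mem_fock_space_infinity:
  "F \<in> fock_space \<infinity> \<longleftrightarrow> entire F \<and> (\<exists>C. \<forall>z. norm (F z) \<le> C * exp ((pi / 2) * (norm z)\<^sup>2))"
proof (cases "entire F")
  case True
  note [measurable] = fock_weighted_measurable[OF True]
  have eq: "norm (F z) \<le> C * exp ((pi / 2) * (norm z)\<^sup>2) \<longleftrightarrow> norm (fock_weighted F z) \<le> C" for z C
    unfolding norm_eq_fock_weighted[of F z] by simp
  have "esssup lborel (\<lambda>x. ennreal (norm (fock_weighted F x))) < \<infinity> \<longleftrightarrow> (\<exists>C. \<forall>z. norm (fock_weighted F z) \<le> C)"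
  proof
    assume fin: "esssup lborel (\<lambda>x. ennreal (norm (fock_weighted F x))) < \<infinity>"
    define C where "C = enn2real (esssup lborel (\<lambda>x. ennreal (norm (fock_weighted F x))))"
    have "AE x in lborel. ennreal (norm (fock_weighted F x)) \<le> esssup lborel (\<lambda>x. ennreal (norm (fock_weighted F x)))"
      by (rule esssup_AE)
    moreover have "esssup lborel (\<lambda>x. ennreal (norm (fock_weighted F x))) = ennreal C"
      using fin by (simp add: C_def less_top)
    moreover have "C \<ge> 0" by (simp add: C_def)
    ultimately have ae: "AE x in lborel. norm (fock_weighted F x) \<le> C" by simp
    have "norm (fock_weighted F z) \<le> C" for z
    proof (rule ccontr)
      assume "\<not> norm (fock_weighted F z) \<le> C"
      define U where "U = {x. C < norm (fock_weighted F x)}"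
      have "open U" unfolding U_def fock_weighted_def using True
        by (intro open_Collect_less continuous_intros entire_continuous) auto
      moreover have "z \<in> U" using \<open>\<not> norm (fock_weighted F z) \<le> C\<close> by (simp add: U_def)
      then have "U \<noteq> {}" by blast
      ultimately have "emeasure lborel U \<noteq> 0"
        using open_not_negligible[of U] negligible_iff_null_sets[of U] null_sets_completionI[of U lborel] \<open>open U\<close>
        by (auto simp: null_sets_def)
      moreover have "emeasure lborel U = 0"
      proof -
        have "AE x in lborel. x \<notin> U" using ae by eventually_elim (auto simp: U_def)
        then show ?thesis using \<open>open U\<close> by (subst (asm) AE_iff_measurable[of U]) auto
      qed
      ultimately show False by simp
    qed
    then show "\<exists>C. \<forall>z. norm (fock_weighted F z) \<le> C" by blast
  next
    assume "\<exists>C. \<forall>z. norm (fock_weighted F z) \<le> C"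
    then obtain C where C: "\<And>z. norm (fock_weighted F z) \<le> C" by blast
    have "esssup lborel (\<lambda>x. ennreal (norm (fock_weighted F x))) \<le> ennreal C"
      by (intro esssup_I) (auto intro!: ennreal_leI C)
    then show "esssup lborel (\<lambda>x. ennreal (norm (fock_weighted F x))) < \<infinity>"
      by (simp add: ennreal_less_top order_le_less_trans)
  qed
  then show ?thesis using True unfolding eq by (simp add: fock_space_def Lp_space_def)
qed (simp add: fock_space_def)

lemma enn2real_ge_1: assumes "1 \<le> p" "p < \<infinity>" shows "1 \<le> enn2real p"
proof -
  have "enn2real 1 \<le> enn2real p" using assms by (intro enn2real_mono) auto
  then show ?thesis by simp
qed

lemma le_one_plus_powr: assumes "0 \<le> t" "1 \<le> (q::real)" shows "t \<le> 1 + t powr q"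
proof (cases "t \<le> 1")
  case False
  then have "t powr 1 \<le> t powr q" using assms by (intro powr_mono) auto
  then show ?thesis using False by simp
qed (simp add: add_increasing2)

lemma add_powr_le: assumes "0 \<le> a" "0 \<le> b" "0 \<le> (q::real)" shows "(a + b) powr q \<le> 2 powr q * (a powr q + b powr q)"
proof -
  have "(a + b) powr q \<le> (2 * max a b) powr q" using assms by (intro powr_mono2) auto
  also have "\<dots> = 2 powr q * (max a b) powr q" using assms by (simp add: powr_mult)
  also have "(max a b) powr q \<le> a powr q + b powr q" by (simp add: max_def)
  finally show ?thesis by simp
qed

lemma fock_space_add:
  assumes "p < \<infinity>" "F \<in> fock_space p" "G \<in> fock_space p"
  shows "(\<lambda>z. F z + G z) \<in> fock_space p"
proof -
  note E = fock_space_entire[OF assms(2)] fock_space_entire[OF assms(3)]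
  note [measurable] = E[THEN fock_weighted_measurable] entire_add[OF E, THEN fock_weighted_measurable]
  have "integrable lborel (\<lambda>z. norm (fock_weighted (\<lambda>z. F z + G z) z) powr enn2real p)"
  proof (rule Bochner_Integration.integrable_bound)
    show "integrable lborel (\<lambda>z. 2 powr enn2real p * (norm (fock_weighted F z) powr enn2real p + norm (fock_weighted G z) powr enn2real p))"
      using assms by (simp add: mem_fock_space_fin)
    have "norm (fock_weighted F z + fock_weighted G z) powr enn2real p \<le> 2 powr enn2real p * (norm (fock_weighted F z) powr enn2real p + norm (fock_weighted G z) powr enn2real p)" for z
      by (rule order_trans[OF powr_mono2 add_powr_le]) (auto intro: norm_triangle_ineq)
    then show "AE z in lborel. norm (norm (fock_weighted (\<lambda>z. F z + G z) z) powr enn2real p) \<le> norm (2 powr enn2real p * (norm (fock_weighted F z) powr enn2real p + norm (fock_weighted G z) powr enn2real p))"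
      by (intro AE_I2) (simp add: fock_weighted_add)
  qed measurable
  then show ?thesis using assms E by (simp add: mem_fock_space_fin entire_add)
qed

lemma fock_space_mult:
  assumes "p < \<infinity>" "F \<in> fock_space p"
  shows "(\<lambda>z. c * F z) \<in> fock_space p"
  using assms fock_space_entire[OF assms(2)]
  by (simp add: mem_fock_space_fin entire_mult entire_const fock_weighted_mult norm_mult powr_mult)

lemma fock_space_diff:
  assumes "p < \<infinity>" "F \<in> fock_space p" "G \<in> fock_space p"
  shows "(\<lambda>z. F z - G z) \<in> fock_space p"
  using fock_space_add[OF assms(1,2) fock_space_mult[OF assms(1,3), of "-1"]] by simp

lemma norm_sq_diff: "(norm (w - z))\<^sup>2 = (norm w)\<^sup>2 - 2 * Re (dotc (cnj_vec w) z) + (norm (z::complex^'n::finite))\<^sup>2"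
  by (simp add: norm_sq_re_im Re_dotc algebra_simps inner_commute)

lemma norm_exp_dotc: "norm (exp (of_real pi * dotc (cnj_vec w) z)) * exp (- pi * (norm w)\<^sup>2)
    = exp (- (pi / 2) * (norm (w - z))\<^sup>2) * exp ((pi / 2) * (norm z)\<^sup>2) * exp (- (pi / 2) * (norm w)\<^sup>2)"
  by (simp add: norm_sq_diff mult_exp_exp algebra_simps)

text \<open>In the reproducing formula the weights combine into a Gaussian centred at \<open>z\<close>. This is the source of
  all pointwise bounds.\<close>

lemma norm_repr_integrand:
  "norm (F w * exp (of_real pi * dotc (cnj_vec w) z) * gw w)
     = norm (fock_weighted F w) * exp (- (pi / 2) * (norm (w - z))\<^sup>2) * exp ((pi / 2) * (norm z)\<^sup>2)"
proof -
  have "norm (F w * exp (of_real pi * dotc (cnj_vec w) z) * gw w) = norm (F w) * (norm (exp (of_real pi * dotc (cnj_vec w) z)) * exp (- pi * (norm w)\<^sup>2))"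
    by (simp add: norm_mult norm_gw)
  then show ?thesis unfolding norm_exp_dotc norm_fock_weighted by simp
qed

lemma gauss_shift:
  "integrable lborel (\<lambda>w::'a::euclidean_space. exp (- (pi / 2) * (norm (w - z))\<^sup>2))"
  "(\<integral>w. exp (- (pi / 2) * (norm (w - z :: 'a))\<^sup>2) \<partial>lborel) = (1 / sqrt (1/2)) ^ DIM('a)"
  "(\<integral>\<^sup>+w. ennreal (exp (- (pi / 2) * (norm (w - z :: 'a))\<^sup>2)) \<partial>lborel) = ennreal ((1 / sqrt (1/2)) ^ DIM('a))"
proof -
  show i: "integrable lborel (\<lambda>w::'a::euclidean_space. exp (- (pi / 2) * (norm (w - z))\<^sup>2))"
    using integral_lborel_translate(2)[of "\<lambda>w::'a. exp (- (pi / 2) * (norm w)\<^sup>2)" "-z"] integrable_gauss[of "1/2", where 'a='a] by simp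
  show e: "(\<integral>w. exp (- (pi / 2) * (norm (w - z :: 'a))\<^sup>2) \<partial>lborel) = (1 / sqrt (1/2)) ^ DIM('a)"
    using integral_lborel_translate(1)[of "\<lambda>w::'a. exp (- (pi / 2) * (norm w)\<^sup>2)" "-z"] integral_gauss[of "1/2", where 'a='a] by simp
  show "(\<integral>\<^sup>+w. ennreal (exp (- (pi / 2) * (norm (w - z :: 'a))\<^sup>2)) \<partial>lborel) = ennreal ((1 / sqrt (1/2)) ^ DIM('a))"
    unfolding e[symmetric] by (rule nn_integral_eq_integral[OF i]) simp
qed

lemma fock_repr_integrable:
  assumes p: "1 \<le> p" "p < \<infinity>" and F: "F \<in> fock_space p"
  shows "integrable lborel (\<lambda>w. F w * exp (of_real pi * dotc (cnj_vec w) z) * gw w)"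
proof (rule Bochner_Integration.integrable_bound)
  define q where "q = enn2real p"
  note [measurable] = entire_measurable[OF fock_space_entire[OF F]]
  have int: "integrable lborel (\<lambda>w. norm (fock_weighted F w) powr q)" using F p by (simp add: mem_fock_space_fin q_def)
  show "integrable lborel (\<lambda>w. (exp (- (pi / 2) * (norm (w - z))\<^sup>2) + norm (fock_weighted F w) powr q) * exp ((pi / 2) * (norm z)\<^sup>2))"
    by (intro integrable_mult_left Bochner_Integration.integrable_add gauss_shift int)
  have "norm (fock_weighted F w) * exp (- (pi / 2) * (norm (w - z))\<^sup>2) \<le> exp (- (pi / 2) * (norm (w - z))\<^sup>2) + norm (fock_weighted F w) powr q" for w
  proof -
    have "norm (fock_weighted F w) * exp (- (pi / 2) * (norm (w - z))\<^sup>2) \<le> (1 + norm (fock_weighted F w) powr q) * exp (- (pi / 2) * (norm (w - z))\<^sup>2)"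
      using enn2real_ge_1[OF p] by (intro mult_right_mono le_one_plus_powr) (auto simp: q_def)
    also have "\<dots> \<le> exp (- (pi / 2) * (norm (w - z))\<^sup>2) + norm (fock_weighted F w) powr q * 1"
      unfolding distrib_right by (intro add_mono mult_left_mono) auto
    finally show ?thesis by simp
  qed
  then show "AE w in lborel. norm (F w * exp (of_real pi * dotc (cnj_vec w) z) * gw w) \<le> norm ((exp (- (pi / 2) * (norm (w - z))\<^sup>2) + norm (fock_weighted F w) powr q) * exp ((pi / 2) * (norm z)\<^sup>2))"
    unfolding norm_repr_integrand by (intro AE_I2) (simp add: abs_mult add_nonneg_nonneg)
  show "(\<lambda>w. F w * exp (of_real pi * dotc (cnj_vec w) z) * gw w) \<in> borel_measurable lborel"
    by measurable
qed

text \<open>By the reproducing formula the weighted function is dominated by its convolution with a Gaussian.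
  Instead of Hoelder's inequality, \<open>t \<le> 1 + t\<^sup>q\<close> is applied to the weighted function divided by any
  \<open>M\<close> larger than the norm; \<open>M\<close> then tends to the norm, which covers the case of norm \<open>0\<close>.\<close>

lemma fock_pointwise:
  fixes p :: ennreal
  assumes p: "1 \<le> p" "p < \<infinity>"
  shows "\<exists>K>0. \<forall>F \<in> (fock_space p :: (complex^'n::finite \<Rightarrow> complex) set). \<forall>z.
     norm (F z) \<le> K * fock_norm p F * exp ((pi / 2) * (norm z)\<^sup>2)"
proof (intro exI[of _ "1 + (1 / sqrt (1/2)) ^ DIM(complex^'n)"] conjI ballI allI)
  let ?K = "1 + (1 / sqrt (1/2)) ^ DIM(complex^'n)"
  show "0 < ?K" by (simp add: add_pos_nonneg)
  define q where "q = enn2real p"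
  have q: "q \<ge> 1" using enn2real_ge_1[OF p] by (simp add: q_def)
  fix F :: "complex^'n \<Rightarrow> complex" and z assume F: "F \<in> fock_space p"
  note [measurable] = entire_measurable[OF fock_space_entire[OF F]] fock_weighted_measurable[OF fock_space_entire[OF F]]
  have int: "integrable lborel (\<lambda>w. norm (fock_weighted F w) powr q)" using F p by (simp add: mem_fock_space_fin q_def)
  define I where "I = (\<integral>w. norm (fock_weighted F w) powr q \<partial>lborel)"
  have I: "I \<ge> 0" unfolding I_def by simp
  have N: "fock_norm p F = I powr (1 / q)" using p by (simp add: fock_norm_fin I_def q_def)
  have key: "norm (F z) \<le> (?K * exp ((pi / 2) * (norm z)\<^sup>2)) * M" if M: "M > fock_norm p F" for M
  proof -
    have M0: "M > 0" using fock_norm_nonneg[of p F] M by linarith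
    have IM: "I \<le> M powr q"
    proof -
      have "I = (I powr (1/q)) powr q" using q I by (simp add: powr_powr)
      also have "\<dots> \<le> M powr q"
      proof (rule powr_mono2)
        show "I powr (1 / q) \<le> M" using M unfolding N by linarith
      qed (use q in simp_all)
      finally show ?thesis .
    qed
    let ?g = "\<lambda>w. exp (- (pi / 2) * (norm (w - z))\<^sup>2)"
    have "norm (F z) \<le> (\<integral>w. M * (?g w + norm (fock_weighted F w) powr q / M powr q) * exp ((pi / 2) * (norm z)\<^sup>2) \<partial>lborel)"
      unfolding reproducing[OF fock_space_entire[OF F] fock_repr_integrable[OF p F, of z], symmetric]
    proof (rule norm_integral_le)
      show "integrable lborel (\<lambda>w. M * (?g w + norm (fock_weighted F w) powr q / M powr q) * exp ((pi / 2) * (norm z)\<^sup>2))"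
      proof -
        have "integrable lborel (\<lambda>w. norm (fock_weighted F w) powr q / M powr q)" using int by simp
        from Bochner_Integration.integrable_add[OF gauss_shift(1)[of z] this]
        show ?thesis by (intro integrable_mult_left integrable_mult_right)
      qed
      fix w
      have "norm (fock_weighted F w) / M \<le> 1 + (norm (fock_weighted F w) / M) powr q"
        using M0 q by (intro le_one_plus_powr) auto
      then have "norm (fock_weighted F w) \<le> M * (1 + norm (fock_weighted F w) powr q / M powr q)"
        unfolding pos_divide_le_eq[OF M0] using M0 by (simp add: powr_divide mult.commute)
      then have "norm (fock_weighted F w) * ?g w \<le> M * (1 + norm (fock_weighted F w) powr q / M powr q) * ?g w"
        by (rule mult_right_mono) simp
      also have "\<dots> = M * (?g w + norm (fock_weighted F w) powr q / M powr q * ?g w)" by (simp add: algebra_simps)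
      also have "\<dots> \<le> M * (?g w + norm (fock_weighted F w) powr q / M powr q * 1)"
        using M0 by (intro mult_left_mono add_left_mono) auto
      finally show "norm (F w * exp (of_real pi * dotc (cnj_vec w) z) * gw w) \<le> M * (?g w + norm (fock_weighted F w) powr q / M powr q) * exp ((pi / 2) * (norm z)\<^sup>2)"
        unfolding norm_repr_integrand by (intro mult_right_mono) simp_all
    qed
    also have "\<dots> = M * ((1 / sqrt (1/2)) ^ DIM(complex^'n) + I / M powr q) * exp ((pi / 2) * (norm z)\<^sup>2)"
      using int gauss_shift[of z] by (simp add: I_def)
    also have "\<dots> \<le> M * ((1 / sqrt (1/2)) ^ DIM(complex^'n) + 1) * exp ((pi / 2) * (norm z)\<^sup>2)"
      using IM M0 by (intro mult_right_mono mult_left_mono add_left_mono) auto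
    also have "\<dots> = (?K * exp ((pi / 2) * (norm z)\<^sup>2)) * M" by (simp only: mult_ac add.commute)
    finally show ?thesis .
  qed
  have "norm (F z) \<le> (?K * exp ((pi / 2) * (norm z)\<^sup>2)) * fock_norm p F"
  proof -
    have c: "?K * exp ((pi / 2) * (norm z)\<^sup>2) > 0" using \<open>0 < ?K\<close> by simp
    have "norm (F z) / (?K * exp ((pi / 2) * (norm z)\<^sup>2)) \<le> fock_norm p F"
      by (rule dense_ge) (use key c in \<open>simp only: pos_divide_le_eq mult.commute\<close>)
    then show ?thesis unfolding pos_divide_le_eq[OF c] by (simp only: mult.commute)
  qed
  then show "norm (F z) \<le> ?K * fock_norm p F * exp ((pi / 2) * (norm z)\<^sup>2)" by (simp only: mult_ac)
qed

lemma fock_norm_1: "fock_norm 1 F = (\<integral>z. norm (fock_weighted F z) \<partial>lborel)"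
  by (simp add: fock_norm_fin)

lemma mem_fock_space_1: "F \<in> fock_space 1 \<longleftrightarrow> entire F \<and> integrable lborel (\<lambda>z. norm (fock_weighted F z))"
  by (simp add: mem_fock_space_fin)

lemma fock_space_infinity_of_fin:
  assumes "1 \<le> p" "p < \<infinity>" "F \<in> fock_space p" shows "F \<in> fock_space \<infinity>"
  using fock_pointwise[OF assms(1,2), where 'n='a] assms(3) fock_space_entire[OF assms(3)]
  unfolding mem_fock_space_infinity by blast

text \<open>A function in \<open>F\<^sup>1\<close> is bounded after weighting, so its power \<open>p\<close> is controlled by a constant times its
  first power.\<close>

lemma fock_space_1_embed:
  fixes p :: ennreal
  assumes p: "1 \<le> p" "p < \<infinity>"
  shows "\<exists>C. \<forall>F \<in> (fock_space 1 :: (complex^'n::finite \<Rightarrow> complex) set). F \<in> fock_space p \<and> fock_norm p F \<le> C * fock_norm 1 F"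
proof -
  obtain K0 where K0: "K0 > 0" "\<And>F z. F \<in> (fock_space 1 :: (complex^'n \<Rightarrow> complex) set) \<Longrightarrow> norm (F z) \<le> K0 * fock_norm 1 F * exp ((pi / 2) * (norm z)\<^sup>2)"
    using fock_pointwise[of 1, where 'n='n] by auto
  define K where "K = max K0 1"
  define q where "q = enn2real p"
  have q: "q \<ge> 1" using enn2real_ge_1[OF p] by (simp add: q_def)
  have "F \<in> fock_space p \<and> fock_norm p F \<le> K * fock_norm 1 F" if F: "F \<in> fock_space 1" for F :: "complex^'n \<Rightarrow> complex"
  proof -
    note [measurable] = fock_weighted_measurable[OF fock_space_entire[OF F]]
    define N where "N = fock_norm 1 F"
    have N0: "N \<ge> 0" unfolding N_def by (rule fock_norm_nonneg)
    have N: "N = (\<integral>z. norm (fock_weighted F z) \<partial>lborel)" unfolding N_def by (rule fock_norm_1)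
    have int: "integrable lborel (\<lambda>z. norm (fock_weighted F z))" using F by (simp add: mem_fock_space_1)
    have b: "norm (fock_weighted F z) \<le> K * N" for z
    proof -
      have "norm (fock_weighted F z) \<le> K0 * N"
        using K0(2)[OF F, of z] unfolding norm_eq_fock_weighted[of F z] N_def by simp
      also have "\<dots> \<le> K * N" using N0 by (intro mult_right_mono) (auto simp: K_def)
      finally show ?thesis .
    qed
    have split: "x powr q = x powr (q - 1) * x" if "x \<ge> 0" for x :: real
      using that q powr_add[of x "q - 1" 1] by (cases "x = 0") auto
    have le: "norm (fock_weighted F z) powr q \<le> (K * N) powr (q - 1) * norm (fock_weighted F z)" for z
      unfolding split[OF norm_ge_zero] using b[of z] q by (intro mult_right_mono powr_mono2) auto
    have int': "integrable lborel (\<lambda>z. norm (fock_weighted F z) powr q)"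
      by (rule Bochner_Integration.integrable_bound[OF integrable_mult_right[OF int, of "(K * N) powr (q - 1)"]])
        (use le in \<open>auto intro!: AE_I2\<close>)
    have "(\<integral>z. norm (fock_weighted F z) powr q \<partial>lborel) \<le> (\<integral>z. (K * N) powr (q - 1) * norm (fock_weighted F z) \<partial>lborel)"
      using int int' le by (intro integral_mono) auto
    also have "\<dots> = (K * N) powr (q - 1) * N" by (simp add: N)
    also have "\<dots> \<le> (K * N) powr (q - 1) * (K * N)"
      using N0 by (intro mult_left_mono) (auto simp: K_def mult_le_cancel_right1)
    also have "\<dots> = (K * N) powr q" using N0 by (subst split[of "K * N"]) (auto simp: K_def)
    finally have "(\<integral>z. norm (fock_weighted F z) powr q \<partial>lborel) powr (1 / q) \<le> ((K * N) powr q) powr (1 / q)"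
      using q by (intro powr_mono2) auto
    also have "\<dots> = K * N" using q N0 by (simp add: powr_powr K_def)
    finally have "fock_norm p F \<le> K * N" using p by (simp add: fock_norm_fin q_def)
    moreover have "F \<in> fock_space p"
      using int' p fock_space_entire[OF F] by (simp add: mem_fock_space_fin q_def)
    ultimately show ?thesis by (simp add: N_def)
  qed
  then show ?thesis by blast
qed

lemma fock_space_1_growth:
  fixes F :: "complex^'n::finite \<Rightarrow> complex"
  assumes "entire F" and c: "c < pi / 2" and le: "\<And>z. norm (F z) \<le> C * exp (c * (norm z)\<^sup>2 + b * norm z)"
  shows "F \<in> fock_space 1"
proof -
  define a where "a = (pi / 2 - c) / pi"
  have a: "a > 0" "- pi * a = c - pi / 2" using c by (simp_all add: a_def)
  note [measurable] = fock_weighted_measurable[OF assms(1)]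
  have C: "C \<ge> 0" using le[of 0] norm_ge_zero[of "F 0"] by (simp del: norm_ge_zero)
  have "integrable lborel (\<lambda>z. norm (fock_weighted F z))"
  proof (rule Bochner_Integration.integrable_bound)
    show "integrable lborel (\<lambda>z::complex^'n. C * exp (- pi * a * (norm z)\<^sup>2 + b * norm z))"
      by (intro integrable_mult_right integrable_gauss_lin a)
    have "norm (fock_weighted F z) \<le> C * exp (- pi * a * (norm z)\<^sup>2 + b * norm z)" for z
    proof -
      have "norm (fock_weighted F z) \<le> C * exp (c * (norm z)\<^sup>2 + b * norm z) * exp (- (pi / 2) * (norm z)\<^sup>2)"
        unfolding norm_fock_weighted by (intro mult_right_mono le) simp
      also have "\<dots> = C * exp (- pi * a * (norm z)\<^sup>2 + b * norm z)"
        unfolding a(2) by (simp add: mult.assoc mult_exp_exp) (simp add: algebra_simps)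
      finally show ?thesis .
    qed
    then show "AE z in lborel. norm (norm (fock_weighted F z)) \<le> norm (C * exp (- pi * a * (norm z)\<^sup>2 + b * norm z))"
      using C by (intro AE_I2) (simp add: abs_mult)
  qed measurable
  then show ?thesis using assms(1) by (simp add: mem_fock_space_1)
qed

text \<open>A concrete sequence tending to \<open>1\<close> from below and bounded away from \<open>0\<close>, so that dilation by it
  distorts Lebesgue measure by a bounded factor.\<close>

definition rseq :: "nat \<Rightarrow> real" where "rseq k = 1 - 1 / (real k + 2)"

lemma rseq: "1 / 2 \<le> rseq k" "rseq k < 1" "rseq \<longlonglongrightarrow> 1"
proof -
  show "1 / 2 \<le> rseq k" "rseq k < 1" by (auto simp: rseq_def field_simps)
  show "rseq \<longlonglongrightarrow> 1" unfolding rseq_def by real_asymp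
qed

definition dil :: "real \<Rightarrow> (complex^'n \<Rightarrow> complex) \<Rightarrow> complex^'n \<Rightarrow> complex" where
  "dil r F z = F (of_real r *s z)"

lemma smult_of_real: "of_real r *s z = r *\<^sub>R (z :: complex^'n)"
  by (simp add: vec_eq_iff scaleR_conv_of_real[where 'a=complex])

lemma entire_dil: "entire F \<Longrightarrow> entire (dil r F)"
  unfolding dil_def[abs_def] by (rule entire_smult)

lemma dil_fock_1:
  fixes F :: "complex^'n::finite \<Rightarrow> complex"
  assumes "F \<in> fock_space \<infinity>" "\<bar>r\<bar> < 1"
  shows "dil r F \<in> fock_space 1"
proof -
  obtain C where C: "\<And>z. norm (F z) \<le> C * exp ((pi / 2) * (norm z)\<^sup>2)" and E: "entire F"
    using assms(1) unfolding mem_fock_space_infinity by blast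
  show ?thesis
  proof (rule fock_space_1_growth[where c="pi / 2 * r\<^sup>2" and b=0])
    show "entire (dil r F)" by (rule entire_dil[OF E])
    have "r\<^sup>2 < 1" using assms(2) by (simp add: abs_square_less_1)
    then show "pi / 2 * r\<^sup>2 < pi / 2" by simp
    fix z show "norm (dil r F z) \<le> C * exp (pi / 2 * r\<^sup>2 * (norm z)\<^sup>2 + 0 * norm z)"
      using C[of "of_real r *s z"] by (simp add: dil_def power_mult_distrib mult.assoc)
  qed
qed

lemma nn_integral_scale:
  fixes f :: "'a::euclidean_space \<Rightarrow> ennreal"
  assumes [measurable]: "f \<in> borel_measurable borel" and c: "c \<noteq> 0"
  shows "(\<integral>\<^sup>+x. ennreal (\<bar>c\<bar> ^ DIM('a)) * f (c *\<^sub>R x) \<partial>lborel) = (\<integral>\<^sup>+x. f x \<partial>lborel)"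
proof -
  have "(\<integral>\<^sup>+x. f x \<partial>lborel) = (\<integral>\<^sup>+x. f x \<partial>density (distr lborel borel (\<lambda>x. 0 + c *\<^sub>R x)) (\<lambda>_. ennreal (\<bar>c\<bar> ^ DIM('a))))"
    using lborel_affine[OF c, of "0::'a"] by simp
  also have "\<dots> = (\<integral>\<^sup>+x. ennreal (\<bar>c\<bar> ^ DIM('a)) * f (c *\<^sub>R x) \<partial>lborel)"
    by (subst nn_integral_density) (auto simp: nn_integral_distr)
  finally show ?thesis ..
qed

text \<open>The weighted dilate is at most the dilate of the weighted function. Scheffe's lemma shows that the
  dilates, normalised in \<open>L\<^sup>1\<close>, of \<open>h\<close>, the power \<open>p\<close> of the weighted function, converge to \<open>h\<close> in \<open>L\<^sup>1\<close>. The pointwise null sequence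
  \<open>d k\<close> is thus dominated by a multiple of \<open>h\<close> up to an error that vanishes in \<open>L\<^sup>1\<close>.\<close>

lemma fock_dilation_tendsto:
  fixes F :: "complex^'n::finite \<Rightarrow> complex"
  assumes p: "1 \<le> p" "p < \<infinity>" and F: "F \<in> fock_space p"
  shows "(\<lambda>k. fock_norm p (\<lambda>z. dil (rseq k) F z - F z)) \<longlonglongrightarrow> 0"
proof -
  define q where "q = enn2real p"
  have q: "q \<ge> 1" using enn2real_ge_1[OF p] by (simp add: q_def)
  note E = fock_space_entire[OF F]
  note [measurable] = fock_weighted_measurable[OF E] fock_weighted_measurable[OF entire_dil[OF E]]
     fock_weighted_measurable[OF entire_diff[OF entire_dil[OF E] E]]
  let ?D = "DIM(complex^'n)"
  define h where "h z = norm (fock_weighted F z) powr q" for z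
  have hint: "integrable lborel h" using F p by (simp add: mem_fock_space_fin q_def h_def[abs_def])
  have hc: "continuous_on UNIV h"
    unfolding h_def fock_weighted_def using q
    by (intro continuous_on_powr' continuous_intros entire_continuous[OF E]) auto
  have [measurable]: "h \<in> borel_measurable borel" by (rule borel_measurable_continuous_onI[OF hc])
  have h0: "h z \<ge> 0" for z by (simp add: h_def)
  define H where "H k z = rseq k ^ ?D * h (rseq k *\<^sub>R z)" for k z
  have r0: "rseq k > 0" for k using rseq(1)[of k] by linarith
  have H0: "H k z \<ge> 0" for k z unfolding H_def using r0[of k] h0 by simp
  have [measurable]: "H k \<in> borel_measurable borel" for k unfolding H_def by measurable
  have Hnn: "(\<integral>\<^sup>+z. ennreal (norm (H k z)) \<partial>lborel) = (\<integral>\<^sup>+z. ennreal (norm (h z)) \<partial>lborel)" for k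
  proof -
    have "(\<integral>\<^sup>+z. ennreal (norm (H k z)) \<partial>lborel) = (\<integral>\<^sup>+z. ennreal (\<bar>rseq k\<bar> ^ ?D) * ennreal (norm (h (rseq k *\<^sub>R z))) \<partial>lborel)"
      unfolding H_def using r0[of k] h0 by (intro nn_integral_cong) (simp add: abs_mult ennreal_mult power_abs)
    also have "\<dots> = (\<integral>\<^sup>+z. ennreal (norm (h z)) \<partial>lborel)"
      using r0[of k] by (intro nn_integral_scale) auto
    finally show ?thesis .
  qed
  have Hint: "integrable lborel (H k)" for k
    using hint Hnn[of k] by (simp add: integrable_iff_bounded)
  have "(\<lambda>k. \<integral>\<^sup>+z. ennreal (norm (H k z - h z)) \<partial>lborel) \<longlonglongrightarrow> 0"
  proof (rule Scheffe_lemma2)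
    show "AE z in lborel. (\<lambda>k. H k z) \<longlonglongrightarrow> h z"
    proof (rule AE_I2)
      fix z :: "complex^'n"
      have "(\<lambda>k. rseq k *\<^sub>R z) \<longlonglongrightarrow> 1 *\<^sub>R z" by (intro tendsto_scaleR rseq(3) tendsto_const)
      then have "(\<lambda>k. h (rseq k *\<^sub>R z)) \<longlonglongrightarrow> h (1 *\<^sub>R z)"
        using hc by (intro isCont_tendsto_compose[of _ h]) (auto simp: continuous_on_eq_continuous_at)
      from tendsto_mult[OF tendsto_power[OF rseq(3), of ?D] this]
      show "(\<lambda>k. H k z) \<longlonglongrightarrow> h z" unfolding H_def by simp
    qed
  qed (use hint Hnn in auto)
  moreover have "(\<integral>\<^sup>+z. ennreal (norm (H k z - h z)) \<partial>lborel) = ennreal (\<integral>z. norm (H k z - h z) \<partial>lborel)" for k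
    using hint Hint[of k] by (intro nn_integral_eq_integral) auto
  ultimately have e: "(\<lambda>k. \<integral>z. norm (H k z - h z) \<partial>lborel) \<longlonglongrightarrow> 0"
    by (simp add: tendsto_ennreal_iff[where x=0, simplified])
  define d where "d k z = norm (fock_weighted (\<lambda>z. dil (rseq k) F z - F z) z) powr q" for k z
  have [measurable]: "d k \<in> borel_measurable borel" for k unfolding d_def by measurable
  have d0: "d k z \<ge> 0" for k z by (simp add: d_def)
  define B where "B = 2 powr q * 2 ^ ?D"
  define A where "A = B + 2 powr q"
  have AB: "A \<ge> 0" "B \<ge> 0" by (simp_all add: A_def B_def)
  have dle: "d k z \<le> A * h z + B * norm (H k z - h z)" for k z
  proof -
    have "d k z \<le> (norm (fock_weighted (dil (rseq k) F) z) + norm (fock_weighted F z)) powr q"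
      unfolding d_def fock_weighted_diff using q by (intro powr_mono2 norm_triangle_ineq4) auto
    also have "\<dots> \<le> 2 powr q * (norm (fock_weighted (dil (rseq k) F) z) powr q + h z)"
      unfolding h_def using q by (intro add_powr_le) auto
    finally have 1: "d k z \<le> 2 powr q * norm (fock_weighted (dil (rseq k) F) z) powr q + 2 powr q * h z"
      by (simp add: algebra_simps)
    have "norm (fock_weighted (dil (rseq k) F) z) \<le> norm (fock_weighted F (rseq k *\<^sub>R z))"
    proof -
      have "(norm (rseq k *\<^sub>R z))\<^sup>2 \<le> (norm z)\<^sup>2"
        using rseq(1,2)[of k] by (intro power_mono) (auto simp: mult_left_le_one_le)
      then show ?thesis unfolding norm_fock_weighted dil_def smult_of_real by (intro mult_left_mono) auto
    qed
    then have "norm (fock_weighted (dil (rseq k) F) z) powr q \<le> h (rseq k *\<^sub>R z)"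
      unfolding h_def using q by (intro powr_mono2) auto
    also have "\<dots> \<le> 2 ^ ?D * H k z"
    proof -
      have "1 \<le> (2 * rseq k) ^ ?D" using rseq(1)[of k] by (intro one_le_power) simp
      then have "1 * h (rseq k *\<^sub>R z) \<le> (2 * rseq k) ^ ?D * h (rseq k *\<^sub>R z)" by (intro mult_right_mono h0)
      then show ?thesis by (simp add: H_def power_mult_distrib mult.assoc)
    qed
    also have "\<dots> \<le> 2 ^ ?D * (h z + norm (H k z - h z))" by (intro mult_left_mono) auto
    finally have "2 powr q * norm (fock_weighted (dil (rseq k) F) z) powr q \<le> 2 powr q * (2 ^ ?D * (h z + norm (H k z - h z)))"
      by (intro mult_left_mono) auto
    with 1 show ?thesis by (simp add: A_def B_def algebra_simps)
  qed
  have dlim: "(\<lambda>k. d k z) \<longlonglongrightarrow> 0" for z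
  proof -
    have "(\<lambda>k. rseq k *\<^sub>R z) \<longlonglongrightarrow> 1 *\<^sub>R z" by (intro tendsto_scaleR rseq(3) tendsto_const)
    then have "(\<lambda>k. F (rseq k *\<^sub>R z)) \<longlonglongrightarrow> F (1 *\<^sub>R z)"
      using entire_continuous[OF E, of UNIV] by (intro isCont_tendsto_compose[of _ F]) (auto simp: continuous_on_eq_continuous_at)
    then have "(\<lambda>k. norm (fock_weighted (\<lambda>z. dil (rseq k) F z - F z) z)) \<longlonglongrightarrow> norm ((F z - F z) * of_real (exp (- pi * (norm z)\<^sup>2 / 2)))"
      unfolding fock_weighted_def dil_def smult_of_real by (intro tendsto_intros) simp
    then show ?thesis unfolding d_def using q by (intro tendsto_zero_powrI[where b=q]) auto
  qed
  \<comment> \<open>dominated convergence applies only to the truncation of \<open>d k\<close> at \<open>A * h\<close>; the excess is part of the \<open>L\<^sup>1\<close> error\<close>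
  have mlim: "(\<lambda>k. \<integral>z. min (d k z) (A * h z) \<partial>lborel) \<longlonglongrightarrow> (\<integral>z. 0 \<partial>(lborel :: (complex^'n) measure))"
  proof (rule integral_dominated_convergence[where w="\<lambda>z. A * h z"])
    show "AE z in lborel. (\<lambda>k. min (d k z) (A * h z)) \<longlonglongrightarrow> 0"
    proof (rule AE_I2)
      fix z
      have "(\<lambda>k. min (d k z) (A * h z)) \<longlonglongrightarrow> min 0 (A * h z)" by (intro tendsto_min dlim tendsto_const)
      then show "(\<lambda>k. min (d k z) (A * h z)) \<longlonglongrightarrow> 0" using AB h0[of z] by simp
    qed
    show "AE z in lborel. norm (min (d k z) (A * h z)) \<le> A * h z" for k
      using AB h0 d0 by (intro AE_I2) (simp add: min_def)
  qed (use hint in \<open>simp_all\<close>)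
  have dint: "integrable lborel (d k)" for k
    by (rule Bochner_Integration.integrable_bound[OF Bochner_Integration.integrable_add[OF integrable_mult_right[OF hint, of A] integrable_mult_right[of B, OF integrable_norm[OF Bochner_Integration.integrable_diff[OF Hint[of k] hint]]]]])
      (use dle d0 in \<open>auto intro!: AE_I2 intro: order_trans[OF _ abs_ge_self]\<close>)
  have upper: "(\<integral>z. d k z \<partial>lborel) \<le> (\<integral>z. min (d k z) (A * h z) \<partial>lborel) + B * (\<integral>z. norm (H k z - h z) \<partial>lborel)" for k
  proof -
    have mi: "integrable lborel (\<lambda>z. min (d k z) (A * h z))"
      using dint hint by (intro integrable_min) auto
    have ni: "integrable lborel (\<lambda>z. norm (H k z - h z))" using Hint[of k] hint by simp
    have "(\<integral>z. d k z \<partial>lborel) \<le> (\<integral>z. min (d k z) (A * h z) + B * norm (H k z - h z) \<partial>lborel)"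
    proof (rule integral_mono)
      show "integrable lborel (\<lambda>z. min (d k z) (A * h z) + B * norm (H k z - h z))" using mi ni by simp
      fix z
      have "B * norm (H k z - h z) \<ge> 0" using AB by simp
      then show "d k z \<le> min (d k z) (A * h z) + B * norm (H k z - h z)" using dle[of k z] by linarith
    qed (rule dint)
    also have "\<dots> = (\<integral>z. min (d k z) (A * h z) \<partial>lborel) + B * (\<integral>z. norm (H k z - h z) \<partial>lborel)"
      using mi ni by simp
    finally show ?thesis .
  qed
  have "(\<lambda>k. \<integral>z. d k z \<partial>lborel) \<longlonglongrightarrow> 0"
  proof (rule tendsto_sandwich[OF _ _ tendsto_const])
    show "(\<lambda>k. (\<integral>z. min (d k z) (A * h z) \<partial>lborel) + B * (\<integral>z. norm (H k z - h z) \<partial>lborel)) \<longlonglongrightarrow> 0"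
      using tendsto_add[OF mlim tendsto_mult[OF tendsto_const e, of B]] by simp
    show "\<forall>\<^sub>F k in sequentially. 0 \<le> (\<integral>z. d k z \<partial>lborel)" using d0 by (intro always_eventually allI) simp
    show "\<forall>\<^sub>F k in sequentially. (\<integral>z. d k z \<partial>lborel) \<le> (\<integral>z. min (d k z) (A * h z) \<partial>lborel) + B * (\<integral>z. norm (H k z - h z) \<partial>lborel)"
      using upper by (intro always_eventually allI)
  qed
  then have "(\<lambda>k. (\<integral>z. d k z \<partial>lborel) powr (1 / q)) \<longlonglongrightarrow> 0"
    using q d0 by (intro tendsto_zero_powrI[where b="1 / q"]) auto
  then show ?thesis unfolding fock_norm_fin[OF p(2)] d_def q_def .
qed

section \<open>Schwartz functions\<close>

lemma schwartz_seminorm_upper: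
  assumes "g \<in> schwartz" shows "(1 + norm x) ^ m * norm (partials js g x) \<le> schwartz_seminorm m js g"
proof -
  have "bdd_above (range (\<lambda>x. (1 + norm x) ^ m * norm (partials js g x)))"
    using assms by (auto simp: schwartz_def)
  then show ?thesis unfolding schwartz_seminorm_def by (intro cSUP_upper) auto
qed

lemma schwartz_seminorm_least:
  assumes "\<And>x. (1 + norm x) ^ m * norm (partials js g x) \<le> M" shows "schwartz_seminorm m js g \<le> M"
  unfolding schwartz_seminorm_def by (rule cSUP_least) (use assms in auto)

lemma schwartz_seminorm_nonneg: "g \<in> schwartz \<Longrightarrow> 0 \<le> schwartz_seminorm m js g"
  by (rule order_trans[OF _ schwartz_seminorm_upper[of g 0]]) auto

lemma schwartz_seminorm_mono:
  assumes "g \<in> schwartz" "m \<le> k" shows "schwartz_seminorm m js g \<le> schwartz_seminorm k js g"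
proof (rule schwartz_seminorm_least)
  fix x
  have "(1 + norm x) ^ m * norm (partials js g x) \<le> (1 + norm x) ^ k * norm (partials js g x)"
    using assms(2) by (intro mult_right_mono power_increasing) auto
  also have "\<dots> \<le> schwartz_seminorm k js g" by (rule schwartz_seminorm_upper[OF assms(1)])
  finally show "(1 + norm x) ^ m * norm (partials js g x) \<le> schwartz_seminorm k js g" .
qed

text \<open>The norm that occurs in the continuity estimate of a tempered distribution.\<close>

definition schwartz_norm :: "nat \<Rightarrow> (real^'n::finite \<Rightarrow> complex) \<Rightarrow> real" where
  "schwartz_norm N g = (\<Sum>js | length js \<le> N. schwartz_seminorm N js g)"

lemma finite_js: "finite {js :: 'n::finite list. length js \<le> N}"
  using finite_lists_length_le[of "UNIV :: 'n set" N] by simp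

lemma schwartz_norm_nonneg: "g \<in> schwartz \<Longrightarrow> 0 \<le> schwartz_norm N g"
  unfolding schwartz_norm_def by (intro sum_nonneg schwartz_seminorm_nonneg)

lemma schwartz_norm_mono:
  assumes "g \<in> schwartz" "N \<le> K" shows "schwartz_norm N g \<le> schwartz_norm K g"
proof -
  have "schwartz_norm N g \<le> (\<Sum>js | length js \<le> N. schwartz_seminorm K js g)"
    unfolding schwartz_norm_def by (intro sum_mono schwartz_seminorm_mono assms)
  also have "\<dots> \<le> schwartz_norm K g"
    unfolding schwartz_norm_def using assms by (intro sum_mono2 finite_js) (auto intro: schwartz_seminorm_nonneg)
  finally show ?thesis .
qed

lemma schwartz_seminorm_le_norm:
  assumes "g \<in> schwartz" "m \<le> N" "length js \<le> N" shows "schwartz_seminorm m js g \<le> schwartz_norm N g"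
proof -
  have "schwartz_seminorm m js g \<le> schwartz_seminorm N js g" by (rule schwartz_seminorm_mono[OF assms(1,2)])
  also have "\<dots> \<le> schwartz_norm N g"
    unfolding schwartz_norm_def using assms by (intro member_le_sum finite_js) (auto intro: schwartz_seminorm_nonneg)
  finally show ?thesis .
qed

lemma partials_Nil [simp]: "partials [] f = f"
  and partials_Cons [simp]: "partials (j # js) f = partial j (partials js f)"
  and partials_append: "partials (js @ ks) f = partials js (partials ks f)"
  by (simp_all add: partials_def)

lemma smooth_partials: "smooth f \<Longrightarrow> partials js f differentiable (at x)"
  by (simp add: smooth_def)

lemma partial_eq: "(f has_derivative D) (at x) \<Longrightarrow> partial j f x = D (axis j 1)"
  unfolding partial_def by (simp add: frechet_derivative_at[symmetric])

lemma partials_add: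
  assumes "smooth f" "smooth g"
  shows "partials js (\<lambda>x. f x + g x) = (\<lambda>x. partials js f x + partials js g x)"
proof (induction js)
  case (Cons j js)
  have "partial j (\<lambda>x. partials js f x + partials js g x) x = partial j (partials js f) x + partial j (partials js g) x" for x
    using has_derivative_add[OF smooth_partials[OF assms(1), unfolded frechet_derivative_works] smooth_partials[OF assms(2), unfolded frechet_derivative_works]]
    by (subst partial_eq) (auto simp: partial_def)
  then show ?case by (simp add: Cons fun_eq_iff)
qed simp

lemma partials_mult:
  assumes "smooth f"
  shows "partials js (\<lambda>x. c * f x) = (\<lambda>x. c * partials js f x)"
proof (induction js)
  case (Cons j js)
  have "partial j (\<lambda>x. c * partials js f x) x = c * partial j (partials js f) x" for x
    using has_derivative_mult_right[OF smooth_partials[OF assms(1), unfolded frechet_derivative_works]]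
    by (subst partial_eq) (auto simp: partial_def)
  then show ?case by (simp add: Cons fun_eq_iff)
qed simp

lemma smooth_add: "smooth f \<Longrightarrow> smooth g \<Longrightarrow> smooth (\<lambda>x. f x + g x)"
  by (auto simp: smooth_def partials_add intro!: differentiable_add)

lemma smooth_mult: "smooth f \<Longrightarrow> smooth (\<lambda>x. c * f x)"
  by (auto simp: smooth_def partials_mult intro!: differentiable_mult)

lemma schwartzI:
  assumes "smooth f" "\<And>m js. \<exists>M. \<forall>x. (1 + norm x) ^ m * norm (partials js f x) \<le> M"
  shows "f \<in> schwartz"
  using assms by (fastforce simp: schwartz_def bdd_above_def)

lemma schwartz_smooth: "f \<in> schwartz \<Longrightarrow> smooth f"
  by (simp add: schwartz_def)

lemma schwartz_add:
  assumes "f \<in> schwartz" "g \<in> schwartz" shows "(\<lambda>x. f x + g x) \<in> schwartz"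
proof (rule schwartzI)
  show "smooth (\<lambda>x. f x + g x)" using assms by (intro smooth_add schwartz_smooth)
  fix m js
  have "(1 + norm x) ^ m * norm (partials js (\<lambda>x. f x + g x) x) \<le> schwartz_seminorm m js f + schwartz_seminorm m js g" for x
  proof -
    have "(1 + norm x) ^ m * norm (partials js (\<lambda>x. f x + g x) x) \<le> (1 + norm x) ^ m * (norm (partials js f x) + norm (partials js g x))"
      unfolding partials_add[OF assms[THEN schwartz_smooth]] by (intro mult_left_mono norm_triangle_ineq) auto
    also have "\<dots> \<le> schwartz_seminorm m js f + schwartz_seminorm m js g"
      unfolding distrib_left by (intro add_mono schwartz_seminorm_upper assms)
    finally show ?thesis .
  qed
  then show "\<exists>M. \<forall>x. (1 + norm x) ^ m * norm (partials js (\<lambda>x. f x + g x) x) \<le> M" by blast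
qed

lemma schwartz_mult:
  assumes "f \<in> schwartz" shows "(\<lambda>x. c * f x) \<in> schwartz"
proof (rule schwartzI)
  show "smooth (\<lambda>x. c * f x)" using assms by (intro smooth_mult schwartz_smooth)
  fix m js
  have "(1 + norm x) ^ m * norm (partials js (\<lambda>x. c * f x) x) \<le> norm c * schwartz_seminorm m js f" for x
    unfolding partials_mult[OF schwartz_smooth[OF assms]] norm_mult
    using mult_left_mono[OF schwartz_seminorm_upper[OF assms, of x m js], of "norm c"] by (simp add: mult_ac)
  then show "\<exists>M. \<forall>x. (1 + norm x) ^ m * norm (partials js (\<lambda>x. c * f x) x) \<le> M" by blast
qed

lemma tempered_bound:
  assumes "u \<in> tempered_distributions"
  shows "\<exists>C N. C \<ge> 0 \<and> (\<forall>g\<in>schwartz. norm (u g) \<le> C * schwartz_norm N g)"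
proof -
  obtain C N where *: "\<forall>g\<in>schwartz. norm (u g) \<le> C * schwartz_norm N g"
    using assms unfolding tempered_distributions_def schwartz_norm_def by blast
  have "norm (u g) \<le> \<bar>C\<bar> * schwartz_norm N g" if g: "g \<in> schwartz" for g
  proof -
    have "norm (u g) \<le> C * schwartz_norm N g" using * g by blast
    also have "\<dots> \<le> \<bar>C\<bar> * schwartz_norm N g" by (intro mult_right_mono schwartz_norm_nonneg g) simp
    finally show ?thesis .
  qed
  then show ?thesis by (intro exI[of _ "\<bar>C\<bar>"] exI[of _ N]) simp
qed

lemma temperedD:
  assumes "u \<in> tempered_distributions"
  shows "g \<in> schwartz \<Longrightarrow> h \<in> schwartz \<Longrightarrow> u (\<lambda>x. g x + h x) = u g + u h"
    "g \<in> schwartz \<Longrightarrow> u (\<lambda>x. c * g x) = c * u g" "g \<notin> schwartz \<Longrightarrow> u g = 0"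
  using assms unfolding tempered_distributions_def by auto

lemma temperedI:
  assumes "\<And>g h. g \<in> schwartz \<Longrightarrow> h \<in> schwartz \<Longrightarrow> u (\<lambda>x. g x + h x) = u g + u h"
    "\<And>c g. g \<in> schwartz \<Longrightarrow> u (\<lambda>x. c * g x) = c * u g" "\<And>g. g \<notin> schwartz \<Longrightarrow> u g = 0"
    "\<And>g. g \<in> schwartz \<Longrightarrow> norm (u g) \<le> C * schwartz_norm N g"
  shows "u \<in> tempered_distributions"
  using assms unfolding tempered_distributions_def schwartz_norm_def by blast

lemma tempered_diff:
  assumes u: "u \<in> tempered_distributions" and v: "v \<in> tempered_distributions"
  shows "(\<lambda>g. u g - v g) \<in> tempered_distributions"
proof -
  obtain C N where C: "C \<ge> 0" "\<And>g. g \<in> schwartz \<Longrightarrow> norm (u g) \<le> C * schwartz_norm N g" using tempered_bound[OF u] by blast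
  obtain D K where D: "D \<ge> 0" "\<And>g. g \<in> schwartz \<Longrightarrow> norm (v g) \<le> D * schwartz_norm K g" using tempered_bound[OF v] by blast
  show ?thesis
  proof (rule temperedI[where C="C + D" and N="max N K"])
    fix g :: "real^'a \<Rightarrow> complex" assume g: "g \<in> schwartz"
    have "norm (u g - v g) \<le> C * schwartz_norm N g + D * schwartz_norm K g"
      using norm_triangle_ineq4[of "u g" "v g"] C(2)[OF g] D(2)[OF g] by linarith
    also have "\<dots> \<le> C * schwartz_norm (max N K) g + D * schwartz_norm (max N K) g"
      using C D by (intro add_mono mult_left_mono schwartz_norm_mono g) auto
    finally show "norm (u g - v g) \<le> (C + D) * schwartz_norm (max N K) g" by (simp add: algebra_simps)
  qed (use temperedD[OF u] temperedD[OF v] in \<open>auto simp: algebra_simps\<close>)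
qed

section \<open>Distributions applied to Gaussians\<close>

text \<open>Derivatives of Gaussians \<open>gker a z\<close>, in the variable \<open>y\<close> as well as in the parameters \<open>a\<close> and \<open>z\<close>, are
  polynomials in \<open>a\<close>, \<open>z\<close>, \<open>y\<close> times the same Gaussian. Representing the polynomials by expressions makes both kinds
  of differentiation recursive functions, so that their commutation and all growth estimates follow by
  induction. The leaves \<open>PZ v\<close>, \<open>PY v\<close> and \<open>PYY\<close> stand for \<open>v z\<close>, \<open>y v\<close> and \<open>y y\<close>.\<close>

datatype 'n pexp = Cst complex | PA | PZ "complex^'n" | PY "complex^'n" | PYY | Pls "'n pexp" "'n pexp" | Tms "'n pexp" "'n pexp"

primrec ev :: "'n::finite pexp \<Rightarrow> complex \<Rightarrow> complex^'n \<Rightarrow> real^'n \<Rightarrow> complex" where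
  "ev (Cst c) a z y = c"
| "ev PA a z y = a"
| "ev (PZ v) a z y = dotc v z"
| "ev (PY v) a z y = dotc (of_real_vec y) v"
| "ev PYY a z y = of_real (y \<bullet> y)"
| "ev (Pls e f) a z y = ev e a z y + ev f a z y"
| "ev (Tms e f) a z y = ev e a z y * ev f a z y"

primrec dY :: "real^'n::finite \<Rightarrow> 'n pexp \<Rightarrow> 'n pexp" where
  "dY h (Cst c) = Cst 0"
| "dY h PA = Cst 0"
| "dY h (PZ v) = Cst 0"
| "dY h (PY v) = Cst (dotc (of_real_vec h) v)"
| "dY h PYY = Tms (Cst 2) (PY (of_real_vec h))"
| "dY h (Pls e f) = Pls (dY h e) (dY h f)"
| "dY h (Tms e f) = Pls (Tms (dY h e) f) (Tms e (dY h f))"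

primrec dR :: "complex \<Rightarrow> complex^'n::finite \<Rightarrow> 'n pexp \<Rightarrow> 'n pexp" where
  "dR b v (Cst c) = Cst 0"
| "dR b v PA = Cst b"
| "dR b v (PZ w) = Cst (dotc w v)"
| "dR b v (PY w) = Cst 0"
| "dR b v PYY = Cst 0"
| "dR b v (Pls e f) = Pls (dR b v e) (dR b v f)"
| "dR b v (Tms e f) = Pls (Tms (dR b v e) f) (Tms e (dR b v f))"

text \<open>Derivative in the direction \<open>h\<close> of polynomial times Gaussian, with the Gaussian factored out.\<close>

definition DY :: "real^'n::finite \<Rightarrow> 'n pexp \<Rightarrow> 'n pexp" where
  "DY h e = Pls (dY h e) (Tms (Pls (Tms (Cst (- 2 * of_real pi)) (Tms PA (PY (of_real_vec h)))) (Tms (Cst (of_real pi)) (PZ (of_real_vec h)))) e)"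

text \<open>Derivative in the parameters \<open>(a, z)\<close> along \<open>(b, v)\<close>, with the Gaussian factored out.\<close>

definition DR :: "complex \<Rightarrow> complex^'n::finite \<Rightarrow> 'n pexp \<Rightarrow> 'n pexp" where
  "DR b v e = Pls (dR b v e) (Tms (Pls (Tms (Cst (- of_real pi * b)) PYY) (Tms (Cst (of_real pi)) (PY v))) e)"

definition gfam :: "'n::finite pexp \<Rightarrow> complex \<Rightarrow> complex^'n \<Rightarrow> real^'n \<Rightarrow> complex" where
  "gfam e a z y = ev e a z y * gker a z y"

lemma gker_eq_gfam: "gker a z = gfam (Cst 1) a z"
  by (simp add: gfam_def fun_eq_iff)

lemma has_derivative_dotc_y: "((\<lambda>y. dotc (of_real_vec y) v) has_derivative (\<lambda>h. dotc (of_real_vec h) v)) (at y)"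
proof (rule bounded_linear_imp_has_derivative)
  have "linear (\<lambda>y. dotc (of_real_vec y) v)"
    by (intro linearI) (auto simp: scaleR_conv_of_real[where 'a=complex])
  then show "bounded_linear (\<lambda>y. dotc (of_real_vec y) v)" by (simp add: linear_conv_bounded_linear)
qed

lemma has_derivative_yy: "((\<lambda>y. complex_of_real (y \<bullet> y)) has_derivative (\<lambda>h. 2 * of_real (y \<bullet> h))) (at y)"
  by (auto intro!: derivative_eq_intros simp: inner_commute)

lemma has_derivative_ev: "(ev e a z has_derivative (\<lambda>h. ev (dY h e) a z y)) (at y)"
proof (induction e)
  case (PY v)
  show ?case using has_derivative_dotc_y by simp
next
  case PYY
  show ?case using has_derivative_yy[of y] by (simp add: inner_commute)
next
  case (Pls e f)
  show ?case using has_derivative_add[OF Pls] by simp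
next
  case (Tms e f)
  show ?case using has_derivative_mult[OF Tms] by (simp add: add.commute)
qed auto

lemma has_derivative_gker:
  "(gker a z has_derivative (\<lambda>h. (- 2 * of_real pi * a * dotc (of_real_vec y) (of_real_vec h) + of_real pi * dotc (of_real_vec h) z) * gker a z y)) (at y)"
proof -
  have "((\<lambda>y. - of_real pi * a * of_real (y \<bullet> y) + of_real pi * dotc (of_real_vec y) z) has_derivative
     (\<lambda>h. - of_real pi * a * (2 * of_real (y \<bullet> h)) + of_real pi * dotc (of_real_vec h) z)) (at y)"
    by (intro has_derivative_add has_derivative_mult_right has_derivative_dotc_y has_derivative_yy)
  from has_derivative_compose[OF this DERIV_exp[THEN has_field_derivative_imp_has_derivative]]
  show ?thesis unfolding gker_def by (rule has_derivative_eq_rhs) (simp add: fun_eq_iff gker_def algebra_simps)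
qed

lemma has_derivative_gfam: "(gfam e a z has_derivative (\<lambda>h. gfam (DY h e) a z y)) (at y)"
  unfolding gfam_def using has_derivative_mult[OF has_derivative_ev has_derivative_gker]
  by (rule has_derivative_eq_rhs) (simp add: fun_eq_iff DY_def algebra_simps)

definition DYs :: "'n::finite list \<Rightarrow> 'n pexp \<Rightarrow> 'n pexp" where
  "DYs js e = foldr (\<lambda>j. DY (axis j 1)) js e"

lemma partials_gfam: "partials js (gfam e a z) = gfam (DYs js e) a z"
proof (induction js)
  case (Cons j js)
  show ?case by (simp add: Cons DYs_def fun_eq_iff partial_eq[OF has_derivative_gfam])
qed (simp add: DYs_def)

lemma smooth_gfam: "smooth (gfam e a z)"
  unfolding smooth_def partials_gfam using has_derivative_gfam differentiable_def by blast

lemma ev_param_derivative: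
  "((\<lambda>t. ev e (a + t * b) (z + t *s v) y) has_field_derivative ev (dR b v e) (a + t * b) (z + t *s v) y) (at t)"
proof (induction e)
  case (Tms e f)
  show ?case using DERIV_mult[OF Tms] by (simp add: algebra_simps)
qed (auto intro!: derivative_eq_intros)

lemma gfam_param_derivative:
  "((\<lambda>t. gfam e (a + t * b) (z + t *s v) y) has_field_derivative gfam (DR b v e) (a + t * b) (z + t *s v) y) (at t)"
proof -
  have "((\<lambda>t. gker (a + t * b) (z + t *s v) y) has_field_derivative (- of_real pi * b * of_real (y \<bullet> y) + of_real pi * dotc (of_real_vec y) v) * gker (a + t * b) (z + t *s v) y) (at t)"
    unfolding gker_def by (auto intro!: derivative_eq_intros simp: algebra_simps)
  from DERIV_mult[OF ev_param_derivative this] show ?thesis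
    unfolding gfam_def by (rule DERIV_cong) (simp add: DR_def algebra_simps)
qed

lemma ev_dY_dR: "ev (dY h (dR b v e)) a z y = ev (dR b v (dY h e)) a z y"
  by (induction e) (auto simp: algebra_simps)

lemma ev_DY_DR: "ev (DY h (DR b v e)) a z y = ev (DR b v (DY h e)) a z y"
  by (simp add: DY_def DR_def ev_dY_dR algebra_simps)

lemma ev_DY_cong: 
  assumes "\<And>a z y. ev e a z y = ev f a z y"
  shows "ev (DY h e) a z y = ev (DY h f) a z y"
proof -
  have "ev e a z = ev f a z" using assms by (simp add: fun_eq_iff)
  from has_derivative_unique[OF has_derivative_ev[of e a z y, unfolded this] has_derivative_ev[of f a z y]]
  have "ev (dY h e) a z y = ev (dY h f) a z y" by (rule fun_cong)
  then show ?thesis by (simp add: DY_def assms)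
qed

lemma ev_DYs_DR: "ev (DYs js (DR b v e)) a z y = ev (DR b v (DYs js e)) a z y"
proof (induction js arbitrary: a z y)
  case (Cons j js)
  have "ev (DY (axis j 1) (DYs js (DR b v e))) a z y = ev (DY (axis j 1) (DR b v (DYs js e))) a z y"
    by (rule ev_DY_cong[OF Cons])
  then show ?case by (simp add: DYs_def ev_DY_DR)
qed (simp add: DYs_def)

lemma ev_growth:
  "\<exists>C N. C \<ge> 0 \<and> (\<forall>a z y. norm a \<le> R \<longrightarrow> norm z \<le> R \<longrightarrow> norm (ev e a z y) \<le> C * (1 + norm y) ^ N)"
proof (induction e)
  case (Cst c)
  show ?case by (intro exI[of _ "norm c"] exI[of _ 0]) simp
next
  case PA
  show ?case by (rule exI[of _ "\<bar>R\<bar>"], rule exI[of _ 0]) auto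
next
  case (PZ v)
  have "norm (dotc v z) \<le> norm v * \<bar>R\<bar>" if "norm z \<le> R" for z
    using order_trans[OF norm_dotc_le mult_left_mono[of "norm z" "\<bar>R\<bar>" "norm v"]] that by auto
  then show ?case by (intro exI[of _ "norm v * \<bar>R\<bar>"] exI[of _ 0]) auto
next
  case (PY v)
  have "norm (dotc (of_real_vec y) v) \<le> norm v * (1 + norm y) ^ 1" for y
  proof -
    have "norm (dotc (of_real_vec y) v) \<le> norm y * norm v" using norm_dotc_le[of "of_real_vec y" v] by simp
    then show ?thesis by (simp add: algebra_simps add_increasing)
  qed
  then show ?case unfolding ev.simps by (intro exI[of _ "norm v"] exI[of _ 1]) auto
next
  case PYY
  have "norm (of_real (y \<bullet> y) :: complex) \<le> 1 * (1 + norm y) ^ 2" for y :: "real^'a"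
  proof -
    have "norm (of_real (y \<bullet> y) :: complex) = (norm y)\<^sup>2" unfolding norm_of_real power2_norm_eq_inner by simp
    then show ?thesis by (simp only:) (simp add: power_mono)
  qed
  then show ?case unfolding ev.simps by (intro exI[of _ 1] exI[of _ 2]) auto
next
  case (Pls e f)
  then obtain C N D K where *: "C \<ge> 0" "D \<ge> 0"
      "\<And>a z y. norm a \<le> R \<Longrightarrow> norm z \<le> R \<Longrightarrow> norm (ev e a z y) \<le> C * (1 + norm y) ^ N"
      "\<And>a z y. norm a \<le> R \<Longrightarrow> norm z \<le> R \<Longrightarrow> norm (ev f a z y) \<le> D * (1 + norm y) ^ K" by blast
  have "norm (ev (Pls e f) a z y) \<le> (C + D) * (1 + norm y) ^ max N K" if "norm a \<le> R" "norm z \<le> R" for a z y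
  proof -
    have "norm (ev (Pls e f) a z y) \<le> C * (1 + norm y) ^ N + D * (1 + norm y) ^ K"
      using norm_triangle_ineq[of "ev e a z y" "ev f a z y"] *(3,4)[OF that, of y] by simp
    also have "\<dots> \<le> C * (1 + norm y) ^ max N K + D * (1 + norm y) ^ max N K"
      using * by (intro add_mono mult_left_mono power_increasing) auto
    finally show ?thesis by (simp add: algebra_simps)
  qed
  then show ?case using *(1,2) by (intro exI[of _ "C + D"] exI[of _ "max N K"]) auto
next
  case (Tms e f)
  then obtain C N D K where *: "C \<ge> 0" "D \<ge> 0"
      "\<And>a z y. norm a \<le> R \<Longrightarrow> norm z \<le> R \<Longrightarrow> norm (ev e a z y) \<le> C * (1 + norm y) ^ N"
      "\<And>a z y. norm a \<le> R \<Longrightarrow> norm z \<le> R \<Longrightarrow> norm (ev f a z y) \<le> D * (1 + norm y) ^ K" by blast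
  have "norm (ev (Tms e f) a z y) \<le> (C * D) * (1 + norm y) ^ (N + K)" if "norm a \<le> R" "norm z \<le> R" for a z y
  proof -
    have "norm (ev (Tms e f) a z y) \<le> (C * (1 + norm y) ^ N) * (D * (1 + norm y) ^ K)"
      unfolding ev.simps norm_mult using *(1,3,4) that by (intro mult_mono) auto
    then show ?thesis by (simp add: power_add mult_ac)
  qed
  then show ?case using *(1,2) by (intro exI[of _ "C * D"] exI[of _ "N + K"]) auto
qed

lemma poly_gauss_bound:
  assumes "\<epsilon> > 0"
  shows "\<exists>M. \<forall>t\<ge>0. (1 + t) ^ K * exp (- pi * \<epsilon> * t\<^sup>2 + b * t) \<le> M"
proof (intro exI allI impI)
  fix t :: real assume t: "t \<ge> 0"
  have "(1 + t) ^ K \<le> exp t ^ K" using exp_ge_add_one_self t by (intro power_mono) auto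
  then have "(1 + t) ^ K * exp (- pi * \<epsilon> * t\<^sup>2 + b * t) \<le> exp t ^ K * exp (- pi * \<epsilon> * t\<^sup>2 + b * t)"
    by (intro mult_right_mono) auto
  also have "\<dots> = exp (- pi * \<epsilon> * t\<^sup>2 + (b + K) * t)"
    by (simp add: exp_of_nat_mult[symmetric] mult_exp_exp algebra_simps)
  also have "\<dots> \<le> exp ((b + K)\<^sup>2 / (2 * pi * \<epsilon>))"
  proof -
    have "0 \<le> pi * (\<epsilon> / 2) * t\<^sup>2" using assms by simp
    then show ?thesis using quad_lin_le[OF assms, of t "b + K"] by simp
  qed
  finally show "(1 + t) ^ K * exp (- pi * \<epsilon> * t\<^sup>2 + b * t) \<le> exp ((b + K)\<^sup>2 / (2 * pi * \<epsilon>))" .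
qed

lemma gfam_bound:
  fixes e :: "'n::finite pexp"
  assumes "\<epsilon> > 0"
  shows "\<exists>M\<ge>0. \<forall>a z y. norm a \<le> R \<longrightarrow> norm z \<le> R \<longrightarrow> \<epsilon> \<le> Re a \<longrightarrow> (1 + norm y) ^ m * norm (partials js (gfam e a z) y) \<le> M"
proof -
  obtain C N where C: "C \<ge> 0" "\<And>a z y. norm a \<le> R \<Longrightarrow> norm z \<le> R \<Longrightarrow> norm (ev (DYs js e) a z y) \<le> C * (1 + norm y) ^ N"
    using ev_growth[of R "DYs js e"] by blast
  obtain M where M: "\<And>t. t \<ge> 0 \<Longrightarrow> (1 + t) ^ (m + N) * exp (- pi * \<epsilon> * t\<^sup>2 + (pi * R) * t) \<le> M"
    using poly_gauss_bound[OF assms] by blast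
  have M0: "M \<ge> 0" using M[of 0] by simp
  have "(1 + norm y) ^ m * norm (partials js (gfam e a z) y) \<le> C * M"
    if *: "norm a \<le> R" "norm z \<le> R" "\<epsilon> \<le> Re a" for a z y
  proof -
    have "norm (partials js (gfam e a z) y) \<le> (C * (1 + norm y) ^ N) * exp (- pi * \<epsilon> * (norm y)\<^sup>2 + pi * R * norm y)"
      unfolding partials_gfam gfam_def norm_mult
      using order_trans[OF norm_re_vec_le *(2)] C * by (intro mult_mono gker_bound) auto
    then have "(1 + norm y) ^ m * norm (partials js (gfam e a z) y) \<le> (1 + norm y) ^ m * ((C * (1 + norm y) ^ N) * exp (- pi * \<epsilon> * (norm y)\<^sup>2 + pi * R * norm y))"
      by (intro mult_left_mono) auto
    also have "\<dots> = C * ((1 + norm y) ^ (m + N) * exp (- pi * \<epsilon> * (norm y)\<^sup>2 + pi * R * norm y))"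
      by (simp only: power_add mult_ac)
    also have "\<dots> \<le> C * M" using C M[of "norm y"] by (intro mult_left_mono) auto
    finally show ?thesis .
  qed
  then show ?thesis using C M0 by (intro exI[of _ "C * M"]) auto
qed

lemma gfam_schwartz: assumes "Re a > 0" shows "gfam e a z \<in> schwartz"
proof (rule schwartzI[OF smooth_gfam])
  fix m js
  show "\<exists>M. \<forall>x. (1 + norm x) ^ m * norm (partials js (gfam e a z) x) \<le> M"
  proof -
    obtain M where M: "\<And>a' z' y. norm a' \<le> max (norm a) (norm z) \<Longrightarrow> norm z' \<le> max (norm a) (norm z) \<Longrightarrow> Re a \<le> Re a' \<Longrightarrow>
        (1 + norm y) ^ m * norm (partials js (gfam e a' z') y) \<le> M"
      using gfam_bound[OF assms, of "max (norm a) (norm z)" m js e] by blast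
    show ?thesis by (rule exI[of _ M]) (auto intro!: M)
  qed
qed

lemma gker_schwartz: "Re a > 0 \<Longrightarrow> gker a z \<in> schwartz"
  unfolding gker_eq_gfam by (rule gfam_schwartz)

text \<open>The function \<open>t \<mapsto> u (gfam e (a + t b) (z + t v))\<close> has the expected derivative at \<open>0\<close>, with a quadratic remainder. Each
  seminorm of the remainder of the test function is estimated pointwise in \<open>y\<close> by \<open>Cauchy_quadratic_1\<close>, because
  partial derivatives in \<open>y\<close> commute with the parameter derivative.\<close>

lemma tempered_gfam_quadratic:
  fixes e :: "'n::finite pexp"
  assumes u: "u \<in> tempered_distributions" and a: "Re a > 0"
  shows "\<exists>C. \<forall>b v t. norm b \<le> Re a / 2 \<longrightarrow> norm v \<le> 1 \<longrightarrow> norm t \<le> 1 / 2 \<longrightarrow>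
     norm (u (gfam e (a + t * b) (z + t *s v)) - u (gfam e a z) - t * u (gfam (DR b v e) a z)) \<le> C * (norm t)\<^sup>2"
proof -
  define R where "R = max (norm a + Re a) (norm z + 1)"
  obtain C N where C: "C \<ge> 0" "\<And>g. g \<in> schwartz \<Longrightarrow> norm (u g) \<le> C * schwartz_norm N g" using tempered_bound[OF u] by blast
  have "\<exists>M. \<forall>js::'n list. 0 \<le> M js \<and> (\<forall>a' z' y. norm a' \<le> R \<longrightarrow> norm z' \<le> R \<longrightarrow> Re a / 2 \<le> Re a' \<longrightarrow> (1 + norm y) ^ N * norm (partials js (gfam e a' z') y) \<le> M js)"
    using gfam_bound[of "Re a / 2" R N _ e] a by (intro choice) auto
  then obtain M where M: "\<And>js::'n list. 0 \<le> M js" "\<And>js a' z' y. norm a' \<le> R \<Longrightarrow> norm z' \<le> R \<Longrightarrow> Re a / 2 \<le> Re a' \<Longrightarrow> (1 + norm y) ^ N * norm (partials js (gfam e a' z') y) \<le> M js" by blast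
  have main: "norm (u (gfam e (a + t * b) (z + t *s v)) - u (gfam e a z) - t * u (gfam (DR b v e) a z)) \<le> (C * (\<Sum>js::'n list | length js \<le> N. 8 * M js)) * (norm t)\<^sup>2"
    if b: "norm b \<le> Re a / 2" and v: "norm v \<le> 1" and t: "norm t \<le> 1 / 2" for b v t
  proof -
    have par: "norm (a + s * b) \<le> R" "norm (z + s *s v) \<le> R" "Re a / 2 \<le> Re (a + s * b)" if s: "norm s \<le> 1" for s
    proof -
      have sb: "norm (s * b) \<le> Re a / 2" using mult_mono[OF s b] by (simp add: norm_mult)
      have sv: "norm (s *s v) \<le> 1" using mult_mono[OF s v] by simp
      show "norm (a + s * b) \<le> R" using norm_triangle_ineq[of a "s * b"] sb a unfolding R_def by linarith
      show "norm (z + s *s v) \<le> R" using norm_triangle_ineq[of z "s *s v"] sv unfolding R_def by linarith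
      show "Re a / 2 \<le> Re (a + s * b)" using abs_Re_le_cmod[of "s * b"] sb by simp
    qed
    define g0 g1 g2 where "g0 = gfam e (a + t * b) (z + t *s v)" and "g1 = gfam e a z" and "g2 = gfam (DR b v e) a z"
    have t1: "norm t \<le> 1" using t by simp
    have S: "g0 \<in> schwartz" "g1 \<in> schwartz" "g2 \<in> schwartz"
      unfolding g0_def g1_def g2_def using par(3)[OF t1] a by (auto intro!: gfam_schwartz)
    define rem where "rem = (\<lambda>y. g0 y + (- 1 * g1 y + - t * g2 y))"
    have S': "(\<lambda>y. - 1 * g1 y) \<in> schwartz" "(\<lambda>y. - t * g2 y) \<in> schwartz" 
      by (rule schwartz_mult, rule S)+
    note S'' = schwartz_add[OF S']
    have remS: "rem \<in> schwartz" unfolding rem_def by (rule schwartz_add[OF S(1) S''])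
    have urem: "u rem = u g0 - u g1 - t * u g2"
      unfolding rem_def temperedD(1)[OF u S(1) S''] temperedD(1)[OF u S'] temperedD(2)[OF u S(2)] temperedD(2)[OF u S(3)] by simp
    have prem: "partials js rem y = partials js g0 y - partials js g1 y - t * partials js g2 y" for js y
      unfolding rem_def partials_add[OF S(1)[THEN schwartz_smooth] S''[THEN schwartz_smooth]]
        partials_add[OF S'[THEN schwartz_smooth]] partials_mult[OF S(2)[THEN schwartz_smooth]] partials_mult[OF S(3)[THEN schwartz_smooth]] by simp
    have "schwartz_seminorm N js rem \<le> 8 * M js * (norm t)\<^sup>2" for js
    proof (rule schwartz_seminorm_least)
      fix y
      define h where "h s = gfam (DYs js e) (a + s * b) (z + s *s v) y" for s
      have hd: "(h has_field_derivative gfam (DR b v (DYs js e)) (a + s * b) (z + s *s v) y) (at s)" for s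
        unfolding h_def by (rule gfam_param_derivative)
      have hol: "h holomorphic_on UNIV" unfolding holomorphic_on_def field_differentiable_def using hd by blast
      have h': "deriv h 0 = partials js g2 y"
        using DERIV_imp_deriv[OF hd[of 0]] by (simp add: g2_def partials_gfam gfam_def ev_DYs_DR)
      define w where "w = (1 + norm y) ^ N"
      have w: "w > 0" by (simp add: w_def add_pos_nonneg)
      have "norm (h t - h 0 - t * deriv h 0) \<le> 8 * (M js / w) / 1\<^sup>2 * (norm t)\<^sup>2"
      proof (rule Cauchy_quadratic_1[OF hol])
        fix s :: complex assume "norm s \<le> 1"
        from M(2)[OF par[OF this], of y js] show "norm (h s) \<le> M js / w"
          using w by (simp add: partials_gfam h_def w_def pos_le_divide_eq mult.commute)
      qed (use t in simp_all)
      moreover have "partials js rem y = h t - h 0 - t * deriv h 0"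
        unfolding prem h' by (simp add: g0_def g1_def partials_gfam h_def)
      ultimately have "norm (partials js rem y) \<le> 8 * M js * (norm t)\<^sup>2 / w" by simp
      then show "(1 + norm y) ^ N * norm (partials js rem y) \<le> 8 * M js * (norm t)\<^sup>2"
        unfolding w_def[symmetric] using w by (simp add: pos_le_divide_eq mult.commute)
    qed
    then have "schwartz_norm N rem \<le> (\<Sum>js::'n list | length js \<le> N. 8 * M js * (norm t)\<^sup>2)"
      unfolding schwartz_norm_def by (intro sum_mono)
    also have "\<dots> = (\<Sum>js::'n list | length js \<le> N. 8 * M js) * (norm t)\<^sup>2" by (simp add: sum_distrib_right)
    finally have "C * schwartz_norm N rem \<le> C * ((\<Sum>js::'n list | length js \<le> N. 8 * M js) * (norm t)\<^sup>2)"
      using C(1) by (intro mult_left_mono)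
    with C(2)[OF remS] have "norm (u rem) \<le> (C * (\<Sum>js::'n list | length js \<le> N. 8 * M js)) * (norm t)\<^sup>2" by simp
    then show ?thesis unfolding urem g0_def g1_def g2_def .
  qed
  show ?thesis by (rule exI, intro allI impI, rule main)
qed

lemma dR_linear:
  "ev (dR b (v + w) e) a z y = ev (dR b v e) a z y + ev (dR 0 w e) a z y"
  "ev (dR (c * b) (c *s v) e) a z y = c * ev (dR b v e) a z y"
  by (induction e) (auto simp: algebra_simps)

lemma gfam_DR_add: "gfam (DR 0 (v + w) e) a z = (\<lambda>y. gfam (DR 0 v e) a z y + gfam (DR 0 w e) a z y)"
  by (simp add: fun_eq_iff gfam_def DR_def dR_linear algebra_simps)

lemma gfam_DR_mult: "gfam (DR 0 (c *s v) e) a z = (\<lambda>y. c * gfam (DR 0 v e) a z y)"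
  using dR_linear(2)[of c 0 v e a z] by (simp add: fun_eq_iff gfam_def DR_def algebra_simps)

lemma tempered_gfam_has_derivative:
  fixes e :: "'n::finite pexp"
  assumes u: "u \<in> tempered_distributions" and a: "Re a > 0"
  shows "((\<lambda>z. u (gfam e a z)) has_derivative (\<lambda>v. u (gfam (DR 0 v e) a z))) (at z)"
    and "u (gfam (DR 0 (c *s v) e) a z) = c * u (gfam (DR 0 v e) a z)"
proof -
  have add: "u (gfam (DR 0 (v + w) e) a z) = u (gfam (DR 0 v e) a z) + u (gfam (DR 0 w e) a z)" for v w
    unfolding gfam_DR_add by (rule temperedD(1)[OF u]) (intro gfam_schwartz a)+
  show mult: "u (gfam (DR 0 (c *s v) e) a z) = c * u (gfam (DR 0 v e) a z)" for c v
    unfolding gfam_DR_mult by (rule temperedD(2)[OF u]) (intro gfam_schwartz a)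
  have lin: "linear (\<lambda>v. u (gfam (DR 0 v e) a z))"
    using mult[of "of_real _"] by (intro linearI add) (simp add: smult_of_real[symmetric] scaleR_conv_of_real[where 'a=complex])
  obtain C where C: "\<And>b v t. norm b \<le> Re a / 2 \<Longrightarrow> norm v \<le> 1 \<Longrightarrow> norm t \<le> 1 / 2 \<Longrightarrow>
     norm (u (gfam e (a + t * b) (z + t *s v)) - u (gfam e a z) - t * u (gfam (DR b v e) a z)) \<le> C * (norm t)\<^sup>2"
    using tempered_gfam_quadratic[OF u a, of e z] by blast
  show "((\<lambda>z. u (gfam e a z)) has_derivative (\<lambda>v. u (gfam (DR 0 v e) a z))) (at z)"
  proof (rule has_derivative_quadratic[OF lin, of "1/2" _ _ C])
    fix v :: "complex^'n" assume v: "norm v < 1 / 2"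
    show "norm (u (gfam e a (z + v)) - u (gfam e a z) - u (gfam (DR 0 v e) a z)) \<le> C * (norm v)\<^sup>2"
    proof (cases "v = 0")
      case True
      then show ?thesis using mult[of 0 0] by simp
    next
      case False
      define w where "w = of_real (1 / norm v) *s v"
      have w: "norm w = 1" "of_real (norm v) *s w = v" using False by (simp_all add: w_def norm_divide vec_eq_iff)
      show ?thesis using C[of 0 w "of_real (norm v)"] w v a mult[of "of_real (norm v)" w] by simp
    qed
  qed simp
qed

lemma tempered_gfam_entire:
  assumes "u \<in> tempered_distributions" "Re a > 0"
  shows "entire (\<lambda>z. u (gfam e a z))"
  unfolding entire_def using tempered_gfam_has_derivative[OF assms] by blast

lemma tempered_gker_entire:
  assumes "u \<in> tempered_distributions" "Re a > 0"
  shows "entire (\<lambda>z. u (gker a z))"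
  unfolding gker_eq_gfam by (rule tempered_gfam_entire[OF assms])

lemma tempered_gfam_field_derivative:
  fixes e :: "'n::finite pexp"
  assumes u: "u \<in> tempered_distributions" and a: "Re a > 0"
  shows "((\<lambda>a. u (gfam e a z)) has_field_derivative u (gfam (DR 1 0 e) a z)) (at a)"
proof -
  obtain C where C: "\<And>b v t. norm b \<le> Re a / 2 \<Longrightarrow> norm v \<le> 1 \<Longrightarrow> norm t \<le> 1 / 2 \<Longrightarrow>
     norm (u (gfam e (a + t * b) (z + t *s v)) - u (gfam e a z) - t * u (gfam (DR b v e) a z)) \<le> C * (norm t)\<^sup>2"
    using tempered_gfam_quadratic[OF u a, of e z] by blast
  define c where "c = complex_of_real (Re a / 2)"
  have c: "norm c = Re a / 2" "c \<noteq> 0" using a by (auto simp: c_def norm_divide)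
  have DRc: "u (gfam (DR c 0 e) a z) = c * u (gfam (DR 1 0 e) a z)"
  proof -
    have "gfam (DR c 0 e) a z = (\<lambda>y. c * gfam (DR 1 0 e) a z y)"
      using dR_linear(2)[of c 1 0 e a z] by (simp add: fun_eq_iff gfam_def DR_def algebra_simps)
    then show ?thesis using temperedD(2)[OF u gfam_schwartz[OF a]] by simp
  qed
  have "((\<lambda>a. u (gfam e a z)) has_derivative (\<lambda>t. t * u (gfam (DR 1 0 e) a z))) (at a)"
  proof (rule has_derivative_quadratic[where r="norm c / 2" and C="C / (norm c)\<^sup>2"])
    show "linear (\<lambda>t. t * u (gfam (DR 1 0 e) a z))" by (intro linearI) (auto simp: algebra_simps)
    fix t :: complex assume t: "norm t < norm c / 2"
    show "norm (u (gfam e (a + t) z) - u (gfam e a z) - t * u (gfam (DR 1 0 e) a z)) \<le> C / (norm c)\<^sup>2 * (norm t)\<^sup>2"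
    proof -
      have n: "norm (t / c) \<le> 1 / 2" using t c by (simp add: norm_divide pos_divide_le_eq)
      have e: "t / c * c = t" "(t / c) *s 0 = (0 :: complex^'n)" "t / c * (c * d) = t * d" for d using c(2) by auto
      have "norm (u (gfam e (a + t) z) - u (gfam e a z) - t * u (gfam (DR 1 0 e) a z)) \<le> C * (norm (t / c))\<^sup>2"
        using C[of c 0 "t / c", OF _ _ n] c(1) unfolding DRc e by simp
      then show ?thesis by (simp add: norm_divide power_divide)
    qed
  qed (use c in simp)
  moreover have "(\<lambda>t. t * d) = (*) d" for d :: complex by (simp add: fun_eq_iff)
  ultimately show ?thesis by (simp add: has_field_derivative_def)
qed

lemma schwartz_sum:
  assumes "finite I" "\<And>i. i \<in> I \<Longrightarrow> f i \<in> schwartz" and u: "u \<in> tempered_distributions"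
  shows "(\<lambda>y. \<Sum>i\<in>I. f i y) \<in> schwartz \<and> u (\<lambda>y. \<Sum>i\<in>I. f i y) = (\<Sum>i\<in>I. u (f i))"
  using assms(1,2)
proof (induction I)
  case empty
  have S: "gfam (Cst 0) 1 0 \<in> schwartz" by (rule gfam_schwartz) simp
  have "(\<lambda>y. 0 * gfam (Cst 0) 1 0 y) = (\<lambda>y. 0)" by simp
  then show ?case using schwartz_mult[OF S, of 0] temperedD(2)[OF u S, of 0] by simp
next
  case (insert i I)
  then show ?case using schwartz_add[of "f i" "\<lambda>y. \<Sum>i\<in>I. f i y"] temperedD(1)[OF u, of "f i" "\<lambda>y. \<Sum>i\<in>I. f i y"] by auto
qed

text \<open>The polynomial \<open>(- pi y\<^sup>2)\<^sup>k\<close> that the derivatives with respect to \<open>a\<close> bring down.\<close>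

primrec yyk :: "nat \<Rightarrow> 'n::finite pexp" where
  "yyk 0 = Cst 1"
| "yyk (Suc k) = Tms (Tms (Cst (- of_real pi)) PYY) (yyk k)"

lemma ev_dR_yyk: "ev (dR b v (yyk k)) a z y = 0"
  by (induction k) auto

text \<open>Derivatives in \<open>z\<close> bring down factors \<open>pi y\<^sub>j\<close>, so \<open>u\<close> also kills the Gaussians with \<open>a = 1\<close> times powers of
  \<open>y\<^sup>2\<close>. These are the derivatives with respect to \<open>a\<close>, so the holomorphic function \<open>a \<mapsto> u (gker a z)\<close> on the right
  half plane has all derivatives \<open>0\<close> at \<open>1\<close>.\<close>

lemma tempered_vanish_gaussian:
  fixes u :: "'n::finite functional"
  assumes u: "u \<in> tempered_distributions" and zero: "\<And>z. u (gker 1 z) = 0" and a: "Re a > 0"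
  shows "u (gker a z) = 0"
proof -
  have PYmult: "u (gfam (Tms (PY v) e) 1 z) = 0"
    if e: "\<And>b v a z y. ev (dR b v e) a z y = 0" "\<And>z. u (gfam e 1 z) = 0" for e v z
  proof -
    have "((\<lambda>z. u (gfam e 1 z)) has_derivative (\<lambda>v. u (gfam (DR 0 v e) 1 z))) (at z)"
      by (rule tempered_gfam_has_derivative[OF u]) simp
    moreover have "((\<lambda>z. u (gfam e 1 z)) has_derivative (\<lambda>v. 0)) (at z)" using e(2) by simp
    ultimately have "u (gfam (DR 0 v e) 1 z) = 0" using has_derivative_unique fun_cong by metis
    moreover have "gfam (DR 0 v e) 1 z = (\<lambda>y. of_real pi * gfam (Tms (PY v) e) 1 z y)"
      by (simp add: fun_eq_iff gfam_def DR_def e(1))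
    ultimately show ?thesis using temperedD(2)[OF u gfam_schwartz[of 1 "Tms (PY v) e" z], of "of_real pi"] by simp
  qed
  have yy: "u (gfam (yyk k) 1 z) = 0" for k z
  proof (induction k arbitrary: z)
    case 0
    then show ?case using zero by (simp add: gker_eq_gfam)
  next
    case (Suc k)
    let ?e = "\<lambda>j. Tms (PY (axis j 1)) (Tms (PY (axis j 1)) (yyk k)) :: 'n pexp"
    have z1: "u (gfam (Tms (PY v) (yyk k)) 1 z) = 0" for v z by (rule PYmult[OF ev_dR_yyk Suc])
    have z2: "u (gfam (?e j) 1 z) = 0" for j by (rule PYmult[OF _ z1]) (simp add: ev_dR_yyk)
    have "gfam (yyk (Suc k)) 1 z = (\<lambda>y. - of_real pi * (\<Sum>j\<in>UNIV. gfam (?e j) 1 z y))"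
    proof
      fix y :: "real^'n"
      have "dotc (of_real_vec y) (axis j 1) = of_real (y $ j)" for j
        by (simp add: dotc_def of_real_vec_def axis_def if_distrib cong: if_cong)
      then show "gfam (yyk (Suc k)) 1 z y = - of_real pi * (\<Sum>j\<in>UNIV. gfam (?e j) 1 z y)"
        by (simp add: gfam_def inner_vec_def sum_distrib_right sum_distrib_left mult_ac)
    qed
    moreover have S: "(\<lambda>y. \<Sum>j\<in>UNIV. gfam (?e j) 1 z y) \<in> schwartz \<and> u (\<lambda>y. \<Sum>j\<in>UNIV. gfam (?e j) 1 z y) = (\<Sum>j\<in>UNIV. u (gfam (?e j) 1 z))"
      by (rule schwartz_sum[OF _ _ u]) (auto intro: gfam_schwartz)
    ultimately show ?case using temperedD(2)[OF u S[THEN conjunct1], of "- of_real pi"] z2 by simp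
  qed
  define H where "H = {a. Re a > 0}"
  define G where "G k a = u (gfam (yyk k) a z)" for k a
  have Gd: "(G k has_field_derivative G (Suc k) a) (at a)" if "a \<in> H" for k a
  proof -
    have "gfam (DR 1 0 (yyk k)) a z = gfam (yyk (Suc k)) a z"
      by (simp add: fun_eq_iff gfam_def DR_def ev_dR_yyk)
    then show ?thesis unfolding G_def using tempered_gfam_field_derivative[OF u, of a "yyk k" z] that by (simp add: H_def)
  qed
  have H: "open H" "connected H" "1 \<in> H" "a \<in> H"
    unfolding H_def using a by (auto intro: open_halfspace_Re_gt convex_connected convex_halfspace_Re_gt)
  have hd: "(deriv ^^ k) (G 0) a = G k a" if "a \<in> H" for k a
    using that
  proof (induction k arbitrary: a)
    case (Suc k)
    have "\<forall>\<^sub>F x in nhds a. (deriv ^^ k) (G 0) x = G k x"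
      using eventually_nhds_in_open[OF H(1) Suc.prems] by eventually_elim (rule Suc.IH)
    then have "deriv ((deriv ^^ k) (G 0)) a = deriv (G k) a" by (rule deriv_cong_ev) simp
    then show ?case using DERIV_imp_deriv[OF Gd[OF Suc.prems, of k]] by simp
  qed simp
  have "G 0 a = 0"
  proof (rule holomorphic_fun_eq_0_on_connected[OF _ H(1,2) _ H(3,4)])
    show "G 0 holomorphic_on H"
      unfolding holomorphic_on_def field_differentiable_def using Gd has_field_derivative_at_within by blast
    show "(deriv ^^ n) (G 0) 1 = 0" for n using hd[OF H(3)] yy by (simp add: G_def)
  qed
  then show ?thesis by (simp add: G_def gker_eq_gfam)
qed

section \<open>Integration by parts and the creation operators\<close>

text \<open>Integrals of difference quotients vanish by translation invariance, and the quotients are dominated by the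
  decay of the derivative.\<close>

lemma integral_derivative_zero:
  fixes f :: "'a::euclidean_space \<Rightarrow> complex"
  assumes der: "\<And>y. (f has_derivative D y) (at y)" and e: "norm e = 1" and K: "2 * DIM('a) \<le> K"
    and f: "\<And>y. norm (f y) \<le> C / (1 + norm y) ^ K" and D: "\<And>y. norm (D y e) \<le> C / (1 + norm y) ^ K"
  shows "integrable lborel (\<lambda>y. D y e)" "(\<integral>y. D y e \<partial>lborel) = 0"
proof -
  have fc: "continuous_on UNIV f" by (rule continuous_at_imp_continuous_on) (auto intro: has_derivative_continuous[OF der])
  then have [measurable]: "f \<in> borel_measurable borel" by (rule borel_measurable_continuous_onI)
  have dec: "integrable lborel (\<lambda>y::'a. C * (1 / (1 + norm y) ^ K))" by (intro integrable_mult_right integrable_decay K)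
  have C: "C \<ge> 0" using f[of 0] norm_ge_zero[of "f 0"] by (simp del: norm_ge_zero)
  define t where "t k = inverse (real (Suc k))" for k
  have "0 < t k" "t k \<le> 1" for k
    unfolding t_def by (auto simp: field_simps)
  moreover have "t \<longlonglongrightarrow> 0" unfolding t_def by (rule LIMSEQ_inverse_real_of_nat)
  ultimately have t: "0 < t k" "t k \<le> 1" "t \<longlonglongrightarrow> 0" for k by auto
  define q where "q k y = (f (y + t k *\<^sub>R e) - f y) /\<^sub>R t k" for k y
  have [measurable]: "q k \<in> borel_measurable borel" for k unfolding q_def by measurable
  have lim: "(\<lambda>k. q k y) \<longlonglongrightarrow> D y e" for y
  proof -
    have "((\<lambda>s. f (y + s *\<^sub>R e)) has_derivative (\<lambda>s. D y (s *\<^sub>R e))) (at 0)"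
      by (rule has_derivative_compose[of "\<lambda>s. y + s *\<^sub>R e" _ 0 _ f]) (auto intro!: derivative_eq_intros der)
    moreover have "D y (s *\<^sub>R e) = s *\<^sub>R D y e" for s
      by (rule linear_scale[OF has_derivative_linear[OF der]])
    ultimately have "((\<lambda>s. f (y + s *\<^sub>R e)) has_derivative (\<lambda>s. s *\<^sub>R D y e)) (at 0)" by simp
    then have 1: "((\<lambda>s. norm (f (y + (0 + s) *\<^sub>R e) - f (y + 0 *\<^sub>R e) - s *\<^sub>R D y e) / norm s) \<longlongrightarrow> 0) (at 0)"
      unfolding has_derivative_at by (rule conjunct2)
    have 2: "norm ((f (y + s *\<^sub>R e) - f y) /\<^sub>R s - D y e) = norm (f (y + (0 + s) *\<^sub>R e) - f (y + 0 *\<^sub>R e) - s *\<^sub>R D y e) / norm s" if "s \<noteq> 0" for s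
    proof -
      have "(f (y + s *\<^sub>R e) - f y) /\<^sub>R s - D y e = (f (y + s *\<^sub>R e) - f y - s *\<^sub>R D y e) /\<^sub>R s"
        unfolding scaleR_diff_right using that by simp
      then show ?thesis by (simp only: norm_scaleR abs_inverse add_0 scaleR_zero_left add_0_right divide_inverse real_norm_def mult.commute)
    qed
    have "((\<lambda>s. norm ((f (y + s *\<^sub>R e) - f y) /\<^sub>R s - D y e)) \<longlongrightarrow> 0) (at 0)"
    proof (rule Lim_transform_eventually[OF 1])
      show "\<forall>\<^sub>F s in at 0. norm (f (y + (0 + s) *\<^sub>R e) - f (y + 0 *\<^sub>R e) - s *\<^sub>R D y e) / norm s = norm ((f (y + s *\<^sub>R e) - f y) /\<^sub>R s - D y e)"
        by (rule eventually_mono[OF eventually_neq_at_within 2[symmetric]])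
    qed
    then have "((\<lambda>s. (f (y + s *\<^sub>R e) - f y) /\<^sub>R s) \<longlongrightarrow> D y e) (at 0)"
      by (rule LIM_zero_cancel[OF tendsto_norm_zero_cancel])
    moreover have "filterlim t (at 0) sequentially"
      using t(1,3) by (auto simp: filterlim_at intro!: always_eventually less_imp_neq[THEN not_sym])
    ultimately show ?thesis unfolding q_def by (rule filterlim_compose)
  qed
  have Dm [measurable]: "(\<lambda>y. D y e) \<in> borel_measurable borel"
    by (rule borel_measurable_LIMSEQ_metric[OF _ lim]) measurable
  show "integrable lborel (\<lambda>y. D y e)"
    by (rule Bochner_Integration.integrable_bound[OF dec]) (use D C in \<open>auto intro!: AE_I2\<close>)
  have fi: "integrable lborel f"
    by (rule Bochner_Integration.integrable_bound[OF dec]) (use f C in \<open>auto intro!: AE_I2\<close>)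
  have q0: "(\<integral>y. q k y \<partial>lborel) = 0" for k
    unfolding q_def using fi integral_lborel_translate[of f "t k *\<^sub>R e"] by simp
  have qb: "norm (q k y) \<le> 2 ^ K * (C * (1 / (1 + norm y) ^ K))" for k y
  proof -
    define \<phi> where "\<phi> s = f (y + s *\<^sub>R e)" for s
    have d\<phi>: "(\<phi> has_derivative (\<lambda>s. s *\<^sub>R D (y + x *\<^sub>R e) e)) (at x within {0..t k})" for x
    proof -
      have "(\<phi> has_derivative (\<lambda>s. D (y + x *\<^sub>R e) (s *\<^sub>R e))) (at x)"
        unfolding \<phi>_def by (rule has_derivative_compose[of "\<lambda>s. y + s *\<^sub>R e" _ x _ f]) (auto intro!: derivative_eq_intros der)
      moreover have "D (y + x *\<^sub>R e) (s *\<^sub>R e) = s *\<^sub>R D (y + x *\<^sub>R e) e" for s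
        by (rule linear_scale[OF has_derivative_linear[OF der]])
      ultimately show ?thesis by (simp add: has_derivative_at_withinI)
    qed
    have "norm (\<phi> (t k) - \<phi> 0) \<le> (2 ^ K * (C * (1 / (1 + norm y) ^ K))) * norm (t k - 0)"
    proof (rule differentiable_bound[OF _ d\<phi>])
      fix x assume x: "x \<in> {0..t k}"
      have "norm y \<le> norm (y + x *\<^sub>R e) + norm (x *\<^sub>R e)" using norm_triangle_ineq4[of "y + x *\<^sub>R e" "x *\<^sub>R e"] by simp
      moreover have "norm (x *\<^sub>R e) \<le> 1" using x e t(2)[of k] by simp
      moreover have "a \<le> A + B \<Longrightarrow> B \<le> 1 \<Longrightarrow> 0 \<le> A \<Longrightarrow> 1 + a \<le> 2 * (1 + A)" for a A B :: real by simp
      ultimately have "1 + norm y \<le> 2 * (1 + norm (y + x *\<^sub>R e))" using norm_ge_zero by blast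
      then have "(1 + norm y) ^ K \<le> 2 ^ K * (1 + norm (y + x *\<^sub>R e)) ^ K"
        unfolding power_mult_distrib[symmetric] by (intro power_mono) auto
      moreover have "(1 + norm y) ^ K > 0" "(1 + norm (y + x *\<^sub>R e)) ^ K > 0" by (auto simp: add_pos_nonneg)
      ultimately have "1 / (1 + norm (y + x *\<^sub>R e)) ^ K \<le> 2 ^ K * (1 / (1 + norm y) ^ K)"
        by (simp add: divide_simps mult.commute)
      then have "C * (1 / (1 + norm (y + x *\<^sub>R e)) ^ K) \<le> C * (2 ^ K * (1 / (1 + norm y) ^ K))" by (intro mult_left_mono C)
      then have bnd: "norm (D (y + x *\<^sub>R e) e) \<le> 2 ^ K * (C * (1 / (1 + norm y) ^ K))"
        using D[of "y + x *\<^sub>R e"] by (simp add: mult_ac)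
      show "onorm (\<lambda>s. s *\<^sub>R D (y + x *\<^sub>R e) e) \<le> 2 ^ K * (C * (1 / (1 + norm y) ^ K))"
      proof (rule onorm_le)
        fix s :: real
        show "norm (s *\<^sub>R D (y + x *\<^sub>R e) e) \<le> 2 ^ K * (C * (1 / (1 + norm y) ^ K)) * norm s"
          using mult_right_mono[OF bnd, of "norm s"] by (simp only: norm_scaleR real_norm_def mult.commute abs_ge_zero simp_thms)
      qed
    qed (use t(1)[of k] in auto)
    then show ?thesis using t(1)[of k] by (simp add: \<phi>_def q_def divide_inverse_commute[symmetric] pos_divide_le_eq)
  qed
  have "(\<lambda>k. \<integral>y. q k y \<partial>lborel) \<longlonglongrightarrow> (\<integral>y. D y e \<partial>lborel)"
  proof (rule integral_dominated_convergence[where w="\<lambda>y. 2 ^ K * (C * (1 / (1 + norm y) ^ K))"])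
    show "integrable lborel (\<lambda>y::'a. 2 ^ K * (C * (1 / (1 + norm y) ^ K)))" by (rule integrable_mult_right[OF dec])
    show "AE y in lborel. (\<lambda>k. q k y) \<longlonglongrightarrow> D y e" using lim by simp
    show "AE y in lborel. norm (q k y) \<le> 2 ^ K * (C * (1 / (1 + norm y) ^ K))" for k by (rule AE_I2) (rule qb)
  qed simp_all
  then show "(\<integral>y. D y e \<partial>lborel) = 0" unfolding q0 by (rule LIMSEQ_unique[OF _ tendsto_const])
qed

lemma schwartz_differentiable: "g \<in> schwartz \<Longrightarrow> (g has_derivative frechet_derivative g (at y)) (at y)"
  using smooth_partials[OF schwartz_smooth, of g "[]" y] by (simp add: frechet_derivative_works)

lemma schwartz_decay:
  assumes "g \<in> schwartz" shows "norm (partials js g y) \<le> schwartz_seminorm m js g / (1 + norm y) ^ m"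
proof -
  have "(1 + norm y) ^ m > 0" by (simp add: add_pos_nonneg)
  then show ?thesis using schwartz_seminorm_upper[OF assms, of y m js] by (simp add: pos_le_divide_eq mult.commute)
qed

lemma integration_by_parts:
  fixes g h :: "real^'n::finite \<Rightarrow> complex"
  assumes g: "g \<in> schwartz" and h: "h \<in> schwartz"
  shows "integrable lborel (\<lambda>y. partial j g y * h y + g y * partial j h y)"
    "(\<integral>y. partial j g y * h y + g y * partial j h y \<partial>lborel) = 0"
proof -
  define K where "K = 2 * DIM(real^'n)"
  define D where "D y v = g y * frechet_derivative h (at y) v + frechet_derivative g (at y) v * h y" for y v
  have D: "((\<lambda>y. g y * h y) has_derivative D y) (at y)" for y
    unfolding D_def by (rule has_derivative_mult[OF schwartz_differentiable[OF g] schwartz_differentiable[OF h]])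
  have De: "D y (axis j 1) = partial j g y * h y + g y * partial j h y" for y
    by (simp add: D_def partial_def)
  define S where "S f = schwartz_seminorm 0 [] f + schwartz_seminorm 0 [j] f + schwartz_seminorm K [] f + schwartz_seminorm K [j] f" for f :: "real^'n \<Rightarrow> complex"
  have b: "norm (f y) \<le> S f" "norm (partial j f y) \<le> S f" "norm (f y) \<le> S f / (1 + norm y) ^ K" "norm (partial j f y) \<le> S f / (1 + norm y) ^ K"
    if f: "f \<in> schwartz" for f and y :: "real^'n"
  proof -
    note nn = schwartz_seminorm_nonneg[OF f, of 0 "[]"] schwartz_seminorm_nonneg[OF f, of 0 "[j]"] schwartz_seminorm_nonneg[OF f, of K "[]"] schwartz_seminorm_nonneg[OF f, of K "[j]"]
    show "norm (f y) \<le> S f" "norm (partial j f y) \<le> S f"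
      using schwartz_decay[OF f, of "[]" y 0] schwartz_decay[OF f, of "[j]" y 0] nn unfolding S_def by auto
    have "schwartz_seminorm K [] f \<le> S f" "schwartz_seminorm K [j] f \<le> S f" using nn unfolding S_def by auto
    then have "schwartz_seminorm K [] f / (1 + norm y) ^ K \<le> S f / (1 + norm y) ^ K" "schwartz_seminorm K [j] f / (1 + norm y) ^ K \<le> S f / (1 + norm y) ^ K"
      by (auto intro!: divide_right_mono)
    then show "norm (f y) \<le> S f / (1 + norm y) ^ K" "norm (partial j f y) \<le> S f / (1 + norm y) ^ K"
      using schwartz_decay[OF f, of "[]" y K] schwartz_decay[OF f, of "[j]" y K] by auto
  qed
  have S0: "S f \<ge> 0" if "f \<in> schwartz" for f using b(1)[OF that, of 0] norm_ge_zero[of "f 0"] by linarith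
  have 1: "norm (g y * h y) \<le> (2 * S g * S h) / (1 + norm y) ^ K" for y
  proof -
    have "norm (g y * h y) \<le> S g * (S h / (1 + norm y) ^ K)"
      unfolding norm_mult using b(1)[OF g] b(3)[OF h] S0[OF g] by (intro mult_mono) auto
    also have "\<dots> \<le> (2 * S g * S h) / (1 + norm y) ^ K"
      using S0[OF g] S0[OF h] by (simp add: divide_right_mono)
    finally show ?thesis .
  qed
  have 2: "norm (D y (axis j 1)) \<le> (2 * S g * S h) / (1 + norm y) ^ K" for y
  proof -
    have "norm (partial j g y * h y + g y * partial j h y) \<le> norm (partial j g y * h y) + norm (g y * partial j h y)"
      by (rule norm_triangle_ineq)
    also have "\<dots> \<le> S g * (S h / (1 + norm y) ^ K) + S g * (S h / (1 + norm y) ^ K)"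
      unfolding norm_mult using b[OF g] b[OF h] S0[OF g] by (intro add_mono mult_mono) auto
    also have "\<dots> = (2 * S g * S h) / (1 + norm y) ^ K" by simp
    finally show ?thesis unfolding De .
  qed
  have e: "norm (axis j (1::real) :: real^'n) = 1" by simp
  from integral_derivative_zero[OF D e _ 1 2]
  show "integrable lborel (\<lambda>y. partial j g y * h y + g y * partial j h y)"
    "(\<integral>y. partial j g y * h y + g y * partial j h y \<partial>lborel) = 0"
    unfolding De by (auto simp: K_def)
qed

text \<open>Continuity on the Schwartz space, in terms of the norms in which tempered distributions are bounded.\<close>

definition tame :: "((real^'n::finite \<Rightarrow> complex) \<Rightarrow> real^'n \<Rightarrow> complex) \<Rightarrow> bool" where
  "tame T \<longleftrightarrow> (\<forall>g\<in>schwartz. T g \<in> schwartz) \<and> (\<forall>M. \<exists>C\<ge>0. \<exists>N. \<forall>g\<in>schwartz. schwartz_norm M (T g) \<le> C * schwartz_norm N g)"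

lemma tameI:
  fixes T :: "(real^'n::finite \<Rightarrow> complex) \<Rightarrow> real^'n \<Rightarrow> complex"
  assumes sm: "\<And>g. g \<in> schwartz \<Longrightarrow> smooth (T g)"
    and b: "\<And>m js. \<exists>C\<ge>0. \<exists>N. \<forall>g\<in>schwartz. \<forall>x. (1 + norm x) ^ m * norm (partials js (T g) x) \<le> C * schwartz_norm N g"
  shows "tame T"
  unfolding tame_def
proof (intro conjI ballI allI)
  fix g :: "real^'n \<Rightarrow> complex" assume g: "g \<in> schwartz"
  show "T g \<in> schwartz"
  proof (rule schwartzI[OF sm[OF g]])
    fix m js show "\<exists>M. \<forall>x. (1 + norm x) ^ m * norm (partials js (T g) x) \<le> M" using b[of m js] g by blast
  qed
next
  fix M
  have "\<exists>C N. \<forall>js::'n list. C js \<ge> 0 \<and> (\<forall>g\<in>schwartz. \<forall>x. (1 + norm x) ^ M * norm (partials js (T g) x) \<le> C js * schwartz_norm (N js) g)"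
    using b[of M] by metis
  then obtain C N where CN: "\<And>js::'n list. C js \<ge> 0" "\<And>js g x. g \<in> schwartz \<Longrightarrow> (1 + norm x) ^ M * norm (partials js (T g) x) \<le> C js * schwartz_norm (N js) g" by blast
  define L where "L = Max (N ` {js::'n list. length js \<le> M})"
  have L: "N js \<le> L" if "length js \<le> M" for js unfolding L_def using that finite_js by (intro Max_ge) auto
  have "schwartz_norm M (T g) \<le> (\<Sum>js::'n list | length js \<le> M. C js) * schwartz_norm L g" if g: "g \<in> schwartz" for g
  proof -
    have "schwartz_norm M (T g) \<le> (\<Sum>js::'n list | length js \<le> M. C js * schwartz_norm L g)"
      unfolding schwartz_norm_def[of M]
    proof (rule sum_mono, rule schwartz_seminorm_least)
      fix js :: "'n list" and x assume "js \<in> {js. length js \<le> M}"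
      then have "C js * schwartz_norm (N js) g \<le> C js * schwartz_norm L g"
        by (intro mult_left_mono schwartz_norm_mono g L CN) auto
      then show "(1 + norm x) ^ M * norm (partials js (T g) x) \<le> C js * schwartz_norm L g"
        using CN(2)[OF g, of x js] by linarith
    qed
    then show ?thesis by (simp add: sum_distrib_right)
  qed
  then show "\<exists>C\<ge>0. \<exists>N. \<forall>g\<in>schwartz. schwartz_norm M (T g) \<le> C * schwartz_norm N g"
    using CN(1) by (intro exI[of _ "\<Sum>js::'n list | length js \<le> M. C js"] exI[of _ L] conjI) (auto intro: sum_nonneg)
qed

lemma tame_compose: assumes "tame S" "tame T" shows "tame (\<lambda>g. S (T g))"
  unfolding tame_def
proof (intro conjI ballI allI)
  fix g :: "real^'a \<Rightarrow> complex" assume "g \<in> schwartz"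
  then show "S (T g) \<in> schwartz" using assms by (simp add: tame_def)
next
  fix M
  obtain C N where CN: "C \<ge> 0" "\<And>g. g \<in> schwartz \<Longrightarrow> schwartz_norm M (S g) \<le> C * schwartz_norm N g"
    using assms(1) unfolding tame_def by blast
  obtain D K where DK: "D \<ge> 0" "\<And>g. g \<in> schwartz \<Longrightarrow> schwartz_norm N (T g) \<le> D * schwartz_norm K g"
    using assms(2) unfolding tame_def by blast
  have "schwartz_norm M (S (T g)) \<le> (C * D) * schwartz_norm K g" if g: "g \<in> schwartz" for g
  proof -
    have "T g \<in> schwartz" using assms(2) g by (simp add: tame_def)
    then have "schwartz_norm M (S (T g)) \<le> C * schwartz_norm N (T g)" by (rule CN)
    also have "\<dots> \<le> C * (D * schwartz_norm K g)" using CN(1) DK(2)[OF g] by (intro mult_left_mono)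
    finally show ?thesis by simp
  qed
  then show "\<exists>C\<ge>0. \<exists>N. \<forall>g\<in>schwartz. schwartz_norm M (S (T g)) \<le> C * schwartz_norm N g"
    using CN(1) DK(1) by (intro exI[of _ "C * D"] exI[of _ K] conjI) auto
qed

lemma tame_id: "tame (\<lambda>g. g)"
  unfolding tame_def by (intro conjI ballI allI, assumption, rule exI[of _ 1], simp, rule exI, rule ballI, rule order_refl)

lemma tame_partial: "tame (partial j)"
proof (rule tameI)
  fix g :: "real^'a \<Rightarrow> complex" assume "g \<in> schwartz"
  then show "smooth (partial j g)"
    using smooth_partials[OF schwartz_smooth, of g "_ @ [j]"] unfolding smooth_def by (simp add: partials_append)
next
  fix m and js :: "'a list"
  have "(1 + norm x) ^ m * norm (partials js (partial j g) x) \<le> 1 * schwartz_norm (max m (Suc (length js))) g" if "g \<in> schwartz" for g x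
    using order_trans[OF schwartz_seminorm_upper[OF that, of x m "js @ [j]"] schwartz_seminorm_le_norm[OF that, of m "max m (Suc (length js))" "js @ [j]"]]
    by (simp add: partials_append)
  then show "\<exists>C\<ge>0. \<exists>N. \<forall>g\<in>schwartz. \<forall>x. (1 + norm x) ^ m * norm (partials js (partial j g) x) \<le> C * schwartz_norm N g"
    by (intro exI[of _ 1] conjI exI[of _ "max m (Suc (length js))"]) auto
qed

lemma partials_coord_mult:
  fixes j :: "'n::finite"
  shows "\<exists>L. (\<forall>ks\<in>set L. length ks \<le> length js) \<and> (\<forall>g. smooth g \<longrightarrow>
     partials js (\<lambda>y. of_real (y $ j) * g y) = (\<lambda>y. of_real (y $ j) * partials js g y + (\<Sum>ks\<leftarrow>L. partials ks g y)))"
proof (induction js)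
  case Nil
  show ?case by (intro exI[of _ "[]"]) auto
next
  case (Cons i js)
  then obtain L where L: "\<And>ks. ks \<in> set L \<Longrightarrow> length ks \<le> length js" "\<And>g. smooth g \<Longrightarrow>
     partials js (\<lambda>y. of_real (y $ j) * g y) = (\<lambda>y. of_real (y $ j) * partials js g y + (\<Sum>ks\<leftarrow>L. partials ks g y))" by blast
  define L' where "L' = (if i = j then [js] else []) @ map ((#) i) L"
  show ?case
  proof (intro exI[of _ L'] conjI ballI allI impI)
    fix ks assume "ks \<in> set L'" then show "length ks \<le> length (i # js)" using L(1) by (auto simp: L'_def split: if_splits)
  next
    fix g :: "real^'n \<Rightarrow> complex" assume g: "smooth g"
    have P: "(partials ks g has_derivative frechet_derivative (partials ks g) (at y)) (at y)" for ks y
      using smooth_partials[OF g] frechet_derivative_works by blast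
    have c: "((\<lambda>y::real^'n. complex_of_real (y $ j)) has_derivative (\<lambda>h. of_real (h $ j))) (at y)" for y
      by (intro bounded_linear_imp_has_derivative bounded_linear_compose[OF bounded_linear_of_real bounded_linear_vec_nth])
    have s: "((\<lambda>y. \<Sum>ks\<leftarrow>M. partials ks g y) has_derivative (\<lambda>h. \<Sum>ks\<leftarrow>M. frechet_derivative (partials ks g) (at y) h)) (at y)" for M y
      by (induction M) (auto intro!: has_derivative_add P)
    have ax: "(axis i 1 :: real^'n) $ j = (if i = j then 1 else 0)" by (simp add: axis_def)
    have "partial i (\<lambda>y. of_real (y $ j) * partials js g y + (\<Sum>ks\<leftarrow>L. partials ks g y)) y =
        of_real (y $ j) * partials (i # js) g y + (\<Sum>ks\<leftarrow>L'. partials ks g y)" for y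
      using partial_eq[OF has_derivative_add[OF has_derivative_mult[OF c P] s], of i js L y]
      by (auto simp: L'_def partial_def[symmetric] comp_def ax)
    then show "partials (i # js) (\<lambda>y. of_real (y $ j) * g y) = (\<lambda>y. of_real (y $ j) * partials (i # js) g y + (\<Sum>ks\<leftarrow>L'. partials ks g y))"
      by (simp add: L(2)[OF g] fun_eq_iff)
  qed
qed

lemma smooth_coord_mult: assumes "smooth g" shows "smooth (\<lambda>y. of_real (y $ j) * g y)"
  unfolding smooth_def
proof (intro allI)
  fix js x
  obtain L where L: "partials js (\<lambda>y. of_real (y $ j) * g y) = (\<lambda>y. of_real (y $ j) * partials js g y + (\<Sum>ks\<leftarrow>L. partials ks g y))"
    using partials_coord_mult[of js j] assms by blast
  have "((\<lambda>y::real^'a. complex_of_real (y $ j)) has_derivative (\<lambda>h. of_real (h $ j))) (at x)"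
    by (intro bounded_linear_imp_has_derivative bounded_linear_compose[OF bounded_linear_of_real bounded_linear_vec_nth])
  then have c: "(\<lambda>y::real^'a. complex_of_real (y $ j)) differentiable (at x)"
    unfolding differentiable_def by blast
  have "(\<lambda>y. \<Sum>ks\<leftarrow>M. partials ks g y) differentiable (at x)" for M
    by (induction M) (auto intro!: differentiable_add smooth_partials assms)
  then show "partials js (\<lambda>y. of_real (y $ j) * g y) differentiable (at x)"
    unfolding L by (intro differentiable_add differentiable_mult c smooth_partials assms)
qed

lemma tame_coord_mult: "tame (\<lambda>g y. of_real (y $ j) * g y)"
proof (rule tameI)
  fix m and js :: "'a list"
  obtain L where L: "\<And>ks. ks \<in> set L \<Longrightarrow> length ks \<le> length js" "\<And>g. smooth g \<Longrightarrow>
     partials js (\<lambda>y. of_real (y $ j) * g y) = (\<lambda>y. of_real (y $ j) * partials js g y + (\<Sum>ks\<leftarrow>L. partials ks g y))"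
    using partials_coord_mult[of js j] by blast
  define N where "N = max (Suc m) (length js)"
  have "(1 + norm x) ^ m * norm (partials js (\<lambda>y. of_real (y $ j) * g y) x) \<le> (1 + real (length L)) * schwartz_norm N g" if g: "g \<in> schwartz" for g x
  proof -
    have 1: "(1 + norm x) ^ m * norm (of_real (x $ j) * partials js g x) \<le> schwartz_norm N g"
    proof -
      have "norm (of_real (x $ j) * partials js g x) \<le> (1 + norm x) * norm (partials js g x)"
        unfolding norm_mult using component_le_norm_cart[of x j] by (intro mult_right_mono) auto
      then have "(1 + norm x) ^ m * norm (of_real (x $ j) * partials js g x) \<le> (1 + norm x) ^ m * ((1 + norm x) * norm (partials js g x))"
        by (intro mult_left_mono) auto
      also have "\<dots> = (1 + norm x) ^ Suc m * norm (partials js g x)" by simp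
      also have "\<dots> \<le> schwartz_norm N g"
        by (rule order_trans[OF schwartz_seminorm_upper[OF g] schwartz_seminorm_le_norm[OF g]]) (auto simp: N_def)
      finally show ?thesis .
    qed
    have 2: "(1 + norm x) ^ m * norm (\<Sum>ks\<leftarrow>L. partials ks g x) \<le> real (length L) * schwartz_norm N g"
      using L(1)
    proof (induction L)
      case (Cons ks L)
      have "(1 + norm x) ^ m * norm (partials ks g x) \<le> schwartz_norm N g"
        using Cons.prems by (intro order_trans[OF schwartz_seminorm_upper[OF g] schwartz_seminorm_le_norm[OF g]]) (force simp: N_def)+
      moreover have "(1 + norm x) ^ m * norm (\<Sum>ks\<leftarrow>L. partials ks g x) \<le> real (length L) * schwartz_norm N g"
        using Cons by auto
      moreover have "(1 + norm x) ^ m * norm (\<Sum>ks\<leftarrow>ks # L. partials ks g x) \<le> (1 + norm x) ^ m * norm (partials ks g x) + (1 + norm x) ^ m * norm (\<Sum>ks\<leftarrow>L. partials ks g x)"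
        unfolding distrib_left[symmetric] by (intro mult_left_mono) (auto intro: norm_triangle_ineq)
      ultimately show ?case by (simp add: algebra_simps)
    qed simp
    have "(1 + norm x) ^ m * norm (partials js (\<lambda>y. of_real (y $ j) * g y) x) \<le> (1 + norm x) ^ m * norm (of_real (x $ j) * partials js g x) + (1 + norm x) ^ m * norm (\<Sum>ks\<leftarrow>L. partials ks g x)"
      unfolding L(2)[OF schwartz_smooth[OF g]] distrib_left[symmetric] by (intro mult_left_mono norm_triangle_ineq) auto
    with 1 2 show ?thesis by (simp add: algebra_simps)
  qed
  then show "\<exists>C\<ge>0. \<exists>N. \<forall>g\<in>schwartz. \<forall>x. (1 + norm x) ^ m * norm (partials js (\<lambda>y. of_real (y $ j) * g y) x) \<le> C * schwartz_norm N g"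
    by (intro exI[of _ "1 + real (length L)"] conjI exI[of _ N]) auto
qed (rule smooth_coord_mult[OF schwartz_smooth])

text \<open>The operator that the Bargmann transform turns into multiplication by \<open>z\<^sub>j\<close>.\<close>

definition creation :: "'n::finite \<Rightarrow> (real^'n \<Rightarrow> complex) \<Rightarrow> real^'n \<Rightarrow> complex" where
  "creation j g y = of_real (y $ j) * g y + (- 1 / (2 * of_real pi)) * partial j g y"

lemma tame_lincomb:
  assumes S: "tame S" and T: "tame T" shows "tame (\<lambda>g y. S g y + c * T g y)"
proof (rule tameI)
  fix g :: "real^'a \<Rightarrow> complex" assume g: "g \<in> schwartz"
  then show "smooth (\<lambda>y. S g y + c * T g y)"
    using S T by (intro smooth_add smooth_mult schwartz_smooth) (auto simp: tame_def)
next
  fix m and js :: "'a list"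
  define M where "M = max m (length js)"
  obtain C N where CN: "C \<ge> 0" "\<And>g. g \<in> schwartz \<Longrightarrow> schwartz_norm M (S g) \<le> C * schwartz_norm N g"
    using S unfolding tame_def by blast
  obtain D K where DK: "D \<ge> 0" "\<And>g. g \<in> schwartz \<Longrightarrow> schwartz_norm M (T g) \<le> D * schwartz_norm K g"
    using T unfolding tame_def by blast
  have "(1 + norm x) ^ m * norm (partials js (\<lambda>y. S g y + c * T g y) x) \<le> (C + norm c * D) * schwartz_norm (max N K) g" if g: "g \<in> schwartz" for g x
  proof -
    have s: "S g \<in> schwartz" "T g \<in> schwartz" using S T g by (auto simp: tame_def)
    note sm = s[THEN schwartz_smooth]
    have up: "(1 + norm x) ^ m * norm (partials js f x) \<le> schwartz_norm M f" if "f \<in> schwartz" for f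
      by (rule order_trans[OF schwartz_seminorm_upper[OF that] schwartz_seminorm_le_norm[OF that]]) (auto simp: M_def)
    have "(1 + norm x) ^ m * norm (partials js (\<lambda>y. S g y + c * T g y) x) \<le> (1 + norm x) ^ m * (norm (partials js (S g) x) + norm c * norm (partials js (T g) x))"
      unfolding partials_add[OF sm(1) smooth_mult[OF sm(2)]] partials_mult[OF sm(2)] norm_mult[symmetric]
      by (intro mult_left_mono norm_triangle_ineq) auto
    also have "\<dots> = (1 + norm x) ^ m * norm (partials js (S g) x) + norm c * ((1 + norm x) ^ m * norm (partials js (T g) x))"
      by (simp only: distrib_left mult.left_commute)
    also have "\<dots> \<le> schwartz_norm M (S g) + norm c * schwartz_norm M (T g)"
      by (intro add_mono mult_left_mono up s) auto
    also have "\<dots> \<le> C * schwartz_norm N g + norm c * (D * schwartz_norm K g)"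
      by (intro add_mono mult_left_mono CN DK g) auto
    also have "\<dots> \<le> C * schwartz_norm (max N K) g + norm c * (D * schwartz_norm (max N K) g)"
      using CN DK by (intro add_mono mult_left_mono schwartz_norm_mono g) auto
    finally show ?thesis by (simp add: algebra_simps)
  qed
  then show "\<exists>C\<ge>0. \<exists>N. \<forall>g\<in>schwartz. \<forall>x. (1 + norm x) ^ m * norm (partials js (\<lambda>y. S g y + c * T g y) x) \<le> C * schwartz_norm N g"
    using CN(1) DK(1) by (intro exI[of _ "C + norm c * D"] conjI exI[of _ "max N K"]) auto
qed

lemma tame_creation: "tame (creation j)"
  using tame_lincomb[OF tame_coord_mult tame_partial, of j "- 1 / (2 * of_real pi)" j]
  unfolding creation_def[abs_def] by simp

lemma tame_creation_pow: "tame (creation j ^^ k)"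
proof (induction k)
  case 0
  show ?case using tame_id by (simp add: id_def)
next
  case (Suc k)
  show ?case using tame_compose[OF tame_creation Suc] by (simp add: comp_def)
qed

section \<open>The Bargmann transform\<close>

text \<open>The kernel of the Bargmann transform, normalised so that the transform is isometric from \<open>L\<^sup>2\<close>.\<close>

definition kf :: "complex^'n::finite \<Rightarrow> real^'n \<Rightarrow> complex" where
  "kf z y = of_real (2 powr (real CARD('n) / 4)) * exp (- of_real pi / 2 * dotc z z) * gker 1 (2 *s z) y"

definition bargmann :: "'n::finite functional \<Rightarrow> complex^'n \<Rightarrow> complex" where
  "bargmann u z = u (kf z)"

text \<open>The Bargmann transform of a function. It applies to bounded functions as well as to Schwartz functions,
  and agrees with \<open>bargmann\<close> of the associated distribution.\<close>

definition fbarg :: "(real^'n::finite \<Rightarrow> complex) \<Rightarrow> complex^'n \<Rightarrow> complex" where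
  "fbarg g z = (\<integral>y. g y * kf z y \<partial>lborel)"

lemma norm_kf: 
  "norm (kf z y) = 2 powr (real CARD('n) / 4) * exp (- pi * (norm (y - re_vec (z::complex^'n::finite)))\<^sup>2) * exp (pi / 2 * (norm z)\<^sup>2)"
proof -
  let ?x = "re_vec z" and ?t = "im_vec z"
  have 1: "Re (- of_real pi / 2 * dotc z z) = - pi / 2 * (?x \<bullet> ?x - ?t \<bullet> ?t)" by (simp add: Re_dotc)
  have "norm (kf z y) = 2 powr (real CARD('n) / 4) * exp (- pi / 2 * (?x \<bullet> ?x - ?t \<bullet> ?t)) * exp (- pi * (norm y)\<^sup>2 + pi * (y \<bullet> (2 *\<^sub>R ?x)))"
    unfolding kf_def norm_mult norm_gker norm_exp_eq_Re 1 by simp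
  also have "\<dots> = 2 powr (real CARD('n) / 4) * (exp (- pi / 2 * (?x \<bullet> ?x - ?t \<bullet> ?t) + (- pi * (norm y)\<^sup>2 + pi * (y \<bullet> (2 *\<^sub>R ?x)))))"
    by (simp only: mult.assoc mult_exp_exp)
  also have "- pi / 2 * (?x \<bullet> ?x - ?t \<bullet> ?t) + (- pi * (norm y)\<^sup>2 + pi * (y \<bullet> (2 *\<^sub>R ?x))) = - pi * (norm (y - ?x))\<^sup>2 + pi / 2 * (norm z)\<^sup>2"
    unfolding norm_sq_re_im[of z] power2_norm_eq_inner[of y] power2_norm_eq_inner[of "y - ?x"] by (simp add: inner_diff_left inner_diff_right inner_commute[of ?x y] algebra_simps)
  finally show ?thesis by (simp only: exp_add mult.assoc)
qed

lemma continuous_kf [continuous_intros]: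
  "continuous_on S f \<Longrightarrow> continuous_on S g \<Longrightarrow> continuous_on S (\<lambda>x. kf (f x) (g x))"
  unfolding kf_def by (intro continuous_intros)

lemma measurable_kf [measurable (raw)]:
  assumes [measurable]: "f \<in> borel_measurable M" "g \<in> borel_measurable M"
  shows "(\<lambda>x. kf (f x) (g x)) \<in> borel_measurable M"
  unfolding kf_def by measurable

lemma kf_schwartz: "kf z \<in> schwartz"
  unfolding kf_def[abs_def] by (rule schwartz_mult) (rule gker_schwartz, simp)

lemma entire_kf: "entire (\<lambda>z. kf z y)"
  unfolding kf_def by (intro entire_mult entire_const entire_exp entire_dotc entire_smult[OF entire_gker])

lemma nn_gauss_center:
  "(\<integral>\<^sup>+y. ennreal (exp (- pi * (norm (y - x :: 'a::euclidean_space))\<^sup>2)) \<partial>lborel) = 1"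
  using nn_integral_lborel_translate[of "\<lambda>y::'a. ennreal (exp (- pi * (norm y)\<^sup>2))" "- x"] nn_gauss[of 1, where 'a='a] by simp

lemma nn_integral_kf:
  "(\<integral>\<^sup>+y. ennreal (norm (kf z y)) \<partial>lborel) = ennreal (2 powr (real CARD('n) / 4) * exp (pi / 2 * (norm (z::complex^'n::finite))\<^sup>2))"
proof -
  have "ennreal (norm (kf z y)) = ennreal (2 powr (real CARD('n) / 4) * exp (pi / 2 * (norm z)\<^sup>2)) * ennreal (exp (- pi * (norm (y - re_vec z))\<^sup>2))" for y
    unfolding norm_kf by (subst ennreal_mult[symmetric]) (auto simp: mult_ac)
  then have "(\<integral>\<^sup>+y. ennreal (norm (kf z y)) \<partial>lborel) = (\<integral>\<^sup>+y. ennreal (2 powr (real CARD('n) / 4) * exp (pi / 2 * (norm z)\<^sup>2)) * ennreal (exp (- pi * (norm (y - re_vec z))\<^sup>2)) \<partial>lborel)"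
    by (simp only:)
  also have "\<dots> = ennreal (2 powr (real CARD('n) / 4) * exp (pi / 2 * (norm z)\<^sup>2)) * (\<integral>\<^sup>+y. ennreal (exp (- pi * (norm (y - re_vec z))\<^sup>2)) \<partial>lborel)"
    by (rule nn_integral_cmult) measurable
  finally show ?thesis by (simp only: nn_gauss_center mult_1_right)
qed

lemma kf_integrable: "integrable lborel (\<lambda>y. kf z y)"
  by (rule integrableI_bounded) (simp_all add: nn_integral_kf)

lemma integral_norm_kf: "(\<integral>y. norm (kf z y) \<partial>lborel) = 2 powr (real CARD('n) / 4) * exp (pi / 2 * (norm (z::complex^'n::finite))\<^sup>2)"
  by (subst integral_eq_nn_integral) (simp_all add: nn_integral_kf)

lemma fbarg_integrable:
  fixes g :: "real^'n::finite \<Rightarrow> complex"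
  assumes [measurable]: "g \<in> borel_measurable borel" and B: "\<And>y. norm (g y) \<le> B"
  shows "integrable lborel (\<lambda>y. g y * kf z y)"
proof (rule Bochner_Integration.integrable_bound)
  show "integrable lborel (\<lambda>y. B * norm (kf z y))" by (intro integrable_mult_right integrable_norm kf_integrable)
  have "0 \<le> B" using order_trans[OF norm_ge_zero B[of 0]] .
  then show "AE y in lborel. norm (g y * kf z y) \<le> norm (B * norm (kf z y))"
    by (intro AE_I2) (simp add: norm_mult mult_right_mono B)
qed measurable

lemma fbarg_bound:
  fixes g :: "real^'n::finite \<Rightarrow> complex"
  assumes B: "\<And>y. norm (g y) \<le> B"
  shows "norm (fbarg g z) \<le> B * 2 powr (real CARD('n) / 4) * exp (pi / 2 * (norm z)\<^sup>2)"
proof -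
  have "norm (fbarg g z) \<le> (\<integral>y. B * norm (kf z y) \<partial>lborel)"
    unfolding fbarg_def
  proof (rule norm_integral_le)
    show "integrable lborel (\<lambda>y. B * norm (kf z y))" by (intro integrable_mult_right integrable_norm kf_integrable)
    show "norm (g y * kf z y) \<le> B * norm (kf z y)" for y unfolding norm_mult by (rule mult_right_mono[OF B norm_ge_zero])
  qed
  also have "\<dots> = B * 2 powr (real CARD('n) / 4) * exp (pi / 2 * (norm z)\<^sup>2)"
    unfolding integral_mult_right_zero integral_norm_kf by simp
  finally show ?thesis .
qed

lemma norm_dotc_self_exp: "norm (z::complex^'n::finite) \<le> R \<Longrightarrow> norm (exp (- of_real pi / 2 * dotc z z)) \<le> exp (pi / 2 * R\<^sup>2)"
proof -
  assume z: "norm z \<le> R"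
  have "Re (- of_real pi / 2 * dotc z z) \<le> norm (- of_real pi / 2 * dotc z z)" by (rule complex_Re_le_cmod)
  also have "\<dots> = pi / 2 * norm (dotc z z)" by (simp add: norm_mult norm_divide)
  also have "\<dots> \<le> pi / 2 * (norm z * norm z)" by (intro mult_left_mono norm_dotc_le) simp
  also have "\<dots> \<le> pi / 2 * R\<^sup>2" unfolding power2_eq_square using z by (intro mult_left_mono mult_mono) (auto intro: order_trans[OF norm_ge_zero z])
  finally show ?thesis unfolding norm_exp_eq_Re by simp
qed

lemma fbarg_entire:
  fixes g :: "real^'n::finite \<Rightarrow> complex"
  assumes [measurable]: "g \<in> borel_measurable borel" and B: "\<And>y. norm (g y) \<le> B"
  shows "entire (fbarg g)"
  unfolding fbarg_def[abs_def]
proof (rule entire_integral)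
  show "entire (\<lambda>z. g y * kf z y)" for y by (intro entire_mult entire_const entire_kf)
  show "(\<lambda>y. g y * kf z y) \<in> borel_measurable lborel" for z by measurable
  fix R :: real
  let ?c = "2 powr (real CARD('n) / 4)"
  let ?h = "\<lambda>y::real^'n. (B * ?c * exp (pi / 2 * R\<^sup>2)) * exp (- pi * 1 * (norm y)\<^sup>2 + pi * (2 * R) * norm y)"
  have B0: "0 \<le> B" using order_trans[OF norm_ge_zero B[of 0]] .
  show "\<exists>h. integrable lborel h \<and> (\<forall>z y. norm (z::complex^'n) \<le> R \<longrightarrow> norm (g y * kf z y) \<le> h y)"
  proof (rule exI[of _ ?h], intro conjI allI impI)
    show "integrable lborel ?h" by (rule integrable_mult_right[OF integrable_gauss_lin]) simp
    fix z :: "complex^'n" and y :: "real^'n" assume z: "norm z \<le> R"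
    have "norm (re_vec (2 *s z)) \<le> 2 * R" using order_trans[OF norm_re_vec_le z] by simp
    then have "norm (gker 1 (2 *s z) y) \<le> exp (- pi * 1 * (norm y)\<^sup>2 + pi * (2 * R) * norm y)" by (intro gker_bound) auto
    then have "norm (kf z y) \<le> ?c * exp (pi / 2 * R\<^sup>2) * exp (- pi * 1 * (norm y)\<^sup>2 + pi * (2 * R) * norm y)"
      unfolding kf_def norm_mult using norm_dotc_self_exp[OF z] by (intro mult_mono) auto
    then have "norm (g y) * norm (kf z y) \<le> B * (?c * exp (pi / 2 * R\<^sup>2) * exp (- pi * 1 * (norm y)\<^sup>2 + pi * (2 * R) * norm y))"
      using B0 by (intro mult_mono B) auto
    then show "norm (g y * kf z y) \<le> ?h y" by (simp only: norm_mult mult.assoc)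
  qed
qed

lemma gker_mult: "gker a z y * gker b w y = gker (a + b) (z + w) y"
  by (simp add: gker_def mult_exp_exp algebra_simps)

lemma fbarg_gker:
  fixes \<zeta> z :: "complex^'n::finite"
  assumes "a > 0"
  shows "fbarg (gker (of_real a) \<zeta>) z = of_real (2 powr (real CARD('n) / 4) * (1 / sqrt (a + 1)) ^ CARD('n))
     * exp (- of_real pi / 2 * dotc z z + of_real pi * dotc (\<zeta> + 2 *s z) (\<zeta> + 2 *s z) / (4 * of_real (a + 1)))"
proof -
  have e: "gker (of_real a) \<zeta> y * kf z y = (of_real (2 powr (real CARD('n) / 4)) * exp (- of_real pi / 2 * dotc z z)) * gker (of_real (a + 1)) (\<zeta> + 2 *s z) y" for y
  proof -
    have "gker (of_real a) \<zeta> y * kf z y = (of_real (2 powr (real CARD('n) / 4)) * exp (- of_real pi / 2 * dotc z z)) * (gker (of_real a) \<zeta> y * gker 1 (2 *s z) y)"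
      unfolding kf_def by (simp only: mult_ac)
    then show ?thesis unfolding gker_mult by simp
  qed
  have a: "a + 1 > 0" using assms by simp
  show ?thesis unfolding fbarg_def e integral_mult_right_zero gker_integral[OF a] exp_add of_real_mult by (simp only: mult_ac)
qed

text \<open>The Bargmann transform of its own kernel is the reproducing kernel of the Fock space.\<close>

lemma fbarg_kf: "fbarg (kf z) v = exp (of_real pi * dotc z (v :: complex^'n::finite))"
proof -
  let ?c = "2 powr (real CARD('n) / 4)"
  have e: "kf z y * kf v y = (of_real ?c * exp (- of_real pi / 2 * dotc z z)) * (gker (of_real 1) (2 *s z) y * kf v y)" for y
    unfolding kf_def[of z] by simp
  have c: "?c * (?c * (1 / sqrt (1 + 1)) ^ CARD('n)) = 1"
  proof -
    have "?c * ?c = 2 powr (real CARD('n) / 2)" by (simp add: powr_add[symmetric])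
    also have "\<dots> = sqrt 2 ^ CARD('n)" by (simp add: powr_half_sqrt[symmetric] powr_realpow[symmetric] powr_powr)
    finally have "?c * ?c * (1 / sqrt 2) ^ CARD('n) = 1" by (simp add: power_divide)
    then show ?thesis by (simp add: mult.assoc)
  qed
  have x: "- of_real pi / 2 * dotc z z + (- of_real pi / 2 * dotc v v + of_real pi * dotc (2 *s z + 2 *s v) (2 *s z + 2 *s v) / (4 * of_real (1 + 1))) = of_real pi * dotc z v"
    by (simp add: dotc_commute[of v z] field_simps)
  have "fbarg (kf z) v = (of_real ?c * exp (- of_real pi / 2 * dotc z z)) * fbarg (gker (of_real 1) (2 *s z)) v"
    unfolding fbarg_def e integral_mult_right_zero ..
  also have "\<dots> = of_real (?c * (?c * (1 / sqrt (1 + 1)) ^ CARD('n))) * (exp (- of_real pi / 2 * dotc z z) * 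
      exp (- of_real pi / 2 * dotc v v + of_real pi * dotc (2 *s z + 2 *s v) (2 *s z + 2 *s v) / (4 * of_real (1 + 1))))"
    unfolding fbarg_gker[OF zero_less_one] of_real_mult by (simp only: mult_ac)
  finally show ?thesis unfolding c mult_exp_exp x by simp
qed

lemma bargmann_eq:
  assumes u: "u \<in> tempered_distributions"
  shows "bargmann u z = of_real (2 powr (real CARD('n) / 4)) * exp (- of_real pi / 2 * dotc z z) * u (gker 1 (2 *s (z::complex^'n::finite)))"
  unfolding bargmann_def kf_def[abs_def] by (rule temperedD(2)[OF u gker_schwartz]) simp

lemma bargmann_entire:
  assumes u: "u \<in> tempered_distributions" shows "entire (bargmann u)"
  unfolding bargmann_eq[OF u, abs_def]
  by (intro entire_mult entire_const entire_exp entire_dotc entire_smult[OF tempered_gker_entire[OF u]]) simp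

text \<open>The conjugated time-frequency shift of the window is a multiple of \<open>kf z\<close> with \<open>z = x - \<i> \<omega>\<close>; the multiple
  has modulus equal to the Fock weight.\<close>

lemma stft_bargmann:
  fixes u :: "'n::finite functional"
  assumes u: "\<And>c z. u (\<lambda>x. c * kf z x) = c * u (kf z)"
  shows "stft u (x, \<omega>) = exp (- of_real pi * \<i> * of_real (x \<bullet> \<omega>)) * fock_weighted (bargmann u) (cvec x (- \<omega>))"
proof -
  let ?z = "cvec x (- \<omega>)"
  define c where "c = exp (- of_real pi * \<i> * of_real (x \<bullet> \<omega>)) * of_real (exp (- pi * (norm ?z)\<^sup>2 / 2))"
  have n: "(norm ?z)\<^sup>2 = x \<bullet> x + \<omega> \<bullet> \<omega>" by (simp add: norm_sq_re_im)
  have zz: "dotc ?z ?z = of_real (x \<bullet> x - \<omega> \<bullet> \<omega>) - 2 * \<i> * of_real (x \<bullet> \<omega>)"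
    by (simp add: complex_eq_iff Re_dotc Im_dotc inner_commute)
  have tz: "dotc (of_real_vec t) (2 *s ?z) = 2 * of_real (t \<bullet> x) - 2 * \<i> * of_real (\<omega> \<bullet> t)" for t
    by (simp add: complex_eq_iff Re_dotc Im_dotc inner_commute)
  have "cnj (tf_shift x \<omega> gauss_window t) = c * kf ?z t" for t
  proof -
    have "cnj (tf_shift x \<omega> gauss_window t) = of_real (2 powr (real CARD('n) / 4)) * exp (cnj (2 * of_real pi * \<i> * of_real (\<omega> \<bullet> t)) + of_real (- pi * ((t - x) \<bullet> (t - x))))"
    proof -
      have "cnj (tf_shift x \<omega> gauss_window t) = exp (cnj (2 * of_real pi * \<i> * of_real (\<omega> \<bullet> t))) * of_real (2 powr (real CARD('n) / 4) * exp (- pi * ((t - x) \<bullet> (t - x))))"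
        by (simp add: tf_shift_def gauss_window_def exp_cnj)
      then show ?thesis unfolding of_real_mult[of "2 powr (real CARD('n) / 4)"] by (simp only: exp_add exp_of_real mult_ac)
    qed
    also have "\<dots> = of_real (2 powr (real CARD('n) / 4)) * exp ((- of_real pi * \<i> * of_real (x \<bullet> \<omega>) + of_real (- pi * (norm ?z)\<^sup>2 / 2)) + (- of_real pi / 2 * dotc ?z ?z + (- of_real pi * 1 * of_real (t \<bullet> t) + of_real pi * dotc (of_real_vec t) (2 *s ?z))))"
    proof -
      have "cnj (2 * of_real pi * \<i> * of_real (\<omega> \<bullet> t)) + of_real (- pi * ((t - x) \<bullet> (t - x))) = (- of_real pi * \<i> * of_real (x \<bullet> \<omega>) + of_real (- pi * (norm ?z)\<^sup>2 / 2)) + (- of_real pi / 2 * dotc ?z ?z + (- of_real pi * 1 * of_real (t \<bullet> t) + of_real pi * dotc (of_real_vec t) (2 *s ?z)))"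
        unfolding zz tz n by (simp add: inner_diff_left inner_diff_right inner_commute field_simps)
      then show ?thesis by (simp only:)
    qed
    also have "\<dots> = c * kf ?z t"
      unfolding c_def kf_def gker_def exp_add exp_of_real by (simp only: mult_ac)
    finally show ?thesis .
  qed
  then have "stft u (x, \<omega>) = c * bargmann u ?z"
    unfolding stft_def bargmann_def using u by simp
  then show ?thesis unfolding c_def fock_weighted_def by (simp only: mult_ac)
qed

lemma lborel_iota: "distr lborel borel (\<lambda>p. cvec (fst p) (- snd p)) = (lborel :: (complex^'n::finite) measure)"
proof (rule measure_eqI)
  fix A :: "(complex^'n) set" assume "A \<in> sets (distr lborel borel (\<lambda>p. cvec (fst p) (- snd p)))"
  then have [measurable]: "A \<in> sets borel" by simp
  have [measurable]: "(\<lambda>p. cvec (fst p) (- snd p)) \<in> borel_measurable (borel :: ((real^'n) \<times> (real^'n)) measure)"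
    by (intro borel_measurable_continuous_onI continuous_intros)
  have "emeasure (distr lborel borel (\<lambda>p. cvec (fst p) (- snd p))) A = (\<integral>\<^sup>+p. indicator A (cvec (fst p) (- snd p)) \<partial>(lborel :: ((real^'n) \<times> (real^'n)) measure))"
    by (subst nn_integral_indicator[symmetric], simp, subst nn_integral_distr) auto
  also have "\<dots> = (\<integral>\<^sup>+x. \<integral>\<^sup>+y. indicator A (cvec x (- y)) \<partial>lborel \<partial>lborel)"
    unfolding lborel_prod[symmetric] by (subst lborel.nn_integral_fst[symmetric]) auto
  also have "\<dots> = (\<integral>\<^sup>+x. \<integral>\<^sup>+y. indicator A (cvec x y) \<partial>lborel \<partial>lborel)"
    by (intro nn_integral_cong nn_integral_uminus[where f="\<lambda>y. indicator A (cvec _ y)"]) measurable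
  also have "\<dots> = (\<integral>\<^sup>+z. indicator A z \<partial>lborel)"
    by (rule nn_integral_cvec'[symmetric]) simp
  finally show "emeasure (distr lborel borel (\<lambda>p. cvec (fst p) (- snd p))) A = emeasure lborel A" by simp
qed simp

lemma iota_measurable [measurable]: "(\<lambda>p. cvec (fst p) (- snd p)) \<in> borel_measurable (borel :: ((real^'n::finite) \<times> (real^'n)) measure)"
  by (intro borel_measurable_continuous_onI continuous_intros)

lemma stft_props:
  fixes u :: "'n::finite functional"
  assumes u: "u \<in> tempered_distributions"
  shows "norm (stft u p) = norm (fock_weighted (bargmann u) (cvec (fst p) (- snd p)))" "stft u \<in> borel_measurable lborel"
proof -
  have s: "stft u p = exp (- of_real pi * \<i> * of_real (fst p \<bullet> snd p)) * fock_weighted (bargmann u) (cvec (fst p) (- snd p))" for p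
    using stft_bargmann[of u "fst p" "snd p"] temperedD(2)[OF u kf_schwartz] by simp
  show "norm (stft u p) = norm (fock_weighted (bargmann u) (cvec (fst p) (- snd p)))"
    unfolding s norm_mult by simp
  note [measurable] = fock_weighted_measurable[OF bargmann_entire[OF u]]
  have "(\<lambda>p. fock_weighted (bargmann u) (cvec (fst p) (- snd p))) \<in> borel_measurable (borel :: ((real^'n) \<times> (real^'n)) measure)"
    by measurable
  moreover have "(\<lambda>p. exp (- of_real pi * \<i> * of_real (fst p \<bullet> snd p))) \<in> borel_measurable (borel :: ((real^'n) \<times> (real^'n)) measure)"
    by (intro borel_measurable_continuous_onI continuous_intros)
  ultimately show "stft u \<in> borel_measurable lborel" using s[abs_def] by simp
qed

lemma modulation_space_fin:
  fixes u :: "'n::finite functional"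
  assumes u: "u \<in> tempered_distributions" and p: "p < \<infinity>"
  shows "u \<in> modulation_space p \<longleftrightarrow> bargmann u \<in> fock_space p" "modulation_norm p u = fock_norm p (bargmann u)"
proof -
  note [measurable] = fock_weighted_measurable[OF bargmann_entire[OF u]]
  have "(\<integral>\<^sup>+z. ennreal (norm (fock_weighted (bargmann u) z) powr enn2real p) \<partial>lborel) = (\<integral>\<^sup>+q. ennreal (norm (stft u q) powr enn2real p) \<partial>lborel)"
    unfolding stft_props(1)[OF u] by (subst lborel_iota[symmetric]) (simp add: nn_integral_distr)
  moreover have "p \<noteq> \<infinity>" using p by auto
  ultimately show "u \<in> modulation_space p \<longleftrightarrow> bargmann u \<in> fock_space p"
    using u stft_props(2)[OF u] bargmann_entire[OF u] by (simp add: modulation_space_def fock_space_def Lp_space_def)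
  have "(\<integral>z. norm (fock_weighted (bargmann u) z) powr enn2real p \<partial>lborel) = (\<integral>q. norm (stft u q) powr enn2real p \<partial>lborel)"
    unfolding stft_props(1)[OF u] by (subst lborel_iota[symmetric]) (simp add: integral_distr)
  then show "modulation_norm p u = fock_norm p (bargmann u)"
    using \<open>p \<noteq> \<infinity>\<close> by (simp add: modulation_norm_def fock_norm_def Lp_norm_def)
qed

lemma Lp_space_infinity: "f \<in> Lp_space \<infinity> M \<longleftrightarrow> f \<in> borel_measurable M \<and> (\<exists>C. AE x in M. norm (f x) \<le> C)"
proof (cases "f \<in> borel_measurable M")
  case [measurable]: True
  have "esssup M (\<lambda>x. ennreal (norm (f x))) < \<infinity> \<longleftrightarrow> (\<exists>C. AE x in M. norm (f x) \<le> C)"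
  proof
    assume fin: "esssup M (\<lambda>x. ennreal (norm (f x))) < \<infinity>"
    have "AE x in M. ennreal (norm (f x)) \<le> esssup M (\<lambda>x. ennreal (norm (f x)))" by (rule esssup_AE)
    moreover have "esssup M (\<lambda>x. ennreal (norm (f x))) = ennreal (enn2real (esssup M (\<lambda>x. ennreal (norm (f x)))))"
      using fin by (simp add: less_top)
    ultimately have "AE x in M. ennreal (norm (f x)) \<le> ennreal (enn2real (esssup M (\<lambda>x. ennreal (norm (f x)))))" by simp
    then show "\<exists>C. AE x in M. norm (f x) \<le> C" by (intro exI[of _ "enn2real (esssup M (\<lambda>x. ennreal (norm (f x))))"]) simp
  next
    assume "\<exists>C. AE x in M. norm (f x) \<le> C"
    then obtain C where "AE x in M. norm (f x) \<le> C" by blast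
    then have "AE x in M. ennreal (norm (f x)) \<le> ennreal C" by eventually_elim (rule ennreal_leI)
    then have "esssup M (\<lambda>x. ennreal (norm (f x))) \<le> ennreal C" by (intro esssup_I) auto
    then show "esssup M (\<lambda>x. ennreal (norm (f x))) < \<infinity>" by (simp add: ennreal_less_top order_le_less_trans)
  qed
  then show ?thesis using True by (simp add: Lp_space_def)
qed (simp add: Lp_space_def)

lemma modulation_space_infinity:
  fixes u :: "'n::finite functional"
  assumes u: "u \<in> tempered_distributions"
  shows "u \<in> modulation_space \<infinity> \<longleftrightarrow> bargmann u \<in> fock_space \<infinity>"
proof -
  note [measurable] = fock_weighted_measurable[OF bargmann_entire[OF u]]
  have "(AE z in lborel. norm (fock_weighted (bargmann u) z) \<le> C) \<longleftrightarrow> (AE q in lborel. norm (stft u q) \<le> C)" for C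
    unfolding stft_props(1)[OF u] by (subst lborel_iota[symmetric]) (simp add: AE_distr_iff)
  then show ?thesis
    using u stft_props(2)[OF u] bargmann_entire[OF u]
    unfolding modulation_space_def fock_space_def mem_Collect_eq Lp_space_infinity by simp
qed

section \<open>Inverse Bargmann transform\<close>

lemma schwartz_bounded: "g \<in> schwartz \<Longrightarrow> norm (g y) \<le> schwartz_norm 0 g"
  using schwartz_decay[of g "[]" y 0] schwartz_seminorm_le_norm[of g 0 0 "[]"] by simp

lemma schwartz_continuous: "g \<in> schwartz \<Longrightarrow> continuous_on S g"
  by (rule continuous_at_imp_continuous_on) (auto intro: has_derivative_continuous schwartz_differentiable)

lemma schwartz_measurable: "g \<in> schwartz \<Longrightarrow> g \<in> borel_measurable borel"
  by (intro borel_measurable_continuous_onI schwartz_continuous)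

lemmas fbarg_schwartz_integrable = fbarg_integrable[OF schwartz_measurable schwartz_bounded]
lemmas fbarg_schwartz_entire = fbarg_entire[OF schwartz_measurable schwartz_bounded]

lemma partial_kf: "partial j (kf z) y = (- 2 * of_real pi * of_real (y $ j) + 2 * of_real pi * z $ j) * kf (z :: complex^'n::finite) y"
proof -
  let ?c = "of_real (2 powr (real CARD('n) / 4)) * exp (- of_real pi / 2 * dotc z z)"
  have d: "dotc (of_real_vec y) (of_real_vec (axis j 1)) = of_real (y $ j)"
    unfolding dotc_of_real by (simp add: inner_axis)
  have e: "dotc (of_real_vec (axis j 1)) (2 *s z) = 2 * z $ j"
  proof -
    have "dotc (of_real_vec (axis j 1)) w = w $ j" for w :: "complex^'n"
    proof -
      have "of_real ((axis j 1 :: real^'n) $ i) * w $ i = (if i = j then w $ i else 0)" for i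
        by (simp add: axis_def)
      then show ?thesis by (simp add: dotc_def of_real_vec_def)
    qed
    then show ?thesis by simp
  qed
  have k: "kf z = (\<lambda>y. ?c * gker 1 (2 *s z) y)" by (simp add: fun_eq_iff kf_def)
  have "(kf z has_derivative (\<lambda>h. ?c * ((- 2 * of_real pi * 1 * dotc (of_real_vec y) (of_real_vec h) + of_real pi * dotc (of_real_vec h) (2 *s z)) * gker 1 (2 *s z) y))) (at y)"
    unfolding k by (rule has_derivative_mult_right[OF has_derivative_gker])
  from partial_eq[OF this, of j] show ?thesis
    unfolding d e by (simp add: kf_def algebra_simps)
qed

lemma creation_schwartz: "g \<in> schwartz \<Longrightarrow> creation j g \<in> schwartz" "g \<in> schwartz \<Longrightarrow> (creation j ^^ k) g \<in> schwartz"
  using tame_creation[of j] tame_creation_pow[of k j] by (auto simp: tame_def)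

lemma fbarg_creation:
  assumes g: "g \<in> schwartz"
  shows "fbarg (creation j g) z = z $ j * fbarg g z"
proof -
  note P = integration_by_parts[OF g kf_schwartz, of j z]
  have "creation j g y * kf z y = z $ j * (g y * kf z y) + (- 1 / (2 * of_real pi)) * (partial j g y * kf z y + g y * partial j (kf z) y)" for y
    unfolding partial_kf creation_def by (simp add: field_simps)
  then have "fbarg (creation j g) z = (\<integral>y. z $ j * (g y * kf z y) + (- 1 / (2 * of_real pi)) * (partial j g y * kf z y + g y * partial j (kf z) y) \<partial>lborel)"
    unfolding fbarg_def by (simp only:)
  also have "\<dots> = z $ j * (\<integral>y. g y * kf z y \<partial>lborel) + (- 1 / (2 * of_real pi)) * (\<integral>y. partial j g y * kf z y + g y * partial j (kf z) y \<partial>lborel)"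
    by (subst Bochner_Integration.integral_add)
      (intro integrable_mult_right fbarg_schwartz_integrable[OF g g] P(1), intro integrable_mult_right fbarg_schwartz_integrable[OF g g] P(1), simp only: integral_mult_right_zero)
  finally show ?thesis unfolding P(2) fbarg_def by simp
qed

lemma fbarg_creation_pow:
  assumes g: "g \<in> schwartz"
  shows "fbarg ((creation j ^^ k) g) z = (z $ j) ^ k * fbarg g z"
proof (induction k)
  case (Suc k)
  show ?case using fbarg_creation[OF creation_schwartz(2)[OF g, of k j], of j z] Suc by simp
qed simp

lemma norm_le_coord:
  fixes z :: "complex^'n::finite"
  shows "\<exists>j. norm z \<le> real CARD('n) * norm (z $ j)"
proof -
  define M where "M = Max (range (\<lambda>j. norm (z $ j)))"
  have "M \<in> range (\<lambda>j. norm (z $ j))" unfolding M_def by (rule Max_in) auto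
  then obtain j where j: "M = norm (z $ j)" by blast
  have "norm (z $ i) \<le> M" for i unfolding M_def by (rule Max_ge) auto
  then have "(\<Sum>i\<in>UNIV. norm (z $ i)) \<le> real CARD('n) * M" using sum_bounded_above[of UNIV "\<lambda>i. norm (z $ i)" M] by simp
  moreover have "norm z \<le> (\<Sum>i\<in>UNIV. norm (z $ i))" unfolding norm_vec_def by (rule L2_set_le_sum) simp
  ultimately show ?thesis unfolding j by (intro exI[of _ j]) linarith
qed

text \<open>Multiplication by \<open>z\<^sub>j\<close> on the transform side is the continuous operator \<open>creation j\<close> on the Schwartz space, so the
  trivial bound \<open>fbarg_bound\<close> applied to its powers gives any polynomial decay.\<close>

lemma fbarg_decay:
  fixes K :: nat
  shows "\<exists>C\<ge>0. \<exists>N. \<forall>g\<in>(schwartz :: (real^'n::finite \<Rightarrow> complex) set). \<forall>z.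
     norm (fbarg g z) \<le> C * schwartz_norm N g / (1 + norm z) ^ K * exp (pi / 2 * (norm z)\<^sup>2)"
proof -
  let ?c = "2 powr (real CARD('n) / 4)"
  have "\<exists>C N. \<forall>j::'n. C j \<ge> 0 \<and> (\<forall>g\<in>schwartz. schwartz_norm 0 ((creation j ^^ K) g) \<le> C j * schwartz_norm (N j) g)"
    using tame_creation_pow[of K] unfolding tame_def by metis
  then obtain C N where CN: "\<And>j::'n. C j \<ge> 0" "\<And>j g. g \<in> schwartz \<Longrightarrow> schwartz_norm 0 ((creation j ^^ K) g) \<le> C j * schwartz_norm (N j) g" by blast
  define L where "L = Max (range N)"
  have L: "N j \<le> L" for j unfolding L_def by (rule Max_ge) auto
  define A where "A = ?c * 2 ^ K * (1 + real CARD('n) ^ K * (\<Sum>j\<in>UNIV. C j))"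
  have S0: "(\<Sum>j\<in>UNIV. C j) \<ge> 0" by (rule sum_nonneg) (rule CN)
  have A0: "A \<ge> 0" unfolding A_def using S0 by simp
  have "norm (fbarg g z) \<le> A * schwartz_norm L g / (1 + norm z) ^ K * exp (pi / 2 * (norm z)\<^sup>2)" if g: "g \<in> schwartz" for g and z :: "complex^'n"
  proof -
    let ?E = "exp (pi / 2 * (norm z)\<^sup>2)"
    let ?s = "schwartz_norm L g"
    have s0: "?s \<ge> 0" by (rule schwartz_norm_nonneg[OF g])
    \<comment> \<open>the coordinate to multiply by depends on \<open>z\<close>\<close>
    obtain j where j: "norm z \<le> real CARD('n) * norm (z $ j)" using norm_le_coord by blast
    have b0: "norm (fbarg g z) \<le> ?c * ?s * ?E"
    proof -
      have "norm (fbarg g z) \<le> schwartz_norm 0 g * ?c * ?E" by (rule fbarg_bound[OF schwartz_bounded[OF g]])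
      also have "\<dots> \<le> ?s * ?c * ?E" by (intro mult_right_mono schwartz_norm_mono[OF g]) auto
      finally show ?thesis by (simp only: mult_ac)
    qed
    have bK: "norm (z $ j) ^ K * norm (fbarg g z) \<le> ?c * ((\<Sum>j\<in>UNIV. C j) * ?s) * ?E"
    proof -
      have "norm (z $ j) ^ K * norm (fbarg g z) = norm (fbarg ((creation j ^^ K) g) z)"
        by (simp add: fbarg_creation_pow[OF g] norm_mult norm_power)
      also have "\<dots> \<le> schwartz_norm 0 ((creation j ^^ K) g) * ?c * ?E" by (rule fbarg_bound[OF schwartz_bounded[OF creation_schwartz(2)[OF g]]])
      also have "\<dots> \<le> ((\<Sum>j\<in>UNIV. C j) * ?s) * ?c * ?E"
      proof (intro mult_right_mono)
        have "C j * schwartz_norm (N j) g \<le> C j * ?s" by (intro mult_left_mono schwartz_norm_mono g L CN)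
        also have "\<dots> \<le> (\<Sum>j\<in>UNIV. C j) * ?s" using CN(1) s0 by (intro mult_right_mono member_le_sum) auto
        finally show "schwartz_norm 0 ((creation j ^^ K) g) \<le> (\<Sum>j\<in>UNIV. C j) * ?s" using CN(2)[OF g, of j] by linarith
      qed auto
      finally show ?thesis by (simp only: mult_ac)
    qed
    have p: "(1 + norm z) ^ K \<le> 2 ^ K * (1 + real CARD('n) ^ K * norm (z $ j) ^ K)"
    proof -
      have "(1 + norm z) ^ K \<le> (2 * max 1 (norm z)) ^ K" by (intro power_mono) auto
      also have "\<dots> = 2 ^ K * (max 1 (norm z)) ^ K" by (rule power_mult_distrib)
      also have "(max 1 (norm z)) ^ K \<le> 1 + norm z ^ K" by (simp add: max_def)
      also have "norm z ^ K \<le> (real CARD('n) * norm (z $ j)) ^ K" using j by (intro power_mono) auto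
      finally show ?thesis by (simp add: power_mult_distrib)
    qed
    have "(1 + norm z) ^ K * norm (fbarg g z) \<le> 2 ^ K * (1 + real CARD('n) ^ K * norm (z $ j) ^ K) * norm (fbarg g z)"
      by (intro mult_right_mono p) simp
    also have "\<dots> = 2 ^ K * (norm (fbarg g z) + real CARD('n) ^ K * (norm (z $ j) ^ K * norm (fbarg g z)))"
      by (simp add: algebra_simps)
    also have "\<dots> \<le> 2 ^ K * (?c * ?s * ?E + real CARD('n) ^ K * (?c * ((\<Sum>j\<in>UNIV. C j) * ?s) * ?E))"
      by (intro mult_left_mono add_mono b0 bK) auto
    also have "\<dots> = A * ?s * ?E" unfolding A_def by (simp add: algebra_simps)
    finally have "(1 + norm z) ^ K * norm (fbarg g z) \<le> A * ?s * ?E" .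
    moreover have "(1 + norm z) ^ K > 0" by (simp add: add_pos_nonneg)
    ultimately show ?thesis by (simp add: pos_le_divide_eq mult.commute)
  qed
  then show ?thesis using A0 by (intro exI[of _ A] conjI exI[of _ L]) auto
qed

lemma fbarg_add:
  assumes "integrable lborel (\<lambda>y. g y * kf z y)" "integrable lborel (\<lambda>y. h y * kf z y)"
  shows "fbarg (\<lambda>y. g y + h y) z = fbarg g z + fbarg h z"
  unfolding fbarg_def distrib_right using assms by simp

lemma fbarg_mult: "fbarg (\<lambda>y. c * g y) z = c * fbarg g z"
  unfolding fbarg_def mult.assoc by simp

text \<open>The inverse of the Bargmann transform. It extends the identity that the pairing of \<open>f\<close> and \<open>g\<close> is the
  integral of \<open>bargmann f\<close> at \<open>w\<close> times the transform of \<open>g\<close> at \<open>cnj w\<close> for the Gaussian measure.\<close>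

definition synth :: "(complex^'n::finite \<Rightarrow> complex) \<Rightarrow> 'n functional" where
  "synth F g = (if g \<in> schwartz then \<integral>w. F w * fbarg g (cnj_vec w) * gw w \<partial>lborel else 0)"

lemma synth_bound:
  fixes F :: "complex^'n::finite \<Rightarrow> complex"
  assumes F: "F \<in> fock_space \<infinity>"
  shows "\<exists>C N. \<forall>g\<in>schwartz. integrable lborel (\<lambda>w. F w * fbarg g (cnj_vec w) * gw w) \<and> norm (synth F g) \<le> C * schwartz_norm N g"
proof -
  obtain B where B: "\<And>z. norm (F z) \<le> B * exp ((pi / 2) * (norm z)\<^sup>2)" and E: "entire F"
    using F unfolding mem_fock_space_infinity by blast
  define K where "K = 2 * DIM(complex^'n)"
  obtain C N where CN: "C \<ge> 0" "\<And>g z. g \<in> (schwartz :: (real^'n \<Rightarrow> complex) set) \<Longrightarrow> norm (fbarg g z) \<le> C * schwartz_norm N g / (1 + norm z) ^ K * exp (pi / 2 * (norm z)\<^sup>2)"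
    using fbarg_decay[of K, where 'n='n] by blast
  have B0: "B \<ge> 0" using order_trans[OF norm_ge_zero B[of 0]] by simp
  define I where "I = (\<integral>w. 1 / (1 + norm (w::complex^'n)) ^ K \<partial>lborel)" 
  have di: "integrable lborel (\<lambda>w::complex^'n. 1 / (1 + norm w) ^ K)" by (rule integrable_decay) (simp add: K_def)
  have "integrable lborel (\<lambda>w. F w * fbarg g (cnj_vec w) * gw w) \<and> norm (synth F g) \<le> (B * C * I) * schwartz_norm N g" if g: "g \<in> schwartz" for g
  proof -
    note [measurable] = entire_measurable[OF E] entire_measurable[OF fbarg_schwartz_entire[OF g g]]
    let ?s = "schwartz_norm N g"
    have s0: "?s \<ge> 0" by (rule schwartz_norm_nonneg[OF g])
    have le: "norm (F w * fbarg g (cnj_vec w) * gw w) \<le> (B * C * ?s) * (1 / (1 + norm w) ^ K)" for w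
    proof -
      let ?e = "exp (pi / 2 * (norm w)\<^sup>2)"
      have "norm (F w * fbarg g (cnj_vec w) * gw w) \<le> (B * ?e) * (C * ?s / (1 + norm w) ^ K * ?e) * exp (- pi * (norm w)\<^sup>2)"
        unfolding norm_mult norm_gw using B[of w] CN(2)[OF g, of "cnj_vec w"] B0 by (intro mult_right_mono mult_mono) auto
      also have "\<dots> = (B * C * ?s) * (1 / (1 + norm w) ^ K) * (?e * ?e * exp (- pi * (norm w)\<^sup>2))" by simp
      also have "?e * ?e * exp (- pi * (norm w)\<^sup>2) = 1" by (simp add: mult_exp_exp)
      finally show ?thesis by simp
    qed
    have i: "integrable lborel (\<lambda>w::complex^'n. (B * C * ?s) * (1 / (1 + norm w) ^ K))" by (rule integrable_mult_right[OF di])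
    have "integrable lborel (\<lambda>w. F w * fbarg g (cnj_vec w) * gw w)"
      by (rule Bochner_Integration.integrable_bound[OF i]) (measurable, rule AE_I2, rule order_trans[OF le], simp only: real_norm_def abs_ge_self)
    moreover have "norm (synth F g) \<le> (\<integral>w. (B * C * ?s) * (1 / (1 + norm w) ^ K) \<partial>(lborel :: (complex^'n) measure))"
      using norm_integral_le[OF i le] g by (simp add: synth_def)
    ultimately show ?thesis unfolding integral_mult_right_zero I_def[symmetric] by (simp add: mult_ac)
  qed
  then show ?thesis by blast
qed

lemma synth_integrable:
  assumes "F \<in> fock_space \<infinity>" "g \<in> schwartz"
  shows "integrable lborel (\<lambda>w. F w * fbarg g (cnj_vec w) * gw w)"
  using synth_bound[OF assms(1)] assms(2) by blast

lemma synth_tempered: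
  fixes F :: "complex^'n::finite \<Rightarrow> complex"
  assumes F: "F \<in> fock_space \<infinity>" shows "synth F \<in> tempered_distributions"
proof -
  obtain C N where CN: "\<And>g. g \<in> schwartz \<Longrightarrow> norm (synth F g) \<le> C * schwartz_norm N g" using synth_bound[OF F] by blast
  show ?thesis
  proof (rule temperedI[OF _ _ _ CN])
    fix g h :: "real^'n \<Rightarrow> complex" assume gh: "g \<in> schwartz" "h \<in> schwartz"
    have "F w * fbarg (\<lambda>y. g y + h y) (cnj_vec w) * gw w = F w * fbarg g (cnj_vec w) * gw w + F w * fbarg h (cnj_vec w) * gw w" for w
      by (subst fbarg_add) (auto intro: fbarg_schwartz_integrable gh simp: algebra_simps)
    then show "synth F (\<lambda>x. g x + h x) = synth F g + synth F h"
      using synth_integrable[OF F gh(1)] synth_integrable[OF F gh(2)] gh schwartz_add[OF gh] by (simp add: synth_def)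
  next
    fix c and g :: "real^'n \<Rightarrow> complex" assume g: "g \<in> schwartz"
    have "F w * fbarg (\<lambda>y. c * g y) (cnj_vec w) * gw w = c * (F w * fbarg g (cnj_vec w) * gw w)" for w
      unfolding fbarg_mult by (simp only: mult_ac)
    then show "synth F (\<lambda>x. c * g x) = c * synth F g"
      using g schwartz_mult[OF g, of c] unfolding synth_def by (simp only: if_True integral_mult_right_zero)
  qed (auto simp: synth_def)
qed

lemma fock_inf_repr_integrable:
  fixes F :: "complex^'n::finite \<Rightarrow> complex"
  assumes F: "F \<in> fock_space \<infinity>"
  shows "integrable lborel (\<lambda>w. F w * exp (of_real pi * dotc (cnj_vec w) z) * gw w)"
  using synth_integrable[OF F kf_schwartz[of z]] unfolding fbarg_kf by (simp only: dotc_commute)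

text \<open>Inserting the Gaussian \<open>kf z\<close> turns the integral into the reproducing formula.\<close>

lemma bargmann_synth:
  fixes F :: "complex^'n::finite \<Rightarrow> complex"
  assumes F: "F \<in> fock_space \<infinity>" shows "bargmann (synth F) = F"
proof
  fix z
  have "bargmann (synth F) z = (\<integral>w. F w * exp (of_real pi * dotc (cnj_vec w) z) * gw w \<partial>lborel)"
    unfolding bargmann_def synth_def fbarg_kf by (simp add: kf_schwartz dotc_commute)
  also have "\<dots> = F z" by (rule reproducing[OF fock_space_entire[OF F] fock_inf_repr_integrable[OF F]])
  finally show "bargmann (synth F) z = F z" .
qed

lemma synth_add:
  assumes "F \<in> fock_space \<infinity>" "G \<in> fock_space \<infinity>"
  shows "synth (\<lambda>z. F z + G z) = (\<lambda>g. synth F g + synth G g)"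
proof
  fix g
  show "synth (\<lambda>z. F z + G z) g = synth F g + synth G g"
    using synth_integrable[OF assms(1), of g] synth_integrable[OF assms(2), of g] by (simp add: synth_def distrib_right)
qed

lemma synth_mult: "synth (\<lambda>z. c * F z) = (\<lambda>g. c * synth F g)"
  by (simp add: synth_def fun_eq_iff mult.assoc)

text \<open>The two distributions have the same Bargmann transform, that is, they agree on the Gaussians with
  \<open>a = 1\<close>, hence on all Gaussians by \<open>tempered_vanish_gaussian\<close>.\<close>

lemma tempered_gker_eq_synth:
  fixes u :: "'n::finite functional"
  assumes u: "u \<in> modulation_space \<infinity>" and a: "Re a > 0"
  shows "u (gker a z) = synth (bargmann u) (gker a z)"
proof -
  have ut: "u \<in> tempered_distributions" using u by (simp add: modulation_space_def)
  have B: "bargmann u \<in> fock_space \<infinity>" using u modulation_space_infinity[OF ut] by simp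
  have d: "(\<lambda>g. u g - synth (bargmann u) g) \<in> tempered_distributions" by (rule tempered_diff[OF ut synth_tempered[OF B]])
  have "u (gker 1 z) - synth (bargmann u) (gker 1 z) = 0" for z :: "complex^'n"
  proof -
    let ?z = "(1/2) *s z"
    have "bargmann u ?z = bargmann (synth (bargmann u)) ?z" unfolding bargmann_synth[OF B] ..
    moreover have "2 *s ?z = z" by (simp add: vec_eq_iff)
    ultimately show ?thesis unfolding bargmann_eq[OF ut] bargmann_eq[OF synth_tempered[OF B]] by simp
  qed
  from tempered_vanish_gaussian[OF d this a, of z] show ?thesis by simp
qed

lemma fock_symbol_gker: "fock_symbol u z = u (gker (1 / 2) (- z))"
proof -
  have "exp (- of_real pi * of_real (y \<bullet> y) / 2 - of_real pi * dotc (of_real_vec y) z) = gker (1 / 2) (- z) y" for y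
    by (simp add: gker_def)
  then show ?thesis unfolding fock_symbol_def by (simp only:)
qed

section \<open>Growth and inversion of the symbol\<close>

text \<open>The transform of the Gaussian of parameter \<open>1 / 2\<close> is concentrated, after weighting, around a point depending on
  \<open>\<zeta>\<close>, and its size is governed by \<open>Re \<zeta>\<close> alone: the quadratic form in the exponent is completed to a square
  separately in the real and the imaginary directions, where the rate \<open>1 / 3\<close> is the smaller one.\<close>

lemma wide_bound:
  fixes \<zeta> w :: "complex^'n::finite"
  shows "norm (fbarg (gker (1 / 2) \<zeta>) (cnj_vec w)) * exp (- (pi / 2) * (norm w)\<^sup>2)
     \<le> (2 powr (real CARD('n) / 4) * (1 / sqrt (3 / 2)) ^ CARD('n)) * exp (pi / 2 * (norm (re_vec \<zeta>))\<^sup>2)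
       * exp (- pi * (1 / 3) * (norm (w - cvec (re_vec \<zeta>) ((1 / 2) *\<^sub>R im_vec \<zeta>)))\<^sup>2)"
proof -
  let ?C = "2 powr (real CARD('n) / 4) * (1 / sqrt (3 / 2)) ^ CARD('n)"
  let ?p = "re_vec w" and ?q = "im_vec w" and ?s = "re_vec \<zeta>" and ?t = "im_vec \<zeta>"
  let ?E = "- of_real pi / 2 * dotc (cnj_vec w) (cnj_vec w) + of_real pi * dotc (\<zeta> + 2 *s cnj_vec w) (\<zeta> + 2 *s cnj_vec w) / 6"
  have h: "fbarg (gker (1 / 2) \<zeta>) (cnj_vec w) = of_real ?C * exp ?E"
    using fbarg_gker[of "1/2" \<zeta> "cnj_vec w"] by simp
  have n: "norm (fbarg (gker (1 / 2) \<zeta>) (cnj_vec w)) = ?C * exp (Re ?E)"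
    unfolding h norm_mult[of "of_real _"] norm_exp_eq_Re norm_of_real by simp
  have Re6: "Re (of_real pi * a / 6) = pi / 6 * Re a" for a :: complex by simp
  have Re2: "Re (- of_real pi / 2 * a) = - pi / 2 * Re a" for a :: complex by simp
  have ReE: "Re ?E = - pi / 2 * (?p \<bullet> ?p - ?q \<bullet> ?q) + pi / 6 * ((?s + 2 *\<^sub>R ?p) \<bullet> (?s + 2 *\<^sub>R ?p) - (?t - 2 *\<^sub>R ?q) \<bullet> (?t - 2 *\<^sub>R ?q))"
    unfolding plus_complex.sel Re2 Re6 Re_dotc by simp
  have "Re ?E - pi / 2 * (norm w)\<^sup>2 \<le> pi / 2 * (norm ?s)\<^sup>2 - pi * (1 / 3) * (norm (w - cvec ?s ((1 / 2) *\<^sub>R ?t)))\<^sup>2"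
  proof -
    have "0 \<le> pi / 3 * ((?q - (1 / 2) *\<^sub>R ?t) \<bullet> (?q - (1 / 2) *\<^sub>R ?t))" by simp
    moreover have "pi / 2 * (norm ?s)\<^sup>2 - pi * (1 / 3) * (norm (w - cvec ?s ((1 / 2) *\<^sub>R ?t)))\<^sup>2 - (Re ?E - pi / 2 * (norm w)\<^sup>2) = pi / 3 * ((?q - (1 / 2) *\<^sub>R ?t) \<bullet> (?q - (1 / 2) *\<^sub>R ?t))"
      unfolding ReE norm_sq_re_im[of w] norm_sq_re_im[of "w - cvec ?s ((1 / 2) *\<^sub>R ?t)"] power2_norm_eq_inner[of ?s]
      by (simp add: inner_add_left inner_add_right inner_diff_left inner_diff_right inner_commute field_simps)
    ultimately show ?thesis by linarith
  qed
  then have "exp (Re ?E) * exp (- (pi / 2) * (norm w)\<^sup>2) \<le> exp (pi / 2 * (norm ?s)\<^sup>2) * exp (- pi * (1 / 3) * (norm (w - cvec ?s ((1 / 2) *\<^sub>R ?t)))\<^sup>2)"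
    unfolding mult_exp_exp exp_le_cancel_iff by simp
  then have "?C * (exp (Re ?E) * exp (- (pi / 2) * (norm w)\<^sup>2)) \<le> ?C * (exp (pi / 2 * (norm ?s)\<^sup>2) * exp (- pi * (1 / 3) * (norm (w - cvec ?s ((1 / 2) *\<^sub>R ?t)))\<^sup>2))"
    by (intro mult_left_mono) auto
  then show ?thesis unfolding n by (simp only: mult.assoc)
qed

lemma nn_gauss_third:
  "(\<integral>\<^sup>+w. ennreal (exp (- pi * (1 / 3) * (norm (w - b :: 'a::euclidean_space))\<^sup>2)) \<partial>lborel) = ennreal ((1 / sqrt (1 / 3)) ^ DIM('a))"
  using nn_integral_lborel_translate[of "\<lambda>w::'a. ennreal (exp (- pi * (1 / 3) * (norm w)\<^sup>2))" "- b"] nn_gauss[of "1 / 3", where 'a='a] by simp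

lemma symbol_kernel_bound:
  fixes U :: "complex^'n::finite \<Rightarrow> complex"
  assumes U: "\<And>z. norm (U z) \<le> B * exp ((pi / 2) * (norm z)\<^sup>2)"
  shows "(\<integral>\<^sup>+w. ennreal (norm (U w * fbarg (gker (1 / 2) \<zeta>) (cnj_vec w) * gw w)) \<partial>lborel)
     \<le> ennreal (B * (2 powr (real CARD('n) / 4) * (1 / sqrt (3 / 2)) ^ CARD('n)) * exp (pi / 2 * (norm (re_vec \<zeta>))\<^sup>2) * (1 / sqrt (1 / 3)) ^ DIM(complex^'n))"
proof -
  let ?C = "2 powr (real CARD('n) / 4) * (1 / sqrt (3 / 2)) ^ CARD('n)"
  let ?e = "exp (pi / 2 * (norm (re_vec \<zeta>))\<^sup>2)"
  let ?g = "\<lambda>w. exp (- pi * (1 / 3) * (norm (w - cvec (re_vec \<zeta>) ((1 / 2) *\<^sub>R im_vec \<zeta>)))\<^sup>2)"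
  have B0: "B \<ge> 0" using order_trans[OF norm_ge_zero U[of 0]] by simp
  have le: "norm (U w * fbarg (gker (1 / 2) \<zeta>) (cnj_vec w) * gw w) \<le> (B * ?C * ?e) * ?g w" for w
  proof -
    have "norm (U w * fbarg (gker (1 / 2) \<zeta>) (cnj_vec w) * gw w) \<le> (B * exp ((pi / 2) * (norm w)\<^sup>2)) * norm (fbarg (gker (1 / 2) \<zeta>) (cnj_vec w)) * exp (- pi * (norm w)\<^sup>2)"
      unfolding norm_mult norm_gw by (intro mult_right_mono U) auto
    also have "\<dots> = B * (norm (fbarg (gker (1 / 2) \<zeta>) (cnj_vec w)) * (exp ((pi / 2) * (norm w)\<^sup>2) * exp (- pi * (norm w)\<^sup>2)))"
      by (simp only: mult_ac)
    also have "exp ((pi / 2) * (norm w)\<^sup>2) * exp (- pi * (norm w)\<^sup>2) = exp (- (pi / 2) * (norm w)\<^sup>2)"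
      by (simp add: mult_exp_exp)
    also have "B * (norm (fbarg (gker (1 / 2) \<zeta>) (cnj_vec w)) * exp (- (pi / 2) * (norm w)\<^sup>2)) \<le> B * (?C * ?e * ?g w)"
      by (intro mult_left_mono wide_bound B0)
    finally show ?thesis by (simp only: mult.assoc)
  qed
  have "(\<integral>\<^sup>+w. ennreal (norm (U w * fbarg (gker (1 / 2) \<zeta>) (cnj_vec w) * gw w)) \<partial>lborel) \<le> (\<integral>\<^sup>+w. ennreal (B * ?C * ?e) * ennreal (?g w) \<partial>lborel)"
  proof (rule nn_integral_mono)
    fix w :: "complex^'n"
    have "0 \<le> B * ?C * ?e" using B0 by simp
    then show "ennreal (norm (U w * fbarg (gker (1 / 2) \<zeta>) (cnj_vec w) * gw w)) \<le> ennreal (B * ?C * ?e) * ennreal (?g w)"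
      by (subst ennreal_mult[symmetric]) (simp, simp, rule ennreal_leI[OF le])
  qed
  also have "\<dots> = ennreal (B * ?C * ?e) * ennreal ((1 / sqrt (1 / 3)) ^ DIM(complex^'n))"
    by (subst nn_integral_cmult) (measurable, simp only: nn_gauss_third)
  also have "\<dots> = ennreal (B * ?C * ?e * (1 / sqrt (1 / 3)) ^ DIM(complex^'n))"
    by (rule ennreal_mult[symmetric]) (use B0 in auto)
  finally show ?thesis .
qed

lemma gker_half_schwartz: "gker (1 / 2) z \<in> schwartz"
  by (rule gker_schwartz) simp

text \<open>Functions in \<open>F\<^sup>\<infinity>\<close> are integrated against the concentrated kernel of \<open>wide_bound\<close>, whose mass does not depend on
  the centre.\<close>

lemma synth_symbol_bound:
  fixes U :: "complex^'n::finite \<Rightarrow> complex"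
  assumes U: "U \<in> fock_space \<infinity>"
  shows "\<exists>C. \<forall>\<zeta>. norm (synth U (gker (1 / 2) \<zeta>)) \<le> C * exp (pi / 2 * (norm (re_vec \<zeta>))\<^sup>2)"
proof -
  obtain B where B: "\<And>z. norm (U z) \<le> B * exp ((pi / 2) * (norm z)\<^sup>2)"
    using U unfolding mem_fock_space_infinity by blast
  have B0: "B \<ge> 0" using order_trans[OF norm_ge_zero B[of 0]] by simp
  let ?C = "B * (2 powr (real CARD('n) / 4) * (1 / sqrt (3 / 2)) ^ CARD('n))"
  let ?D = "(1 / sqrt (1 / 3)) ^ DIM(complex^'n)"
  have "norm (synth U (gker (1 / 2) \<zeta>)) \<le> (?C * ?D) * exp (pi / 2 * (norm (re_vec \<zeta>))\<^sup>2)" for \<zeta>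
  proof -
    have "ennreal (norm (synth U (gker (1 / 2) \<zeta>))) \<le> (\<integral>\<^sup>+w. ennreal (norm (U w * fbarg (gker (1 / 2) \<zeta>) (cnj_vec w) * gw w)) \<partial>lborel)"
      unfolding synth_def using gker_half_schwartz[of \<zeta>]
      by (simp add: integral_norm_bound_ennreal[OF synth_integrable[OF U gker_half_schwartz]])
    also have "\<dots> \<le> ennreal (?C * exp (pi / 2 * (norm (re_vec \<zeta>))\<^sup>2) * ?D)" by (rule symbol_kernel_bound[OF B])
    finally have "norm (synth U (gker (1 / 2) \<zeta>)) \<le> ?C * exp (pi / 2 * (norm (re_vec \<zeta>))\<^sup>2) * ?D"
      using B0 by (subst (asm) ennreal_le_iff) auto
    then show ?thesis by (simp only: mult_ac)
  qed
  then show ?thesis by blast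
qed

text \<open>For fixed \<open>w\<close> the integral over \<open>\<eta>\<close> is Gaussian and yields the reproducing kernel, so that after Fubini the
  integral over \<open>w\<close> is the reproducing formula for \<open>U\<close>. The left-hand side depends on \<open>U\<close> only through its symbol
  on the shifted imaginary subspace \<open>\<i> \<eta> - z\<close>.\<close>

lemma symbol_inversion:
  fixes U :: "complex^'n::finite \<Rightarrow> complex"
  assumes U: "U \<in> fock_space \<infinity>"
  shows "(\<integral>\<eta>. synth U (gker (1 / 2) (z - \<i> *s of_real_vec \<eta>)) * gker (1 / 2) (\<i> *s z) \<eta> \<partial>lborel) = of_real (2 powr (real CARD('n) / 4)) * U z"
proof -
  obtain B where B: "\<And>z. norm (U z) \<le> B * exp ((pi / 2) * (norm z)\<^sup>2)" and E: "entire U"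
    using U unfolding mem_fock_space_infinity by blast
  note [measurable] = entire_measurable[OF E]
  let ?c = "2 powr (real CARD('n) / 4)"
  let ?c4 = "?c * (1 / sqrt (1 / 2 + 1)) ^ CARD('n)"
  let ?h = "\<lambda>\<eta> :: real^'n. z - \<i> *s of_real_vec \<eta>"
  have fg: "fbarg (gker (1 / 2) \<zeta>) v = of_real ?c4 * exp (- of_real pi / 2 * dotc v v + of_real pi * dotc (\<zeta> + 2 *s v) (\<zeta> + 2 *s v) / (4 * of_real (1 / 2 + 1)))" for \<zeta> v :: "complex^'n"
    using fbarg_gker[of "1/2" \<zeta> v] by simp
  have m: "(\<lambda>p. U (snd p) * fbarg (gker (1 / 2) (?h (fst p))) (cnj_vec (snd p)) * gw (snd p) * gker (1 / 2) (\<i> *s z) (fst p)) \<in> borel_measurable (borel \<Otimes>\<^sub>M borel)"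
    unfolding fg by measurable
  have inner: "(\<integral>\<eta>. fbarg (gker (1 / 2) (?h \<eta>)) v * gker (1 / 2) (\<i> *s z) \<eta> \<partial>lborel) = of_real ?c * exp (of_real pi * dotc z v)" for v
  proof -
    let ?A = "- of_real pi / 2 * dotc v v + of_real pi / 6 * dotc (z + 2 *s v) (z + 2 *s v)"
    let ?y = "(2 / 3 * \<i>) *s (z - v)"
    have e: "fbarg (gker (1 / 2) (?h \<eta>)) v * gker (1 / 2) (\<i> *s z) \<eta> = (of_real ?c4 * exp ?A) * gker (of_real (2 / 3)) ?y \<eta>" for \<eta>
    proof -
      have x: "- of_real pi / 2 * dotc v v + of_real pi * dotc (?h \<eta> + 2 *s v) (?h \<eta> + 2 *s v) / (4 * of_real (1 / 2 + 1)) + (- of_real pi * (1 / 2) * of_real (\<eta> \<bullet> \<eta>) + of_real pi * dotc (of_real_vec \<eta>) (\<i> *s z))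
         = ?A + (- of_real pi * of_real (2 / 3) * of_real (\<eta> \<bullet> \<eta>) + of_real pi * dotc (of_real_vec \<eta>) ?y)"
        by (simp add: dotc_commute[of z "of_real_vec \<eta>"] dotc_commute[of v "of_real_vec \<eta>"] dotc_commute[of v z] field_simps)
      have x': "exp (- of_real pi / 2 * dotc v v + of_real pi * dotc (?h \<eta> + 2 *s v) (?h \<eta> + 2 *s v) / (4 * of_real (1 / 2 + 1))) * gker (1 / 2) (\<i> *s z) \<eta> = exp ?A * gker (of_real (2 / 3)) ?y \<eta>"
        unfolding gker_def mult_exp_exp by (rule arg_cong[OF x])
      show ?thesis unfolding fg mult.assoc[of "of_real ?c4"] x' by (rule refl)
    qed
    have "(\<integral>\<eta>. fbarg (gker (1 / 2) (?h \<eta>)) v * gker (1 / 2) (\<i> *s z) \<eta> \<partial>lborel) = (of_real ?c4 * exp ?A) * (of_real ((1 / sqrt (2 / 3)) ^ CARD('n)) * exp (of_real pi * dotc ?y ?y / (4 * of_real (2 / 3))))"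
      unfolding e integral_mult_right_zero by (subst gker_integral) simp_all
    also have "\<dots> = of_real (?c4 * (1 / sqrt (2 / 3)) ^ CARD('n)) * exp (?A + of_real pi * dotc ?y ?y / (4 * of_real (2 / 3)))"
      unfolding exp_add of_real_mult by (simp only: mult_ac)
    finally have 1: "(\<integral>\<eta>. fbarg (gker (1 / 2) (?h \<eta>)) v * gker (1 / 2) (\<i> *s z) \<eta> \<partial>lborel) = of_real (?c4 * (1 / sqrt (2 / 3)) ^ CARD('n)) * exp (?A + of_real pi * dotc ?y ?y / (4 * of_real (2 / 3)))" .
    have "(1 / sqrt (1 / 2 + 1)) * (1 / sqrt (2 / 3)) = 1" by (simp add: real_sqrt_divide)
    then have 2: "?c4 * (1 / sqrt (2 / 3)) ^ CARD('n) = ?c"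
      unfolding mult.assoc power_mult_distrib[symmetric] by simp
    have 3: "?A + of_real pi * dotc ?y ?y / (4 * of_real (2 / 3)) = of_real pi * dotc z v"
      by (simp add: dotc_commute[of v z] field_simps power2_eq_square[symmetric])
    show ?thesis unfolding 1 2 3 by (rule refl)
  qed
  have "(\<integral>\<eta>. synth U (gker (1 / 2) (?h \<eta>)) * gker (1 / 2) (\<i> *s z) \<eta> \<partial>lborel)
     = (\<integral>\<eta>. \<integral>w. U w * fbarg (gker (1 / 2) (?h \<eta>)) (cnj_vec w) * gw w * gker (1 / 2) (\<i> *s z) \<eta> \<partial>lborel \<partial>lborel)"
    unfolding synth_def by (simp add: gker_half_schwartz)
  also have "\<dots> = (\<integral>w. \<integral>\<eta>. U w * fbarg (gker (1 / 2) (?h \<eta>)) (cnj_vec w) * gw w * gker (1 / 2) (\<i> *s z) \<eta> \<partial>lborel \<partial>lborel)"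
  proof (rule Fubini_lborel(1))
    let ?D = "B * (?c * (1 / sqrt (3 / 2)) ^ CARD('n)) * exp (pi / 2 * (norm (re_vec z))\<^sup>2) * (1 / sqrt (1 / 3)) ^ DIM(complex^'n)"
    have "(\<integral>\<^sup>+\<eta>. \<integral>\<^sup>+w. ennreal (norm (U w * fbarg (gker (1 / 2) (?h \<eta>)) (cnj_vec w) * gw w * gker (1 / 2) (\<i> *s z) \<eta>)) \<partial>lborel \<partial>lborel)
      \<le> (\<integral>\<^sup>+\<eta>. ennreal ?D * ennreal (norm (gker (1 / 2) (\<i> *s z) \<eta>)) \<partial>lborel)"
    proof (rule nn_integral_mono)
      fix \<eta> :: "real^'n"
      have re: "re_vec (?h \<eta>) = re_vec z" by simp
      have "(\<integral>\<^sup>+w. ennreal (norm (U w * fbarg (gker (1 / 2) (?h \<eta>)) (cnj_vec w) * gw w * gker (1 / 2) (\<i> *s z) \<eta>)) \<partial>lborel)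
         = (\<integral>\<^sup>+w. ennreal (norm (U w * fbarg (gker (1 / 2) (?h \<eta>)) (cnj_vec w) * gw w)) * ennreal (norm (gker (1 / 2) (\<i> *s z) \<eta>)) \<partial>lborel)"
        by (intro nn_integral_cong) (simp add: norm_mult ennreal_mult)
      also have "\<dots> = (\<integral>\<^sup>+w. ennreal (norm (U w * fbarg (gker (1 / 2) (?h \<eta>)) (cnj_vec w) * gw w)) \<partial>lborel) * ennreal (norm (gker (1 / 2) (\<i> *s z) \<eta>))"
        unfolding fg by (rule nn_integral_multc) measurable
      also have "\<dots> \<le> ennreal ?D * ennreal (norm (gker (1 / 2) (\<i> *s z) \<eta>))"
        using symbol_kernel_bound[OF B, of "?h \<eta>"] unfolding re by (rule mult_right_mono) simp
      finally show "(\<integral>\<^sup>+w. ennreal (norm (U w * fbarg (gker (1 / 2) (?h \<eta>)) (cnj_vec w) * gw w * gker (1 / 2) (\<i> *s z) \<eta>)) \<partial>lborel) \<le> ennreal ?D * ennreal (norm (gker (1 / 2) (\<i> *s z) \<eta>))" .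
    qed
    also have "\<dots> = ennreal ?D * (\<integral>\<^sup>+\<eta>. ennreal (norm (gker (1 / 2) (\<i> *s z) \<eta>)) \<partial>lborel)"
      by (rule nn_integral_cmult) measurable
    also have "\<dots> < \<infinity>"
    proof -
      have "integrable lborel (gker (1 / 2) (\<i> *s z))" using gker_integrable[of "1/2" "\<i> *s z"] by simp
      then have "(\<integral>\<^sup>+\<eta>. ennreal (norm (gker (1 / 2) (\<i> *s z) \<eta>)) \<partial>lborel) < \<infinity>" unfolding integrable_iff_bounded by blast
      then show ?thesis by (simp add: ennreal_mult_less_top)
    qed
    finally show "(\<integral>\<^sup>+\<eta>. \<integral>\<^sup>+w. ennreal (norm (U w * fbarg (gker (1 / 2) (?h \<eta>)) (cnj_vec w) * gw w * gker (1 / 2) (\<i> *s z) \<eta>)) \<partial>lborel \<partial>lborel) < \<infinity>" .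
  qed (rule m)
  also have "\<dots> = (\<integral>w. of_real ?c * (U w * exp (of_real pi * dotc (cnj_vec w) z) * gw w) \<partial>lborel)"
  proof (rule Bochner_Integration.integral_cong[OF refl])
    fix w :: "complex^'n"
    have "(\<integral>\<eta>. U w * fbarg (gker (1 / 2) (?h \<eta>)) (cnj_vec w) * gw w * gker (1 / 2) (\<i> *s z) \<eta> \<partial>lborel)
       = (\<integral>\<eta>. (U w * gw w) * (fbarg (gker (1 / 2) (?h \<eta>)) (cnj_vec w) * gker (1 / 2) (\<i> *s z) \<eta>) \<partial>lborel)"
      by (simp only: mult_ac)
    also have "\<dots> = (U w * gw w) * (of_real ?c * exp (of_real pi * dotc z (cnj_vec w)))"
      unfolding integral_mult_right_zero inner ..
    finally show "(\<integral>\<eta>. U w * fbarg (gker (1 / 2) (?h \<eta>)) (cnj_vec w) * gw w * gker (1 / 2) (\<i> *s z) \<eta> \<partial>lborel) = of_real ?c * (U w * exp (of_real pi * dotc (cnj_vec w) z) * gw w)"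
      unfolding dotc_commute[of z] by (simp only: mult_ac)
  qed
  also have "\<dots> = of_real ?c * U z"
    unfolding integral_mult_right_zero reproducing[OF E fock_inf_repr_integrable[OF U], of z] ..
  finally show ?thesis .
qed

lemma exp_symbol_bound:
  fixes v z :: "complex^'n::finite"
  shows "norm (exp (of_real pi * dotc (cnj_vec v) z)) * exp (pi / 2 * (norm (re_vec (cnj_vec v - z)))\<^sup>2) * exp (- pi * (norm v)\<^sup>2)
     \<le> exp (pi / 2 * (norm z)\<^sup>2) * exp (- (pi / 2) * (norm v)\<^sup>2)"
proof -
  have R: "Re (of_real pi * a) = pi * Re a" for a :: complex by simp
  have "0 \<le> pi / 2 * ((im_vec v - im_vec z) \<bullet> (im_vec v - im_vec z))" by simp
  moreover have "(pi / 2 * (norm z)\<^sup>2 + - (pi / 2) * (norm v)\<^sup>2) - (Re (of_real pi * dotc (cnj_vec v) z) + pi / 2 * (norm (re_vec (cnj_vec v - z)))\<^sup>2 + - pi * (norm v)\<^sup>2) = pi / 2 * ((im_vec v - im_vec z) \<bullet> (im_vec v - im_vec z))"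
    unfolding R Re_dotc norm_sq_re_im[of v] norm_sq_re_im[of z] power2_norm_eq_inner[of "re_vec (cnj_vec v - z)"]
    by (simp add: inner_diff_left inner_diff_right inner_commute field_simps)
  ultimately have "Re (of_real pi * dotc (cnj_vec v) z) + pi / 2 * (norm (re_vec (cnj_vec v - z)))\<^sup>2 + - pi * (norm v)\<^sup>2 \<le> pi / 2 * (norm z)\<^sup>2 + - (pi / 2) * (norm v)\<^sup>2" by linarith
  then show ?thesis unfolding norm_exp_eq_Re mult_exp_exp exp_le_cancel_iff .
qed

text \<open>A symbol bounded by \<open>exp (pi |Re \<zeta>|\<^sup>2 / 2)\<close> is exactly compensated by the kernel and half of the Gaussian
  density, uniformly in \<open>v\<close>.\<close>

lemma fock_integrand_bound:
  assumes \<phi>: "\<And>\<zeta>. norm (\<phi> \<zeta>) \<le> C * exp (pi / 2 * (norm (re_vec \<zeta>))\<^sup>2)"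
  shows "norm (fock_integrand \<phi> F z v) \<le> C * exp (pi / 2 * (norm z)\<^sup>2) * norm (fock_weighted F v)"
proof -
  have C: "C \<ge> 0" using order_trans[OF norm_ge_zero \<phi>[of 0]] by simp
  have "norm (fock_integrand \<phi> F z v) = norm (F v) * (norm (exp (of_real pi * dotc (cnj_vec v) z)) * norm (\<phi> (cnj_vec v - z)) * exp (- pi * (norm v)\<^sup>2))"
    by (simp add: fock_integrand_def norm_mult mult.assoc)
  also have "\<dots> \<le> norm (F v) * (norm (exp (of_real pi * dotc (cnj_vec v) z)) * (C * exp (pi / 2 * (norm (re_vec (cnj_vec v - z)))\<^sup>2)) * exp (- pi * (norm v)\<^sup>2))"
    by (intro mult_left_mono mult_right_mono \<phi>) auto
  also have "\<dots> = norm (F v) * C * (norm (exp (of_real pi * dotc (cnj_vec v) z)) * exp (pi / 2 * (norm (re_vec (cnj_vec v - z)))\<^sup>2) * exp (- pi * (norm v)\<^sup>2))"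
    by (simp only: mult_ac)
  also have "\<dots> \<le> norm (F v) * C * (exp (pi / 2 * (norm z)\<^sup>2) * exp (- (pi / 2) * (norm v)\<^sup>2))"
    using C by (intro mult_left_mono exp_symbol_bound) auto
  finally show ?thesis unfolding norm_fock_weighted by (simp only: mult_ac)
qed

lemma fock_integrand_measurable:
  assumes "entire \<phi>" "entire F"
  shows "fock_integrand \<phi> F z \<in> borel_measurable borel"
proof -
  note [measurable] = assms[THEN entire_measurable]
  show ?thesis unfolding fock_integrand_def[abs_def] by measurable
qed

lemma fock_operator:
  fixes F :: "complex^'n::finite \<Rightarrow> complex"
  assumes E: "entire \<phi>" and \<phi>: "\<And>\<zeta>. norm (\<phi> \<zeta>) \<le> C * exp (pi / 2 * (norm (re_vec \<zeta>))\<^sup>2)" and F: "F \<in> fock_space 1"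
  shows "integrable lborel (fock_integrand \<phi> F z)" "fock_integral_operator \<phi> F \<in> fock_space \<infinity>"
proof -
  have EF: "entire F" by (rule fock_space_entire[OF F])
  have Fi: "integrable lborel (\<lambda>v. norm (fock_weighted F v))" using F by (simp add: mem_fock_space_1)
  have C: "C \<ge> 0" using order_trans[OF norm_ge_zero \<phi>[of 0]] by simp
  note b = fock_integrand_bound[OF \<phi>, of F]
  show i: "integrable lborel (fock_integrand \<phi> F z)" for z
  proof (rule Bochner_Integration.integrable_bound)
    show "integrable lborel (\<lambda>v. C * exp (pi / 2 * (norm z)\<^sup>2) * norm (fock_weighted F v))" by (intro integrable_mult_right Fi)
    show "fock_integrand \<phi> F z \<in> borel_measurable lborel" using fock_integrand_measurable[OF E EF, of z] by simp
    show "AE v in lborel. norm (fock_integrand \<phi> F z v) \<le> norm (C * exp (pi / 2 * (norm z)\<^sup>2) * norm (fock_weighted F v))"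
      by (rule AE_I2) (rule order_trans[OF b], simp)
  qed
  have ent: "entire (\<lambda>z. \<integral>v. fock_integrand \<phi> F z v \<partial>lborel)"
  proof (rule entire_integral)
    fix v :: "complex^'n"
    have e: "(- 1) *s z + cnj_vec v = cnj_vec v - z" for z by (simp add: vec_eq_iff)
    have "entire (\<lambda>z. \<phi> (cnj_vec v - z))" using entire_affine[OF E, of "-1" "cnj_vec v"] unfolding e .
    then show "entire (\<lambda>z. fock_integrand \<phi> F z v)"
      unfolding fock_integrand_def by (intro entire_mult entire_const entire_exp entire_dotc)
  next
    fix z show "fock_integrand \<phi> F z \<in> borel_measurable lborel" using fock_integrand_measurable[OF E EF, of z] by simp
  next
    fix R :: real
    show "\<exists>h. integrable lborel h \<and> (\<forall>z v. norm (z::complex^'n) \<le> R \<longrightarrow> norm (fock_integrand \<phi> F z v) \<le> h v)"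
    proof (rule exI[of _ "\<lambda>v. C * exp (pi / 2 * R\<^sup>2) * norm (fock_weighted F v)"], intro conjI allI impI)
      show "integrable lborel (\<lambda>v. C * exp (pi / 2 * R\<^sup>2) * norm (fock_weighted F v))" by (intro integrable_mult_right Fi)
      fix z v :: "complex^'n" assume z: "norm z \<le> R"
      have "(norm z)\<^sup>2 \<le> R\<^sup>2" using z by (intro power_mono) auto
      then have "C * exp (pi / 2 * (norm z)\<^sup>2) * norm (fock_weighted F v) \<le> C * exp (pi / 2 * R\<^sup>2) * norm (fock_weighted F v)"
        using C by (intro mult_right_mono mult_left_mono) auto
      then show "norm (fock_integrand \<phi> F z v) \<le> C * exp (pi / 2 * R\<^sup>2) * norm (fock_weighted F v)" using b[of z v] by linarith
    qed
  qed
  have "norm (fock_integral_operator \<phi> F z) \<le> (C * (\<integral>v. norm (fock_weighted F v) \<partial>lborel)) * exp ((pi / 2) * (norm z)\<^sup>2)" for z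
  proof -
    have "norm (fock_integral_operator \<phi> F z) \<le> (\<integral>v. C * exp (pi / 2 * (norm z)\<^sup>2) * norm (fock_weighted F v) \<partial>lborel)"
      unfolding fock_integral_operator_def by (rule norm_integral_le[OF _ b]) (intro integrable_mult_right Fi)
    then show ?thesis unfolding integral_mult_right_zero by (simp only: mult_ac)
  qed
  then show "fock_integral_operator \<phi> F \<in> fock_space \<infinity>"
    unfolding mem_fock_space_infinity using ent[folded fock_integral_operator_def] by (auto simp: fock_integral_operator_def[abs_def])
qed

section \<open>Convolution in the Fock picture\<close>

lemma cnj_cvec: "cnj_vec (cvec x y) = cvec x (- y)"
  by (simp add: cnj_vec_def cvec_def vec_eq_iff complex_eq_iff)

lemma nn_integral_cnj:
  fixes f :: "complex^'n::finite \<Rightarrow> ennreal"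
  assumes [measurable]: "f \<in> borel_measurable borel"
  shows "(\<integral>\<^sup>+w. f (cnj_vec w) \<partial>lborel) = (\<integral>\<^sup>+w. f w \<partial>lborel)"
proof -
  have "(\<integral>\<^sup>+w. f (cnj_vec w) \<partial>lborel) = (\<integral>\<^sup>+x. \<integral>\<^sup>+y. f (cvec x (- y)) \<partial>lborel \<partial>lborel)"
    by (subst nn_integral_cvec') (simp_all add: cnj_cvec)
  also have "\<dots> = (\<integral>\<^sup>+x. \<integral>\<^sup>+y. f (cvec x y) \<partial>lborel \<partial>lborel)"
    by (intro nn_integral_cong nn_integral_uminus[where f="\<lambda>y. f (cvec _ y)"]) measurable
  also have "\<dots> = (\<integral>\<^sup>+w. f w \<partial>lborel)" by (rule nn_integral_cvec'[symmetric]) simp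
  finally show ?thesis .
qed

lemma distr_cnj: "distr lborel borel cnj_vec = (lborel :: (complex^'n::finite) measure)"
proof (rule measure_eqI)
  fix A :: "(complex^'n) set" assume "A \<in> sets (distr lborel borel cnj_vec)"
  then have [measurable]: "A \<in> sets borel" by simp
  have "emeasure (distr lborel borel cnj_vec) A = (\<integral>\<^sup>+z. indicator A (cnj_vec z) \<partial>lborel)"
    by (subst nn_integral_indicator[symmetric], simp, subst nn_integral_distr) auto
  also have "\<dots> = emeasure lborel A" by (subst nn_integral_cnj) auto
  finally show "emeasure (distr lborel borel cnj_vec) A = emeasure lborel A" .
qed simp

lemma integral_cnj:
  fixes f :: "complex^'n::finite \<Rightarrow> complex"
  assumes [measurable]: "f \<in> borel_measurable borel"
  shows "(\<integral>w. f (cnj_vec w) \<partial>lborel) = (\<integral>w. f w \<partial>lborel)"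
  using integral_distr[of cnj_vec lborel borel f] distr_cnj[where 'n='n] by simp

lemma nn_integral_reflect:
  fixes f :: "complex^'n::finite \<Rightarrow> ennreal"
  assumes [measurable]: "f \<in> borel_measurable borel"
  shows "(\<integral>\<^sup>+w. f (a - cnj_vec w) \<partial>lborel) = (\<integral>\<^sup>+w. f w \<partial>lborel)"
proof -
  have "(\<integral>\<^sup>+w. f (a - cnj_vec w) \<partial>lborel) = (\<integral>\<^sup>+w. f (a - w) \<partial>lborel)"
    by (rule nn_integral_cnj[of "\<lambda>w. f (a - w)"]) measurable
  also have "\<dots> = (\<integral>\<^sup>+w. f (w + a) \<partial>lborel)"
    using nn_integral_uminus[of "\<lambda>w. f (w + a)"] by simp
  also have "\<dots> = (\<integral>\<^sup>+w. f w \<partial>lborel)" by (rule nn_integral_lborel_translate) simp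
  finally show ?thesis .
qed

text \<open>The factor by which reflection, conjugation and translation by \<open>x\<close> act on the kernel of the Bargmann
  transform, see \<open>cnj_kf_reflect\<close>.\<close>

definition shift_factor :: "real^'n::finite \<Rightarrow> complex^'n \<Rightarrow> complex" where
  "shift_factor x w = exp (- of_real pi / 2 * of_real (x \<bullet> x) + of_real pi * dotc (of_real_vec x) (cnj_vec w))"

definition hker :: "(complex^'n::finite \<Rightarrow> complex) \<Rightarrow> (complex^'n \<Rightarrow> complex) \<Rightarrow> real^'n \<Rightarrow> complex^'n \<Rightarrow> complex" where
  "hker U F x w = U w * (shift_factor x w * F (of_real_vec x - cnj_vec w)) * gw w"

text \<open>The convolution as a function on \<open>real^'n\<close>, expressed through the Bargmann transforms \<open>U\<close> and \<open>F\<close> of its two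
  factors.\<close>

definition hconv :: "(complex^'n::finite \<Rightarrow> complex) \<Rightarrow> (complex^'n \<Rightarrow> complex) \<Rightarrow> real^'n \<Rightarrow> complex" where
  "hconv U F x = (\<integral>w. hker U F x w \<partial>lborel)"

lemma norm_shift_factor:
  "norm (shift_factor x w) * exp (pi / 2 * (norm (of_real_vec x - cnj_vec w))\<^sup>2) = exp (pi / 2 * (norm (w::complex^'n::finite))\<^sup>2)"
proof -
  have R: "Re (- of_real pi / 2 * of_real (x \<bullet> x) + of_real pi * dotc (of_real_vec x) (cnj_vec w)) = - pi / 2 * (x \<bullet> x) + pi * (x \<bullet> re_vec w)"
    by (simp add: Re_dotc)
  have "- pi / 2 * (x \<bullet> x) + pi * (x \<bullet> re_vec w) + pi / 2 * (norm (of_real_vec x - cnj_vec w))\<^sup>2 = pi / 2 * (norm w)\<^sup>2"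
    unfolding norm_sq_re_im by (simp add: inner_diff_left inner_diff_right inner_commute field_simps)
  then show ?thesis unfolding shift_factor_def norm_exp_eq_Re R mult_exp_exp by (rule arg_cong)
qed

lemma measurable_shift_factor [measurable (raw)]:
  fixes g :: "_ \<Rightarrow> complex^'n::finite"
  assumes [measurable]: "f \<in> borel_measurable M" "g \<in> borel_measurable M"
  shows "(\<lambda>x. shift_factor (f x) (g x)) \<in> borel_measurable M"
  unfolding shift_factor_def by measurable

lemma hker_bound:
  assumes U: "\<And>z. norm (U z) \<le> B * exp ((pi / 2) * (norm z)\<^sup>2)"
  shows "norm (hker U F x w) \<le> B * norm (fock_weighted F (of_real_vec x - cnj_vec w))"
proof -
  have "norm (hker U F x w) \<le> (B * exp ((pi / 2) * (norm w)\<^sup>2)) * (norm (shift_factor x w) * norm (F (of_real_vec x - cnj_vec w))) * exp (- pi * (norm w)\<^sup>2)"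
    unfolding hker_def norm_mult norm_gw by (intro mult_right_mono U) auto
  also have "\<dots> = B * norm (fock_weighted F (of_real_vec x - cnj_vec w)) * (exp ((pi / 2) * (norm w)\<^sup>2) * (norm (shift_factor x w) * exp (pi / 2 * (norm (of_real_vec x - cnj_vec w))\<^sup>2)) * exp (- pi * (norm w)\<^sup>2))"
    unfolding norm_eq_fock_weighted[of F] by (simp only: mult_ac)
  also have "\<dots> = B * norm (fock_weighted F (of_real_vec x - cnj_vec w))"
    unfolding norm_shift_factor by (simp add: mult_exp_exp)
  finally show ?thesis .
qed

lemma nn_fock_1:
  assumes "F \<in> fock_space 1"
  shows "(\<integral>\<^sup>+w. ennreal (norm (fock_weighted F w)) \<partial>lborel) = ennreal (fock_norm 1 F)"
  unfolding fock_norm_1 using assms by (intro nn_integral_eq_integral) (auto simp: mem_fock_space_1)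

lemma nn_hker_bound:
  assumes U: "\<And>z. norm (U z) \<le> B * exp ((pi / 2) * (norm z)\<^sup>2)" and F: "F \<in> fock_space 1"
  shows "(\<integral>\<^sup>+w. ennreal (norm (hker U F x w)) \<partial>lborel) \<le> ennreal (B * fock_norm 1 F)"
proof -
  note [measurable] = fock_weighted_measurable[OF fock_space_entire[OF F]]
  have B0: "B \<ge> 0" using order_trans[OF norm_ge_zero U[of 0]] by simp
  have "(\<integral>\<^sup>+w. ennreal (norm (hker U F x w)) \<partial>lborel) \<le> (\<integral>\<^sup>+w. ennreal B * ennreal (norm (fock_weighted F (of_real_vec x - cnj_vec w))) \<partial>lborel)"
    using hker_bound[OF U, of F x] B0 by (intro nn_integral_mono) (simp add: ennreal_mult[symmetric] ennreal_leI)
  also have "\<dots> = ennreal B * (\<integral>\<^sup>+w. ennreal (norm (fock_weighted F (of_real_vec x - cnj_vec w))) \<partial>lborel)"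
    by (rule nn_integral_cmult) measurable
  also have "\<dots> = ennreal B * ennreal (fock_norm 1 F)"
    using nn_integral_reflect[of "\<lambda>w. ennreal (norm (fock_weighted F w))" "of_real_vec x"] nn_fock_1[OF F] by simp
  also have "\<dots> = ennreal (B * fock_norm 1 F)" by (rule ennreal_mult[OF B0 fock_norm_nonneg, symmetric])
  finally show ?thesis .
qed

lemma hker_measurable:
  fixes U F :: "complex^'n::finite \<Rightarrow> complex"
  assumes "entire U" "entire F"
  shows "(\<lambda>p. hker U F (fst p) (snd p)) \<in> borel_measurable (borel \<Otimes>\<^sub>M borel)"
proof -
  note [measurable] = assms[THEN entire_measurable]
  show ?thesis unfolding hker_def by measurable
qed

lemma hconv_props:
  fixes U F :: "complex^'n::finite \<Rightarrow> complex"
  assumes EU: "entire U" and U: "\<And>z. norm (U z) \<le> B * exp ((pi / 2) * (norm z)\<^sup>2)" and F: "F \<in> fock_space 1"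
  shows "hconv U F \<in> borel_measurable borel" "norm (hconv U F x) \<le> B * fock_norm 1 F"
proof -
  have m: "(\<lambda>p. hker U F (fst p) (snd p)) \<in> borel_measurable (borel \<Otimes>\<^sub>M lborel)"
    using hker_measurable[OF EU fock_space_entire[OF F]] by (simp cong: measurable_cong_sets)
  show "hconv U F \<in> borel_measurable borel"
    unfolding hconv_def[abs_def] using lborel.borel_measurable_lebesgue_integral[of "hker U F" borel] m by (simp add: case_prod_unfold)
  have B0: "B \<ge> 0" using order_trans[OF norm_ge_zero U[of 0]] by simp
  have i: "integrable lborel (hker U F x)"
  proof (rule integrableI_bounded)
    show "hker U F x \<in> borel_measurable lborel" using measurable_compose[OF _ m, of "\<lambda>w. (x, w)" lborel] by simp
    show "(\<integral>\<^sup>+w. ennreal (norm (hker U F x w)) \<partial>lborel) < \<infinity>"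
      using nn_hker_bound[OF U F, of x] by (simp add: order_le_less_trans)
  qed
  have "ennreal (norm (hconv U F x)) \<le> ennreal (B * fock_norm 1 F)"
    unfolding hconv_def by (rule order_trans[OF integral_norm_bound_ennreal[OF i] nn_hker_bound[OF U F]])
  then show "norm (hconv U F x) \<le> B * fock_norm 1 F"
    using B0 fock_norm_nonneg[of 1 F] by (simp add: ennreal_le_iff)
qed

lemma cnj_kf_reflect: "cnj (kf z (x - t)) = shift_factor x z * kf (of_real_vec x - cnj_vec z) (t :: real^'n::finite)"
proof -
  let ?c = "of_real (2 powr (real CARD('n) / 4)) :: complex"
  have 1: "cnj (kf z (x - t)) = ?c * exp (- of_real pi / 2 * dotc (cnj_vec z) (cnj_vec z) + (- of_real pi * of_real ((x - t) \<bullet> (x - t)) + of_real pi * dotc (of_real_vec (x - t)) (2 *s cnj_vec z)))"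
    unfolding kf_def gker_def complex_cnj_mult exp_cnj[symmetric] exp_add by (simp add: cnj_dotc exp_cnj)
  have 2: "shift_factor x z * kf (of_real_vec x - cnj_vec z) t = ?c * exp ((- of_real pi / 2 * of_real (x \<bullet> x) + of_real pi * dotc (of_real_vec x) (cnj_vec z)) + (- of_real pi / 2 * dotc (of_real_vec x - cnj_vec z) (of_real_vec x - cnj_vec z) + (- of_real pi * 1 * of_real (t \<bullet> t) + of_real pi * dotc (of_real_vec t) (2 *s (of_real_vec x - cnj_vec z)))))"
    unfolding shift_factor_def kf_def gker_def exp_add by (simp only: mult_ac)
  have 3: "- of_real pi / 2 * dotc (cnj_vec z) (cnj_vec z) + (- of_real pi * of_real ((x - t) \<bullet> (x - t)) + of_real pi * dotc (of_real_vec (x - t)) (2 *s cnj_vec z)) =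
     (- of_real pi / 2 * of_real (x \<bullet> x) + of_real pi * dotc (of_real_vec x) (cnj_vec z)) + (- of_real pi / 2 * dotc (of_real_vec x - cnj_vec z) (of_real_vec x - cnj_vec z) + (- of_real pi * 1 * of_real (t \<bullet> t) + of_real pi * dotc (of_real_vec t) (2 *s (of_real_vec x - cnj_vec z))))"
    by (simp add: dotc_commute[of "cnj_vec z" "of_real_vec x"] inner_diff_left inner_diff_right inner_commute field_simps)
  show ?thesis unfolding 1 2 3 ..
qed

text \<open>In the product of the two short-time Fourier transforms the phases cancel, the weights combine to the
  Gaussian density, and reflection and conjugation act on the Bargmann transform by \<open>w \<mapsto> x - cnj w\<close>.\<close>

lemma modulation_pairing_hconv:
  fixes u f :: "'n::finite functional"
  assumes u: "u \<in> tempered_distributions" and f: "f \<in> tempered_distributions"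
  shows "modulation_pairing u (reflect_conj_shift x f) = hconv (bargmann u) (bargmann f) x"
proof -
  define r where "r = reflect_conj_shift x f"
  have fk: "f (\<lambda>t. c * kf z t) = c * bargmann f z" for c z
    unfolding bargmann_def by (rule temperedD(2)[OF f kf_schwartz])
  have rc: "r (\<lambda>t. c * kf z t) = c * cnj (shift_factor x z * bargmann f (of_real_vec x - cnj_vec z))" for c z
    unfolding r_def reflect_conj_shift_def complex_cnj_mult cnj_kf_reflect mult.assoc[symmetric] fk by simp
  have r1: "bargmann r z = cnj (shift_factor x z * bargmann f (of_real_vec x - cnj_vec z))" for z
    using rc[of 1 z] by (simp add: bargmann_def)
  have rh: "r (\<lambda>t. c * kf z t) = c * r (kf z)" for c z
    using rc[of c z] rc[of 1 z] by simp
  let ?G = "hker (bargmann u) (bargmann f) x"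
  note [measurable] = bargmann_entire[OF u, THEN entire_measurable] bargmann_entire[OF f, THEN entire_measurable]
  have Gm [measurable]: "?G \<in> borel_measurable borel" unfolding hker_def by measurable
  have "stft u p * cnj (stft r p) = ?G (cvec (fst p) (- snd p))" for p
  proof -
    let ?z = "cvec (fst p) (- snd p)"
    let ?\<theta> = "exp (- of_real pi * \<i> * of_real (fst p \<bullet> snd p))"
    have s: "stft u p = ?\<theta> * fock_weighted (bargmann u) ?z" "stft r p = ?\<theta> * fock_weighted (bargmann r) ?z"
      using stft_bargmann[of u "fst p" "snd p", OF temperedD(2)[OF u kf_schwartz]] stft_bargmann[of r "fst p" "snd p", OF rh] by simp_all
    have "?\<theta> * cnj ?\<theta> = 1" by (simp add: exp_cnj mult_exp_exp)
    moreover have "\<theta> * a * (cnj \<theta> * b) = (\<theta> * cnj \<theta>) * (a * b)" for \<theta> a b :: complex by (simp only: mult_ac)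
    ultimately have "stft u p * cnj (stft r p) = fock_weighted (bargmann u) ?z * cnj (fock_weighted (bargmann r) ?z)"
      unfolding s complex_cnj_mult by (simp only: mult_1)
    also have "\<dots> = bargmann u ?z * cnj (bargmann r ?z) * (of_real (exp (- pi * (norm ?z)\<^sup>2 / 2)) * of_real (exp (- pi * (norm ?z)\<^sup>2 / 2)))"
      by (simp add: fock_weighted_def)
    also have "of_real (exp (- pi * (norm ?z)\<^sup>2 / 2)) * of_real (exp (- pi * (norm ?z)\<^sup>2 / 2)) = gw ?z"
      unfolding gw_def of_real_mult[symmetric] mult_exp_exp by simp
    finally show ?thesis unfolding r1 hker_def by simp
  qed
  then have "modulation_pairing u r = (\<integral>p. ?G (cvec (fst p) (- snd p)) \<partial>lborel)" unfolding modulation_pairing_def by (simp only:)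
  also have "\<dots> = (\<integral>w. ?G w \<partial>distr lborel borel (\<lambda>p. cvec (fst p) (- snd p)))" by (simp add: integral_distr)
  also have "\<dots> = hconv (bargmann u) (bargmann f) x" unfolding lborel_iota hconv_def ..
  finally show ?thesis unfolding r_def .
qed

text \<open>A Gaussian integral, the case of \<open>fbarg_hconv\<close> in which \<open>F\<close> is a reproducing kernel and \<open>U\<close> is replaced by a point mass.\<close>

lemma hconv_kernel_integral:
  fixes z w v :: "complex^'n::finite"
  shows "(\<integral>x. shift_factor x w * exp (of_real pi * dotc v (of_real_vec x - cnj_vec w)) * kf z x \<partial>lborel)
    = exp (of_real pi * dotc v z) * fbarg (gker (1 / 2) (z - v)) (cnj_vec w)"
proof -
  let ?W = "cnj_vec w"
  let ?c = "2 powr (real CARD('n) / 4)"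
  let ?A = "- of_real pi * dotc v ?W - of_real pi / 2 * dotc z z"
  let ?s = "?W + v + 2 *s z"
  have e: "shift_factor x w * exp (of_real pi * dotc v (of_real_vec x - ?W)) * kf z x = (of_real ?c * exp ?A) * gker (of_real (3 / 2)) ?s x" for x
  proof -
    have x: "((- of_real pi / 2 * of_real (x \<bullet> x) + of_real pi * dotc (of_real_vec x) ?W) + of_real pi * dotc v (of_real_vec x - ?W)) + (- of_real pi / 2 * dotc z z + (- of_real pi * 1 * of_real (x \<bullet> x) + of_real pi * dotc (of_real_vec x) (2 *s z)))
      = ?A + (- of_real pi * of_real (3 / 2) * of_real (x \<bullet> x) + of_real pi * dotc (of_real_vec x) ?s)"
      by (simp add: dotc_commute[of v "of_real_vec x"] field_simps)
    have "shift_factor x w * exp (of_real pi * dotc v (of_real_vec x - ?W)) * kf z x = of_real ?c * exp (((- of_real pi / 2 * of_real (x \<bullet> x) + of_real pi * dotc (of_real_vec x) ?W) + of_real pi * dotc v (of_real_vec x - ?W)) + (- of_real pi / 2 * dotc z z + (- of_real pi * 1 * of_real (x \<bullet> x) + of_real pi * dotc (of_real_vec x) (2 *s z))))"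
      unfolding shift_factor_def kf_def gker_def exp_add by (simp only: mult_ac)
    also have "\<dots> = of_real ?c * (exp ?A * gker (of_real (3 / 2)) ?s x)" unfolding x exp_add gker_def by (rule refl)
    finally show ?thesis by (simp only: mult.assoc)
  qed
  have "(\<integral>x. shift_factor x w * exp (of_real pi * dotc v (of_real_vec x - ?W)) * kf z x \<partial>lborel) = (of_real ?c * exp ?A) * (of_real ((1 / sqrt (3 / 2)) ^ CARD('n)) * exp (of_real pi * dotc ?s ?s / (4 * of_real (3 / 2))))"
    unfolding e integral_mult_right_zero by (subst gker_integral) simp_all
  also have "\<dots> = of_real (?c * (1 / sqrt (3 / 2)) ^ CARD('n)) * exp (?A + of_real pi * dotc ?s ?s / (4 * of_real (3 / 2)))"
    unfolding exp_add of_real_mult by (simp only: mult_ac)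
  finally have 1: "(\<integral>x. shift_factor x w * exp (of_real pi * dotc v (of_real_vec x - ?W)) * kf z x \<partial>lborel) = of_real (?c * (1 / sqrt (3 / 2)) ^ CARD('n)) * exp (?A + of_real pi * dotc ?s ?s / (4 * of_real (3 / 2)))" .
  let ?t = "z - v + 2 *s ?W"
  have 2: "fbarg (gker (1 / 2) (z - v)) ?W = of_real (?c * (1 / sqrt (3 / 2)) ^ CARD('n)) * exp (- of_real pi / 2 * dotc ?W ?W + of_real pi * dotc ?t ?t / (4 * of_real (3 / 2)))"
    using fbarg_gker[of "1 / 2" "z - v" ?W] by simp
  have 3: "?A + of_real pi * dotc ?s ?s / (4 * of_real (3 / 2)) = of_real pi * dotc v z + (- of_real pi / 2 * dotc ?W ?W + of_real pi * dotc ?t ?t / (4 * of_real (3 / 2)))"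
    by (simp add: dotc_commute[of v z] dotc_commute[of ?W z] dotc_commute[of ?W v] field_simps)
  show ?thesis unfolding 1 2 3 exp_add by (simp only: mult_ac)
qed

lemma fbarg_hconv_inner:
  fixes F :: "complex^'n::finite \<Rightarrow> complex"
  assumes F: "F \<in> fock_space 1"
  shows "(\<integral>x. shift_factor x w * F (of_real_vec x - cnj_vec w) * kf z x \<partial>lborel)
    = (\<integral>v. F v * gw v * (exp (of_real pi * dotc (cnj_vec v) z) * fbarg (gker (1 / 2) (z - cnj_vec v)) (cnj_vec w)) \<partial>lborel)"
proof -
  have E: "entire F" by (rule fock_space_entire[OF F])
  note [measurable] = entire_measurable[OF E] fock_weighted_measurable[OF E]
  let ?f = "\<lambda>x v. shift_factor x w * (F v * exp (of_real pi * dotc (cnj_vec v) (of_real_vec x - cnj_vec w)) * gw v) * kf z x"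
  have ri: "integrable lborel (\<lambda>v. F v * exp (of_real pi * dotc (cnj_vec v) y) * gw v)" for y
    by (rule fock_repr_integrable[OF _ _ F]) auto
  have "shift_factor x w * F (of_real_vec x - cnj_vec w) * kf z x = (\<integral>v. ?f x v \<partial>lborel)" for x
    unfolding integral_mult_left_zero integral_mult_right_zero reproducing[OF E ri[of "of_real_vec x - cnj_vec w"]] ..
  then have "(\<integral>x. shift_factor x w * F (of_real_vec x - cnj_vec w) * kf z x \<partial>lborel) = (\<integral>x. \<integral>v. ?f x v \<partial>lborel \<partial>lborel)" by (simp only:)
  also have "\<dots> = (\<integral>v. \<integral>x. ?f x v \<partial>lborel \<partial>lborel)"
  proof (rule Fubini_lborel(1))
    show "(\<lambda>p. ?f (fst p) (snd p)) \<in> borel_measurable (borel \<Otimes>\<^sub>M borel)" by measurable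
    let ?D = "exp (pi / 2 * (norm w)\<^sup>2)"
    have le: "norm (?f x v) \<le> norm (fock_weighted F v) * (?D * norm (kf z x))" for x v
    proof -
      let ?y = "of_real_vec x - cnj_vec w"
      have "norm (?f x v) = norm (shift_factor x w) * (norm (fock_weighted F v) * exp (- (pi / 2) * (norm (v - ?y))\<^sup>2) * exp ((pi / 2) * (norm ?y)\<^sup>2)) * norm (kf z x)"
        unfolding norm_mult[of "_ * _" "kf z x"] norm_mult[of "shift_factor x w"] norm_repr_integrand ..
      also have "\<dots> = norm (fock_weighted F v) * (exp (- (pi / 2) * (norm (v - ?y))\<^sup>2) * ((norm (shift_factor x w) * exp (pi / 2 * (norm ?y)\<^sup>2)) * norm (kf z x)))"
        by (simp only: mult_ac)
      also have "\<dots> \<le> norm (fock_weighted F v) * (1 * ((norm (shift_factor x w) * exp (pi / 2 * (norm ?y)\<^sup>2)) * norm (kf z x)))"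
        by (intro mult_left_mono mult_right_mono) auto
      finally show ?thesis unfolding norm_shift_factor by simp
    qed
    have "(\<integral>\<^sup>+x. \<integral>\<^sup>+v. ennreal (norm (?f x v)) \<partial>lborel \<partial>lborel) \<le> (\<integral>\<^sup>+x. \<integral>\<^sup>+v. ennreal (norm (fock_weighted F v)) * ennreal (?D * norm (kf z x)) \<partial>lborel \<partial>lborel)"
      by (intro nn_integral_mono) (simp only: ennreal_mult[symmetric] norm_ge_zero exp_ge_zero mult_nonneg_nonneg ennreal_leI[OF le])
    also have "\<dots> = (\<integral>\<^sup>+x. ennreal (fock_norm 1 F) * ennreal (?D * norm (kf z x)) \<partial>lborel)"
      by (intro nn_integral_cong) (subst nn_integral_multc, auto simp: nn_fock_1[OF F])
    also have "\<dots> = ennreal (fock_norm 1 F) * (\<integral>\<^sup>+x. ennreal ?D * ennreal (norm (kf z x)) \<partial>lborel)"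
      by (subst nn_integral_cmult[symmetric]) (auto simp: ennreal_mult)
    also have "\<dots> = ennreal (fock_norm 1 F) * (ennreal ?D * (\<integral>\<^sup>+x. ennreal (norm (kf z x)) \<partial>lborel))"
      by (subst nn_integral_cmult) auto
    also have "\<dots> < \<infinity>" unfolding nn_integral_kf by (simp add: ennreal_mult_less_top)
    finally show "(\<integral>\<^sup>+x. \<integral>\<^sup>+v. ennreal (norm (?f x v)) \<partial>lborel \<partial>lborel) < \<infinity>" .
  qed
  also have "\<dots> = (\<integral>v. F v * gw v * (exp (of_real pi * dotc (cnj_vec v) z) * fbarg (gker (1 / 2) (z - cnj_vec v)) (cnj_vec w)) \<partial>lborel)"
  proof (rule Bochner_Integration.integral_cong[OF refl])
    fix v :: "complex^'n"
    have "(\<integral>x. ?f x v \<partial>lborel) = (\<integral>x. (F v * gw v) * (shift_factor x w * exp (of_real pi * dotc (cnj_vec v) (of_real_vec x - cnj_vec w)) * kf z x) \<partial>lborel)"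
      by (simp only: mult_ac)
    also have "\<dots> = F v * gw v * (exp (of_real pi * dotc (cnj_vec v) z) * fbarg (gker (1 / 2) (z - cnj_vec v)) (cnj_vec w))"
      unfolding integral_mult_right_zero hconv_kernel_integral ..
    finally show "(\<integral>x. ?f x v \<partial>lborel) = F v * gw v * (exp (of_real pi * dotc (cnj_vec v) z) * fbarg (gker (1 / 2) (z - cnj_vec v)) (cnj_vec w))" .
  qed
  finally show ?thesis .
qed

text \<open>Expand \<open>F\<close> by the reproducing formula, so that the integral over \<open>x\<close> becomes the Gaussian one of
  \<open>hconv_kernel_integral\<close>; the remaining integral over \<open>w\<close> is the value of \<open>synth U\<close> on a Gaussian. The
  orders of integration are exchanged in pairs, and the integral over \<open>x\<close> is evaluated before \<open>w\<close> and \<open>v\<close> are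
  exchanged, so that each step has a simple dominating function.\<close>

lemma fbarg_hconv:
  fixes U F :: "complex^'n::finite \<Rightarrow> complex"
  assumes U: "U \<in> fock_space \<infinity>" and F: "F \<in> fock_space 1"
  shows "fbarg (hconv U F) z = fock_integral_operator (\<lambda>\<zeta>. synth U (gker (1 / 2) (- \<zeta>))) F z"
proof -
  obtain B where B: "\<And>z. norm (U z) \<le> B * exp ((pi / 2) * (norm z)\<^sup>2)" and EU: "entire U"
    using U unfolding mem_fock_space_infinity by blast
  have B0: "B \<ge> 0" using order_trans[OF norm_ge_zero B[of 0]] by simp
  have EF: "entire F" by (rule fock_space_entire[OF F])
  note [measurable] = entire_measurable[OF EU] entire_measurable[OF EF] fock_weighted_measurable[OF EF]
  let ?N = "fock_norm 1 F"
  let ?fb = "\<lambda>w v. fbarg (gker (1 / 2) (z - cnj_vec v)) (cnj_vec w)"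
  let ?g = "\<lambda>w v. U w * gw w * (F v * gw v * (exp (of_real pi * dotc (cnj_vec v) z) * ?fb w v))"
  have "fbarg (hconv U F) z = (\<integral>x. \<integral>w. hker U F x w * kf z x \<partial>lborel \<partial>lborel)"
    unfolding fbarg_def hconv_def integral_mult_left_zero ..
  also have "\<dots> = (\<integral>w. \<integral>x. hker U F x w * kf z x \<partial>lborel \<partial>lborel)"
  proof (rule Fubini_lborel(1))
    show "(\<lambda>p. hker U F (fst p) (snd p) * kf z (fst p)) \<in> borel_measurable (borel \<Otimes>\<^sub>M borel)"
      using hker_measurable[OF EU EF] by measurable
    have hm: "hker U F x \<in> borel_measurable lborel" for x unfolding hker_def by measurable
    have "(\<integral>\<^sup>+x. \<integral>\<^sup>+w. ennreal (norm (hker U F x w * kf z x)) \<partial>lborel \<partial>lborel) = (\<integral>\<^sup>+x. (\<integral>\<^sup>+w. ennreal (norm (hker U F x w)) \<partial>lborel) * ennreal (norm (kf z x)) \<partial>lborel)"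
      unfolding norm_mult using hm by (intro nn_integral_cong) (subst nn_integral_multc[symmetric], auto simp: ennreal_mult)
    also have "\<dots> \<le> (\<integral>\<^sup>+x. ennreal (B * ?N) * ennreal (norm (kf z x)) \<partial>lborel)"
      by (intro nn_integral_mono mult_right_mono nn_hker_bound[OF B F]) auto
    also have "\<dots> = ennreal (B * ?N) * (\<integral>\<^sup>+x. ennreal (norm (kf z x)) \<partial>lborel)" by (rule nn_integral_cmult) measurable
    also have "\<dots> < \<infinity>" unfolding nn_integral_kf by (simp add: ennreal_mult_less_top)
    finally show "(\<integral>\<^sup>+x. \<integral>\<^sup>+w. ennreal (norm (hker U F x w * kf z x)) \<partial>lborel \<partial>lborel) < \<infinity>" .
  qed
  also have "\<dots> = (\<integral>w. \<integral>v. ?g w v \<partial>lborel \<partial>lborel)"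
  proof (rule Bochner_Integration.integral_cong[OF refl])
    fix w :: "complex^'n"
    have "(\<integral>x. hker U F x w * kf z x \<partial>lborel) = (\<integral>x. (U w * gw w) * (shift_factor x w * F (of_real_vec x - cnj_vec w) * kf z x) \<partial>lborel)"
      unfolding hker_def by (simp only: mult_ac)
    also have "\<dots> = (\<integral>v. ?g w v \<partial>lborel)"
      unfolding integral_mult_right_zero fbarg_hconv_inner[OF F] ..
    finally show "(\<integral>x. hker U F x w * kf z x \<partial>lborel) = (\<integral>v. ?g w v \<partial>lborel)" .
  qed
  also have "\<dots> = (\<integral>v. \<integral>w. ?g w v \<partial>lborel \<partial>lborel)"
  proof (rule Fubini_lborel(1)[symmetric])
    have fm: "(\<lambda>p. ?fb (snd p) (fst p)) \<in> borel_measurable (borel \<Otimes>\<^sub>M borel)"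
    proof -
      have "?fb w v = of_real (2 powr (real CARD('n) / 4) * (1 / sqrt (1 / 2 + 1)) ^ CARD('n)) * exp (- of_real pi / 2 * dotc (cnj_vec w) (cnj_vec w)
         + of_real pi * dotc ((z - cnj_vec v) + 2 *s cnj_vec w) ((z - cnj_vec v) + 2 *s cnj_vec w) / (4 * of_real (1 / 2 + 1)))" for w v
        using fbarg_gker[of "1/2" "z - cnj_vec v" "cnj_vec w"] by simp
      then show ?thesis by (simp only:) measurable
    qed
    then show "(\<lambda>p. ?g (snd p) (fst p)) \<in> borel_measurable (borel \<Otimes>\<^sub>M borel)" by measurable
    let ?C = "2 powr (real CARD('n) / 4) * (1 / sqrt (3 / 2)) ^ CARD('n)"
    let ?D = "(1 / sqrt (1 / 3)) ^ DIM(complex^'n)"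
    let ?k = "B * ?C * ?D * exp (pi / 2 * (norm z)\<^sup>2)"
    have in1: "(\<integral>\<^sup>+w. ennreal (norm (?g w v)) \<partial>lborel) \<le> ennreal ?k * ennreal (norm (fock_weighted F v))" for v
    proof -
      let ?a = "norm (F v) * (exp (- pi * (norm v)\<^sup>2) * norm (exp (of_real pi * dotc (cnj_vec v) z)))"
      let ?h = "\<lambda>w. U w * ?fb w v * gw w"
      have fv [measurable]: "(\<lambda>w. ?fb w v) \<in> borel_measurable borel"
        using measurable_compose[OF _ fm, of "\<lambda>w. (v, w)" borel] by simp
      have "norm (?g w v) = ?a * norm (?h w)" for w unfolding norm_mult norm_gw[of v] by (simp only: mult_ac)
      then have "(\<integral>\<^sup>+w. ennreal (norm (?g w v)) \<partial>lborel) = (\<integral>\<^sup>+w. ennreal ?a * ennreal (norm (?h w)) \<partial>lborel)"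
        by (simp only: ennreal_mult[symmetric] norm_ge_zero exp_ge_zero mult_nonneg_nonneg)
      also have "\<dots> = ennreal ?a * (\<integral>\<^sup>+w. ennreal (norm (?h w)) \<partial>lborel)"
        by (rule nn_integral_cmult) measurable
      also have "\<dots> \<le> ennreal ?a * ennreal (B * ?C * exp (pi / 2 * (norm (re_vec (z - cnj_vec v)))\<^sup>2) * ?D)"
        by (intro mult_left_mono symbol_kernel_bound[OF B]) auto
      also have "\<dots> = ennreal (?a * (B * ?C * exp (pi / 2 * (norm (re_vec (z - cnj_vec v)))\<^sup>2) * ?D))"
        by (rule ennreal_mult[symmetric]) (use B0 in auto)
      also have "\<dots> \<le> ennreal (?k * norm (fock_weighted F v))"
      proof (rule ennreal_leI)
        have n: "norm (re_vec (z - cnj_vec v)) = norm (re_vec (cnj_vec v - z))" by (simp add: norm_minus_commute)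
        have "?a * (B * ?C * exp (pi / 2 * (norm (re_vec (z - cnj_vec v)))\<^sup>2) * ?D) = (norm (F v) * (B * ?C * ?D)) * (norm (exp (of_real pi * dotc (cnj_vec v) z)) * exp (pi / 2 * (norm (re_vec (cnj_vec v - z)))\<^sup>2) * exp (- pi * (norm v)\<^sup>2))"
          unfolding n by (simp only: mult_ac)
        also have "\<dots> \<le> (norm (F v) * (B * ?C * ?D)) * (exp (pi / 2 * (norm z)\<^sup>2) * exp (- (pi / 2) * (norm v)\<^sup>2))"
          using B0 by (intro mult_left_mono exp_symbol_bound) auto
        also have "\<dots> = ?k * norm (fock_weighted F v)" unfolding norm_fock_weighted by (simp only: mult_ac)
        finally show "?a * (B * ?C * exp (pi / 2 * (norm (re_vec (z - cnj_vec v)))\<^sup>2) * ?D) \<le> ?k * norm (fock_weighted F v)" .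
      qed
      also have "\<dots> = ennreal ?k * ennreal (norm (fock_weighted F v))" by (rule ennreal_mult) (use B0 in auto)
      finally show ?thesis .
    qed
    have "(\<integral>\<^sup>+v. \<integral>\<^sup>+w. ennreal (norm (?g w v)) \<partial>lborel \<partial>lborel) \<le> (\<integral>\<^sup>+v. ennreal ?k * ennreal (norm (fock_weighted F v)) \<partial>lborel)"
      by (intro nn_integral_mono in1)
    also have "\<dots> = ennreal ?k * ennreal ?N" by (subst nn_integral_cmult) (auto simp: nn_fock_1[OF F])
    also have "\<dots> < \<infinity>" by (simp add: ennreal_mult_less_top)
    finally show "(\<integral>\<^sup>+v. \<integral>\<^sup>+w. ennreal (norm (?g w v)) \<partial>lborel \<partial>lborel) < \<infinity>" .
  qed
  also have "\<dots> = (\<integral>v. fock_integrand (\<lambda>\<zeta>. synth U (gker (1 / 2) (- \<zeta>))) F z v \<partial>lborel)"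
  proof (rule Bochner_Integration.integral_cong[OF refl])
    fix v :: "complex^'n"
    have "(\<integral>w. ?g w v \<partial>lborel) = (\<integral>w. (F v * exp (of_real pi * dotc (cnj_vec v) z) * gw v) * (U w * ?fb w v * gw w) \<partial>lborel)"
      by (simp only: mult_ac)
    also have "\<dots> = (F v * exp (of_real pi * dotc (cnj_vec v) z) * gw v) * synth U (gker (1 / 2) (z - cnj_vec v))"
      unfolding integral_mult_right_zero synth_def by (simp add: gker_half_schwartz)
    also have "\<dots> = fock_integrand (\<lambda>\<zeta>. synth U (gker (1 / 2) (- \<zeta>))) F z v"
      unfolding fock_integrand_def gw_def[symmetric] minus_diff_eq by (simp only: mult_ac)
    finally show "(\<integral>w. ?g w v \<partial>lborel) = fock_integrand (\<lambda>\<zeta>. synth U (gker (1 / 2) (- \<zeta>))) F z v" .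
  qed
  finally show ?thesis unfolding fock_integral_operator_def .
qed

section \<open>Inversion on Schwartz functions\<close>

lemma integral_affine:
  fixes f :: "'a::euclidean_space \<Rightarrow> complex"
  assumes [measurable]: "f \<in> borel_measurable borel" and s: "s > 0"
  shows "(\<integral>y. f y \<partial>lborel) = of_real (s ^ DIM('a)) * (\<integral>t. f (x + s *\<^sub>R t) \<partial>lborel)"
proof -
  have "(\<integral>y. f y \<partial>lborel) = (\<integral>y. f y \<partial>density (distr lborel borel (\<lambda>t. x + s *\<^sub>R t)) (\<lambda>_. ennreal (s ^ DIM('a))))"
    using lborel_affine[of s x] s by simp
  also have "\<dots> = (\<integral>y. s ^ DIM('a) *\<^sub>R f y \<partial>distr lborel borel (\<lambda>t. x + s *\<^sub>R t))"
    using s by (subst integral_density) auto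
  also have "\<dots> = (\<integral>t. s ^ DIM('a) *\<^sub>R f (x + s *\<^sub>R t) \<partial>lborel)"
    by (subst integral_distr) auto
  finally show ?thesis by (simp add: scaleR_conv_of_real)
qed

text \<open>The hypothesis says that the Fourier transform of \<open>h\<close> times a Gaussian vanishes. Integrating it against
  Gaussians in \<open>\<tau>\<close> centred in phase at \<open>x\<close> produces averages of that function around \<open>x\<close> over scale \<open>s\<close>, which tend to its
  value at \<open>x\<close> as \<open>s\<close> tends to \<open>0\<close>.\<close>

lemma gaussian_transform_injective:
  fixes h :: "real^'n::finite \<Rightarrow> complex"
  assumes a: "a > 0" and hc: "continuous_on UNIV h" and hb: "\<And>y. norm (h y) \<le> B"
    and zero: "\<And>\<tau>. (\<integral>y. h y * gker (of_real a) (\<i> *s of_real_vec \<tau>) y \<partial>lborel) = 0"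
  shows "h x = 0"
proof -
  have [measurable]: "h \<in> borel_measurable borel" by (rule borel_measurable_continuous_onI[OF hc])
  have B0: "B \<ge> 0" using order_trans[OF norm_ge_zero hb[of 0]] .
  define k where "k y = h y * of_real (exp (- pi * a * (norm y)\<^sup>2))" for y
  have kb: "norm (k y) \<le> B" for y
  proof -
    have "norm (k y) \<le> B * 1" unfolding k_def norm_mult using a B0 by (intro mult_mono hb) auto
    then show ?thesis by simp
  qed
  have kc: "continuous_on UNIV k" unfolding k_def by (intro continuous_intros hc)
  have [measurable]: "k \<in> borel_measurable borel" by (rule borel_measurable_continuous_onI[OF kc])
  have z: "(\<integral>t. k (x + s *\<^sub>R t) * of_real (exp (- pi * (norm t)\<^sup>2)) \<partial>lborel) = 0" if s: "s > 0" for s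
  proof -
    let ?v = "\<lambda>\<tau> y. h y * gker (of_real a) (\<i> *s of_real_vec \<tau>) y * gker (of_real (s\<^sup>2 / 4)) (- (\<i> *s of_real_vec x)) \<tau>"
    have s2: "s\<^sup>2 / 4 > 0" using s by simp
    have "0 = (\<integral>\<tau>. (\<integral>y. ?v \<tau> y \<partial>lborel) \<partial>lborel)" unfolding integral_mult_left_zero zero by simp
    also have "\<dots> = (\<integral>y. (\<integral>\<tau>. ?v \<tau> y \<partial>lborel) \<partial>lborel)"
    proof (rule Fubini_lborel(1))
      show "(\<lambda>p. ?v (fst p) (snd p)) \<in> borel_measurable (borel \<Otimes>\<^sub>M borel)" by measurable
      have le: "norm (?v \<tau> y) \<le> (B * exp (- pi * a * (norm y)\<^sup>2)) * exp (- pi * (s\<^sup>2 / 4) * (norm \<tau>)\<^sup>2)" for \<tau> y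
      proof -
        have "norm (?v \<tau> y) = norm (h y) * exp (- pi * a * (norm y)\<^sup>2) * exp (- pi * (s\<^sup>2 / 4) * (norm \<tau>)\<^sup>2)"
          by (simp add: norm_mult norm_gker)
        also have "\<dots> \<le> (B * exp (- pi * a * (norm y)\<^sup>2)) * exp (- pi * (s\<^sup>2 / 4) * (norm \<tau>)\<^sup>2)"
          by (intro mult_right_mono hb) auto
        finally show ?thesis .
      qed
      have "(\<integral>\<^sup>+\<tau>. \<integral>\<^sup>+y. ennreal (norm (?v \<tau> y)) \<partial>lborel \<partial>lborel) \<le> (\<integral>\<^sup>+\<tau>. \<integral>\<^sup>+y. (ennreal B * ennreal (exp (- pi * a * (norm (y::real^'n))\<^sup>2))) * ennreal (exp (- pi * (s\<^sup>2 / 4) * (norm (\<tau>::real^'n))\<^sup>2)) \<partial>lborel \<partial>lborel)"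
        using B0 by (intro nn_integral_mono) (simp only: ennreal_mult[symmetric] exp_ge_zero mult_nonneg_nonneg ennreal_leI[OF le])
      also have "\<dots> = (\<integral>\<^sup>+\<tau>. (ennreal B * ennreal ((1 / sqrt a) ^ DIM(real^'n))) * ennreal (exp (- pi * (s\<^sup>2 / 4) * (norm (\<tau>::real^'n))\<^sup>2)) \<partial>lborel)"
        by (intro nn_integral_cong) (subst nn_integral_multc, measurable, subst nn_integral_cmult, measurable, simp only: nn_gauss[OF a])
      also have "\<dots> = (ennreal B * ennreal ((1 / sqrt a) ^ DIM(real^'n))) * ennreal ((1 / sqrt (s\<^sup>2 / 4)) ^ DIM(real^'n))"
        by (subst nn_integral_cmult, measurable, simp only: nn_gauss[OF s2])
      also have "\<dots> < \<infinity>" by (simp add: ennreal_mult_less_top)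
      finally show "(\<integral>\<^sup>+\<tau>. \<integral>\<^sup>+y. ennreal (norm (?v \<tau> y)) \<partial>lborel \<partial>lborel) < \<infinity>" .
    qed
    also have "\<dots> = (\<integral>y. of_real ((1 / sqrt (s\<^sup>2 / 4)) ^ CARD('n)) * (k y * of_real (exp (- pi * (norm (y - x))\<^sup>2 / s\<^sup>2))) \<partial>lborel)"
    proof (rule Bochner_Integration.integral_cong[OF refl])
      fix y :: "real^'n"
      have "?v \<tau> y = k y * gker (of_real (s\<^sup>2 / 4)) (\<i> *s of_real_vec (y - x)) \<tau>" for \<tau>
      proof -
        have e: "gker (of_real a) (\<i> *s of_real_vec \<tau>) y = of_real (exp (- pi * a * (norm y)\<^sup>2)) * exp (of_real pi * dotc (of_real_vec \<tau>) (\<i> *s of_real_vec y))"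
          unfolding gker_def exp_add power2_norm_eq_inner exp_of_real[symmetric] by (simp add: inner_commute)
        have e2: "exp (of_real pi * dotc (of_real_vec \<tau>) (\<i> *s of_real_vec y)) * gker (of_real (s\<^sup>2 / 4)) (- (\<i> *s of_real_vec x)) \<tau> = gker (of_real (s\<^sup>2 / 4)) (\<i> *s of_real_vec (y - x)) \<tau>"
          unfolding gker_def mult_exp_exp by (rule arg_cong[where f=exp]) (simp add: inner_diff_right algebra_simps)
        show ?thesis unfolding e k_def e2[symmetric] by (simp only: mult_ac)
      qed
      then have "(\<integral>\<tau>. ?v \<tau> y \<partial>lborel) = k y * (of_real ((1 / sqrt (s\<^sup>2 / 4)) ^ CARD('n)) * exp (of_real pi * dotc (\<i> *s of_real_vec (y - x)) (\<i> *s of_real_vec (y - x)) / (4 * of_real (s\<^sup>2 / 4))))"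
        by (simp only: integral_mult_right_zero gker_integral[OF s2])
      also have "of_real pi * dotc (\<i> *s of_real_vec (y - x)) (\<i> *s of_real_vec (y - x)) / (4 * of_real (s\<^sup>2 / 4)) = (of_real (- pi * (norm (y - x))\<^sup>2 / s\<^sup>2) :: complex)"
      proof -
        have "dotc (\<i> *s of_real_vec (y - x)) (\<i> *s of_real_vec (y - x)) = - of_real ((norm (y - x))\<^sup>2)"
          unfolding power2_norm_eq_inner dotc_of_real[symmetric] dotc_simps mult.assoc[symmetric] by simp
        then show ?thesis by simp
      qed
      finally show "(\<integral>\<tau>. ?v \<tau> y \<partial>lborel) = of_real ((1 / sqrt (s\<^sup>2 / 4)) ^ CARD('n)) * (k y * of_real (exp (- pi * (norm (y - x))\<^sup>2 / s\<^sup>2)))"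
        unfolding exp_of_real by (simp only: mult_ac)
    qed
    also have "\<dots> = of_real ((1 / sqrt (s\<^sup>2 / 4)) ^ CARD('n)) * (of_real (s ^ DIM(real^'n)) * (\<integral>t. k (x + s *\<^sub>R t) * of_real (exp (- pi * (norm ((x + s *\<^sub>R t) - x))\<^sup>2 / s\<^sup>2)) \<partial>lborel))"
    proof -
      have m: "(\<lambda>y. k y * of_real (exp (- pi * (norm (y - x))\<^sup>2 / s\<^sup>2))) \<in> borel_measurable borel" by measurable
      show ?thesis unfolding integral_mult_right_zero by (rule arg_cong[OF integral_affine[OF m s]])
    qed
    finally have "(\<integral>t. k (x + s *\<^sub>R t) * of_real (exp (- pi * (norm ((x + s *\<^sub>R t) - x))\<^sup>2 / s\<^sup>2)) \<partial>lborel) = 0"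
      using s by simp
    moreover have "- pi * (norm ((x + s *\<^sub>R t) - x))\<^sup>2 / s\<^sup>2 = - pi * (norm t)\<^sup>2" for t
      using s by (simp add: power_mult_distrib)
    ultimately show ?thesis by (simp only:)
  qed
  have gi: "integrable lborel (\<lambda>t::real^'n. exp (- pi * (norm t)\<^sup>2))" using integrable_gauss[of 1, where 'a="real^'n"] by simp
  have "(\<lambda>n. \<integral>t. k (x + inverse (real (Suc n)) *\<^sub>R t) * of_real (exp (- pi * (norm t)\<^sup>2)) \<partial>lborel) \<longlonglongrightarrow> (\<integral>t. k x * of_real (exp (- pi * (norm (t::real^'n))\<^sup>2)) \<partial>lborel)"
  proof (rule integral_dominated_convergence[where w="\<lambda>t. B * exp (- pi * (norm t)\<^sup>2)"])
    show "integrable lborel (\<lambda>t::real^'n. B * exp (- pi * (norm t)\<^sup>2))" by (rule integrable_mult_right[OF gi])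
    show "AE t in lborel. (\<lambda>n. k (x + inverse (real (Suc n)) *\<^sub>R t) * of_real (exp (- pi * (norm t)\<^sup>2))) \<longlonglongrightarrow> k x * of_real (exp (- pi * (norm t)\<^sup>2))"
    proof (rule AE_I2)
      fix t :: "real^'n"
      have "(\<lambda>n. x + inverse (real (Suc n)) *\<^sub>R t) \<longlonglongrightarrow> x + 0 *\<^sub>R t"
        by (intro tendsto_add tendsto_const tendsto_scaleR LIMSEQ_inverse_real_of_nat)
      then have "(\<lambda>n. k (x + inverse (real (Suc n)) *\<^sub>R t)) \<longlonglongrightarrow> k (x + 0 *\<^sub>R t)"
        using kc by (intro isCont_tendsto_compose[of _ k]) (auto simp: continuous_on_eq_continuous_at)
      then show "(\<lambda>n. k (x + inverse (real (Suc n)) *\<^sub>R t) * of_real (exp (- pi * (norm t)\<^sup>2))) \<longlonglongrightarrow> k x * of_real (exp (- pi * (norm t)\<^sup>2))"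
        by (intro tendsto_mult tendsto_const) simp
    qed
    show "AE t in lborel. norm (k (x + inverse (real (Suc n)) *\<^sub>R t) * of_real (exp (- pi * (norm t)\<^sup>2))) \<le> B * exp (- pi * (norm t)\<^sup>2)" for n
      unfolding norm_mult by (rule AE_I2) (simp add: mult_right_mono kb)
  qed measurable
  then have "(\<lambda>n::nat. 0) \<longlonglongrightarrow> (\<integral>t. k x * of_real (exp (- pi * (norm (t::real^'n))\<^sup>2)) \<partial>lborel)"
    using z[of "inverse (real (Suc _))"] by simp
  then have "(\<integral>t. k x * of_real (exp (- pi * (norm (t::real^'n))\<^sup>2)) \<partial>lborel) = 0"
    using LIMSEQ_unique[OF tendsto_const] by metis
  moreover have "(\<integral>t. exp (- pi * (norm (t::real^'n))\<^sup>2) \<partial>lborel) = 1" using integral_gauss[of 1, where 'a="real^'n"] by simp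
  ultimately have "k x = 0" by simp
  then show ?thesis by (simp add: k_def)
qed

lemma norm_kf_weighted: "norm (kf w x) * exp (- (pi / 2) * (norm w)\<^sup>2) = 2 powr (real CARD('n) / 4) * exp (- pi * (norm (x - re_vec (w::complex^'n::finite)))\<^sup>2)"
  unfolding norm_kf by (simp add: mult.assoc mult_exp_exp)

lemma pairing_fbarg:
  fixes h g :: "real^'n::finite \<Rightarrow> complex"
  assumes G: "entire G" and Gd: "\<And>w. norm (G w) \<le> C / (1 + norm w) ^ (2 * DIM(complex^'n)) * exp (pi / 2 * (norm w)\<^sup>2)"
    and [measurable]: "h \<in> borel_measurable borel" and hb: "\<And>y. norm (h y) \<le> B"
  shows "(\<integral>x. h x * (\<integral>w. G (cnj_vec w) * kf w x * gw w \<partial>lborel) \<partial>lborel) = (\<integral>w. fbarg h w * G (cnj_vec w) * gw w \<partial>lborel)"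
proof -
  note [measurable] = entire_measurable[OF G]
  let ?K = "2 * DIM(complex^'n)"
  have B0: "B \<ge> 0" using order_trans[OF norm_ge_zero hb[of 0]] .
  have C0: "C \<ge> 0" using order_trans[OF norm_ge_zero Gd[of 0]] by simp
  let ?v = "\<lambda>w x. h x * (G (cnj_vec w) * kf w x * gw w)"
  have "(\<integral>x. h x * (\<integral>w. G (cnj_vec w) * kf w x * gw w \<partial>lborel) \<partial>lborel) = (\<integral>x. \<integral>w. ?v w x \<partial>lborel \<partial>lborel)"
    unfolding integral_mult_right_zero ..
  also have "\<dots> = (\<integral>w. \<integral>x. ?v w x \<partial>lborel \<partial>lborel)"
  proof (rule Fubini_lborel(1)[symmetric])
    show "(\<lambda>p. ?v (fst p) (snd p)) \<in> borel_measurable (borel \<Otimes>\<^sub>M borel)" by measurable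
    let ?c = "2 powr (real CARD('n) / 4)"
    have le: "norm (?v w x) \<le> (B * ?c * (C * (1 / (1 + norm w) ^ ?K))) * exp (- pi * (norm (x - re_vec w))\<^sup>2)" for w x
    proof -
      have "norm (?v w x) \<le> B * ((C / (1 + norm w) ^ ?K * exp (pi / 2 * (norm w)\<^sup>2)) * norm (kf w x) * exp (- pi * (norm w)\<^sup>2))"
        unfolding norm_mult norm_gw using Gd[of "cnj_vec w"] C0 B0 by (intro mult_mono mult_right_mono hb) auto
      also have "\<dots> = B * (C / (1 + norm w) ^ ?K) * (norm (kf w x) * (exp (pi / 2 * (norm w)\<^sup>2) * exp (- pi * (norm w)\<^sup>2)))"
        by (simp only: mult_ac)
      also have "exp (pi / 2 * (norm w)\<^sup>2) * exp (- pi * (norm w)\<^sup>2) = exp (- (pi / 2) * (norm w)\<^sup>2)" by (simp add: mult_exp_exp)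
      finally show ?thesis unfolding norm_kf_weighted by (simp add: mult_ac)
    qed
    have "(\<integral>\<^sup>+w. \<integral>\<^sup>+x. ennreal (norm (?v w x)) \<partial>lborel \<partial>lborel) \<le> (\<integral>\<^sup>+w. \<integral>\<^sup>+x. ennreal (B * ?c * (C * (1 / (1 + norm (w::complex^'n)) ^ ?K))) * ennreal (exp (- pi * (norm (x - re_vec w))\<^sup>2)) \<partial>lborel \<partial>lborel)"
    proof (intro nn_integral_mono)
      fix w :: "complex^'n" and x :: "real^'n"
      have "0 \<le> B * ?c * (C * (1 / (1 + norm w) ^ ?K))" using B0 C0 by simp
      then show "ennreal (norm (?v w x)) \<le> ennreal (B * ?c * (C * (1 / (1 + norm w) ^ ?K))) * ennreal (exp (- pi * (norm (x - re_vec w))\<^sup>2))"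
        by (simp only: ennreal_mult[symmetric] exp_ge_zero ennreal_leI[OF le])
    qed
    also have "\<dots> = (\<integral>\<^sup>+w. ennreal (B * ?c * (C * (1 / (1 + norm (w::complex^'n)) ^ ?K))) \<partial>lborel)"
      by (intro nn_integral_cong) (subst nn_integral_cmult, measurable, simp only: nn_gauss_center mult_1_right)
    also have "\<dots> < \<infinity>"
    proof -
      have "integrable lborel (\<lambda>w::complex^'n. B * ?c * (C * (1 / (1 + norm w) ^ ?K)))"
        by (intro integrable_mult_right integrable_decay) simp
      then show ?thesis using B0 C0 unfolding integrable_iff_bounded by (simp add: abs_mult)
    qed
    finally show "(\<integral>\<^sup>+w. \<integral>\<^sup>+x. ennreal (norm (?v w x)) \<partial>lborel \<partial>lborel) < \<infinity>" .
  qed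
  also have "\<dots> = (\<integral>w. fbarg h w * G (cnj_vec w) * gw w \<partial>lborel)"
  proof (rule Bochner_Integration.integral_cong[OF refl])
    fix w :: "complex^'n"
    have "(\<integral>x. ?v w x \<partial>lborel) = (\<integral>x. (G (cnj_vec w) * gw w) * (h x * kf w x) \<partial>lborel)" by (simp only: mult_ac)
    also have "\<dots> = fbarg h w * G (cnj_vec w) * gw w" unfolding integral_mult_right_zero fbarg_def by (simp only: mult_ac)
    finally show "(\<integral>x. ?v w x \<partial>lborel) = fbarg h w * G (cnj_vec w) * gw w" .
  qed
  finally show ?thesis .
qed

text \<open>Both sides are bounded continuous functions of \<open>x\<close> with the same Bargmann transform, by the reproducing
  formula; such a function is determined by its transform according to \<open>gaussian_transform_injective\<close>.\<close>

lemma schwartz_inversion: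
  fixes g :: "real^'n::finite \<Rightarrow> complex"
  assumes g: "g \<in> schwartz"
  shows "(\<integral>w. fbarg g (cnj_vec w) * kf w x * gw w \<partial>lborel) = g x"
proof -
  let ?K = "2 * DIM(complex^'n)"
  let ?c = "2 powr (real CARD('n) / 4)"
  obtain C0 N where "C0 \<ge> 0" "\<And>z. norm (fbarg g z) \<le> C0 * schwartz_norm N g / (1 + norm z) ^ ?K * exp (pi / 2 * (norm z)\<^sup>2)"
    using fbarg_decay[of ?K, where 'n='n] g by blast
  then obtain C where C: "\<And>z. norm (fbarg g z) \<le> C / (1 + norm z) ^ ?K * exp (pi / 2 * (norm z)\<^sup>2)" by blast
  have Cge: "C \<ge> 0" using order_trans[OF norm_ge_zero C[of 0]] by simp
  have E: "entire (fbarg g)" by (rule fbarg_schwartz_entire[OF g g])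
  note [measurable] = entire_measurable[OF E]
  define R where "R x = (\<integral>w. fbarg g (cnj_vec w) * kf w x * gw w \<partial>lborel)" for x
  have le: "norm (fbarg g (cnj_vec w) * kf w x * gw w) \<le> (C * ?c) * (1 / (1 + norm w) ^ ?K)" for w x
  proof -
    have "norm (fbarg g (cnj_vec w) * kf w x * gw w) \<le> (C / (1 + norm w) ^ ?K * exp (pi / 2 * (norm w)\<^sup>2)) * norm (kf w x) * exp (- pi * (norm w)\<^sup>2)"
      unfolding norm_mult norm_gw using C[of "cnj_vec w"] by (intro mult_right_mono) auto
    also have "\<dots> = (C / (1 + norm w) ^ ?K) * (norm (kf w x) * (exp (pi / 2 * (norm w)\<^sup>2) * exp (- pi * (norm w)\<^sup>2)))"
      by (simp only: mult_ac)
    also have "exp (pi / 2 * (norm w)\<^sup>2) * exp (- pi * (norm w)\<^sup>2) = exp (- (pi / 2) * (norm w)\<^sup>2)" by (simp add: mult_exp_exp)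
    also have "(C / (1 + norm w) ^ ?K) * (norm (kf w x) * exp (- (pi / 2) * (norm w)\<^sup>2)) \<le> (C / (1 + norm w) ^ ?K) * (?c * 1)"
      unfolding norm_kf_weighted using Cge by (intro mult_left_mono) auto
    finally show ?thesis by simp
  qed
  have di: "integrable lborel (\<lambda>w::complex^'n. (C * ?c) * (1 / (1 + norm w) ^ ?K))" by (intro integrable_mult_right integrable_decay) simp
  have Rb: "norm (R x) \<le> (\<integral>w. (C * ?c) * (1 / (1 + norm (w::complex^'n)) ^ ?K) \<partial>lborel)" for x
    unfolding R_def by (rule norm_integral_le[OF di le])
  have Rc: "continuous_on UNIV R"
  proof (rule continuous_at_imp_continuous_on, intro ballI)
    fix x :: "real^'n"
    show "isCont R x"
      unfolding continuous_at_sequentially comp_def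
    proof (intro allI impI)
      fix X :: "nat \<Rightarrow> real^'n" assume X: "X \<longlonglongrightarrow> x"
      show "(\<lambda>n. R (X n)) \<longlonglongrightarrow> R x"
        unfolding R_def
      proof (rule integral_dominated_convergence[OF _ _ di])
        show "AE w in lborel. (\<lambda>n. fbarg g (cnj_vec w) * kf w (X n) * gw w) \<longlonglongrightarrow> fbarg g (cnj_vec w) * kf w x * gw w"
        proof (rule AE_I2)
          fix w :: "complex^'n"
          have "continuous_on UNIV (\<lambda>x. kf w x)" by (intro continuous_intros)
          then have "(\<lambda>n. kf w (X n)) \<longlonglongrightarrow> kf w x"
            using X by (intro isCont_tendsto_compose[of _ "kf w"]) (auto simp: continuous_on_eq_continuous_at)
          then show "(\<lambda>n. fbarg g (cnj_vec w) * kf w (X n) * gw w) \<longlonglongrightarrow> fbarg g (cnj_vec w) * kf w x * gw w"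
            by (intro tendsto_mult tendsto_const)
        qed
        show "AE w in lborel. norm (fbarg g (cnj_vec w) * kf w (X n) * gw w) \<le> (C * ?c) * (1 / (1 + norm w) ^ ?K)" for n
          by (rule AE_I2) (rule le)
      qed measurable
    qed
  qed
  have Rm [measurable]: "R \<in> borel_measurable borel" by (rule borel_measurable_continuous_onI[OF Rc])
  have RB: "fbarg R z = fbarg g z" for z
  proof -
    have kz: "norm (kf z y) \<le> ?c * exp (pi / 2 * (norm z)\<^sup>2)" for y
    proof -
      have "norm (kf z y) \<le> ?c * 1 * exp (pi / 2 * (norm z)\<^sup>2)"
        unfolding norm_kf by (intro mult_right_mono mult_left_mono) auto
      then show ?thesis by simp
    qed
    have "fbarg R z = (\<integral>x. kf z x * (\<integral>w. fbarg g (cnj_vec w) * kf w x * gw w \<partial>lborel) \<partial>lborel)"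
      unfolding fbarg_def[of R] R_def by (simp only: mult_ac)
    also have "\<dots> = (\<integral>w. fbarg (kf z) w * fbarg g (cnj_vec w) * gw w \<partial>lborel)"
      by (rule pairing_fbarg[OF E C _ kz]) measurable
    also have "\<dots> = (\<integral>w. fbarg g (cnj_vec w) * exp (of_real pi * dotc (cnj_vec (cnj_vec w)) z) * gw (cnj_vec w) \<partial>lborel)"
      unfolding fbarg_kf gw_def by (simp add: mult_ac dotc_commute)
    also have "\<dots> = (\<integral>w. fbarg g w * exp (of_real pi * dotc (cnj_vec w) z) * gw w \<partial>lborel)"
      by (rule integral_cnj[of "\<lambda>w. fbarg g w * exp (of_real pi * dotc (cnj_vec w) z) * gw w"]) measurable
    also have "\<dots> = fbarg g z"
    proof (rule reproducing[OF E])
      have "norm (fbarg g w) \<le> C * exp ((pi / 2) * (norm w)\<^sup>2)" for w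
      proof -
        have "C / (1 + norm w) ^ ?K \<le> C / 1" using Cge by (intro divide_left_mono one_le_power) (auto simp: add_pos_nonneg)
        then have "C / (1 + norm w) ^ ?K * exp (pi / 2 * (norm w)\<^sup>2) \<le> C * exp (pi / 2 * (norm w)\<^sup>2)" by (intro mult_right_mono) auto
        then show ?thesis using C[of w] by linarith
      qed
      then have "fbarg g \<in> fock_space \<infinity>" unfolding mem_fock_space_infinity using E by blast
      then show "integrable lborel (\<lambda>w. fbarg g w * exp (of_real pi * dotc (cnj_vec w) z) * gw w)" by (rule fock_inf_repr_integrable)
    qed
    finally show ?thesis .
  qed
  define h where "h y = R y - g y" for y
  have gm [measurable]: "g \<in> borel_measurable borel" by (rule schwartz_measurable[OF g])
  have "h x = 0"
  proof (rule gaussian_transform_injective[where a=1])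
    show "continuous_on UNIV h" unfolding h_def by (intro continuous_intros Rc schwartz_continuous[OF g])
    show "norm (h y) \<le> (\<integral>w. (C * ?c) * (1 / (1 + norm (w::complex^'n)) ^ ?K) \<partial>lborel) + schwartz_norm 0 g" for y
      unfolding h_def using norm_triangle_ineq4[of "R y" "g y"] Rb[of y] schwartz_bounded[OF g, of y] by linarith
    fix \<tau> :: "real^'n"
    let ?z = "(1 / 2) *s (\<i> *s of_real_vec \<tau>)"
    have 2: "2 *s ?z = \<i> *s of_real_vec \<tau>" by (simp add: vec_eq_iff)
    have "fbarg h ?z = fbarg R ?z - fbarg g ?z"
      unfolding fbarg_def h_def left_diff_distrib
      by (rule Bochner_Integration.integral_diff[OF fbarg_integrable[OF Rm Rb] fbarg_schwartz_integrable[OF g g]])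
    then have "fbarg h ?z = 0" unfolding RB by simp
    moreover have "fbarg h ?z = (of_real ?c * exp (- of_real pi / 2 * dotc ?z ?z)) * (\<integral>y. h y * gker 1 (\<i> *s of_real_vec \<tau>) y \<partial>lborel)"
      unfolding fbarg_def kf_def 2 integral_mult_right_zero[symmetric] by (simp only: mult_ac)
    ultimately show "(\<integral>y. h y * gker (of_real 1) (\<i> *s of_real_vec \<tau>) y \<partial>lborel) = 0" by simp
  qed simp
  then show ?thesis by (simp add: h_def R_def)
qed

text \<open>Insert the inversion formula for \<open>g\<close>. Bounded functions are thereby recovered, as distributions, from their
  Bargmann transforms.\<close>

lemma integral_eq_synth:
  fixes h g :: "real^'n::finite \<Rightarrow> complex"
  assumes h: "h \<in> borel_measurable borel" "\<And>y. norm (h y) \<le> B" and g: "g \<in> schwartz"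
  shows "(\<integral>x. h x * g x \<partial>lborel) = synth (fbarg h) g"
proof -
  obtain C0 N where "C0 \<ge> 0" "\<And>z. norm (fbarg g z) \<le> C0 * schwartz_norm N g / (1 + norm z) ^ (2 * DIM(complex^'n)) * exp (pi / 2 * (norm z)\<^sup>2)"
    using fbarg_decay[of "2 * DIM(complex^'n)", where 'n='n] g by blast
  then obtain C where C: "\<And>z. norm (fbarg g z) \<le> C / (1 + norm z) ^ (2 * DIM(complex^'n)) * exp (pi / 2 * (norm z)\<^sup>2)" by blast
  have "(\<integral>x. h x * g x \<partial>lborel) = (\<integral>x. h x * (\<integral>w. fbarg g (cnj_vec w) * kf w x * gw w \<partial>lborel) \<partial>lborel)"
    unfolding schwartz_inversion[OF g] ..
  also have "\<dots> = (\<integral>w. fbarg h w * fbarg g (cnj_vec w) * gw w \<partial>lborel)"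
    by (rule pairing_fbarg[OF fbarg_schwartz_entire[OF g g] C h])
  finally show ?thesis using g by (simp add: synth_def)
qed

section \<open>Functionals determined by reproducing kernels\<close>

text \<open>The reproducing kernel at \<open>cnj_vec \<zeta>\<close>. Its parameter is not conjugated, so that it is entire in both arguments.\<close>

definition ekern :: "complex^'n::finite \<Rightarrow> complex^'n \<Rightarrow> complex" where
  "ekern \<zeta> x = exp (of_real pi * dotc \<zeta> x)"

lemma norm_ekern_le: "norm (ekern \<zeta> x) \<le> exp (pi * norm \<zeta> * norm x)"
proof -
  have "Re (of_real pi * dotc \<zeta> x) \<le> norm (of_real pi * dotc \<zeta> x)" by (rule complex_Re_le_cmod)
  also have "\<dots> \<le> pi * (norm \<zeta> * norm x)" unfolding norm_mult using norm_dotc_le[of \<zeta> x] by (intro mult_mono) auto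
  finally show ?thesis unfolding ekern_def norm_exp_eq_Re by (simp add: mult.assoc)
qed

lemma entire_ekern: "entire (ekern \<zeta>)" "entire (\<lambda>\<zeta>. ekern \<zeta> x)"
  unfolding ekern_def[abs_def] by (intro entire_exp entire_mult entire_const entire_dotc)+

lemma measurable_ekern [measurable (raw)]:
  fixes f g :: "_ \<Rightarrow> complex^'n::finite"
  assumes [measurable]: "f \<in> borel_measurable M" "g \<in> borel_measurable M"
  shows "(\<lambda>x. ekern (f x) (g x)) \<in> borel_measurable M"
  unfolding ekern_def by measurable

lemma ekern_fock_1: "ekern \<zeta> \<in> fock_space 1"
  by (rule fock_space_1_growth[of _ 0 1 "pi * norm \<zeta>"]) (use norm_ekern_le[of \<zeta>] in \<open>auto intro: entire_ekern\<close>)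

lemma norm_fock_weighted_ekern:
  "norm (fock_weighted (ekern \<zeta>) x) = exp (- (pi / 2) * (norm (x - cnj_vec \<zeta>))\<^sup>2) * exp (pi / 2 * (norm \<zeta>)\<^sup>2)"
proof -
  have R: "Re (of_real pi * dotc \<zeta> x) = pi * Re (dotc \<zeta> x)" by simp
  have "pi * Re (dotc \<zeta> x) + - (pi / 2) * (norm x)\<^sup>2 = - (pi / 2) * (norm (x - cnj_vec \<zeta>))\<^sup>2 + pi / 2 * (norm \<zeta>)\<^sup>2"
    unfolding norm_sq_re_im Re_dotc by (simp add: inner_diff_left inner_diff_right inner_add_left inner_add_right inner_commute field_simps)
  then show ?thesis unfolding norm_fock_weighted ekern_def norm_exp_eq_Re R mult_exp_exp by (rule arg_cong)
qed

lemma nn_fock_weighted_ekern: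
  "(\<integral>\<^sup>+x. ennreal (norm (fock_weighted (ekern \<zeta>) x)) \<partial>lborel) = ennreal ((1 / sqrt (1 / 2)) ^ DIM(complex^'n) * exp (pi / 2 * (norm (\<zeta> :: complex^'n::finite))\<^sup>2))"
proof -
  have "(\<integral>\<^sup>+x. ennreal (norm (fock_weighted (ekern \<zeta>) x)) \<partial>lborel) = (\<integral>\<^sup>+x. ennreal (exp (- (pi / 2) * (norm (x - cnj_vec \<zeta>))\<^sup>2)) * ennreal (exp (pi / 2 * (norm \<zeta>)\<^sup>2)) \<partial>lborel)"
    unfolding norm_fock_weighted_ekern by (simp only: ennreal_mult exp_ge_zero)
  also have "\<dots> = ennreal ((1 / sqrt (1 / 2)) ^ DIM(complex^'n)) * ennreal (exp (pi / 2 * (norm \<zeta>)\<^sup>2))"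
    by (subst nn_integral_multc) (measurable, simp only: gauss_shift(3))
  finally show ?thesis by (simp only: ennreal_mult exp_ge_zero) (subst ennreal_mult, auto)
qed

lemma fock_norm_ekern: "fock_norm 1 (ekern (\<zeta> :: complex^'n::finite)) = (1 / sqrt (1 / 2)) ^ DIM(complex^'n) * exp (pi / 2 * (norm \<zeta>)\<^sup>2)"
  using nn_fock_1[OF ekern_fock_1[of \<zeta>]] unfolding nn_fock_weighted_ekern
  by (subst (asm) ennreal_inj) (auto intro: fock_norm_nonneg)

text \<open>Continuous linear functionals on \<open>F\<^sup>1\<close>. The aim is that such a functional may be exchanged with the integral in the
  reproducing formula.\<close>

locale fock_functional =
  fixes L :: "(complex^'n::finite \<Rightarrow> complex) \<Rightarrow> complex" and A :: real
  assumes add: "\<And>F G. F \<in> fock_space 1 \<Longrightarrow> G \<in> fock_space 1 \<Longrightarrow> L (\<lambda>z. F z + G z) = L F + L G"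
    and mult: "\<And>c F. F \<in> fock_space 1 \<Longrightarrow> L (\<lambda>z. c * F z) = c * L F"
    and bound: "\<And>F. F \<in> fock_space 1 \<Longrightarrow> norm (L F) \<le> A * fock_norm 1 F"
begin

lemma A0: "A \<ge> 0"
proof -
  have "0 \<le> A * fock_norm 1 (ekern (0 :: complex^'n))" using bound[OF ekern_fock_1] norm_ge_zero order_trans by blast
  moreover have "fock_norm 1 (ekern (0 :: complex^'n)) > 0" unfolding fock_norm_ekern by simp
  ultimately show ?thesis by (simp add: zero_le_mult_iff)
qed

lemma diff:
  assumes "F \<in> fock_space 1" "G \<in> fock_space 1" shows "L (\<lambda>z. F z - G z) = L F - L G"
proof -
  have "(\<lambda>z. - 1 * G z) \<in> fock_space 1" by (rule fock_space_mult[OF _ assms(2)]) simp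
  then show ?thesis using add[OF assms(1), of "\<lambda>z. - 1 * G z"] mult[OF assms(2), of "- 1"] by simp
qed

text \<open>Taylor's formula for the exponential bounds the \<open>F\<^sup>1\<close> norm of the remainder of \<open>\<zeta> \<mapsto> ekern \<zeta>\<close> by the square of
  the increment.\<close>

lemma entire_L_ekern: "entire (\<lambda>\<zeta>. L (ekern \<zeta>))"
proof (rule entireI_quadratic)
  fix \<zeta> :: "complex^'n"
  let ?D = "\<lambda>v. (\<lambda>x. of_real pi * dotc v x * ekern \<zeta> x)"
  let ?b = "1 + pi * norm \<zeta>"
  have DF: "?D v \<in> fock_space 1" for v
  proof (rule fock_space_1_growth[of _ 0 "pi * norm v" "?b"])
    show "entire (?D v)" by (intro entire_mult entire_const entire_dotc entire_ekern)
    fix x :: "complex^'n"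
    have "norm x \<le> exp (norm x)" using exp_ge_add_one_self[of "norm x"] by linarith
    then have "norm (dotc v x) \<le> norm v * exp (norm x)" using order_trans[OF norm_dotc_le[of v x] mult_left_mono[OF _ norm_ge_zero[of v]]] by blast
    then have "norm (?D v x) \<le> pi * (norm v * exp (norm x)) * exp (pi * norm \<zeta> * norm x)"
      unfolding norm_mult using norm_ekern_le[of \<zeta> x] by (intro mult_mono) auto
    also have "\<dots> = pi * norm v * exp (0 * (norm x)\<^sup>2 + ?b * norm x)" by (simp add: mult.assoc mult_exp_exp algebra_simps)
    finally show "norm (?D v x) \<le> pi * norm v * exp (0 * (norm x)\<^sup>2 + ?b * norm x)" .
  qed simp
  let ?h = "\<lambda>x :: complex^'n. exp (- pi * (1 / 2) * (norm x)\<^sup>2 + (2 + pi + pi * norm \<zeta>) * norm x)"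
  have hi: "integrable lborel ?h" by (rule integrable_gauss_lin) simp
  define M where "M = (\<integral>x. ?h x \<partial>lborel)"
  have q: "norm (L (ekern (\<zeta> + v)) - L (ekern \<zeta>) - L (?D v)) \<le> (A * (pi\<^sup>2 * M)) * (norm v)\<^sup>2" if v: "norm v < 1" for v
  proof -
    define R where "R x = (ekern (\<zeta> + v) x - ekern \<zeta> x) - ?D v x" for x
    have RF0: "(\<lambda>x. ekern (\<zeta> + v) x - ekern \<zeta> x) \<in> fock_space 1" by (rule fock_space_diff[OF _ ekern_fock_1 ekern_fock_1]) simp
    have RF: "R \<in> fock_space 1" unfolding R_def[abs_def] by (rule fock_space_diff[OF _ RF0 DF]) simp
    have LR: "L R = L (ekern (\<zeta> + v)) - L (ekern \<zeta>) - L (?D v)"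
      unfolding R_def[abs_def] diff[OF RF0 DF] diff[OF ekern_fock_1 ekern_fock_1] ..
    have le: "norm (norm (fock_weighted R x)) \<le> (pi\<^sup>2 * (norm v)\<^sup>2) * ?h x" for x
    proof -
      let ?s = "of_real pi * dotc v x"
      have Rx: "R x = ekern \<zeta> x * (exp ?s - (1 + ?s))"
        unfolding R_def ekern_def by (simp add: exp_add algebra_simps)
      have ns: "norm ?s \<le> pi * norm v * norm x" unfolding norm_mult using norm_dotc_le[of v x] by (simp add: mult.assoc)
      have "norm (exp ?s - (\<Sum>k\<le>1. ?s ^ k / fact k)) \<le> exp \<bar>Re ?s\<bar> * (norm ?s) ^ Suc 1 / fact 1" by (rule Taylor_exp)
      then have "norm (exp ?s - (1 + ?s)) \<le> exp \<bar>Re ?s\<bar> * (norm ?s)\<^sup>2" by (simp add: power2_eq_square)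
      also have "\<dots> \<le> exp (pi * norm x) * (pi * norm v * norm x)\<^sup>2"
      proof (intro mult_mono power_mono ns)
        have "\<bar>Re ?s\<bar> \<le> pi * norm v * norm x" using abs_Re_le_cmod[of ?s] ns by linarith
        also have "\<dots> \<le> pi * 1 * norm x" using v by (intro mult_right_mono mult_left_mono) auto
        finally show "exp \<bar>Re ?s\<bar> \<le> exp (pi * norm x)" by simp
      qed auto
      also have "(pi * norm v * norm x)\<^sup>2 = (pi\<^sup>2 * (norm v)\<^sup>2) * (norm x)\<^sup>2" by (simp add: power_mult_distrib)
      also have "(norm x)\<^sup>2 \<le> exp (2 * norm x)"
      proof -
        have "norm x \<le> exp (norm x)" using exp_ge_add_one_self[of "norm x"] by linarith
        then have "(norm x)\<^sup>2 \<le> (exp (norm x))\<^sup>2" by (intro power_mono) auto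
        then show ?thesis by (simp add: exp_double)
      qed
      finally have e: "norm (exp ?s - (1 + ?s)) \<le> exp (pi * norm x) * ((pi\<^sup>2 * (norm v)\<^sup>2) * exp (2 * norm x))"
        by (simp add: mult_left_mono)
      have "norm (fock_weighted R x) \<le> (exp (pi * norm \<zeta> * norm x) * (exp (pi * norm x) * ((pi\<^sup>2 * (norm v)\<^sup>2) * exp (2 * norm x)))) * exp (- (pi / 2) * (norm x)\<^sup>2)"
        unfolding norm_fock_weighted Rx norm_mult by (intro mult_right_mono mult_mono norm_ekern_le e) auto
      also have "\<dots> = (pi\<^sup>2 * (norm v)\<^sup>2) * (exp (pi * norm \<zeta> * norm x) * (exp (pi * norm x) * (exp (2 * norm x) * exp (- (pi / 2) * (norm x)\<^sup>2))))"
        by (simp only: mult_ac)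
      also have "exp (pi * norm \<zeta> * norm x) * (exp (pi * norm x) * (exp (2 * norm x) * exp (- (pi / 2) * (norm x)\<^sup>2))) = ?h x"
        unfolding mult_exp_exp by (rule arg_cong[where f=exp]) (simp add: algebra_simps)
      finally show ?thesis by simp
    qed
    have "fock_norm 1 R \<le> (pi\<^sup>2 * (norm v)\<^sup>2) * M"
      using norm_integral_le[OF integrable_mult_right[OF hi] le] unfolding fock_norm_1 integral_mult_right_zero M_def[symmetric] by simp
    then have "A * fock_norm 1 R \<le> A * ((pi\<^sup>2 * (norm v)\<^sup>2) * M)" by (intro mult_left_mono A0)
    with bound[OF RF] show ?thesis unfolding LR by (simp add: mult_ac)
  qed
  have Dadd: "L (?D (v + w)) = L (?D v) + L (?D w)" for v w
    using add[OF DF[of v] DF[of w]] by (simp add: algebra_simps)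
  have Dmult: "L (?D (c *s v)) = c * L (?D v)" for c v
    using mult[OF DF[of v], of c] by (simp add: mult_ac)
  show "\<exists>D C r. r > 0 \<and> (\<forall>v w. D (v + w) = D v + D w) \<and> (\<forall>c v. D (c *s v) = c * D v) \<and>
      (\<forall>v. norm v < r \<longrightarrow> norm (L (ekern (\<zeta> + v)) - L (ekern \<zeta>) - D v) \<le> C * (norm v)\<^sup>2)"
    by (rule exI[of _ "\<lambda>v. L (?D v)"], rule exI[of _ "A * (pi\<^sup>2 * M)"], rule exI[of _ 1], intro conjI allI impI zero_less_one Dadd Dmult q)
qed

definition ell :: "complex^'n \<Rightarrow> complex" where "ell w = L (ekern (cnj_vec w))"

lemma ell_bound: "norm (ell w) \<le> (A * (1 / sqrt (1 / 2)) ^ DIM(complex^'n)) * exp (pi / 2 * (norm w)\<^sup>2)"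
  using bound[OF ekern_fock_1[of "cnj_vec w"]] unfolding ell_def fock_norm_ekern norm_cnj_vec by (simp only: mult.assoc)

lemma ell_continuous: "continuous_on S ell"
  unfolding ell_def by (rule continuous_on_compose2[OF entire_continuous[OF entire_L_ekern, of UNIV]]) (auto intro: continuous_intros continuous_on_id)

lemma ell_measurable [measurable]: "ell \<in> borel_measurable borel"
  by (intro borel_measurable_continuous_onI ell_continuous)

lemma L_sum:
  assumes "finite I" shows "(\<lambda>x. \<Sum>v\<in>I. c v * ekern (e v) x) \<in> fock_space 1 \<and> L (\<lambda>x. \<Sum>v\<in>I. c v * ekern (e v) x) = (\<Sum>v\<in>I. c v * L (ekern (e v)))"
  using assms
proof induction
  case empty
  have "(\<lambda>x. 0 * ekern 0 x) \<in> (fock_space 1 :: (complex^'n \<Rightarrow> complex) set)" by (rule fock_space_mult[OF _ ekern_fock_1]) simp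
  then show ?case using mult[OF ekern_fock_1, of 0 0] by simp
next
  case (insert v I)
  have 1: "(\<lambda>x. c v * ekern (e v) x) \<in> fock_space 1" by (rule fock_space_mult[OF _ ekern_fock_1]) simp
  show ?case using insert fock_space_add[OF _ 1 insert.IH[THEN conjunct1]] add[OF 1 insert.IH[THEN conjunct1]] mult[OF ekern_fock_1, of "c v" "e v"] by simp
qed

lemma integrand_bound: "norm (F w * ell w * gw w) \<le> (A * (1 / sqrt (1 / 2)) ^ DIM(complex^'n)) * norm (fock_weighted F w)"
proof -
  let ?B = "A * (1 / sqrt (1 / 2)) ^ DIM(complex^'n)"
  have "norm (F w * ell w * gw w) \<le> norm (F w) * (?B * exp (pi / 2 * (norm w)\<^sup>2)) * exp (- pi * (norm w)\<^sup>2)"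
    unfolding norm_mult norm_gw by (intro mult_right_mono mult_left_mono ell_bound) auto
  also have "\<dots> = ?B * (norm (F w) * (exp (pi / 2 * (norm w)\<^sup>2) * exp (- pi * (norm w)\<^sup>2)))" by (simp only: mult_ac)
  also have "exp (pi / 2 * (norm w)\<^sup>2) * exp (- pi * (norm w)\<^sup>2) = exp (- (pi / 2) * (norm w)\<^sup>2)" by (simp add: mult_exp_exp)
  finally show ?thesis unfolding norm_fock_weighted .
qed

lemma integrand_integrable:
  assumes F: "F \<in> fock_space 1" shows "integrable lborel (\<lambda>w. F w * ell w * gw w)"
proof (rule Bochner_Integration.integrable_bound)
  note [measurable] = entire_measurable[OF fock_space_entire[OF F]]
  show "integrable lborel (\<lambda>w. (A * (1 / sqrt (1 / 2)) ^ DIM(complex^'n)) * norm (fock_weighted F w))"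
    using F by (intro integrable_mult_right) (simp add: mem_fock_space_1)
  show "(\<lambda>w. F w * ell w * gw w) \<in> borel_measurable lborel" by measurable
  show "AE w in lborel. norm (F w * ell w * gw w) \<le> norm ((A * (1 / sqrt (1 / 2)) ^ DIM(complex^'n)) * norm (fock_weighted F w))"
    by (rule AE_I2) (rule order_trans[OF integrand_bound], simp only: real_norm_def abs_ge_self)
qed

text \<open>In the reproducing formula \<open>F\<close> is an integral of kernels, which are elements of \<open>F\<^sup>1\<close>. It is approximated by the finite sums \<open>G i\<close> obtained by replacing the kernel at \<open>w\<close>
  by the one at \<open>s i w\<close>, where the simple functions \<open>s i\<close> converge to the identity. Linearity gives the claim
  for the sums, and both sides converge; the decay of \<open>F\<close> relative to the weight leaves room for the distance between
  \<open>w\<close> and \<open>s i w\<close> in the dominating functions.\<close>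

lemma representation_decay:
  fixes F :: "complex^'n \<Rightarrow> complex"
  assumes E: "entire F" and c: "c < pi / 2" and le: "\<And>z. norm (F z) \<le> C * exp (c * (norm z)\<^sup>2)"
  shows "L F = (\<integral>w. F w * ell w * gw w \<partial>lborel)"
proof -
  note [measurable] = entire_measurable[OF E]
  have F: "F \<in> fock_space 1" by (rule fock_space_1_growth[OF E c, of _ 0]) (use le in simp)
  have C0: "C \<ge> 0" using order_trans[OF norm_ge_zero le[of 0]] by simp
  obtain f :: "nat \<Rightarrow> complex^'n \<Rightarrow> complex^'n" where f: "\<And>i. simple_function borel (f i)" "\<And>x. (\<lambda>i. f i x) \<longlonglongrightarrow> x"
    using borel_measurable_implies_sequence_metric[of "\<lambda>x::complex^'n. x" borel 0] by auto
  have [measurable]: "f i \<in> borel_measurable borel" for i using f(1) by (rule borel_measurable_simple_function)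
  \<comment> \<open>truncation keeps the approximating kernels within the dominating function\<close>
  define s where "s i w = (if w \<in> {w. norm (f i w) \<le> norm w + 1} then f i w else 0)" for i w
  have ssf: "simple_function borel (s i)" for i
    unfolding s_def by (intro simple_function_If_set f simple_function_const) measurable
  have sm [measurable]: "s i \<in> borel_measurable borel" for i using ssf by (rule borel_measurable_simple_function)
  have fin: "finite (range (s i))" for i using simple_functionD(1)[OF ssf[of i]] by simp
  have sb: "norm (s i w) \<le> norm w + 1" for i w unfolding s_def by auto
  have slim: "(\<lambda>i. s i w) \<longlonglongrightarrow> w" for w
  proof (rule Lim_transform_eventually[OF f(2)])
    have "(\<lambda>i. norm (f i w)) \<longlonglongrightarrow> norm w" by (intro tendsto_norm f)
    then have "\<forall>\<^sub>F i in sequentially. norm (f i w) < norm w + 1" by (rule order_tendstoD) simp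
    then show "\<forall>\<^sub>F i in sequentially. f i w = s i w" by eventually_elim (simp add: s_def)
  qed
  let ?N = "(1 / sqrt (1 / 2)) ^ DIM(complex^'n)"
  define cf where "cf i v = (\<integral>w. F w * gw w * indicator (s i -` {v}) w \<partial>lborel)" for i v
  define G where "G i x = (\<Sum>v\<in>range (s i). cf i v * ekern (cnj_vec v) x)" for i x
  have GF: "G i \<in> fock_space 1" and LG: "L (G i) = (\<Sum>v\<in>range (s i). cf i v * ell v)" for i
    using L_sum[OF fin[of i], of "cf i" cnj_vec] unfolding G_def[abs_def] ell_def by auto
  have Fg: "integrable lborel (\<lambda>w. F w * gw w)"
    using fock_repr_integrable[OF _ _ F, of 0] by simp
  have simple_sum: "(\<integral>w. F w * gw w * H (s i w) \<partial>lborel) = (\<Sum>v\<in>range (s i). cf i v * H v)" for H :: "complex^'n \<Rightarrow> complex" and i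
  proof -
    have "F w * gw w * H (s i w) = (\<Sum>v\<in>range (s i). F w * gw w * indicator (s i -` {v}) w * H v)" for w
    proof -
      have "(\<Sum>v\<in>range (s i). F w * gw w * indicator (s i -` {v}) w * H v) = (\<Sum>v\<in>range (s i). if v = s i w then F w * gw w * H v else 0)"
        by (intro sum.cong refl) (auto simp: indicator_def)
      then show ?thesis using fin[of i] by simp
    qed
    moreover have "integrable lborel (\<lambda>w. F w * gw w * indicator (s i -` {v}) w * H v)" for v
    proof -
      have [measurable]: "s i -` {v} \<in> sets borel" using measurable_sets[OF sm[of i], of "{v}"] by simp
      have "integrable lborel (\<lambda>w. indicator (s i -` {v}) w *\<^sub>R (F w * gw w))" by (rule integrable_mult_indicator[OF _ Fg]) simp
      then have "integrable lborel (\<lambda>w. F w * gw w * indicator (s i -` {v}) w)"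
        by (rule Bochner_Integration.integrable_cong[THEN iffD1, rotated -1]) (auto simp: indicator_def)
      then show ?thesis by (rule integrable_mult_left)
    qed
    ultimately show ?thesis unfolding cf_def integral_mult_left_zero[symmetric] by simp
  qed
  have LG': "L (G i) = (\<integral>w. F w * gw w * ell (s i w) \<partial>lborel)" for i
    unfolding LG simple_sum[of ell] ..
  have G': "G i x = (\<integral>w. F w * gw w * ekern (cnj_vec (s i w)) x \<partial>lborel)" for i x
    unfolding G_def simple_sum[of "\<lambda>v. ekern (cnj_vec v) x"] ..
  let ?d = "(pi / 2 - c) / pi"
  have d: "?d > 0" using c by simp
  have dom0: "norm (F w * gw w) * exp (pi / 2 * (norm w + 1)\<^sup>2) \<le> C * exp (pi / 2) * exp (- pi * ?d * (norm w)\<^sup>2 + pi * norm w)" for w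
  proof -
    have "norm (F w * gw w) * exp (pi / 2 * (norm w + 1)\<^sup>2) \<le> (C * exp (c * (norm w)\<^sup>2)) * exp (- pi * (norm w)\<^sup>2) * exp (pi / 2 * (norm w + 1)\<^sup>2)"
      unfolding norm_mult norm_gw by (intro mult_right_mono le) auto
    also have "\<dots> = C * exp (c * (norm w)\<^sup>2 + - pi * (norm w)\<^sup>2 + pi / 2 * (norm w + 1)\<^sup>2)" by (simp only: mult.assoc exp_add)
    also have "c * (norm w)\<^sup>2 + - pi * (norm w)\<^sup>2 + pi / 2 * (norm w + 1)\<^sup>2 = pi / 2 + (- pi * ?d * (norm w)\<^sup>2 + pi * norm w)"
      by (simp add: power2_eq_square field_simps)
    finally show ?thesis by (simp only: exp_add mult.assoc)
  qed
  have di: "integrable lborel (\<lambda>w::complex^'n. K * (C * exp (pi / 2) * exp (- pi * ?d * (norm w)\<^sup>2 + pi * norm w)))" for K :: real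
    by (intro integrable_mult_right integrable_gauss_lin d)
  have sq: "exp (pi / 2 * (norm (s i w))\<^sup>2) \<le> exp (pi / 2 * (norm w + 1)\<^sup>2)" for i w
    using sb[of i w] by (simp add: power_mono)
  \<comment> \<open>the discretised integrals converge\<close>
  have lim1: "(\<lambda>i. L (G i)) \<longlonglongrightarrow> (\<integral>w. F w * gw w * ell w \<partial>lborel)"
    unfolding LG'
  proof (rule integral_dominated_convergence[OF _ _ di[of "A * ?N"]])
    show "AE w in lborel. (\<lambda>i. F w * gw w * ell (s i w)) \<longlonglongrightarrow> F w * gw w * ell w"
      using ell_continuous[of UNIV] by (intro AE_I2 tendsto_mult tendsto_const isCont_tendsto_compose[OF _ slim]) (auto simp: continuous_on_eq_continuous_at)
    show "AE w in lborel. norm (F w * gw w * ell (s i w)) \<le> A * ?N * (C * exp (pi / 2) * exp (- pi * ?d * (norm w)\<^sup>2 + pi * norm w))" for i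
    proof (rule AE_I2)
      fix w
      have AN: "A * ?N \<ge> 0" using A0 by simp
      have "norm (F w * gw w * ell (s i w)) \<le> norm (F w * gw w) * ((A * ?N) * exp (pi / 2 * (norm (s i w))\<^sup>2))"
        unfolding norm_mult[of _ "ell (s i w)"] by (intro mult_left_mono ell_bound) auto
      also have "\<dots> \<le> norm (F w * gw w) * ((A * ?N) * exp (pi / 2 * (norm w + 1)\<^sup>2))"
        by (intro mult_left_mono sq AN) auto
      also have "\<dots> = (A * ?N) * (norm (F w * gw w) * exp (pi / 2 * (norm w + 1)\<^sup>2))" by (simp only: mult_ac)
      also have "\<dots> \<le> (A * ?N) * (C * exp (pi / 2) * exp (- pi * ?d * (norm w)\<^sup>2 + pi * norm w))" by (intro mult_left_mono dom0 AN)
      finally show "norm (F w * gw w * ell (s i w)) \<le> A * ?N * (C * exp (pi / 2) * exp (- pi * ?d * (norm w)\<^sup>2 + pi * norm w))" .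
    qed
  qed measurable
  \<comment> \<open>the discretisations converge in norm\<close>
  define n where "n i w = (\<integral>\<^sup>+x. ennreal (norm (fock_weighted (\<lambda>x. ekern (cnj_vec w) x - ekern (cnj_vec (s i w)) x) x)) \<partial>lborel)" for i w
  have fwm: "(\<lambda>p. fock_weighted (\<lambda>x. ekern (cnj_vec (fst p)) x - ekern (cnj_vec (s i (fst p))) x) (snd p)) \<in> borel_measurable (borel \<Otimes>\<^sub>M borel)" for i
    unfolding fock_weighted_def by measurable
  have nm [measurable]: "n i \<in> borel_measurable borel" for i
  proof -
    have "(\<lambda>p. ennreal (norm (fock_weighted (\<lambda>x. ekern (cnj_vec (fst p)) x - ekern (cnj_vec (s i (fst p))) x) (snd p)))) \<in> borel_measurable (borel \<Otimes>\<^sub>M lborel)"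
      using fwm[of i] by (intro measurable_compose[OF _ measurable_ennreal] borel_measurable_norm) (simp cong: measurable_cong_sets)
    from lborel.borel_measurable_nn_integral_fst[OF this] show ?thesis unfolding n_def[abs_def] by simp
  qed
  have nb: "n i w \<le> ennreal (2 * ?N * exp (pi / 2 * (norm w + 1)\<^sup>2))" for i w
  proof -
    have "n i w \<le> (\<integral>\<^sup>+x. ennreal (norm (fock_weighted (ekern (cnj_vec w)) x)) + ennreal (norm (fock_weighted (ekern (cnj_vec (s i w))) x)) \<partial>lborel)"
      unfolding n_def fock_weighted_diff by (intro nn_integral_mono) (simp add: ennreal_plus[symmetric] ennreal_leI norm_triangle_ineq4 del: ennreal_plus)
    also have "\<dots> = ennreal (?N * exp (pi / 2 * (norm w)\<^sup>2)) + ennreal (?N * exp (pi / 2 * (norm (s i w))\<^sup>2))"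
    proof (subst nn_integral_add)
      have "fock_weighted (ekern \<zeta>) \<in> borel_measurable borel" for \<zeta> :: "complex^'n" by (rule fock_weighted_measurable[OF entire_ekern(1)])
      then show "(\<lambda>x. ennreal (norm (fock_weighted (ekern (cnj_vec w)) x))) \<in> borel_measurable lborel"
        "(\<lambda>x. ennreal (norm (fock_weighted (ekern (cnj_vec (s i w))) x))) \<in> borel_measurable lborel" by measurable
    qed (simp add: nn_fock_weighted_ekern)
    also have "\<dots> = ennreal (?N * exp (pi / 2 * (norm w)\<^sup>2) + ?N * exp (pi / 2 * (norm (s i w))\<^sup>2))"
      by (rule ennreal_plus[symmetric]) auto
    also have "\<dots> \<le> ennreal (?N * exp (pi / 2 * (norm w + 1)\<^sup>2) + ?N * exp (pi / 2 * (norm w + 1)\<^sup>2))"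
      by (intro ennreal_leI add_mono mult_left_mono sq) (auto intro!: power_mono)
    finally show ?thesis by (simp add: mult_ac)
  qed
  have nlim: "(\<lambda>i. n i w) \<longlonglongrightarrow> 0" for w
  proof -
    let ?h = "\<lambda>x::complex^'n. 2 * exp (- pi * (1 / 2) * (norm x)\<^sup>2 + pi * (norm w + 1) * norm x)"
    have "(\<lambda>i. n i w) \<longlonglongrightarrow> (\<integral>\<^sup>+x. 0 \<partial>(lborel :: (complex^'n) measure))"
      unfolding n_def
    proof (rule nn_integral_dominated_convergence[where w="\<lambda>x. ennreal (?h x)"])
      have "integrable lborel ?h" by (intro integrable_mult_right integrable_gauss_lin) simp
      then show "(\<integral>\<^sup>+x. ennreal (?h x) \<partial>lborel) < \<infinity>" unfolding integrable_iff_bounded by simp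
      show "AE x in lborel. ennreal (norm (fock_weighted (\<lambda>x. ekern (cnj_vec w) x - ekern (cnj_vec (s i w)) x) x)) \<le> ennreal (?h x)" for i
      proof (intro AE_I2 ennreal_leI)
        fix x :: "complex^'n"
        have 1: "norm (ekern (cnj_vec v) x) \<le> exp (pi * (norm w + 1) * norm x)" if "norm v \<le> norm w + 1" for v
        proof -
          have "norm (ekern (cnj_vec v) x) \<le> exp (pi * norm v * norm x)" using norm_ekern_le[of "cnj_vec v" x] by simp
          also have "\<dots> \<le> exp (pi * (norm w + 1) * norm x)" using that by (simp add: mult_mono)
          finally show ?thesis .
        qed
        have "norm (ekern (cnj_vec w) x - ekern (cnj_vec (s i w)) x) \<le> exp (pi * (norm w + 1) * norm x) + exp (pi * (norm w + 1) * norm x)"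
          by (rule order_trans[OF norm_triangle_ineq4 add_mono[OF 1 1]]) (use sb in auto)
        then have "norm (fock_weighted (\<lambda>x. ekern (cnj_vec w) x - ekern (cnj_vec (s i w)) x) x) \<le> (exp (pi * (norm w + 1) * norm x) + exp (pi * (norm w + 1) * norm x)) * exp (- (pi / 2) * (norm x)\<^sup>2)"
          unfolding norm_fock_weighted by (rule mult_right_mono) simp
        also have "\<dots> = ?h x" by (simp add: mult_exp_exp exp_add mult_ac)
        finally show "norm (fock_weighted (\<lambda>x. ekern (cnj_vec w) x - ekern (cnj_vec (s i w)) x) x) \<le> ?h x" .
      qed
      show "AE x in lborel. (\<lambda>i. ennreal (norm (fock_weighted (\<lambda>x. ekern (cnj_vec w) x - ekern (cnj_vec (s i w)) x) x))) \<longlonglongrightarrow> 0"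
      proof (rule AE_I2)
        fix x :: "complex^'n"
        have "continuous_on UNIV (\<lambda>v. ekern (cnj_vec v) x)" unfolding ekern_def by (intro continuous_intros)
        then have "(\<lambda>i. ekern (cnj_vec (s i w)) x) \<longlonglongrightarrow> ekern (cnj_vec w) x"
          by (intro isCont_tendsto_compose[OF _ slim[of w], where g="\<lambda>v. ekern (cnj_vec v) x"]) (auto simp: continuous_on_eq_continuous_at)
        then have "(\<lambda>i. norm (fock_weighted (\<lambda>x. ekern (cnj_vec w) x - ekern (cnj_vec (s i w)) x) x)) \<longlonglongrightarrow> norm ((ekern (cnj_vec w) x - ekern (cnj_vec w) x) * of_real (exp (- pi * (norm x)\<^sup>2 / 2)))"
          unfolding fock_weighted_def by (intro tendsto_norm tendsto_mult tendsto_diff tendsto_const)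
        then have "(\<lambda>i. norm (fock_weighted (\<lambda>x. ekern (cnj_vec w) x - ekern (cnj_vec (s i w)) x) x)) \<longlonglongrightarrow> 0" by simp
        from tendsto_ennrealI[OF this] show "(\<lambda>i. ennreal (norm (fock_weighted (\<lambda>x. ekern (cnj_vec w) x - ekern (cnj_vec (s i w)) x) x))) \<longlonglongrightarrow> 0" by simp
      qed
    qed (auto simp: fock_weighted_def)
    then show ?thesis by simp
  qed
  have FG: "(\<lambda>x. F x - G i x) \<in> fock_space 1" for i by (rule fock_space_diff[OF _ F GF]) simp
  have upper: "ennreal (fock_norm 1 (\<lambda>x. F x - G i x)) \<le> (\<integral>\<^sup>+w. ennreal (norm (F w * gw w)) * n i w \<partial>lborel)" for i
  proof -
    let ?k = "\<lambda>w x. F w * gw w * fock_weighted (\<lambda>x. ekern (cnj_vec w) x - ekern (cnj_vec (s i w)) x) x"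
    have km: "(\<lambda>p. ?k (fst p) (snd p)) \<in> borel_measurable (borel \<Otimes>\<^sub>M borel)" using fwm[of i] by measurable
    have e: "fock_weighted (\<lambda>x. F x - G i x) x = (\<integral>w. ?k w x \<partial>lborel)" and ki: "integrable lborel (\<lambda>w. ?k w x)" for x
    proof -
      have i1: "integrable lborel (\<lambda>w. F w * gw w * ekern (cnj_vec w) x)"
        using fock_repr_integrable[OF _ _ F, of x] unfolding ekern_def by (simp add: mult_ac)
      have r1: "F x = (\<integral>w. F w * gw w * ekern (cnj_vec w) x \<partial>lborel)"
        using reproducing[OF E fock_repr_integrable[OF _ _ F, of x]] unfolding ekern_def by (simp add: mult_ac)
      have i2: "integrable lborel (\<lambda>w. F w * gw w * ekern (cnj_vec (s i w)) x)"
      proof -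
        have "finite ((\<lambda>w. ekern (cnj_vec (s i w)) x) ` UNIV)" using fin[of i] by (simp add: image_image[symmetric, of "\<lambda>v. ekern (cnj_vec v) x" "s i"])
        then obtain Bd where Bd: "\<And>w. norm (ekern (cnj_vec (s i w)) x) \<le> Bd" using finite_imp_bounded bounded_iff by (metis rangeI)
        show ?thesis
        proof (rule Bochner_Integration.integrable_bound[OF integrable_mult_right[OF integrable_norm[OF Fg], of Bd]])
          show "AE w in lborel. norm (F w * gw w * ekern (cnj_vec (s i w)) x) \<le> norm (Bd * norm (F w * gw w))"
          proof (rule AE_I2)
            fix w
            have "norm (F w * gw w * ekern (cnj_vec (s i w)) x) \<le> norm (F w * gw w) * Bd" unfolding norm_mult[of _ "ekern _ x"] by (intro mult_left_mono Bd) simp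
            then show "norm (F w * gw w * ekern (cnj_vec (s i w)) x) \<le> norm (Bd * norm (F w * gw w))" using abs_ge_self[of "Bd * norm (F w * gw w)"] unfolding real_norm_def mult.commute[of Bd] by linarith
          qed
        qed measurable
      qed
      have k: "?k w x = (F w * gw w * ekern (cnj_vec w) x - F w * gw w * ekern (cnj_vec (s i w)) x) * of_real (exp (- pi * (norm x)\<^sup>2 / 2))" for w
        by (simp add: fock_weighted_def algebra_simps)
      show "integrable lborel (\<lambda>w. ?k w x)" unfolding k by (intro integrable_mult_left Bochner_Integration.integrable_diff i1 i2)
      show "fock_weighted (\<lambda>x. F x - G i x) x = (\<integral>w. ?k w x \<partial>lborel)"
      proof -
        have "(\<integral>w. ?k w x \<partial>lborel) = ((\<integral>w. F w * gw w * ekern (cnj_vec w) x \<partial>lborel) - (\<integral>w. F w * gw w * ekern (cnj_vec (s i w)) x \<partial>lborel)) * of_real (exp (- pi * (norm x)\<^sup>2 / 2))"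
          unfolding k integral_mult_left_zero Bochner_Integration.integral_diff[OF i1 i2] ..
        also have "\<dots> = (F x - G i x) * of_real (exp (- pi * (norm x)\<^sup>2 / 2))" by (simp only: r1[symmetric] G'[symmetric])
        finally show ?thesis by (simp only: fock_weighted_def)
      qed
    qed
    have "ennreal (fock_norm 1 (\<lambda>x. F x - G i x)) = (\<integral>\<^sup>+x. ennreal (norm (\<integral>w. ?k w x \<partial>lborel)) \<partial>lborel)"
      unfolding nn_fock_1[OF FG, symmetric] e ..
    also have "\<dots> \<le> (\<integral>\<^sup>+x. \<integral>\<^sup>+w. ennreal (norm (?k w x)) \<partial>lborel \<partial>lborel)"
      by (intro nn_integral_mono integral_norm_bound_ennreal ki)
    also have "\<dots> = (\<integral>\<^sup>+w. \<integral>\<^sup>+x. ennreal (norm (?k w x)) \<partial>lborel \<partial>lborel)"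
    proof (rule lborel_pair.Fubini')
      have "(\<lambda>p. ennreal (norm (?k (fst p) (snd p)))) \<in> borel_measurable (borel \<Otimes>\<^sub>M borel)" using km by measurable
      then show "(\<lambda>(w, x). ennreal (norm (?k w x))) \<in> borel_measurable (lborel \<Otimes>\<^sub>M lborel)" by (simp add: case_prod_unfold cong: measurable_cong_sets)
    qed
    also have "\<dots> = (\<integral>\<^sup>+w. ennreal (norm (F w * gw w)) * n i w \<partial>lborel)"
    proof (intro nn_integral_cong)
      fix w
      have [measurable]: "fock_weighted (\<lambda>x. ekern (cnj_vec w) x - ekern (cnj_vec (s i w)) x) \<in> borel_measurable borel"
        by (intro fock_weighted_measurable entire_diff entire_ekern)
      show "(\<integral>\<^sup>+x. ennreal (norm (?k w x)) \<partial>lborel) = ennreal (norm (F w * gw w)) * n i w"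
        unfolding n_def norm_mult[of "F w * gw w"] by (subst nn_integral_cmult[symmetric]) (measurable, simp only: ennreal_mult norm_ge_zero)
    qed
    finally show ?thesis .
  qed
  have "(\<lambda>i. \<integral>\<^sup>+w. ennreal (norm (F w * gw w)) * n i w \<partial>lborel) \<longlonglongrightarrow> (\<integral>\<^sup>+w. 0 \<partial>(lborel :: (complex^'n) measure))"
  proof (rule nn_integral_dominated_convergence[where w="\<lambda>w. ennreal (2 * ?N * (C * exp (pi / 2) * exp (- pi * ?d * (norm w)\<^sup>2 + pi * norm w)))"])
    show "(\<integral>\<^sup>+w. ennreal (2 * ?N * (C * exp (pi / 2) * exp (- pi * ?d * (norm w)\<^sup>2 + pi * norm w))) \<partial>(lborel :: (complex^'n) measure)) < \<infinity>"
      using di[of "2 * ?N"] C0 unfolding integrable_iff_bounded by (simp add: abs_mult)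
    show "AE w in lborel. ennreal (norm (F w * gw w)) * n i w \<le> ennreal (2 * ?N * (C * exp (pi / 2) * exp (- pi * ?d * (norm w)\<^sup>2 + pi * norm w)))" for i
    proof (rule AE_I2)
      fix w
      have "ennreal (norm (F w * gw w)) * n i w \<le> ennreal (norm (F w * gw w)) * ennreal (2 * ?N * exp (pi / 2 * (norm w + 1)\<^sup>2))"
        by (intro mult_left_mono nb) simp
      also have "\<dots> = ennreal (norm (F w * gw w) * (2 * ?N * exp (pi / 2 * (norm w + 1)\<^sup>2)))" by (rule ennreal_mult[symmetric]) auto
      also have "norm (F w * gw w) * (2 * ?N * exp (pi / 2 * (norm w + 1)\<^sup>2)) = 2 * ?N * (norm (F w * gw w) * exp (pi / 2 * (norm w + 1)\<^sup>2))" by (simp only: mult_ac)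
      also have "ennreal (2 * ?N * (norm (F w * gw w) * exp (pi / 2 * (norm w + 1)\<^sup>2))) \<le> ennreal (2 * ?N * (C * exp (pi / 2) * exp (- pi * ?d * (norm w)\<^sup>2 + pi * norm w)))"
        by (intro ennreal_leI mult_left_mono dom0) auto
      finally show "ennreal (norm (F w * gw w)) * n i w \<le> ennreal (2 * ?N * (C * exp (pi / 2) * exp (- pi * ?d * (norm w)\<^sup>2 + pi * norm w)))" .
    qed
    show "AE w in lborel. (\<lambda>i. ennreal (norm (F w * gw w)) * n i w) \<longlonglongrightarrow> 0"
    proof (rule AE_I2)
      fix w
      have "(\<lambda>i. ennreal (norm (F w * gw w)) * n i w) \<longlonglongrightarrow> ennreal (norm (F w * gw w)) * 0"
        by (rule ennreal_tendsto_cmult[OF _ nlim]) simp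
      then show "(\<lambda>i. ennreal (norm (F w * gw w)) * n i w) \<longlonglongrightarrow> 0" by simp
    qed
  qed measurable
  then have u0: "(\<lambda>i. \<integral>\<^sup>+w. ennreal (norm (F w * gw w)) * n i w \<partial>lborel) \<longlonglongrightarrow> 0" by simp
  have "(\<lambda>i. ennreal (fock_norm 1 (\<lambda>x. F x - G i x))) \<longlonglongrightarrow> ennreal 0"
    by (rule tendsto_sandwich[OF _ _ tendsto_const]) (use upper u0 in \<open>auto intro!: always_eventually\<close>)
  then have N0: "(\<lambda>i. fock_norm 1 (\<lambda>x. F x - G i x)) \<longlonglongrightarrow> 0"
    by (rule tendsto_ennrealD) (auto intro!: always_eventually fock_norm_nonneg)
  have "(\<lambda>i. L F - L (G i)) \<longlonglongrightarrow> 0"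
  proof (rule Lim_null_comparison)
    show "\<forall>\<^sub>F i in sequentially. norm (L F - L (G i)) \<le> A * fock_norm 1 (\<lambda>x. F x - G i x)"
      using bound[OF FG] unfolding diff[OF F GF] by (intro always_eventually allI)
    show "(\<lambda>i. A * fock_norm 1 (\<lambda>x. F x - G i x)) \<longlonglongrightarrow> 0" using tendsto_mult[OF tendsto_const N0, of A] by simp
  qed
  from tendsto_diff[OF tendsto_const[of "L F"] this] have "(\<lambda>i. L (G i)) \<longlonglongrightarrow> L F" by simp
  from LIMSEQ_unique[OF this lim1] show ?thesis by (simp add: mult_ac)
qed

text \<open>Dilates satisfy the decay required in \<open>representation_decay\<close>, and both sides are continuous in the \<open>F\<^sup>1\<close> norm.\<close>

lemma representation:
  fixes F :: "complex^'n \<Rightarrow> complex"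
  assumes F: "F \<in> fock_space 1"
  shows "L F = (\<integral>w. F w * ell w * gw w \<partial>lborel)"
proof -
  let ?F = "\<lambda>k. dil (rseq k) F"
  let ?B = "A * (1 / sqrt (1 / 2)) ^ DIM(complex^'n)"
  have Fi: "F \<in> fock_space \<infinity>" by (rule fock_space_infinity_of_fin[OF _ _ F]) auto
  then obtain C where C: "\<And>z. norm (F z) \<le> C * exp ((pi / 2) * (norm z)\<^sup>2)" unfolding mem_fock_space_infinity by blast
  have r: "\<bar>rseq k\<bar> < 1" for k using rseq(1,2)[of k] by linarith
  have F1: "?F k \<in> fock_space 1" for k by (rule dil_fock_1[OF Fi r])
  have D: "(\<lambda>z. ?F k z - F z) \<in> fock_space 1" for k by (rule fock_space_diff[OF _ F1 F]) simp
  have N: "(\<lambda>k. fock_norm 1 (\<lambda>z. ?F k z - F z)) \<longlonglongrightarrow> 0" by (rule fock_dilation_tendsto[OF _ _ F]) auto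
  have rep: "L (?F k) = (\<integral>w. ?F k w * ell w * gw w \<partial>lborel)" for k
  proof (rule representation_decay[where c="pi / 2 * (rseq k)\<^sup>2"])
    show "entire (?F k)" by (rule entire_dil[OF fock_space_entire[OF F]])
    have "(rseq k)\<^sup>2 < 1" using r[of k] by (simp add: abs_square_less_1)
    then show "pi / 2 * (rseq k)\<^sup>2 < pi / 2" by simp
    fix z show "norm (?F k z) \<le> C * exp (pi / 2 * (rseq k)\<^sup>2 * (norm z)\<^sup>2)"
      using C[of "of_real (rseq k) *s z"] by (simp add: dil_def power_mult_distrib mult.assoc)
  qed
  let ?J = "\<lambda>F. \<integral>w. F w * ell w * gw w \<partial>lborel"
  have "norm ((L F - ?J F)) \<le> (A + ?B) * fock_norm 1 (\<lambda>z. ?F k z - F z)" for k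
  proof -
    have "L F - ?J F = - L (\<lambda>z. ?F k z - F z) + ?J (\<lambda>z. ?F k z - F z)"
      unfolding diff[OF F1 F] left_diff_distrib Bochner_Integration.integral_diff[OF integrand_integrable[OF F1] integrand_integrable[OF F]] rep by simp
    moreover have "norm (L (\<lambda>z. ?F k z - F z)) \<le> A * fock_norm 1 (\<lambda>z. ?F k z - F z)" by (rule bound[OF D])
    moreover have "norm (?J (\<lambda>z. ?F k z - F z)) \<le> ?B * fock_norm 1 (\<lambda>z. ?F k z - F z)"
    proof -
      have "norm (?J (\<lambda>z. ?F k z - F z)) \<le> (\<integral>w. ?B * norm (fock_weighted (\<lambda>z. ?F k z - F z) w) \<partial>lborel)"
      proof (rule norm_integral_le)
        show "integrable lborel (\<lambda>w. ?B * norm (fock_weighted (\<lambda>z. ?F k z - F z) w))"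
          using D[of k] by (intro integrable_mult_right) (simp add: mem_fock_space_1)
      qed (rule integrand_bound)
      then show ?thesis by (simp add: fock_norm_1)
    qed
    moreover have "norm (- a + b) \<le> norm a + norm b" for a b :: complex using norm_triangle_ineq[of "-a" b] by simp
    ultimately show ?thesis by (smt (verit, best) distrib_right)
  qed
  moreover have "(\<lambda>k. (A + ?B) * fock_norm 1 (\<lambda>z. ?F k z - F z)) \<longlonglongrightarrow> 0" using tendsto_mult[OF tendsto_const N, of "A + ?B"] by simp
  ultimately have "norm (L F - ?J F) \<le> 0" by (intro LIMSEQ_le_const[of _ 0]) auto
  then show ?thesis by simp
qed

end

section \<open>Convolution and the integral operator\<close>

lemma fock_symbol_props:
  fixes u :: "'n::finite functional"
  assumes u: "u \<in> modulation_space \<infinity>"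
  shows "entire (fock_symbol u)"
    and "\<exists>C. \<forall>\<zeta>. norm (fock_symbol u \<zeta>) \<le> C * exp (pi / 2 * (norm (re_vec \<zeta>))\<^sup>2)"
    and "fock_symbol u = (\<lambda>\<zeta>. synth (bargmann u) (gker (1 / 2) (- \<zeta>)))"
proof -
  have ut: "u \<in> tempered_distributions" using u unfolding modulation_space_def by simp
  have U: "bargmann u \<in> fock_space \<infinity>" using u modulation_space_infinity[OF ut] by simp
  show s: "fock_symbol u = (\<lambda>\<zeta>. synth (bargmann u) (gker (1 / 2) (- \<zeta>)))"
    by (rule ext) (simp add: fock_symbol_gker tempered_gker_eq_synth[OF u])
  have m: "(- 1) *s \<zeta> + 0 = - \<zeta>" for \<zeta> :: "complex^'n" by (simp add: vec_eq_iff)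
  have "entire (\<lambda>\<zeta>. u (gker (1 / 2) ((- 1) *s \<zeta> + 0)))" by (rule entire_affine[OF tempered_gker_entire[OF ut]]) simp
  then show "entire (fock_symbol u)" unfolding fock_symbol_gker[abs_def] m .
  obtain C where C: "\<And>\<zeta>. norm (synth (bargmann u) (gker (1 / 2) \<zeta>)) \<le> C * exp (pi / 2 * (norm (re_vec \<zeta>))\<^sup>2)"
    using synth_symbol_bound[OF U] by blast
  have "norm (fock_symbol u \<zeta>) \<le> C * exp (pi / 2 * (norm (re_vec \<zeta>))\<^sup>2)" for \<zeta>
    unfolding s using C[of "- \<zeta>"] by simp
  then show "\<exists>C. \<forall>\<zeta>. norm (fock_symbol u \<zeta>) \<le> C * exp (pi / 2 * (norm (re_vec \<zeta>))\<^sup>2)" by blast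
qed

lemma modulation_space_bargmann:
  fixes f :: "'n::finite functional"
  assumes "p < \<infinity>" "f \<in> modulation_space p"
  shows "f \<in> tempered_distributions" "bargmann f \<in> fock_space p" "modulation_norm p f = fock_norm p (bargmann f)"
proof -
  show f: "f \<in> tempered_distributions" using assms(2) unfolding modulation_space_def by simp
  show "bargmann f \<in> fock_space p" "modulation_norm p f = fock_norm p (bargmann f)"
    using assms(2) modulation_space_fin[OF f assms(1)] by auto
qed

lemma synth_modulation_space:
  fixes F :: "complex^'n::finite \<Rightarrow> complex"
  assumes p: "1 \<le> p" "p < \<infinity>" and F: "F \<in> fock_space p"
  shows "synth F \<in> modulation_space p" "modulation_norm p (synth F) = fock_norm p F" "bargmann (synth F) = F"
proof -
  have Fi: "F \<in> fock_space \<infinity>" by (rule fock_space_infinity_of_fin[OF p F])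
  show B: "bargmann (synth F) = F" by (rule bargmann_synth[OF Fi])
  show "synth F \<in> modulation_space p" "modulation_norm p (synth F) = fock_norm p F"
    using modulation_space_fin[OF synth_tempered[OF Fi] p(2)] F unfolding B by auto
qed

lemma convolution_hconv:
  fixes u f :: "'n::finite functional"
  assumes "u \<in> tempered_distributions" "f \<in> tempered_distributions"
  shows "Defs.convolution u f = distribution_of (hconv (bargmann u) (bargmann f))"
  unfolding Defs.convolution_def modulation_pairing_hconv[OF assms] ..

text \<open>The convolution is a bounded function, so it is recovered from its Bargmann transform.\<close>

lemma distribution_of_hconv:
  fixes U F :: "complex^'n::finite \<Rightarrow> complex"
  assumes U: "U \<in> fock_space \<infinity>" and F: "F \<in> fock_space 1"
  shows "distribution_of (hconv U F) = synth (fbarg (hconv U F))"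
    and "bargmann (distribution_of (hconv U F)) = fbarg (hconv U F)"
proof -
  obtain B where B: "\<And>z. norm (U z) \<le> B * exp ((pi / 2) * (norm z)\<^sup>2)" using U unfolding mem_fock_space_infinity by blast
  note h = hconv_props[OF fock_space_entire[OF U] B F]
  show "distribution_of (hconv U F) = synth (fbarg (hconv U F))"
  proof
    fix g :: "real^'n \<Rightarrow> complex"
    show "distribution_of (hconv U F) g = synth (fbarg (hconv U F)) g"
      using integral_eq_synth[OF h] unfolding distribution_of_def by (cases "g \<in> schwartz") (auto simp: synth_def)
  qed
  show "bargmann (distribution_of (hconv U F)) = fbarg (hconv U F)"
    by (rule ext) (simp add: bargmann_def distribution_of_def kf_schwartz fbarg_def)
qed

lemma fbarg_hconv_symbol:
  fixes u :: "'n::finite functional"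
  assumes u: "u \<in> modulation_space \<infinity>" and F: "F \<in> fock_space 1"
  shows "fbarg (hconv (bargmann u) F) = fock_integral_operator (fock_symbol u) F"
proof
  fix z
  have ut: "u \<in> tempered_distributions" using u unfolding modulation_space_def by simp
  have U: "bargmann u \<in> fock_space \<infinity>" using u modulation_space_infinity[OF ut] by simp
  show "fbarg (hconv (bargmann u) F) z = fock_integral_operator (fock_symbol u) F z"
    unfolding fock_symbol_props(3)[OF u] by (rule fbarg_hconv[OF U F])
qed

section \<open>Shifts and bounded operators on Fock spaces\<close>

text \<open>The exponential factor of the shift is what makes it a translation of the weighted function.\<close>

lemma norm_fock_weighted_shift:
  "norm (fock_weighted (fock_shift y F) w) = norm (fock_weighted F (w - of_real_vec y))"
proof -
  have R: "Re (- of_real pi * of_real (y \<bullet> y) / 2 + of_real pi * dotc (of_real_vec y) w) = - (pi / 2) * (y \<bullet> y) + pi * (y \<bullet> re_vec w)"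
    by (simp add: Re_dotc)
  have "(- (pi / 2) * (y \<bullet> y) + pi * (y \<bullet> re_vec w)) + - (pi / 2) * (norm w)\<^sup>2 = - (pi / 2) * (norm (w - of_real_vec y))\<^sup>2"
    unfolding norm_sq_re_im by (simp add: inner_diff_left inner_diff_right inner_commute field_simps)
  then have e: "exp (- (pi / 2) * (y \<bullet> y) + pi * (y \<bullet> re_vec w)) * exp (- (pi / 2) * (norm w)\<^sup>2) = exp (- (pi / 2) * (norm (w - of_real_vec y))\<^sup>2)"
    by (simp only: mult_exp_exp)
  have "norm (fock_weighted (fock_shift y F) w) = norm (F (w - of_real_vec y)) * (exp (- (pi / 2) * (y \<bullet> y) + pi * (y \<bullet> re_vec w)) * exp (- (pi / 2) * (norm w)\<^sup>2))"
    unfolding norm_fock_weighted fock_shift_def norm_mult norm_exp_eq_Re R by (simp only: mult_ac)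
  then show ?thesis unfolding e norm_fock_weighted .
qed

lemma entire_fock_shift:
  fixes F :: "complex^'n::finite \<Rightarrow> complex"
  assumes "entire F" shows "entire (fock_shift y F)"
proof -
  have "entire (\<lambda>w. F (w + - of_real_vec y))" by (rule entire_translate[OF assms])
  then have "entire (\<lambda>w. F (w - of_real_vec y))" by simp
  then show ?thesis unfolding fock_shift_def[abs_def] by (intro entire_mult entire_exp entire_add entire_const entire_dotc)
qed

lemma fock_shift_space:
  fixes F :: "complex^'n::finite \<Rightarrow> complex"
  assumes p: "p < \<infinity>" and F: "F \<in> fock_space p"
  shows "fock_shift y F \<in> fock_space p" "fock_norm p (fock_shift y F) = fock_norm p F"
proof -
  have E: "entire F" by (rule fock_space_entire[OF F])
  let ?f = "\<lambda>w. norm (fock_weighted F w) powr enn2real p"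
  note [measurable] = fock_weighted_measurable[OF E]
  have m: "?f \<in> borel_measurable borel" by measurable
  have e: "norm (fock_weighted (fock_shift y F) w) powr enn2real p = ?f (w + - of_real_vec y)" for w
    unfolding norm_fock_weighted_shift by simp
  show "fock_shift y F \<in> fock_space p"
    using F entire_fock_shift[OF E] unfolding mem_fock_space_fin[OF p] e integral_lborel_translate(2)[OF m] by blast
  show "fock_norm p (fock_shift y F) = fock_norm p F"
    unfolding fock_norm_fin[OF p] e integral_lborel_translate(1)[OF m] ..
qed

lemma fock_shift_add: "fock_shift y (\<lambda>z. F z + G z) = (\<lambda>z. fock_shift y F z + fock_shift y G z)"
  and fock_shift_mult: "fock_shift y (\<lambda>z. c * F z) = (\<lambda>z. c * fock_shift y F z)"
  unfolding fock_shift_def by (rule ext, simp only: distrib_left, rule ext, simp only: mult.left_commute)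

lemma fock_integral_operator_shift:
  fixes F :: "complex^'n::finite \<Rightarrow> complex"
  assumes \<phi>: "entire \<phi>" and F: "entire F"
  shows "fock_integral_operator \<phi> (fock_shift y F) = fock_shift y (fock_integral_operator \<phi> F)"
proof
  fix z :: "complex^'n"
  let ?Y = "of_real_vec y :: complex^'n"
  let ?c = "exp (- of_real pi * of_real (y \<bullet> y) / 2 + of_real pi * dotc ?Y z)"
  have i: "fock_integrand \<phi> (fock_shift y F) z (w + ?Y) = ?c * fock_integrand \<phi> F (z - ?Y) w" for w
  proof -
    have d: "dotc ?Y (cnj_vec w) = dotc (cnj_vec w) ?Y" by (rule dotc_commute)
    have "- of_real pi * of_real (y \<bullet> y) / 2 + of_real pi * dotc ?Y (w + ?Y) + of_real pi * dotc (cnj_vec (w + ?Y)) z + - of_real pi * dotc (cnj_vec (w + ?Y)) (w + ?Y)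
      = (- of_real pi * of_real (y \<bullet> y) / 2 + of_real pi * dotc ?Y z) + of_real pi * dotc (cnj_vec w) (z - ?Y) + - of_real pi * dotc (cnj_vec w) w"
      by (simp add: field_simps)
    then have e: "exp (- of_real pi * of_real (y \<bullet> y) / 2 + of_real pi * dotc ?Y (w + ?Y)) * exp (of_real pi * dotc (cnj_vec (w + ?Y)) z) * gw (w + ?Y)
      = ?c * exp (of_real pi * dotc (cnj_vec w) (z - ?Y)) * gw w"
      unfolding gw_eq mult_exp_exp by (rule arg_cong)
    have c: "cnj_vec (w + ?Y) - z = cnj_vec w - (z - ?Y)" by simp
    have "fock_integrand \<phi> (fock_shift y F) z (w + ?Y)
      = (exp (- of_real pi * of_real (y \<bullet> y) / 2 + of_real pi * dotc ?Y (w + ?Y)) * exp (of_real pi * dotc (cnj_vec (w + ?Y)) z) * gw (w + ?Y)) * F w * \<phi> (cnj_vec w - (z - ?Y))"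
      unfolding fock_integrand_def fock_shift_def c gw_def[symmetric] add_diff_cancel_right' by (simp only: mult_ac)
    also have "\<dots> = ?c * fock_integrand \<phi> F (z - ?Y) w"
      unfolding e fock_integrand_def gw_def[symmetric] by (simp only: mult_ac)
    finally show ?thesis .
  qed
  have "fock_integral_operator \<phi> (fock_shift y F) z = (\<integral>w. fock_integrand \<phi> (fock_shift y F) z (w + ?Y) \<partial>lborel)"
    unfolding fock_integral_operator_def by (rule integral_lborel_translate(1)[OF fock_integrand_measurable[OF \<phi> entire_fock_shift[OF F]], symmetric])
  also have "\<dots> = ?c * fock_integral_operator \<phi> F (z - ?Y)" unfolding i fock_integral_operator_def by simp
  finally show "fock_integral_operator \<phi> (fock_shift y F) z = fock_shift y (fock_integral_operator \<phi> F) z" unfolding fock_shift_def .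
qed

lemma bounded_operator_onD:
  assumes "bounded_operator_on X N T"
  shows "f \<in> X \<Longrightarrow> T f \<in> X" "f \<in> X \<Longrightarrow> g \<in> X \<Longrightarrow> T (\<lambda>x. f x + g x) = (\<lambda>x. T f x + T g x)"
    "f \<in> X \<Longrightarrow> T (\<lambda>x. c * f x) = (\<lambda>x. c * T f x)" "\<exists>C. \<forall>f\<in>X. N (T f) \<le> C * N f"
  using assms unfolding bounded_operator_on_def by blast+

lemma bounded_operator_shift:
  fixes T :: "(complex^'n::finite \<Rightarrow> complex) \<Rightarrow> complex^'n \<Rightarrow> complex"
  assumes p: "p < \<infinity>" and T: "bounded_operator_on (fock_space p) (fock_norm p) T"
  shows "bounded_operator_on (fock_space p) (fock_norm p) (\<lambda>F. T (fock_shift y F))"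
    and "bounded_operator_on (fock_space p) (fock_norm p) (\<lambda>F. fock_shift y (T F))"
proof -
  note D = bounded_operator_onD[OF T] and S = fock_shift_space[OF p]
  obtain C where C: "\<And>F. F \<in> fock_space p \<Longrightarrow> fock_norm p (T F) \<le> C * fock_norm p F" using D(4) by blast
  have 1: "fock_norm p (T (fock_shift y F)) \<le> C * fock_norm p F" if "F \<in> fock_space p" for F
    using C[OF S(1)[OF that, of y]] S(2)[OF that, of y] by simp
  have 2: "fock_norm p (fock_shift y (T F)) \<le> C * fock_norm p F" if "F \<in> fock_space p" for F
    using C[OF that] S(2)[OF D(1)[OF that], of y] by simp
  show "bounded_operator_on (fock_space p) (fock_norm p) (\<lambda>F. T (fock_shift y F))"
    unfolding bounded_operator_on_def
    proof (intro conjI ballI allI exI[of _ C])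
    fix F :: "complex^'n \<Rightarrow> complex" assume F: "F \<in> fock_space p"
    show "T (fock_shift y F) \<in> fock_space p" by (rule D(1)[OF S(1)[OF F]])
    show "fock_norm p (T (fock_shift y F)) \<le> C * fock_norm p F" by (rule 1[OF F])
    show "T (fock_shift y (\<lambda>x. c * F x)) = (\<lambda>x. c * T (fock_shift y F) x)" for c unfolding fock_shift_mult by (rule D(3)[OF S(1)[OF F]])
    show "T (fock_shift y (\<lambda>x. F x + G x)) = (\<lambda>x. T (fock_shift y F) x + T (fock_shift y G) x)" if "G \<in> fock_space p" for G
      unfolding fock_shift_add by (rule D(2)[OF S(1)[OF F] S(1)[OF that]])
  qed
  show "bounded_operator_on (fock_space p) (fock_norm p) (\<lambda>F. fock_shift y (T F))"
    unfolding bounded_operator_on_def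
    proof (intro conjI ballI allI exI[of _ C])
    fix F :: "complex^'n \<Rightarrow> complex" assume F: "F \<in> fock_space p"
    show "fock_shift y (T F) \<in> fock_space p" by (rule S(1)[OF D(1)[OF F]])
    show "fock_norm p (fock_shift y (T F)) \<le> C * fock_norm p F" by (rule 2[OF F])
    show "fock_shift y (T (\<lambda>x. c * F x)) = (\<lambda>x. c * fock_shift y (T F) x)" for c
      unfolding D(3)[OF F] by (rule fock_shift_mult)
    show "fock_shift y (T (\<lambda>x. F x + G x)) = (\<lambda>x. fock_shift y (T F) x + fock_shift y (T G) x)" if G: "G \<in> fock_space p" for G
      unfolding D(2)[OF F G] by (rule fock_shift_add)
  qed
qed

lemma bounded_operator_pointwise:
  fixes T :: "(complex^'n::finite \<Rightarrow> complex) \<Rightarrow> complex^'n \<Rightarrow> complex"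
  assumes p: "1 \<le> p" "p < \<infinity>" and T: "bounded_operator_on (fock_space p) (fock_norm p) T"
  shows "\<exists>A\<ge>0. \<forall>F\<in>fock_space p. \<forall>z. norm (T F z) \<le> A * exp (pi / 2 * (norm z)\<^sup>2) * fock_norm p F"
proof -
  obtain K where K: "K > 0" "\<And>F z. F \<in> (fock_space p :: (complex^'n \<Rightarrow> complex) set) \<Longrightarrow> norm (F z) \<le> K * fock_norm p F * exp ((pi / 2) * (norm z)\<^sup>2)"
    using fock_pointwise[OF p, where 'n='n] by blast
  obtain C where C: "\<And>F. F \<in> fock_space p \<Longrightarrow> fock_norm p (T F) \<le> C * fock_norm p F" using bounded_operator_onD(4)[OF T] by blast
  have "norm (T F z) \<le> (K * \<bar>C\<bar>) * exp (pi / 2 * (norm z)\<^sup>2) * fock_norm p F" if F: "F \<in> fock_space p" for F z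
  proof -
    have "fock_norm p (T F) \<le> \<bar>C\<bar> * fock_norm p F"
      by (rule order_trans[OF C[OF F]]) (intro mult_right_mono abs_ge_self fock_norm_nonneg)
    then have "K * fock_norm p (T F) * exp ((pi / 2) * (norm z)\<^sup>2) \<le> K * (\<bar>C\<bar> * fock_norm p F) * exp ((pi / 2) * (norm z)\<^sup>2)"
      using K(1) by (intro mult_right_mono mult_left_mono) auto
    from order_trans[OF K(2)[OF bounded_operator_onD(1)[OF T F], of z] this] show ?thesis by (simp only: mult_ac)
  qed
  then show ?thesis using K(1) by (intro exI[of _ "K * \<bar>C\<bar>"] conjI) auto
qed

text \<open>Operators are compared on the dilates of \<open>F\<close>, which lie in \<open>F\<^sup>1\<close>, and norm convergence in \<open>F\<^sup>p\<close> implies pointwise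
  convergence.\<close>

lemma bounded_operators_eq:
  fixes T T' :: "(complex^'n::finite \<Rightarrow> complex) \<Rightarrow> complex^'n \<Rightarrow> complex"
  assumes p: "1 \<le> p" "p < \<infinity>" and T: "bounded_operator_on (fock_space p) (fock_norm p) T"
    and T': "bounded_operator_on (fock_space p) (fock_norm p) T'"
    and eq: "\<And>F. F \<in> fock_space 1 \<Longrightarrow> T F = T' F" and F: "F \<in> fock_space p"
  shows "T F = T' F"
proof
  fix z
  let ?G = "\<lambda>k. dil (rseq k) F"
  obtain C where "\<forall>F \<in> (fock_space 1 :: (complex^'n \<Rightarrow> complex) set). F \<in> fock_space p \<and> fock_norm p F \<le> C * fock_norm 1 F"
    using fock_space_1_embed[OF p, where 'n='n] by blast
  then have emb: "H \<in> fock_space p" if "H \<in> fock_space 1" for H :: "complex^'n \<Rightarrow> complex" using that by blast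
  have "\<bar>rseq k\<bar> < 1" for k using rseq(1,2)[of k] by linarith
  then have G1: "?G k \<in> fock_space 1" for k by (rule dil_fock_1[OF fock_space_infinity_of_fin[OF p F]])
  have lim: "(\<lambda>k. L (?G k) z) \<longlonglongrightarrow> L F z" if L: "bounded_operator_on (fock_space p) (fock_norm p) L" for L
  proof -
    obtain A where A: "\<And>F z. F \<in> fock_space p \<Longrightarrow> norm (L F z) \<le> A * exp (pi / 2 * (norm z)\<^sup>2) * fock_norm p F"
      using bounded_operator_pointwise[OF p L] by blast
    have "norm (L (?G k) z - L F z) \<le> A * exp (pi / 2 * (norm z)\<^sup>2) * fock_norm p (\<lambda>x. ?G k x - F x)" for k
    proof -
      have GF: "(\<lambda>x. ?G k x - F x) \<in> fock_space p" by (rule fock_space_diff[OF p(2) emb[OF G1] F])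
      have "L (\<lambda>x. (?G k x - F x) + F x) = (\<lambda>x. L (\<lambda>x. ?G k x - F x) x + L F x)" by (rule bounded_operator_onD(2)[OF L GF F])
      then have "L (?G k) = (\<lambda>x. L (\<lambda>x. ?G k x - F x) x + L F x)" by (simp only: diff_add_cancel)
      from fun_cong[OF this, of z] have e: "L (?G k) z - L F z = L (\<lambda>x. ?G k x - F x) z" by (simp only: add_diff_cancel_right')
      show ?thesis unfolding e by (rule A[OF GF])
    qed
    moreover have "(\<lambda>k. A * exp (pi / 2 * (norm z)\<^sup>2) * fock_norm p (\<lambda>x. ?G k x - F x)) \<longlonglongrightarrow> 0"
      using tendsto_mult[OF tendsto_const fock_dilation_tendsto[OF p F], of "A * exp (pi / 2 * (norm z)\<^sup>2)"] by simp
    ultimately have "(\<lambda>k. L (?G k) z - L F z) \<longlonglongrightarrow> 0"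
      by (rule Lim_null_comparison[OF always_eventually[OF allI]])
    then show ?thesis by (rule LIM_zero_cancel)
  qed
  show "T F z = T' F z" using LIMSEQ_unique[OF lim[OF T] lim[OF T', folded eq[OF G1]]] .
qed

section \<open>From convolutors to operators\<close>

text \<open>The extension is the conjugate under the Bargmann transform of the operator on \<open>M\<^sup>p\<close>. Translation invariance
  is an identity between the two bounded operators \<open>F \<mapsto> T (fock_shift y F)\<close> and \<open>F \<mapsto> fock_shift y (T F)\<close>, so it suffices to
  check it on \<open>F\<^sup>1\<close>.\<close>

lemma convolutor_extension:
  fixes u :: "'n::finite functional"
  assumes p: "1 \<le> p" "p < \<infinity>" and u: "u \<in> convolutors p"
  shows "\<exists>T. bounded_invariant_extension p (fock_integral_operator (fock_symbol u)) T"
proof -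
  have ui: "u \<in> modulation_space \<infinity>" using u unfolding convolutors_def by simp
  then have ut: "u \<in> tempered_distributions" unfolding modulation_space_def by simp
  have U: "bargmann u \<in> fock_space \<infinity>" using ui modulation_space_infinity[OF ut] by simp
  obtain T0 where T0: "bounded_operator_on (modulation_space p) (modulation_norm p) T0"
    and conv: "\<And>f. f \<in> modulation_space 1 \<Longrightarrow> T0 f = Defs.convolution u f" using u unfolding convolutors_def by blast
  note D = bounded_operator_onD[OF T0] and M = synth_modulation_space[OF p] and B = modulation_space_bargmann[OF p(2)]
  define T where "T F = bargmann (T0 (synth F))" for F :: "complex^'n \<Rightarrow> complex"
  obtain C where C: "\<And>f. f \<in> modulation_space p \<Longrightarrow> modulation_norm p (T0 f) \<le> C * modulation_norm p f" using D(4) by blast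
  have T: "bounded_operator_on (fock_space p) (fock_norm p) T"
    unfolding bounded_operator_on_def
  proof (intro conjI ballI allI exI[of _ C])
    fix F :: "complex^'n \<Rightarrow> complex" assume F: "F \<in> fock_space p"
    show "T F \<in> fock_space p" unfolding T_def by (rule B(2)[OF D(1)[OF M(1)[OF F]]])
    show "fock_norm p (T F) \<le> C * fock_norm p F"
      using C[OF M(1)[OF F]] unfolding T_def M(2)[OF F] B(3)[OF D(1)[OF M(1)[OF F]]] .
    show "T (\<lambda>x. c * F x) = (\<lambda>x. c * T F x)" for c
      unfolding T_def synth_mult D(3)[OF M(1)[OF F]] by (rule ext) (simp only: bargmann_def)
    fix G :: "complex^'n \<Rightarrow> complex" assume G: "G \<in> fock_space p"
    show "T (\<lambda>x. F x + G x) = (\<lambda>x. T F x + T G x)"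
      unfolding T_def synth_add[OF fock_space_infinity_of_fin[OF p F] fock_space_infinity_of_fin[OF p G]] D(2)[OF M(1)[OF F] M(1)[OF G]]
      by (rule ext) (simp only: bargmann_def)
  qed
  have ext: "T F = fock_integral_operator (fock_symbol u) F" if F: "F \<in> fock_space 1" for F
  proof -
    have f: "synth F \<in> modulation_space 1" and b: "bargmann (synth F) = F" by (rule synth_modulation_space[OF _ _ F], simp, simp)+
    have "T0 (synth F) = distribution_of (hconv (bargmann u) F)"
      using conv[OF f] convolution_hconv[OF ut, of "synth F"] f b unfolding modulation_space_def by simp
    then show ?thesis unfolding T_def using distribution_of_hconv(2)[OF U F] fbarg_hconv_symbol[OF ui F] by simp
  qed
  have "T (fock_shift y F) = fock_shift y (T F)" if F: "F \<in> fock_space p" for y F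
  proof (rule bounded_operators_eq[OF p bounded_operator_shift[OF p(2) T] _ F])
    fix F :: "complex^'n \<Rightarrow> complex" assume F: "F \<in> fock_space 1"
    have "fock_shift y F \<in> fock_space 1" by (rule fock_shift_space(1)[OF _ F]) simp
    then show "T (fock_shift y F) = fock_shift y (T F)"
      using fock_integral_operator_shift[OF fock_symbol_props(1)[OF ui] fock_space_entire[OF F]] by (simp only: ext F)
  qed
  with T ext show ?thesis unfolding bounded_invariant_extension_def translation_invariant_on_def by blast
qed

section \<open>From operators to convolutors\<close>

text \<open>Up to a constant, the formula of \<open>symbol_inversion\<close> that recovers a Bargmann transform from the symbol.\<close>

definition cross :: "(complex^'n::finite \<Rightarrow> complex) \<Rightarrow> complex^'n \<Rightarrow> complex" where
  "cross \<psi> z = (\<integral>\<eta>. \<psi> (\<i> *s of_real_vec \<eta> - z) * gker (1 / 2) (\<i> *s z) \<eta> \<partial>lborel)"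

lemma cross_props:
  fixes \<psi> :: "complex^'n::finite \<Rightarrow> complex"
  assumes E: "entire \<psi>" and le: "\<And>\<zeta>. norm (\<psi> \<zeta>) \<le> C * exp (pi / 2 * (norm (re_vec \<zeta>))\<^sup>2)"
  shows "integrable lborel (\<lambda>\<eta>. \<psi> (\<i> *s of_real_vec \<eta> - z) * gker (1 / 2) (\<i> *s z) \<eta>)"
    and "norm (cross \<psi> z) \<le> C * (1 / sqrt (1 / 2)) ^ DIM(real^'n) * exp (pi / 2 * (norm z)\<^sup>2)"
    and "entire (cross \<psi>)"
proof -
  note [measurable] = entire_measurable[OF E]
  have [measurable]: "(\<lambda>\<eta>. \<i> *s of_real_vec \<eta> :: complex^'n) \<in> borel_measurable borel"
    by (intro borel_measurable_continuous_onI continuous_intros)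
  have m: "(\<lambda>\<eta>. \<psi> (\<i> *s of_real_vec \<eta> - z) * gker (1 / 2) (\<i> *s z) \<eta>) \<in> borel_measurable lborel" for z
    by measurable
  have C0: "C \<ge> 0" using order_trans[OF norm_ge_zero le[of 0]] by simp
  have le': "norm (\<psi> (\<i> *s of_real_vec \<eta> - z)) \<le> C * exp (pi / 2 * (norm (re_vec z))\<^sup>2)" for \<eta> z
    using le[of "\<i> *s of_real_vec \<eta> - z"] by simp
  have b: "norm (\<psi> (\<i> *s of_real_vec \<eta> - z) * gker (1 / 2) (\<i> *s z) \<eta>)
      \<le> (C * exp (pi / 2 * (norm z)\<^sup>2)) * exp (- (pi / 2) * (norm (\<eta> - - im_vec z))\<^sup>2)" for \<eta> z
  proof -
    have "norm (\<psi> (\<i> *s of_real_vec \<eta> - z) * gker (1 / 2) (\<i> *s z) \<eta>)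
      \<le> (C * exp (pi / 2 * (norm (re_vec z))\<^sup>2)) * exp (- pi * Re (1 / 2) * (norm \<eta>)\<^sup>2 + pi * (\<eta> \<bullet> re_vec (\<i> *s z)))"
      unfolding norm_mult norm_gker by (intro mult_right_mono le') simp
    also have "\<dots> = C * exp (pi / 2 * (norm (re_vec z))\<^sup>2 + (- pi * Re (1 / 2) * (norm \<eta>)\<^sup>2 + pi * (\<eta> \<bullet> re_vec (\<i> *s z))))"
      by (simp only: exp_add mult.assoc)
    also have "pi / 2 * (norm (re_vec z))\<^sup>2 + (- pi * Re (1 / 2) * (norm \<eta>)\<^sup>2 + pi * (\<eta> \<bullet> re_vec (\<i> *s z)))
        = pi / 2 * (norm z)\<^sup>2 + - (pi / 2) * (norm (\<eta> - - im_vec z))\<^sup>2"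
      unfolding norm_sq_re_im power2_norm_eq_inner by (simp add: inner_add_left inner_add_right inner_commute field_simps)
    finally show ?thesis by (simp only: exp_add mult.assoc)
  qed
  have i: "integrable lborel (\<lambda>\<eta>. (C * exp (pi / 2 * (norm z)\<^sup>2)) * exp (- (pi / 2) * (norm (\<eta> - - im_vec z))\<^sup>2))" for z :: "complex^'n"
    by (intro integrable_mult_right gauss_shift(1))
  show "integrable lborel (\<lambda>\<eta>. \<psi> (\<i> *s of_real_vec \<eta> - z) * gker (1 / 2) (\<i> *s z) \<eta>)"
    by (rule Bochner_Integration.integrable_bound[OF i[of z] m]) (rule AE_I2, rule order_trans[OF b], simp only: real_norm_def abs_ge_self)
  show "norm (cross \<psi> z) \<le> C * (1 / sqrt (1 / 2)) ^ DIM(real^'n) * exp (pi / 2 * (norm z)\<^sup>2)"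
    using norm_integral_le[OF i b] unfolding integral_mult_right_zero gauss_shift(2) cross_def by (simp only: mult_ac)
  show "entire (cross \<psi>)" unfolding cross_def[abs_def]
  proof (rule entire_integral[OF _ m])
    fix \<eta> :: "real^'n"
    have "\<i> *s of_real_vec \<eta> - z = (- 1) *s z + \<i> *s of_real_vec \<eta>" for z :: "complex^'n" by (simp add: vec_eq_iff)
    then show "entire (\<lambda>z. \<psi> (\<i> *s of_real_vec \<eta> - z) * gker (1 / 2) (\<i> *s z) \<eta>)"
      using entire_affine[OF E, of "- 1" "\<i> *s of_real_vec \<eta>"] entire_smult[OF entire_gker[of "1 / 2" \<eta>], of \<i>]
      by (simp only: entire_mult)
  next
    fix R
    let ?h = "\<lambda>\<eta>::real^'n. (C * exp (pi / 2 * R\<^sup>2)) * exp (- pi * (1 / 2) * (norm \<eta>)\<^sup>2 + pi * R * norm \<eta>)"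
    have "integrable lborel ?h" by (intro integrable_mult_right integrable_gauss_lin) simp
    moreover have "norm (\<psi> (\<i> *s of_real_vec \<eta> - z) * gker (1 / 2) (\<i> *s z) \<eta>) \<le> ?h \<eta>" if z: "norm z \<le> R" for z \<eta>
      unfolding norm_mult
    proof (intro mult_mono)
      have "norm (re_vec z) \<le> R" using order_trans[OF norm_re_vec_le z] .
      then have "exp (pi / 2 * (norm (re_vec z))\<^sup>2) \<le> exp (pi / 2 * R\<^sup>2)" by (simp add: power_mono)
      from order_trans[OF le' mult_left_mono[OF this C0]] show "norm (\<psi> (\<i> *s of_real_vec \<eta> - z)) \<le> C * exp (pi / 2 * R\<^sup>2)" .
      show "norm (gker (1 / 2) (\<i> *s z) \<eta>) \<le> exp (- pi * (1 / 2) * (norm \<eta>)\<^sup>2 + pi * R * norm \<eta>)"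
        using order_trans[OF norm_im_vec_le z] by (intro gker_bound) auto
    qed (use C0 in auto)
    ultimately show "\<exists>h. integrable lborel h \<and> (\<forall>z \<eta>. norm z \<le> R \<longrightarrow> norm (\<psi> (\<i> *s of_real_vec \<eta> - z) * gker (1 / 2) (\<i> *s z) \<eta>) \<le> h \<eta>)"
      by blast
  qed
qed

text \<open>At imaginary \<open>z\<close> a translation of the variable turns \<open>cross \<psi> z\<close> into a Gaussian transform with real parameter
  of the restriction of \<open>\<psi>\<close> to the imaginary subspace. This transform is entire in its parameter, so it vanishes also at imaginary
  parameters, where \<open>gaussian_transform_injective\<close> applies.\<close>

lemma cross_eq_0:
  fixes \<psi> :: "complex^'n::finite \<Rightarrow> complex"
  assumes E: "entire \<psi>" and le: "\<And>\<zeta>. norm (\<psi> \<zeta>) \<le> C * exp (pi / 2 * (norm (re_vec \<zeta>))\<^sup>2)"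
    and zero: "\<And>z. cross \<psi> z = 0"
  shows "\<psi> z = 0"
proof -
  define h where "h \<eta> = \<psi> (\<i> *s of_real_vec \<eta>)" for \<eta>
  have hc: "continuous_on UNIV h" unfolding h_def[abs_def]
    by (rule continuous_on_compose2[OF entire_continuous[OF E, of UNIV]]) (intro continuous_intros, simp)
  then have [measurable]: "h \<in> borel_measurable borel" by (rule borel_measurable_continuous_onI)
  have hb: "norm (h \<eta>) \<le> C" for \<eta> using le[of "\<i> *s of_real_vec \<eta>"] unfolding h_def by simp
  have C0: "C \<ge> 0" using order_trans[OF norm_ge_zero hb[of 0]] .
  define J where "J \<zeta> = (\<integral>\<eta>. h \<eta> * gker (1 / 2) \<zeta> \<eta> \<partial>lborel)" for \<zeta> :: "complex^'n"
  have J: "entire J" unfolding J_def[abs_def]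
  proof (rule entire_integral)
    show "entire (\<lambda>z. h \<eta> * gker (1 / 2) z \<eta>)" for \<eta> by (intro entire_mult entire_const entire_gker)
    show "(\<lambda>\<eta>. h \<eta> * gker (1 / 2) z \<eta>) \<in> borel_measurable lborel" for z by measurable
    fix R
    let ?h = "\<lambda>\<eta>::real^'n. C * exp (- pi * (1 / 2) * (norm \<eta>)\<^sup>2 + pi * R * norm \<eta>)"
    have "integrable lborel ?h" by (intro integrable_mult_right integrable_gauss_lin) simp
    moreover have "norm (h \<eta> * gker (1 / 2) z \<eta>) \<le> ?h \<eta>" if "norm z \<le> R" for z \<eta>
      unfolding norm_mult using order_trans[OF norm_re_vec_le that] by (intro mult_mono hb gker_bound C0) auto
    ultimately show "\<exists>h'. integrable lborel h' \<and> (\<forall>z \<eta>. norm z \<le> R \<longrightarrow> norm (h \<eta> * gker (1 / 2) z \<eta>) \<le> h' \<eta>)" by blast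
  qed
  have "J (of_real_vec \<sigma>) = 0" for \<sigma>
  proof -
    \<comment> \<open>translating the variable by \<open>\<tau>\<close> changes the parameter \<open>- \<tau>\<close> into \<open>- 2 \<tau>\<close>\<close>
    define \<tau> where "\<tau> = (- 1 / 2) *\<^sub>R \<sigma>"
    define c where "c = exp (- of_real pi * of_real (3 / 2 * (\<tau> \<bullet> \<tau>)) :: complex)"
    have st: "\<sigma> = (- 2) *\<^sub>R \<tau>" by (simp add: \<tau>_def)
    have shift: "\<psi> (\<i> *s of_real_vec (\<eta> + \<tau>) - \<i> *s of_real_vec \<tau>) * gker (1 / 2) (\<i> *s (\<i> *s of_real_vec \<tau>)) (\<eta> + \<tau>) = c * (h \<eta> * gker (1 / 2) (of_real_vec \<sigma>) \<eta>)" for \<eta>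
    proof -
      have 1: "\<i> *s of_real_vec (\<eta> + \<tau>) - \<i> *s of_real_vec \<tau> = \<i> *s (of_real_vec \<eta> :: complex^'n)" by (simp add: vec_eq_iff distrib_left)
      have 2: "\<i> *s (\<i> *s of_real_vec \<tau>) = of_real_vec (- \<tau>)" by (simp add: vec_eq_iff)
      have "gker (1 / 2) (of_real_vec (- \<tau>)) (\<eta> + \<tau>) = c * gker (1 / 2) (of_real_vec \<sigma>) \<eta>"
        unfolding gker_def c_def mult_exp_exp dotc_of_real st
        by (rule arg_cong[where f=exp]) (simp add: inner_add_left inner_add_right inner_commute field_simps)
      then show ?thesis unfolding 1 2 h_def by simp
    qed
    have [measurable]: "(\<lambda>\<eta>. \<i> *s of_real_vec \<eta> - \<i> *s of_real_vec \<tau> :: complex^'n) \<in> borel_measurable borel"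
      by (intro borel_measurable_continuous_onI continuous_intros)
    note [measurable] = entire_measurable[OF E]
    have "cross \<psi> (\<i> *s of_real_vec \<tau>) = (\<integral>\<eta>. \<psi> (\<i> *s of_real_vec (\<eta> + \<tau>) - \<i> *s of_real_vec \<tau>) * gker (1 / 2) (\<i> *s (\<i> *s of_real_vec \<tau>)) (\<eta> + \<tau>) \<partial>lborel)"
      unfolding cross_def
      by (rule integral_lborel_translate(1)[where f="\<lambda>\<eta>. \<psi> (\<i> *s of_real_vec \<eta> - \<i> *s of_real_vec \<tau>) * gker (1 / 2) (\<i> *s (\<i> *s of_real_vec \<tau>)) \<eta>", symmetric]) measurable
    also have "\<dots> = c * J (of_real_vec \<sigma>)" unfolding shift J_def by simp
    finally show ?thesis using zero[of "\<i> *s of_real_vec \<tau>"] by (simp add: c_def)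
  qed
  then have J0: "J \<zeta> = 0" for \<zeta> using entire_eq_on_real[OF J entire_const[of 0]] by blast
  have "h x = 0" for x
  proof (rule gaussian_transform_injective[OF _ hc hb, of "1 / 2"])
    show "(\<integral>y. h y * gker (of_real (1 / 2)) (\<i> *s of_real_vec \<tau>) y \<partial>lborel) = 0" for \<tau>
      using J0[of "\<i> *s of_real_vec \<tau>"] unfolding J_def by simp
  qed simp
  then have "\<psi> (\<i> *s of_real_vec x) = 0" for x unfolding h_def .
  then have "\<psi> (\<i> *s v) = 0" for v
    using entire_eq_on_real[OF entire_smult[OF E, of \<i>] entire_const[of 0]] by blast
  from this[of "(- \<i>) *s z"] show ?thesis by simp
qed

locale invariant_operator =
  fixes p :: ennreal and S :: "(complex^'n::finite \<Rightarrow> complex) \<Rightarrow> complex^'n \<Rightarrow> complex"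
  assumes p: "1 \<le> p" "p < \<infinity>" and S: "bounded_operator_on (fock_space p) (fock_norm p) S"
    and inv: "translation_invariant_on p S"
begin

lemma fock_1_fock_p: "F \<in> fock_space 1 \<Longrightarrow> F \<in> (fock_space p :: (complex^'n \<Rightarrow> complex) set)"
  using fock_space_1_embed[OF p, where 'n='n] by blast

lemma evaluation_functional: "\<exists>A\<ge>0. \<forall>z. fock_functional (\<lambda>F. S F z) (A * exp (pi / 2 * (norm z)\<^sup>2))"
proof -
  obtain A where A: "A \<ge> 0" "\<And>F z. F \<in> fock_space p \<Longrightarrow> norm (S F z) \<le> A * exp (pi / 2 * (norm z)\<^sup>2) * fock_norm p F"
    using bounded_operator_pointwise[OF p S] by blast
  obtain C where C: "\<And>F. F \<in> fock_space 1 \<Longrightarrow> fock_norm p (F :: complex^'n \<Rightarrow> complex) \<le> C * fock_norm 1 F"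
    using fock_space_1_embed[OF p, where 'n='n] by blast
  have "fock_functional (\<lambda>F. S F z) ((A * \<bar>C\<bar>) * exp (pi / 2 * (norm z)\<^sup>2))" for z
  proof
    fix F G :: "complex^'n \<Rightarrow> complex" and c assume F: "F \<in> fock_space 1"
    show "S (\<lambda>z. c * F z) z = c * S F z" using bounded_operator_onD(3)[OF S fock_1_fock_p[OF F]] by simp
    show "S (\<lambda>z. F z + G z) z = S F z + S G z" if "G \<in> fock_space 1"
      using bounded_operator_onD(2)[OF S fock_1_fock_p[OF F] fock_1_fock_p[OF that]] by simp
    have "fock_norm p F \<le> \<bar>C\<bar> * fock_norm 1 F"
      by (rule order_trans[OF C[OF F]]) (intro mult_right_mono abs_ge_self fock_norm_nonneg)
    then have "A * exp (pi / 2 * (norm z)\<^sup>2) * fock_norm p F \<le> A * exp (pi / 2 * (norm z)\<^sup>2) * (\<bar>C\<bar> * fock_norm 1 F)"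
      using A(1) by (intro mult_left_mono) auto
    from order_trans[OF A(2)[OF fock_1_fock_p[OF F]] this]
    show "norm (S F z) \<le> (A * \<bar>C\<bar>) * exp (pi / 2 * (norm z)\<^sup>2) * fock_norm 1 F" by (simp only: mult_ac)
  qed
  then show ?thesis using A(1) by (intro exI[of _ "A * \<bar>C\<bar>"] conjI) auto
qed

definition symb :: "complex^'n \<Rightarrow> complex" where "symb \<zeta> = S (ekern \<zeta>) 0"

lemma entire_symb: "entire symb"
proof -
  obtain A where "fock_functional (\<lambda>F. S F 0) A" using evaluation_functional by blast
  then show ?thesis unfolding symb_def[abs_def] by (rule fock_functional.entire_L_ekern)
qed

text \<open>A real shift maps the kernel with parameter \<open>\<zeta> - y\<close> to a multiple of the kernel with parameter \<open>\<zeta>\<close>. Invariance of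
  \<open>S\<close> then gives the formula at \<open>z = y\<close>, and both sides are entire in \<open>z\<close>.\<close>

lemma S_ekern: "S (ekern \<zeta>) z = ekern \<zeta> z * symb (\<zeta> - z)"
proof (rule entire_eq_on_real[where F="S (ekern \<zeta>)" and G="\<lambda>z. ekern \<zeta> z * symb (\<zeta> - z)"])
  show "entire (S (ekern \<zeta>))" by (rule fock_space_entire[OF bounded_operator_onD(1)[OF S fock_1_fock_p[OF ekern_fock_1]]])
  have "(- 1) *s z + \<zeta> = \<zeta> - z" for z :: "complex^'n" by (simp add: vec_eq_iff)
  then have "entire (\<lambda>z. symb (\<zeta> - z))" using entire_affine[OF entire_symb, of "- 1" \<zeta>] by simp
  then show "entire (\<lambda>z. ekern \<zeta> z * symb (\<zeta> - z))" by (rule entire_mult[OF entire_ekern(1)])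
  fix y :: "real^'n"
  let ?Y = "of_real_vec y :: complex^'n"
  let ?c = "exp (- of_real pi * of_real (y \<bullet> y) / 2 - of_real pi * dotc (\<zeta> - ?Y) ?Y)"
  have "fock_shift y (ekern (\<zeta> - ?Y)) = (\<lambda>w. ?c * ekern \<zeta> w)"
  proof
    fix w
    show "fock_shift y (ekern (\<zeta> - ?Y)) w = ?c * ekern \<zeta> w"
      unfolding fock_shift_def ekern_def mult_exp_exp by (rule arg_cong[where f=exp]) (simp add: algebra_simps)
  qed
  moreover have "S (fock_shift y (ekern (\<zeta> - ?Y))) = fock_shift y (S (ekern (\<zeta> - ?Y)))"
    using inv fock_1_fock_p[OF ekern_fock_1] unfolding translation_invariant_on_def by blast
  ultimately have "(\<lambda>w. ?c * S (ekern \<zeta>) w) = fock_shift y (S (ekern (\<zeta> - ?Y)))"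
    using bounded_operator_onD(3)[OF S fock_1_fock_p[OF ekern_fock_1[of \<zeta>]], of ?c] by simp
  from fun_cong[OF this, of ?Y] have "?c * S (ekern \<zeta>) ?Y = exp (- of_real pi * of_real (y \<bullet> y) / 2 + of_real pi * dotc ?Y ?Y) * symb (\<zeta> - ?Y)"
    unfolding fock_shift_def symb_def by simp
  also have "exp (- of_real pi * of_real (y \<bullet> y) / 2 + of_real pi * dotc ?Y ?Y) = ?c * ekern \<zeta> ?Y"
    unfolding ekern_def mult_exp_exp by (rule arg_cong[where f=exp]) (simp add: algebra_simps)
  finally have "?c * S (ekern \<zeta>) ?Y = ?c * (ekern \<zeta> ?Y * symb (\<zeta> - ?Y))" by (simp only: mult.assoc)
  then show "S (ekern \<zeta>) ?Y = ekern \<zeta> ?Y * symb (\<zeta> - ?Y)" by simp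
qed

text \<open>The formula \<open>S_ekern\<close> expresses \<open>symb \<zeta>\<close> through \<open>S (ekern (\<zeta> + z)) z\<close> for any \<open>z\<close>, and each \<open>z\<close> gives a bound; the
  best choice removes the imaginary part of \<open>\<zeta>\<close>.\<close>

lemma symb_bound: "\<exists>C. \<forall>\<zeta>. norm (symb \<zeta>) \<le> C * exp (pi / 2 * (norm (re_vec \<zeta>))\<^sup>2)"
proof -
  obtain A where A: "\<And>z. fock_functional (\<lambda>F. S F z) (A * exp (pi / 2 * (norm z)\<^sup>2))" using evaluation_functional by blast
  let ?N = "(1 / sqrt (1 / 2)) ^ DIM(complex^'n)"
  have "norm (symb \<zeta>) \<le> (A * ?N) * exp (pi / 2 * (norm (re_vec \<zeta>))\<^sup>2)" for \<zeta>
  proof -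
    \<comment> \<open>minimises \<open>(norm z)\<^sup>2 + (norm (\<zeta> + z))\<^sup>2 - 2 * Re (dotc (\<zeta> + z) z)\<close>\<close>
    define z where "z = cvec 0 ((- 1 / 2) *\<^sub>R im_vec \<zeta>)"
    have e: "S (ekern (\<zeta> + z)) z = ekern (\<zeta> + z) z * symb \<zeta>" using S_ekern[of "\<zeta> + z" z] by simp
    have R: "Re (of_real pi * dotc (\<zeta> + z) z) = pi * Re (dotc (\<zeta> + z) z)" by simp
    have x: "pi / 2 * (norm z)\<^sup>2 + pi / 2 * (norm (\<zeta> + z))\<^sup>2 = pi * Re (dotc (\<zeta> + z) z) + pi / 2 * (norm (re_vec \<zeta>))\<^sup>2"
      unfolding norm_sq_re_im Re_dotc power2_norm_eq_inner z_def
      by (simp add: inner_add_left inner_add_right inner_diff_left inner_diff_right inner_commute field_simps)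
    have "norm (S (ekern (\<zeta> + z)) z) \<le> A * exp (pi / 2 * (norm z)\<^sup>2) * (?N * exp (pi / 2 * (norm (\<zeta> + z))\<^sup>2))"
      using fock_functional.bound[OF A ekern_fock_1[of "\<zeta> + z"], of z] unfolding fock_norm_ekern .
    also have "\<dots> = (A * ?N) * exp (pi / 2 * (norm z)\<^sup>2 + pi / 2 * (norm (\<zeta> + z))\<^sup>2)" by (simp only: exp_add mult_ac)
    also have "\<dots> = exp (pi * Re (dotc (\<zeta> + z) z)) * ((A * ?N) * exp (pi / 2 * (norm (re_vec \<zeta>))\<^sup>2))" unfolding x by (simp only: exp_add mult_ac)
    finally show ?thesis unfolding e norm_mult ekern_def norm_exp_eq_Re R by simp
  qed
  then show ?thesis by blast
qed

lemma S_eq_fock_integral_operator: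
  assumes F: "F \<in> fock_space 1" shows "S F = fock_integral_operator symb F"
proof
  fix z
  obtain A where A: "\<And>z. fock_functional (\<lambda>F. S F z) (A * exp (pi / 2 * (norm z)\<^sup>2))" using evaluation_functional by blast
  have "S F z = (\<integral>w. F w * S (ekern (cnj_vec w)) z * gw w \<partial>lborel)"
    using fock_functional.representation[OF A F, of z] unfolding fock_functional.ell_def[OF A] .
  then show "S F z = fock_integral_operator symb F z"
    unfolding S_ekern fock_integral_operator_def fock_integrand_def gw_def ekern_def by (simp only: mult.assoc)
qed

text \<open>The candidate \<open>u\<close> is defined by applying to \<open>symb\<close> the formula that recovers a Bargmann transform from its symbol.
  The symbol of \<open>u\<close> and \<open>symb\<close> are then recovered to the same function, so they coincide.\<close>

lemma convolutor:
  "\<exists>u\<in>(convolutors p :: 'n functional set). \<forall>F\<in>fock_space 1. S F = fock_integral_operator (fock_symbol u) F"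
proof -
  obtain C where C: "\<And>\<zeta>. norm (symb \<zeta>) \<le> C * exp (pi / 2 * (norm (re_vec \<zeta>))\<^sup>2)" using symb_bound by blast
  let ?k = "2 powr (real CARD('n) / 4)"
  define U where "U z = of_real (1 / ?k) * cross symb z" for z
  have U: "U \<in> fock_space \<infinity>" unfolding mem_fock_space_infinity
  proof (intro conjI exI allI)
    show "entire U" unfolding U_def[abs_def] by (intro entire_mult entire_const cross_props(3)[OF entire_symb C])
    fix z
    have "norm (U z) \<le> 1 / ?k * (C * (1 / sqrt (1 / 2)) ^ DIM(real^'n) * exp (pi / 2 * (norm z)\<^sup>2))"
      unfolding U_def norm_mult by (intro mult_mono cross_props(2)[OF entire_symb C]) (auto simp: norm_divide)
    then show "norm (U z) \<le> (1 / ?k * (C * (1 / sqrt (1 / 2)) ^ DIM(real^'n))) * exp (pi / 2 * (norm z)\<^sup>2)" by (simp only: mult.assoc)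
  qed
  define u where "u = synth U"
  have ut: "u \<in> tempered_distributions" unfolding u_def by (rule synth_tempered[OF U])
  have Bu: "bargmann u = U" unfolding u_def by (rule bargmann_synth[OF U])
  have ui: "u \<in> modulation_space \<infinity>" using modulation_space_infinity[OF ut] U Bu by simp
  obtain C' where C': "\<And>\<zeta>. norm (fock_symbol u \<zeta>) \<le> C' * exp (pi / 2 * (norm (re_vec \<zeta>))\<^sup>2)" using fock_symbol_props(2)[OF ui] by blast
  note eu = fock_symbol_props(1)[OF ui]
  have symb: "symb = fock_symbol u"
  proof
    fix \<zeta>
    have "symb \<zeta> - fock_symbol u \<zeta> = 0"
    proof (rule cross_eq_0[where \<psi>="\<lambda>\<zeta>. symb \<zeta> - fock_symbol u \<zeta>" and C="C + C'"])
      show "entire (\<lambda>\<zeta>. symb \<zeta> - fock_symbol u \<zeta>)" by (rule entire_diff[OF entire_symb eu])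
      show "norm (symb \<zeta> - fock_symbol u \<zeta>) \<le> (C + C') * exp (pi / 2 * (norm (re_vec \<zeta>))\<^sup>2)" for \<zeta>
        using order_trans[OF norm_triangle_ineq4 add_mono[OF C C']] by (simp only: distrib_right)
      fix z
      have "cross (fock_symbol u) z = of_real ?k * U z"
        using symbol_inversion[OF U, of z] unfolding cross_def fock_symbol_props(3)[OF ui] Bu by simp
      moreover have "cross symb z = of_real ?k * U z" unfolding U_def by simp
      moreover have "cross (\<lambda>\<zeta>. symb \<zeta> - fock_symbol u \<zeta>) z = cross symb z - cross (fock_symbol u) z"
        unfolding cross_def left_diff_distrib
        by (rule Bochner_Integration.integral_diff[OF cross_props(1)[OF entire_symb C] cross_props(1)[OF eu C']])
      ultimately show "cross (\<lambda>\<zeta>. symb \<zeta> - fock_symbol u \<zeta>) z = 0" by simp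
    qed
    then show "symb \<zeta> = fock_symbol u \<zeta>" by simp
  qed
  have SF: "\<forall>F\<in>fock_space 1. S F = fock_integral_operator (fock_symbol u) F"
    using S_eq_fock_integral_operator unfolding symb by blast
  note D = bounded_operator_onD[OF S] and M = synth_modulation_space[OF p] and B = modulation_space_bargmann[OF p(2)]
  define T where "T f = synth (S (bargmann f))" for f
  obtain K where K: "\<And>F. F \<in> fock_space p \<Longrightarrow> fock_norm p (S F) \<le> K * fock_norm p F" using D(4) by blast
  have "bounded_operator_on (modulation_space p) (modulation_norm p) T"
    unfolding bounded_operator_on_def
  proof (intro conjI ballI allI exI[of _ K])
    fix f :: "'n functional" assume f: "f \<in> modulation_space p"
    show "T f \<in> modulation_space p" unfolding T_def by (rule M(1)[OF D(1)[OF B(2)[OF f]]])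
    show "modulation_norm p (T f) \<le> K * modulation_norm p f"
      using K[OF B(2)[OF f]] unfolding T_def M(2)[OF D(1)[OF B(2)[OF f]]] B(3)[OF f] .
    show "T (\<lambda>x. c * f x) = (\<lambda>x. c * T f x)" for c
    proof -
      have "bargmann (\<lambda>x. c * f x) = (\<lambda>z. c * bargmann f z)" by (simp add: bargmann_def fun_eq_iff)
      then show ?thesis unfolding T_def by (simp only: D(3)[OF B(2)[OF f]] synth_mult)
    qed
    fix g :: "'n functional" assume g: "g \<in> modulation_space p"
    have "bargmann (\<lambda>x. f x + g x) = (\<lambda>z. bargmann f z + bargmann g z)" by (simp add: bargmann_def fun_eq_iff)
    then show "T (\<lambda>x. f x + g x) = (\<lambda>x. T f x + T g x)"
      unfolding T_def by (simp only: D(2)[OF B(2)[OF f] B(2)[OF g]]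
        synth_add[OF fock_space_infinity_of_fin[OF p D(1)[OF B(2)[OF f]]] fock_space_infinity_of_fin[OF p D(1)[OF B(2)[OF g]]]])
  qed
  moreover have "T f = Defs.convolution u f" if f: "f \<in> modulation_space 1" for f
  proof -
    have ft: "f \<in> tempered_distributions" and F: "bargmann f \<in> fock_space 1" using modulation_space_bargmann[OF _ f] by auto
    have "Defs.convolution u f = synth (fbarg (hconv (bargmann u) (bargmann f)))"
      unfolding convolution_hconv[OF ut ft] using distribution_of_hconv(1)[OF U F] unfolding Bu .
    then show ?thesis using SF F unfolding T_def fbarg_hconv_symbol[OF ui F] by simp
  qed
  ultimately have "u \<in> convolutors p" using ui unfolding convolutors_def by blast
  with SF show ?thesis by blast
qed

end

theorem theorem3p2:
  fixes p :: ennreal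
  assumes "1 \<le> p" and "p < \<infinity>"
  shows
    "(\<forall>u \<in> (convolutors p :: 'n::finite functional set).
        (\<forall>F\<in>fock_space 1.
           (\<forall>z. integrable lborel (fock_integrand (fock_symbol u) F z)) \<and>
           fock_integral_operator (fock_symbol u) F \<in> fock_space \<infinity>) \<and>
        (\<exists>T. bounded_invariant_extension p (fock_integral_operator (fock_symbol u)) T \<and>
             (\<forall>T'. bounded_invariant_extension p (fock_integral_operator (fock_symbol u)) T' \<longrightarrow>
                   (\<forall>F\<in>fock_space p. T' F = T F)))) \<and>
     (\<forall>S. bounded_operator_on (fock_space p :: (complex^'n \<Rightarrow> complex) set) (fock_norm p) S \<and>
          translation_invariant_on p S \<longrightarrow>
          (\<exists>u \<in> (convolutors p :: 'n functional set).
             \<forall>F\<in>fock_space 1. S F = fock_integral_operator (fock_symbol u) F))"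
proof (intro conjI ballI allI impI)
  fix u :: "'n functional" assume u: "u \<in> convolutors p"
  then have ui: "u \<in> modulation_space \<infinity>" unfolding convolutors_def by simp
  obtain C where C: "\<And>\<zeta>. norm (fock_symbol u \<zeta>) \<le> C * exp (pi / 2 * (norm (re_vec \<zeta>))\<^sup>2)" using fock_symbol_props(2)[OF ui] by blast
  show "integrable lborel (fock_integrand (fock_symbol u) F z)" "fock_integral_operator (fock_symbol u) F \<in> fock_space \<infinity>"
    if "F \<in> fock_space 1" for F z
    using fock_operator[OF fock_symbol_props(1)[OF ui] C that] by auto
  obtain T where T: "bounded_invariant_extension p (fock_integral_operator (fock_symbol u)) T"
    using convolutor_extension[OF assms u] by blast
  have "T' F = T F" if T': "bounded_invariant_extension p (fock_integral_operator (fock_symbol u)) T'" and F: "F \<in> fock_space p" for T' F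
    by (rule bounded_operators_eq[OF assms _ _ _ F]) (use T T' in \<open>auto simp: bounded_invariant_extension_def\<close>)
  with T show "\<exists>T. bounded_invariant_extension p (fock_integral_operator (fock_symbol u)) T \<and>
      (\<forall>T'. bounded_invariant_extension p (fock_integral_operator (fock_symbol u)) T' \<longrightarrow> (\<forall>F\<in>fock_space p. T' F = T F))" by blast
next
  fix S :: "(complex^'n \<Rightarrow> complex) \<Rightarrow> complex^'n \<Rightarrow> complex"
  assume "bounded_operator_on (fock_space p) (fock_norm p) S \<and> translation_invariant_on p S"
  then interpret invariant_operator p S using assms by unfold_locales auto
  show "\<exists>u\<in>(convolutors p :: 'n functional set). \<forall>F\<in>fock_space 1. S F = fock_integral_operator (fock_symbol u) F" by (rule convolutor)
qed

end
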